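(* Let $\beta>0$, $\lambda\in\mathbb R$, $h=0$, and let $A(\beta,\lambda)=\lim_{N\to\infty}A_N(\beta,\lambda)$. Then $$A(\beta,\lambda)=\inf_{x\in\mathcal X}\hat A(\beta,\lambda;x),$$ $$\hat A(\beta,\lambda;x)=\log\sigma(Q)+\frac12\beta^2\sigma^2(Q)\int_0^Q\frac{dq}{1-\beta^2\sigma^2(Q)\int_q^Qx(q')dq'}+\frac{\beta^2}{4}Q^2-\frac{\beta^2}{2}\int_0^Qq\,x(q)\,dq,$$ and the infimum is attained at the replica symmetric order parameter: $Q=q^{RS}$ and $x\equiv0$ on $[0,q^{RS})$ (i.e. $K=1$, $m_1=0$), where $q^{RS}=0$ if $\lambda<1$ and $\beta\le1-\lambda$, and $q^{RS}=\frac{\beta-(1-\lambda)}{\beta^2}$ if $\beta>1-\lambda$.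
   Context: For $N\ge1$, $J=(J_{ij})_{i,j=1}^N$ i.i.d. $\mathcal N(0,1)$ over all ordered pairs, $\mathbb E_z$ the standard Gaussian measure on $\mathbb R^N$, $Z_N(\beta,\lambda;J)=\mathbb E_z\exp\big(\frac{\beta}{\sqrt{2N}}\sum_{i,j}J_{ij}z_iz_j-\frac{\beta^2}{4N}(\sum_iz_i^2)^2+\frac\lambda2\sum_iz_i^2\big)$ and $A_N(\beta,\lambda)=\frac1N\mathbb E\log Z_N$. $\mathcal X$ is the set of pairs $(Q,x)$ with $Q\ge0$, $1-\lambda+\beta^2Q>0$, and $x:[0,Q]\to[0,1]$ a nondecreasing piecewise constant function (given by $0=q_0\le\dots\le q_K=Q$, $0\le m_1\le\dots\le m_K\le1$, $x=m_a$ on $[q_{a-1},q_a)$) such that $\beta^2\sigma^2(Q)\int_q^Qx(q')dq'<1$ for all $q\in[0,Q]$; here $\sigma(Q)=(1-\lambda+\beta^2Q)^{-1/2}$. *)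

theory Defs
  imports "HOL-Probability.Probability"
begin

definition std_gauss :: "real measure" where
  "std_gauss = density lborel std_normal_density"

definition gauss_vec :: "nat \<Rightarrow> (nat \<Rightarrow> real) measure" where
  "gauss_vec N = PiM {..<N} (\<lambda>_. std_gauss)"

definition disorder :: "nat \<Rightarrow> (nat \<times> nat \<Rightarrow> real) measure" where
  "disorder N = PiM ({..<N} \<times> {..<N}) (\<lambda>_. std_gauss)"

definition Z_N :: "nat \<Rightarrow> real \<Rightarrow> real \<Rightarrow> (nat \<times> nat \<Rightarrow> real) \<Rightarrow> real" where
  "Z_N N \<beta> lam J = (\<integral>z. exp (\<beta> / sqrt (2 * real N) * (\<Sum>i<N. \<Sum>j<N. J (i, j) * z i * z j)
        - \<beta>\<^sup>2 / (4 * real N) * (\<Sum>i<N. (z i)\<^sup>2)\<^sup>2 + lam / 2 * (\<Sum>i<N. (z i)\<^sup>2)) \<partial>gauss_vec N)"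

definition A_N :: "nat \<Rightarrow> real \<Rightarrow> real \<Rightarrow> real" where
  "A_N N \<beta> lam = (1 / real N) * (\<integral>J. ln (Z_N N \<beta> lam J) \<partial>disorder N)"

definition sigma :: "real \<Rightarrow> real \<Rightarrow> real \<Rightarrow> real" where
  "sigma \<beta> lam Q = 1 / sqrt (1 - lam + \<beta>\<^sup>2 * Q)"

definition piecewise_order_param :: "real \<Rightarrow> (real \<Rightarrow> real) \<Rightarrow> bool" where
  "piecewise_order_param Q x \<longleftrightarrow>
     (\<exists>K::nat. \<exists>q m :: nat \<Rightarrow> real. K \<ge> 1 \<and> q 0 = 0 \<and> q K = Q \<and>
        (\<forall>a<K. q a \<le> q (Suc a)) \<and> 0 \<le> m 1 \<and> (\<forall>a. 1 \<le> a \<and> a < K \<longrightarrow> m a \<le> m (Suc a)) \<and> m K \<le> 1 \<and>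
        (\<forall>a t. 1 \<le> a \<and> a \<le> K \<and> q (a - 1) \<le> t \<and> t < q a \<longrightarrow> x t = m a))"

definition param_set :: "real \<Rightarrow> real \<Rightarrow> (real \<times> (real \<Rightarrow> real)) set" where
  "param_set \<beta> lam = {(Q, x). Q \<ge> 0 \<and> 1 - lam + \<beta>\<^sup>2 * Q > 0 \<and> piecewise_order_param Q x \<and>
      (\<forall>q\<in>{0..Q}. \<beta>\<^sup>2 * (sigma \<beta> lam Q)\<^sup>2 * integral {q..Q} x < 1)}"

definition A_hat :: "real \<Rightarrow> real \<Rightarrow> real \<times> (real \<Rightarrow> real) \<Rightarrow> real" where
  "A_hat \<beta> lam p = (case p of (Q, x) \<Rightarrow>
      ln (sigma \<beta> lam Q)
      + 1/2 * \<beta>\<^sup>2 * (sigma \<beta> lam Q)\<^sup>2 *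
          integral {0..Q} (\<lambda>q. 1 / (1 - \<beta>\<^sup>2 * (sigma \<beta> lam Q)\<^sup>2 * integral {q..Q} x))
      + \<beta>\<^sup>2 / 4 * Q\<^sup>2
      - \<beta>\<^sup>2 / 2 * integral {0..Q} (\<lambda>q. q * x q))"

definition q_RS :: "real \<Rightarrow> real \<Rightarrow> real" where
  "q_RS \<beta> lam = (if \<beta> > 1 - lam then (\<beta> - (1 - lam)) / \<beta>\<^sup>2 else 0)"

end

theory Submission
  imports Defs "HOL-Real_Asymp.Real_Asymp"
begin

text \<open>
  Write \<open>w = 1 - \<lambda>\<close>, \<open>q = q\<^sub>R\<^sub>S\<close> and \<open>U = w + \<beta>\<^sup>2 q\<close>, so that \<open>U \<ge> \<beta>\<close>.

  Upper bound: the covariance of the quadratic field \<open>\<beta>/\<surd>(2N) \<Sum> J\<^sub>i\<^sub>j z\<^sub>i z\<^sub>j\<close> is \<open>\<beta>\<^sup>2/(2N) (z \<cdot> z')\<^sup>2\<close>, which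
  lies above the tangent parabola \<open>\<beta>\<^sup>2 Q (z \<cdot> z') - N \<beta>\<^sup>2 Q\<^sup>2/2\<close>, the covariance of a linear random field minus a
  constant. Kahane's comparison inequality therefore bounds the free energy by that of independent spins in a
  Gaussian external field, for which everything is explicit; \<open>Q = q\<close> gives the replica symmetric value.

  Lower bound: for \<open>v > U\<close> replace \<open>\<lambda>\<close> by \<open>1 - v\<close>. This model is in its high temperature phase
  (\<open>\<beta> < v\<close>); restricted to the shell \<open>|z|\<^sup>2 \<approx> N/v\<close> its quenched and annealed free energies agree up to \<open>O(1)\<close>
  and its Gibbs means of \<open>z\<^sub>i z\<^sub>j\<close> are small. Shift the integration variable by a macroscopic vector supported near the
  upper spectral edge of the symmetrised matrix \<open>M\<close> of \<open>J\<close>, namely \<open>\<alpha> M\<^sup>k (M + 2) g\<close> with \<open>g\<close> Gaussian and squared length about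
  \<open>N q\<close>. The gain is then computed from the moments of the semicircle law, and it tends to the replica symmetric value as
  \<open>k \<rightarrow> \<infinity>\<close> and \<open>v \<rightarrow> U\<close>.

  Variational part: with \<open>v(s) = 1/\<sigma>\<^sup>2 - \<beta>\<^sup>2 \<integral>\<^sub>s\<^sup>Q x\<close>, integration by parts turns the functional into an
  integral of \<open>h(v(s))\<close> with \<open>h(v) = \<beta>\<^sup>2/v + v\<close>, and \<open>v(s) \<ge> w + \<beta>\<^sup>2 s\<close> because \<open>x \<le> 1\<close>. Bounding
  \<open>h\<close> below by its minimum \<open>2\<beta>\<close> for \<open>s < q\<close> and by \<open>h(w + \<beta>\<^sup>2 s)\<close> for \<open>s \<ge> q\<close> yields the value at \<open>q\<close>.
\<close>

section \<open>Gaussian product measures\<close>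

text \<open>The exponent of the model is a Gaussian field minus half its variance: the quartic term
  is that half variance. Diagonal terms therefore cancel, the disorder average of the partition
  function carries no interaction, and adding an independent field with time increment d changes the
  quenched free energy by -d/2 times the mean sum of squared Gibbs averages. This one increment
  estimate carries both the comparison inequality and the high temperature bound. Because
  \<open>sqrt t\<close> is not smooth at 0, increments with an error of order d^(3/2) are summed in
  place of differentiating. The estimate asks for bounded fields, which is why cubes and shells
  appear.

  For q > 0 the value U equals \<beta>, the boundary of the high temperature phase, so v must stay
  strictly above U until the very end. In the shift the factor M + 2 is needed because the limiting
  spectrum is symmetric: a power of M alone weights both edges equally, while M + 2 vanishes at the
  lower edge -2.\<close>

lemma space_std_gauss [simp]: "space std_gauss = UNIV"
  by (simp add: std_gauss_def)

lemma sets_std_gauss [simp, measurable_cong]: "sets std_gauss = sets borel"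
  by (simp add: std_gauss_def)

lemma prob_space_std_gauss: "prob_space std_gauss"
  unfolding std_gauss_def by (rule prob_space_normal_density) simp

abbreviation gaussP :: "'i set \<Rightarrow> ('i \<Rightarrow> real) measure" where
  "gaussP I \<equiv> PiM I (\<lambda>_. std_gauss)"

lemma gauss_vec_eq: "gauss_vec N = gaussP {..<N}"
  by (simp add: gauss_vec_def)

lemma disorder_eq: "disorder N = gaussP ({..<N} \<times> {..<N})"
  by (simp add: disorder_def)

interpretation gauss_product: product_sigma_finite "\<lambda>_::'i. std_gauss"
  by (simp add: product_sigma_finite_def prob_space_imp_sigma_finite prob_space_std_gauss)

lemma prob_space_gaussP: "prob_space (gaussP I)"
  by (rule prob_space_PiM) (simp add: prob_space_std_gauss)

lemma measurable_gaussP_component [measurable (raw)]: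
  "i \<in> I \<Longrightarrow> (\<lambda>J. J i) \<in> borel_measurable (gaussP I)"
  using measurable_component_singleton[of i I "\<lambda>_. std_gauss"]
  by (simp cong: measurable_cong_sets)

lemma measurable_gaussP_component_fst [measurable (raw)]:
  "i \<in> I \<Longrightarrow> (\<lambda>p. fst p i) \<in> borel_measurable (gaussP I \<Otimes>\<^sub>M M)"
  using measurable_compose[OF measurable_fst measurable_gaussP_component[of i I]] by simp

lemma measurable_gaussP_component_snd [measurable (raw)]:
  "i \<in> I \<Longrightarrow> (\<lambda>p. snd p i) \<in> borel_measurable (M \<Otimes>\<^sub>M gaussP I)"
  using measurable_compose[OF measurable_snd measurable_gaussP_component[of i I]] by simp

lemma measurable_gaussP_restrict:
  assumes "\<And>i. i \<in> I \<Longrightarrow> (\<lambda>x. f x i) \<in> borel_measurable M"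
  shows "(\<lambda>x. \<lambda>i\<in>I. f x i) \<in> measurable M (gaussP I)"
  using assms by (intro measurable_restrict) (simp cong: measurable_cong_sets)

section \<open>Gaussian integrals with a quadratic tilt\<close>

text \<open>Completing the square turns the tilted density into a constant times the normal density
  with mean b/w and variance 1/w. Writing the tilt as (1 - w)/2 makes w the resulting precision, so
  w plays the role of 1 - \<open>lam\<close>.\<close>

lemma has_bochner_integral_std_gauss_mgf:
  fixes b w :: real
  assumes w: "w > 0"
  shows "has_bochner_integral std_gauss (\<lambda>x. exp (b * x + (1 - w) / 2 * x\<^sup>2)) (exp (b\<^sup>2 / (2 * w)) / sqrt w)"
proof -
  have eq: "std_normal_density x * exp (b * x + (1 - w) / 2 * x\<^sup>2)
     = (exp (b\<^sup>2 / (2 * w)) / sqrt w) * normal_density (b / w) (1 / sqrt w) x" for x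
  proof -
    have "- x\<^sup>2 / 2 + (b * x + (1 - w) / 2 * x\<^sup>2) = b\<^sup>2 / (2 * w) + - (x - b / w)\<^sup>2 / (2 * (1 / sqrt w)\<^sup>2)"
      using w by (simp add: power_divide real_sqrt_pow2 power2_eq_square field_simps)
    then have "exp (- x\<^sup>2 / 2) * exp (b * x + (1 - w) / 2 * x\<^sup>2)
        = exp (b\<^sup>2 / (2 * w)) * exp (- (x - b / w)\<^sup>2 / (2 * (1 / sqrt w)\<^sup>2))"
      by (simp only: exp_add[symmetric])
    moreover have "sqrt (2 * pi * (1 / sqrt w)\<^sup>2) = sqrt (2 * pi) / sqrt w"
      using w by (simp add: power_divide real_sqrt_divide)
    ultimately show ?thesis
      using w unfolding std_normal_density_def normal_density_def by (simp add: field_simps)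
  qed
  have "has_bochner_integral lborel (\<lambda>x. std_normal_density x * exp (b * x + (1 - w) / 2 * x\<^sup>2))
      ((exp (b\<^sup>2 / (2 * w)) / sqrt w) * 1)"
    unfolding eq using w
    by (intro has_bochner_integral_mult_right)
       (auto simp: has_bochner_integral_iff)
  then show ?thesis
    unfolding std_gauss_def
    by (simp add: has_bochner_integral_density)
qed

lemma gaussP_mgf:
  fixes b :: "'i \<Rightarrow> real" and w :: real
  assumes w: "w > 0" and I: "finite I"
  shows "integrable (gaussP I) (\<lambda>z. exp ((\<Sum>i\<in>I. b i * z i) + (1 - w) / 2 * (\<Sum>i\<in>I. (z i)\<^sup>2)))"
    and "(\<integral>z. exp ((\<Sum>i\<in>I. b i * z i) + (1 - w) / 2 * (\<Sum>i\<in>I. (z i)\<^sup>2)) \<partial>gaussP I)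
         = exp ((\<Sum>i\<in>I. (b i)\<^sup>2) / (2 * w)) / sqrt w ^ card I"
proof -
  have e: "exp ((\<Sum>i\<in>I. b i * z i) + (1 - w) / 2 * (\<Sum>i\<in>I. (z i)\<^sup>2))
     = (\<Prod>i\<in>I. exp (b i * z i + (1 - w) / 2 * (z i)\<^sup>2))" for z
    using I by (simp add: exp_sum[symmetric] sum.distrib sum_distrib_left)
  note h = has_bochner_integral_std_gauss_mgf[OF w]
  show "integrable (gaussP I) (\<lambda>z. exp ((\<Sum>i\<in>I. b i * z i) + (1 - w) / 2 * (\<Sum>i\<in>I. (z i)\<^sup>2)))"
    unfolding e using h I
    by (intro gauss_product.product_integrable_prod) (auto simp: has_bochner_integral_iff)
  have "(\<integral>z. exp ((\<Sum>i\<in>I. b i * z i) + (1 - w) / 2 * (\<Sum>i\<in>I. (z i)\<^sup>2)) \<partial>gaussP I)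
      = (\<Prod>i\<in>I. exp ((b i)\<^sup>2 / (2 * w)) / sqrt w)"
    unfolding e using h I
    by (subst gauss_product.product_integral_prod) (auto simp: has_bochner_integral_iff)
  also have "\<dots> = exp ((\<Sum>i\<in>I. (b i)\<^sup>2) / (2 * w)) / sqrt w ^ card I"
    using I by (simp add: prod_dividef exp_sum[symmetric] sum_divide_distrib)
  finally show "(\<integral>z. exp ((\<Sum>i\<in>I. b i * z i) + (1 - w) / 2 * (\<Sum>i\<in>I. (z i)\<^sup>2)) \<partial>gaussP I)
         = exp ((\<Sum>i\<in>I. (b i)\<^sup>2) / (2 * w)) / sqrt w ^ card I" .
qed

lemma gaussP_exp_linear:
  fixes b :: "'i \<Rightarrow> real"
  assumes I: "finite I"
  shows "integrable (gaussP I) (\<lambda>z. exp (\<Sum>i\<in>I. b i * z i))"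
    and "(\<integral>z. exp (\<Sum>i\<in>I. b i * z i) \<partial>gaussP I) = exp ((\<Sum>i\<in>I. (b i)\<^sup>2) / 2)"
  using gaussP_mgf[OF zero_less_one I, of b] by simp_all

section \<open>Functions of at most exponential growth\<close>

lemma std_gauss_exp_abs: "integrable std_gauss (\<lambda>x. exp (a * \<bar>x\<bar>))"
proof (rule Bochner_Integration.integrable_bound)
  have h: "integrable std_gauss (\<lambda>x. exp (b * x))" for b :: real
    using has_bochner_integral_std_gauss_mgf[OF zero_less_one, of b]
    by (simp add: has_bochner_integral_iff)
  show "integrable std_gauss (\<lambda>x. exp (a * x) + exp (- a * x))"
    by (rule Bochner_Integration.integrable_add[OF h h])
  show "AE x in std_gauss. norm (exp (a * \<bar>x\<bar>)) \<le> norm (exp (a * x) + exp (- a * x))"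
  proof (rule AE_I2)
    fix x :: real
    have "exp (a * \<bar>x\<bar>) \<le> exp (a * x) + exp (- a * x)" by (cases "x \<ge> 0") auto
    then show "norm (exp (a * \<bar>x\<bar>)) \<le> norm (exp (a * x) + exp (- a * x))" by simp
  qed
qed measurable

text \<open>A class closed under sums, products and powers that contains polynomials in the disorder
  as well as log partition functions, so that one membership proof replaces separate integrability
  arguments. The bound is required for every J, not almost everywhere, so that it survives freezing
  all coordinates but one in \<open>gaussP_by_parts\<close>.\<close>

definition exp_bounded :: "'i set \<Rightarrow> (('i \<Rightarrow> real) \<Rightarrow> real) \<Rightarrow> bool" where
  "exp_bounded I F \<longleftrightarrow> F \<in> borel_measurable (gaussP I) \<and>
     (\<exists>a C. 0 \<le> a \<and> 0 \<le> C \<and> (\<forall>J. \<bar>F J\<bar> \<le> C * exp (a * (\<Sum>i\<in>I. \<bar>J i\<bar>))))"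

lemma exp_bounded_measurable: "exp_bounded I F \<Longrightarrow> F \<in> borel_measurable (gaussP I)"
  by (simp add: exp_bounded_def)

lemma exp_bounded_integrable:
  assumes I: "finite I" and F: "exp_bounded I F"
  shows "integrable (gaussP I) F"
proof -
  obtain a C where aC: "0 \<le> a" "0 \<le> C" "\<And>J. \<bar>F J\<bar> \<le> C * exp (a * (\<Sum>i\<in>I. \<bar>J i\<bar>))"
    using F unfolding exp_bounded_def by blast
  have "integrable (gaussP I) (\<lambda>J. \<Prod>i\<in>I. exp (a * \<bar>J i\<bar>))"
    using I std_gauss_exp_abs by (intro gauss_product.product_integrable_prod) auto
  moreover have "(\<Prod>i\<in>I. exp (a * \<bar>J i\<bar>)) = exp (a * (\<Sum>i\<in>I. \<bar>J i\<bar>))" for J :: "'a \<Rightarrow> real"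
    by (simp only: sum_distrib_left exp_sum[OF I])
  ultimately have "integrable (gaussP I) (\<lambda>J. C * exp (a * (\<Sum>i\<in>I. \<bar>J i\<bar>)))"
    by simp
  then show ?thesis
  proof (rule Bochner_Integration.integrable_bound)
    show "F \<in> borel_measurable (gaussP I)" using F by (simp add: exp_bounded_def)
    show "AE J in gaussP I. norm (F J) \<le> norm (C * exp (a * (\<Sum>i\<in>I. \<bar>J i\<bar>)))"
      using aC by (intro AE_I2) (simp add: abs_mult)
  qed
qed

lemma exp_bounded_const [intro]: "exp_bounded I (\<lambda>_. c)"
  unfolding exp_bounded_def by (intro conjI exI[of _ "0::real"] exI[of _ "\<bar>c\<bar>"]) auto

lemma exp_bounded_component [intro]:
  assumes "finite I" "i \<in> I" shows "exp_bounded I (\<lambda>J. J i)"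
  unfolding exp_bounded_def
proof (intro conjI exI[of _ 1] allI)
  fix J :: "'a \<Rightarrow> real"
  have "\<bar>J i\<bar> \<le> (\<Sum>i\<in>I. \<bar>J i\<bar>)"
    using assms by (intro member_le_sum) auto
  also have "\<dots> \<le> exp (\<Sum>i\<in>I. \<bar>J i\<bar>)"
    using exp_ge_add_one_self[of "\<Sum>i\<in>I. \<bar>J i\<bar>"] by linarith
  finally show "\<bar>J i\<bar> \<le> 1 * exp (1 * (\<Sum>i\<in>I. \<bar>J i\<bar>))" by simp
qed (use assms in auto)

lemma exp_bounded_add [intro]:
  assumes "exp_bounded I F" "exp_bounded I G" shows "exp_bounded I (\<lambda>J. F J + G J)"
proof -
  obtain a C where 1: "0 \<le> a" "0 \<le> C" "\<And>J. \<bar>F J\<bar> \<le> C * exp (a * (\<Sum>i\<in>I. \<bar>J i\<bar>))"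
    using assms(1) unfolding exp_bounded_def by blast
  obtain b D where 2: "0 \<le> b" "0 \<le> D" "\<And>J. \<bar>G J\<bar> \<le> D * exp (b * (\<Sum>i\<in>I. \<bar>J i\<bar>))"
    using assms(2) unfolding exp_bounded_def by blast
  have "\<bar>F J + G J\<bar> \<le> (C + D) * exp (max a b * (\<Sum>i\<in>I. \<bar>J i\<bar>))" for J
  proof -
    have s: "0 \<le> (\<Sum>i\<in>I. \<bar>J i\<bar>)" by (simp add: sum_nonneg)
    have "\<bar>F J\<bar> \<le> C * exp (max a b * (\<Sum>i\<in>I. \<bar>J i\<bar>))"
      using s 1 by (intro order_trans[OF 1(3)] mult_left_mono) (auto intro!: mult_right_mono)
    moreover have "\<bar>G J\<bar> \<le> D * exp (max a b * (\<Sum>i\<in>I. \<bar>J i\<bar>))"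
      using s 2 by (intro order_trans[OF 2(3)] mult_left_mono) (auto intro!: mult_right_mono)
    ultimately show ?thesis by (simp add: distrib_right)
  qed
  then show ?thesis using assms 1 2 unfolding exp_bounded_def
    by (intro conjI exI[of _ "max a b"] exI[of _ "C + D"]) auto
qed

lemma exp_bounded_mult [intro]:
  assumes "exp_bounded I F" "exp_bounded I G" shows "exp_bounded I (\<lambda>J. F J * G J)"
proof -
  obtain a C where 1: "0 \<le> a" "0 \<le> C" "\<And>J. \<bar>F J\<bar> \<le> C * exp (a * (\<Sum>i\<in>I. \<bar>J i\<bar>))"
    using assms(1) unfolding exp_bounded_def by blast
  obtain b D where 2: "0 \<le> b" "0 \<le> D" "\<And>J. \<bar>G J\<bar> \<le> D * exp (b * (\<Sum>i\<in>I. \<bar>J i\<bar>))"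
    using assms(2) unfolding exp_bounded_def by blast
  have "\<bar>F J * G J\<bar> \<le> (C * D) * exp ((a + b) * (\<Sum>i\<in>I. \<bar>J i\<bar>))" for J
    using mult_mono[OF 1(3)[of J] 2(3)[of J]] 1 2 by (simp add: abs_mult distrib_right exp_add mult_ac)
  then show ?thesis using assms 1 2 unfolding exp_bounded_def
    by (intro conjI exI[of _ "a + b"] exI[of _ "C * D"]) auto
qed

lemma exp_bounded_diff [intro]:
  "exp_bounded I F \<Longrightarrow> exp_bounded I G \<Longrightarrow> exp_bounded I (\<lambda>J. F J - G J)"
  using exp_bounded_add[of I F "\<lambda>J. (-1) * G J"] exp_bounded_mult[of I "\<lambda>_. -1" G] by auto

lemma exp_bounded_sum [intro]:
  "(\<And>i. i \<in> A \<Longrightarrow> exp_bounded I (F i)) \<Longrightarrow> exp_bounded I (\<lambda>J. \<Sum>i\<in>A. F i J)"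
  by (induction A rule: infinite_finite_induct) auto

lemma exp_bounded_power [intro]: "exp_bounded I F \<Longrightarrow> exp_bounded I (\<lambda>J. F J ^ n)"
  by (induction n) auto

lemma exp_bounded_bound:
  assumes "exp_bounded I G" "F \<in> borel_measurable (gaussP I)" "\<And>J. \<bar>F J\<bar> \<le> G J"
  shows "exp_bounded I F"
proof -
  have "\<bar>F J\<bar> \<le> \<bar>G J\<bar>" for J using assms(3)[of J] by linarith
  then show ?thesis using assms unfolding exp_bounded_def by (meson order_trans)
qed

lemma exp_bounded_abs [intro]: "exp_bounded I F \<Longrightarrow> exp_bounded I (\<lambda>J. \<bar>F J\<bar>)"
  unfolding exp_bounded_def by (auto intro: borel_measurable_abs)

section \<open>Translation and rotation invariance of Gaussian measures\<close>

text \<open>The Cameron-Martin formula on the line: translation invariance of Lebesgue measure, with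
  the ratio of the normal densities at x + s and x kept as a weight. Working with nonnegative
  integrals avoids integrability conditions.\<close>

lemma std_gauss_shift:
  assumes [measurable]: "f \<in> borel_measurable borel"
  shows "(\<integral>\<^sup>+x. f x \<partial>std_gauss) = (\<integral>\<^sup>+x. ennreal (exp (- s * x - s\<^sup>2 / 2)) * f (x + s) \<partial>std_gauss)"
proof -
  have d: "std_normal_density (s + x) = std_normal_density x * exp (- s * x - s\<^sup>2 / 2)" for x
    unfolding std_normal_density_def
    by (simp add: exp_add[symmetric] power2_eq_square field_simps)
  have "(\<integral>\<^sup>+x. f x \<partial>std_gauss) = (\<integral>\<^sup>+x. ennreal (std_normal_density x) * f x \<partial>lborel)"
    unfolding std_gauss_def by (simp add: nn_integral_density)
  also have "\<dots> = (\<integral>\<^sup>+x. ennreal (std_normal_density (s + x)) * f (s + x) \<partial>lborel)"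
    by (subst nn_integral_real_affine[where t=s and c=1]) (simp_all add: mult_ac)
  also have "\<dots> = (\<integral>\<^sup>+x. ennreal (std_normal_density x) * (ennreal (exp (- s * x - s\<^sup>2 / 2)) * f (x + s)) \<partial>lborel)"
    unfolding d by (simp add: ennreal_mult mult.assoc add.commute[of s])
  also have "\<dots> = (\<integral>\<^sup>+x. ennreal (exp (- s * x - s\<^sup>2 / 2)) * f (x + s) \<partial>std_gauss)"
    unfolding std_gauss_def by (simp add: nn_integral_density)
  finally show ?thesis .
qed

lemma std_gauss_scale:
  assumes a: "a > 0" and [measurable]: "f \<in> borel_measurable borel"
  shows "(\<integral>\<^sup>+x. f (a * x) \<partial>std_gauss) = (\<integral>\<^sup>+x. ennreal (normal_density 0 a x) * f x \<partial>lborel)"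
proof -
  have d: "a * normal_density 0 a (a * x) = std_normal_density x" for x
    using a unfolding normal_density_def by (simp add: real_sqrt_mult power_mult_distrib field_simps)
  have "(\<integral>\<^sup>+x. ennreal (normal_density 0 a x) * f x \<partial>lborel)
      = ennreal \<bar>a\<bar> * (\<integral>\<^sup>+x. ennreal (normal_density 0 a (0 + a * x)) * f (0 + a * x) \<partial>lborel)"
    using a by (intro nn_integral_real_affine) auto
  also have "\<dots> = (\<integral>\<^sup>+x. ennreal (a * normal_density 0 a (a * x)) * f (a * x) \<partial>lborel)"
    using a by (simp add: nn_integral_cmult[symmetric] ennreal_mult mult.assoc)
  also have "\<dots> = (\<integral>\<^sup>+x. f (a * x) \<partial>std_gauss)"
    unfolding std_gauss_def d by (simp add: nn_integral_density)
  finally show ?thesis ..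
qed

text \<open>Variances of independent centred normals add. The degenerate cases a = 0 and b = 0 are
  treated apart because the convolution formula for normal densities asks for positive standard
  deviations.\<close>

lemma std_gauss_conv:
  assumes ab: "a\<^sup>2 + b\<^sup>2 = 1" "a \<ge> 0" "b \<ge> 0" and [measurable]: "f \<in> borel_measurable borel"
  shows "(\<integral>\<^sup>+x. \<integral>\<^sup>+y. f (a * x + b * y) \<partial>std_gauss \<partial>std_gauss) = (\<integral>\<^sup>+x. f x \<partial>std_gauss)"
proof -
  interpret prob_space std_gauss by (rule prob_space_std_gauss)
  consider "a = 0" "b = 1" | "b = 0" "a = 1" | "a > 0" "b > 0"
    using ab by (cases "a = 0"; cases "b = 0") (auto simp: power2_eq_1_iff)
  then show ?thesis
  proof cases
    case 3
    have "(\<integral>\<^sup>+x. \<integral>\<^sup>+y. f (a * x + b * y) \<partial>std_gauss \<partial>std_gauss)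
        = (\<integral>\<^sup>+x. \<integral>\<^sup>+v. ennreal (normal_density 0 b v) * f (a * x + v) \<partial>lborel \<partial>std_gauss)"
      using 3 by (intro nn_integral_cong std_gauss_scale[of b "\<lambda>v. f (_ + v)"]) auto
    also have "\<dots> = (\<integral>\<^sup>+v. \<integral>\<^sup>+x. ennreal (normal_density 0 b v) * f (a * x + v) \<partial>std_gauss \<partial>lborel)"
    proof (rule pair_sigma_finite.Fubini')
      show "pair_sigma_finite lborel std_gauss"
        by (simp add: pair_sigma_finite_def sigma_finite_lborel prob_space_imp_sigma_finite prob_space_std_gauss)
    qed measurable
    also have "\<dots> = (\<integral>\<^sup>+v. \<integral>\<^sup>+u. ennreal (normal_density 0 a u) * (ennreal (normal_density 0 b v) * f (u + v)) \<partial>lborel \<partial>lborel)"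
      using 3 by (intro nn_integral_cong std_gauss_scale[of a "\<lambda>u. ennreal (normal_density 0 b _) * f (u + _)"]) auto
    \<comment> \<open>After a translation by v and an exchange of the integrals, the inner integral
      is the convolution of two centred normal densities.\<close>
    also have "\<dots> = (\<integral>\<^sup>+v. \<integral>\<^sup>+u. ennreal (normal_density 0 a (u - v)) * (ennreal (normal_density 0 b v) * f u) \<partial>lborel \<partial>lborel)"
    proof (rule nn_integral_cong)
      fix v :: real
      show "(\<integral>\<^sup>+u. ennreal (normal_density 0 a u) * (ennreal (normal_density 0 b v) * f (u + v)) \<partial>lborel)
          = (\<integral>\<^sup>+u. ennreal (normal_density 0 a (u - v)) * (ennreal (normal_density 0 b v) * f u) \<partial>lborel)"
        using nn_integral_real_affine[of "\<lambda>u. ennreal (normal_density 0 a (u - v)) * (ennreal (normal_density 0 b v) * f u)" 1 v]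
        by (simp add: add.commute)
    qed
    also have "\<dots> = (\<integral>\<^sup>+u. \<integral>\<^sup>+v. ennreal (normal_density 0 a (u - v)) * (ennreal (normal_density 0 b v) * f u) \<partial>lborel \<partial>lborel)"
      by (rule lborel_pair.Fubini') measurable
    also have "\<dots> = (\<integral>\<^sup>+u. (\<integral>\<^sup>+v. ennreal (normal_density 0 a (u - v) * normal_density 0 b v) \<partial>lborel) * f u \<partial>lborel)"
      by (intro nn_integral_cong, subst nn_integral_multc[symmetric])
         (simp_all add: ennreal_mult mult.assoc)
    also have "\<dots> = (\<integral>\<^sup>+u. ennreal (std_normal_density u) * f u \<partial>lborel)"
      using conv_normal_density_zero_mean[of a b] 3 ab(1)
      by (simp add: fun_eq_iff)
    also have "\<dots> = (\<integral>\<^sup>+x. f x \<partial>std_gauss)"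
      unfolding std_gauss_def by (simp add: nn_integral_density)
    finally show ?thesis .
  qed (use emeasure_space_1 in simp_all)
qed

text \<open>The Cameron-Martin formula in finitely many dimensions, obtained by peeling off one
  coordinate at a time. The shifted point is restricted to I because points of the product space are
  \<open>undefined\<close> outside the index set.\<close>

lemma gaussP_shift:
  fixes s :: "'i \<Rightarrow> real"
  assumes "finite I" and "F \<in> borel_measurable (gaussP I)"
  shows "(\<integral>\<^sup>+z. F z \<partial>gaussP I)
    = (\<integral>\<^sup>+z. ennreal (exp (- (\<Sum>i\<in>I. s i * z i) - (\<Sum>i\<in>I. (s i)\<^sup>2) / 2)) * F (\<lambda>i\<in>I. z i + s i) \<partial>gaussP I)"
  using assms
proof (induction I arbitrary: F rule: finite_induct)
  case empty
  show ?case
    by (subst (1 2) nn_integral_cong[of _ _ "\<lambda>_. F (\<lambda>_. undefined)"]) (auto simp: space_PiM restrict_def)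
next
  case (insert k I)
  note [measurable] = insert.prems
  let ?e = "\<lambda>I z. ennreal (exp (- (\<Sum>i\<in>I. s i * z i) - (\<Sum>i\<in>I. (s i)\<^sup>2) / 2))"
  have upd [measurable]: "(\<lambda>x. z(k := x)) \<in> measurable borel (gaussP (insert k I))" if "z \<in> space (gaussP I)" for z
    using measurable_fun_upd[of "insert k I" I k "\<lambda>x. z" borel "\<lambda>_. std_gauss" "\<lambda>x. x"] that by simp
  have "(\<integral>\<^sup>+z. F z \<partial>gaussP (insert k I)) = (\<integral>\<^sup>+z. \<integral>\<^sup>+x. F (z(k := x)) \<partial>std_gauss \<partial>gaussP I)"
    using insert by (intro gauss_product.product_nn_integral_insert) auto
  also have "\<dots> = (\<integral>\<^sup>+z. \<integral>\<^sup>+x. ennreal (exp (- s k * x - (s k)\<^sup>2 / 2)) * F (z(k := x + s k)) \<partial>std_gauss \<partial>gaussP I)"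
  proof (rule nn_integral_cong, rule std_gauss_shift)
    fix z :: "'i \<Rightarrow> real" assume "z \<in> space (gaussP I)"
    from measurable_compose[OF upd[OF this] insert.prems]
    show "(\<lambda>x. F (z(k := x))) \<in> borel_measurable borel" by (simp add: fun_upd_def)
  qed
  also have "\<dots> = (\<integral>\<^sup>+x. \<integral>\<^sup>+z. ennreal (exp (- s k * x - (s k)\<^sup>2 / 2)) * F (z(k := x + s k)) \<partial>gaussP I \<partial>std_gauss)"
  proof (rule pair_sigma_finite.Fubini')
    show "pair_sigma_finite std_gauss (gaussP I)"
      by (simp add: pair_sigma_finite_def prob_space_imp_sigma_finite prob_space_std_gauss prob_space_gaussP)
    have "(\<lambda>p. (snd p)(k := fst p + s k)) \<in> measurable (std_gauss \<Otimes>\<^sub>M gaussP I) (gaussP (insert k I))"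
      by (rule measurable_fun_upd) (auto cong: measurable_cong_sets)
    from measurable_compose[OF this insert.prems]
    show "(\<lambda>(x, z). ennreal (exp (- s k * x - (s k)\<^sup>2 / 2)) * F (z(k := x + s k)))
      \<in> borel_measurable (std_gauss \<Otimes>\<^sub>M gaussP I)"
      by (simp add: case_prod_beta) measurable
  qed
  also have "\<dots> = (\<integral>\<^sup>+x. \<integral>\<^sup>+z. ?e I z * (ennreal (exp (- s k * x - (s k)\<^sup>2 / 2)) * F ((\<lambda>i\<in>I. z i + s i)(k := x + s k))) \<partial>gaussP I \<partial>std_gauss)"
  proof (rule nn_integral_cong)
    fix x :: real
    have "(\<lambda>z. z(k := x + s k)) \<in> measurable (gaussP I) (gaussP (insert k I))"
      by (rule measurable_fun_upd) (auto cong: measurable_cong_sets)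
    from measurable_compose[OF this insert.prems]
    show "(\<integral>\<^sup>+z. ennreal (exp (- s k * x - (s k)\<^sup>2 / 2)) * F (z(k := x + s k)) \<partial>gaussP I)
      = (\<integral>\<^sup>+z. ?e I z * (ennreal (exp (- s k * x - (s k)\<^sup>2 / 2)) * F ((\<lambda>i\<in>I. z i + s i)(k := x + s k))) \<partial>gaussP I)"
      by (intro insert.IH) measurable
  qed
  also have "\<dots> = (\<integral>\<^sup>+x. \<integral>\<^sup>+z. ?e (insert k I) (z(k := x)) * F (\<lambda>i\<in>insert k I. (z(k := x)) i + s i) \<partial>gaussP I \<partial>std_gauss)"
  proof (intro nn_integral_cong)
    fix x :: real and z :: "'i \<Rightarrow> real"
    have "(\<Sum>i\<in>I. s i * (z(k := x)) i) = (\<Sum>i\<in>I. s i * z i)"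
      using insert.hyps by (intro sum.cong) auto
    then have "?e (insert k I) (z(k := x)) = ?e I z * ennreal (exp (- s k * x - (s k)\<^sup>2 / 2))"
      using insert.hyps by (simp add: ennreal_mult[symmetric] exp_add[symmetric] algebra_simps add_divide_distrib)
    moreover have "(\<lambda>i\<in>I. z i + s i)(k := x + s k) = (\<lambda>i\<in>insert k I. (z(k := x)) i + s i)"
      using insert.hyps by (auto simp: fun_eq_iff)
    ultimately show "?e I z * (ennreal (exp (- s k * x - (s k)\<^sup>2 / 2)) * F ((\<lambda>i\<in>I. z i + s i)(k := x + s k)))
      = ?e (insert k I) (z(k := x)) * F (\<lambda>i\<in>insert k I. (z(k := x)) i + s i)"
      by (simp add: mult.assoc)
  qed
  also have "\<dots> = (\<integral>\<^sup>+z. ?e (insert k I) z * F (\<lambda>i\<in>insert k I. z i + s i) \<partial>gaussP (insert k I))"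
  proof (rule gauss_product.product_nn_integral_insert_rev[symmetric])
    have "(\<lambda>z. \<lambda>i\<in>insert k I. z i + s i) \<in> measurable (gaussP (insert k I)) (gaussP (insert k I))"
      by (rule measurable_gaussP_restrict) measurable
    from measurable_compose[OF this insert.prems] insert.hyps
    show "(\<lambda>z. ?e (insert k I) z * F (\<lambda>i\<in>insert k I. z i + s i)) \<in> borel_measurable (gaussP (insert k I))"
      by measurable
  qed (use insert.hyps in auto)
  finally show ?case .
qed

lemma measurable_gaussP_upd:
  assumes "f \<in> measurable M (gaussP I)" "g \<in> borel_measurable M"
  shows "(\<lambda>p. (f p)(k := g p)) \<in> measurable M (gaussP (insert k I))"
  by (rule measurable_fun_upd) (use assms in \<open>auto cong: measurable_cong_sets\<close>)

text \<open>Rotation invariance coordinate by coordinate. It is what allows a Gaussian field at time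
  t + d to be split into independent fields at times t and d, see
  \<open>field_exponent_conv\<close>.\<close>

lemma gaussP_conv:
  fixes a b :: real and F :: "('i \<Rightarrow> real) \<Rightarrow> ennreal"
  assumes ab: "a\<^sup>2 + b\<^sup>2 = 1" "a \<ge> 0" "b \<ge> 0"
    and "finite I" and "F \<in> borel_measurable (gaussP I)"
  shows "(\<integral>\<^sup>+x. \<integral>\<^sup>+y. F (\<lambda>i\<in>I. a * x i + b * y i) \<partial>gaussP I \<partial>gaussP I) = (\<integral>\<^sup>+x. F x \<partial>gaussP I)"
  using assms(4,5)
proof (induction I arbitrary: F rule: finite_induct)
  case empty
  have "(\<integral>\<^sup>+x. F x \<partial>gaussP {}) = (\<integral>\<^sup>+x. F (\<lambda>_. undefined) \<partial>gaussP ({} :: 'i set))"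
    by (intro nn_integral_cong) (auto simp: space_PiM)
  then show ?case
    by (simp add: restrict_def prob_space.emeasure_space_1[OF prob_space_gaussP])
next
  case (insert k I)
  have psf: "pair_sigma_finite std_gauss (gaussP I)"
    by (simp add: pair_sigma_finite_def prob_space_imp_sigma_finite prob_space_std_gauss prob_space_gaussP)
  let ?J = "insert k I"
  let ?G = "\<lambda>x y. F (\<lambda>i\<in>?J. a * x i + b * y i)"
  have mr: "(\<lambda>p. F (\<lambda>i\<in>?J. a * f p i + b * g p i)) \<in> borel_measurable M"
    if "f \<in> measurable M (gaussP ?J)" "g \<in> measurable M (gaussP ?J)" for f g and M :: "'z measure"
  proof -
    have "(\<lambda>p. \<lambda>i\<in>?J. a * f p i + b * g p i) \<in> measurable M (gaussP ?J)"
    proof (rule measurable_gaussP_restrict)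
      fix i assume "i \<in> ?J"
      from measurable_compose[OF that(1) measurable_gaussP_component[OF this]]
           measurable_compose[OF that(2) measurable_gaussP_component[OF this]]
      show "(\<lambda>p. a * f p i + b * g p i) \<in> borel_measurable M" by measurable
    qed
    from measurable_compose[OF this insert.prems] show ?thesis .
  qed
  have F': "(\<lambda>p. F ((snd p)(k := fst p))) \<in> borel_measurable (std_gauss \<Otimes>\<^sub>M gaussP I)"
    by (rule measurable_compose[OF measurable_gaussP_upd insert.prems]) (auto cong: measurable_cong_sets)
  have upd: "(\<lambda>i\<in>?J. a * (x(k := u)) i + b * (y(k := v)) i) = (\<lambda>i\<in>I. a * x i + b * y i)(k := a * u + b * v)" for x y u v
    using insert.hyps by (auto simp: fun_eq_iff)
  have "(\<integral>\<^sup>+x. \<integral>\<^sup>+y. ?G x y \<partial>gaussP ?J \<partial>gaussP ?J)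
      = (\<integral>\<^sup>+x. \<integral>\<^sup>+v. \<integral>\<^sup>+y. ?G x (y(k := v)) \<partial>gaussP I \<partial>std_gauss \<partial>gaussP ?J)"
    by (intro nn_integral_cong gauss_product.product_nn_integral_insert_rev insert.hyps mr) auto
  also have "\<dots> = (\<integral>\<^sup>+u. \<integral>\<^sup>+x. \<integral>\<^sup>+v. \<integral>\<^sup>+y. ?G (x(k := u)) (y(k := v)) \<partial>gaussP I \<partial>std_gauss \<partial>gaussP I \<partial>std_gauss)"
  proof (rule gauss_product.product_nn_integral_insert_rev[OF insert.hyps])
    have "(\<lambda>q. ?G (fst (fst q)) ((snd q)(k := snd (fst q)))) \<in> borel_measurable ((gaussP ?J \<Otimes>\<^sub>M std_gauss) \<Otimes>\<^sub>M gaussP I)"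
      by (intro mr measurable_gaussP_upd) (auto cong: measurable_cong_sets)
    then have "(\<lambda>p. \<integral>\<^sup>+y. ?G (fst p) (y(k := snd p)) \<partial>gaussP I) \<in> borel_measurable (gaussP ?J \<Otimes>\<^sub>M std_gauss)"
      using sigma_finite_measure.borel_measurable_nn_integral[OF pair_sigma_finite.axioms(2)[OF psf],
         of "\<lambda>p y. ?G (fst p) (y(k := snd p))" "gaussP ?J \<Otimes>\<^sub>M std_gauss"]
      by (simp add: case_prod_beta)
    then show "(\<lambda>x. \<integral>\<^sup>+v. \<integral>\<^sup>+y. ?G x (y(k := v)) \<partial>gaussP I \<partial>std_gauss) \<in> borel_measurable (gaussP ?J)"
      using sigma_finite_measure.borel_measurable_nn_integral[OF pair_sigma_finite.axioms(1)[OF psf],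
         of "\<lambda>x v. \<integral>\<^sup>+y. ?G x (y(k := v)) \<partial>gaussP I" "gaussP ?J"]
      by (simp add: case_prod_beta)
  qed
  also have "\<dots> = (\<integral>\<^sup>+u. \<integral>\<^sup>+v. \<integral>\<^sup>+x. \<integral>\<^sup>+y. F ((\<lambda>i\<in>I. a * x i + b * y i)(k := a * u + b * v)) \<partial>gaussP I \<partial>gaussP I \<partial>std_gauss \<partial>std_gauss)"
    unfolding upd
  proof (rule nn_integral_cong, rule pair_sigma_finite.Fubini'[OF psf])
    fix u :: real
    have "(\<lambda>q. F ((\<lambda>i\<in>I. a * snd (fst q) i + b * snd q i)(k := a * u + b * fst (fst q))))
       \<in> borel_measurable ((std_gauss \<Otimes>\<^sub>M gaussP I) \<Otimes>\<^sub>M gaussP I)"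
    proof (rule measurable_compose[OF measurable_gaussP_upd insert.prems], rule measurable_gaussP_restrict)
      show "(\<lambda>q. a * snd (fst q) i + b * snd q i) \<in> borel_measurable ((std_gauss \<Otimes>\<^sub>M gaussP I) \<Otimes>\<^sub>M gaussP I)"
        if "i \<in> I" for i
        using that measurable_compose[OF measurable_fst measurable_gaussP_component_snd[OF that, of std_gauss], of "gaussP I"]
        by measurable
      show "(\<lambda>q. a * u + b * fst (fst q)) \<in> borel_measurable ((std_gauss \<Otimes>\<^sub>M gaussP I) \<Otimes>\<^sub>M gaussP I)"
        using measurable_compose[OF measurable_fst[of "std_gauss \<Otimes>\<^sub>M gaussP I" "gaussP I"] measurable_fst[of std_gauss "gaussP I"]]
        by (auto cong: measurable_cong_sets)
    qed
    then show "(\<lambda>(v, x). \<integral>\<^sup>+y. F ((\<lambda>i\<in>I. a * x i + b * y i)(k := a * u + b * v)) \<partial>gaussP I)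
        \<in> borel_measurable (std_gauss \<Otimes>\<^sub>M gaussP I)"
      using sigma_finite_measure.borel_measurable_nn_integral[OF pair_sigma_finite.axioms(2)[OF psf],
         of "\<lambda>p y. F ((\<lambda>i\<in>I. a * snd p i + b * y i)(k := a * u + b * fst p))" "std_gauss \<Otimes>\<^sub>M gaussP I"]
      by (simp add: case_prod_beta)
  qed
  also have "\<dots> = (\<integral>\<^sup>+u. \<integral>\<^sup>+v. \<integral>\<^sup>+x. F (x(k := a * u + b * v)) \<partial>gaussP I \<partial>std_gauss \<partial>std_gauss)"
  proof (rule nn_integral_cong, rule nn_integral_cong, rule insert.IH)
    fix u v :: real
    show "(\<lambda>x. F (x(k := a * u + b * v))) \<in> borel_measurable (gaussP I)"
      by (rule measurable_compose[OF measurable_gaussP_upd insert.prems]) auto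
  qed
  also have "\<dots> = (\<integral>\<^sup>+u. \<integral>\<^sup>+x. F (x(k := u)) \<partial>gaussP I \<partial>std_gauss)"
  proof (rule std_gauss_conv[OF ab])
    show "(\<lambda>u. \<integral>\<^sup>+x. F (x(k := u)) \<partial>gaussP I) \<in> borel_measurable borel"
      using sigma_finite_measure.borel_measurable_nn_integral[OF pair_sigma_finite.axioms(2)[OF psf],
         of "\<lambda>u x. F (x(k := u))" std_gauss] F'
      by (simp add: case_prod_beta cong: measurable_cong_sets)
  qed
  also have "\<dots> = (\<integral>\<^sup>+x. F x \<partial>gaussP ?J)"
    by (rule gauss_product.product_nn_integral_insert_rev[OF insert.hyps insert.prems, symmetric])
  finally show ?case .
qed

section \<open>Gaussian integration by parts\<close>

lemma exp_decay:
  assumes "a > (0::real)"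
  shows "((\<lambda>x::real. exp (a * \<bar>x\<bar>) * exp (- x\<^sup>2 / 2)) \<longlongrightarrow> 0) at_top"
    and "((\<lambda>x::real. exp (a * \<bar>x\<bar>) * exp (- x\<^sup>2 / 2)) \<longlongrightarrow> 0) at_bot"
proof -
  show t: "((\<lambda>x::real. exp (a * \<bar>x\<bar>) * exp (- x\<^sup>2 / 2)) \<longlongrightarrow> 0) at_top"
    using assms by real_asymp
  show "((\<lambda>x::real. exp (a * \<bar>x\<bar>) * exp (- x\<^sup>2 / 2)) \<longlongrightarrow> 0) at_bot"
    using t by (simp add: filterlim_at_bot_mirror)
qed

text \<open>The product of f with the normal density has derivative (f' - x f) times that density;
  its integral over the line is the difference of the boundary values, and these vanish because a
  Gaussian beats any exponential.\<close>

lemma std_gauss_by_parts: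
  fixes f f' :: "real \<Rightarrow> real"
  assumes f: "\<And>x. (f has_real_derivative f' x) (at x)" and f': "continuous_on UNIV f'"
    and bf: "\<And>x. \<bar>f x\<bar> \<le> C * exp (a * \<bar>x\<bar>)" and bf': "\<And>x. \<bar>f' x\<bar> \<le> C * exp (a * \<bar>x\<bar>)"
    and a: "a > 0"
  shows "(\<integral>x. x * f x \<partial>std_gauss) = (\<integral>x. f' x \<partial>std_gauss)"
proof -
  have cf: "continuous_on UNIV f"
    using f by (meson DERIV_isCont continuous_at_imp_continuous_on)
  have [measurable]: "f \<in> borel_measurable borel" "f' \<in> borel_measurable borel"
    using cf f' by (auto intro: borel_measurable_continuous_onI)
  have C: "C \<ge> 0" using bf[of 0] by simp
  have i1: "integrable std_gauss f'"
  proof (rule Bochner_Integration.integrable_bound[OF integrable_mult_right[OF std_gauss_exp_abs, of C a]])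
    show "AE x in std_gauss. norm (f' x) \<le> norm (C * exp (a * \<bar>x\<bar>))"
      by (rule AE_I2) (use bf' C in \<open>simp add: abs_mult\<close>)
  qed measurable
  have i2: "integrable std_gauss (\<lambda>x. x * f x)"
  proof (rule Bochner_Integration.integrable_bound[OF integrable_mult_right[OF std_gauss_exp_abs, of C "a + 1"]])
    show "AE x in std_gauss. norm (x * f x) \<le> norm (C * exp ((a + 1) * \<bar>x\<bar>))"
    proof (rule AE_I2)
      fix x :: real
      have "\<bar>x\<bar> \<le> exp \<bar>x\<bar>" using exp_ge_add_one_self[of "\<bar>x\<bar>"] by linarith
      then have "\<bar>x\<bar> * \<bar>f x\<bar> \<le> exp \<bar>x\<bar> * (C * exp (a * \<bar>x\<bar>))"
        by (intro mult_mono bf) auto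
      also have "\<dots> = C * exp ((a + 1) * \<bar>x\<bar>)" by (simp add: exp_add[symmetric] distrib_right)
      finally show "norm (x * f x) \<le> norm (C * exp ((a + 1) * \<bar>x\<bar>))" using C by (simp add: abs_mult)
    qed
  qed measurable
  define F where "F x = f x * std_normal_density x" for x
  define g where "g x = std_normal_density x * (f' x - x * f x)" for x
  have dF: "(F has_real_derivative g x) (at x)" for x
    unfolding F_def g_def std_normal_density_def
    by (rule derivative_eq_intros f refl | simp)+ (simp add: field_simps)
  have ig: "integrable lborel g"
    using Bochner_Integration.integrable_diff[OF i1 i2] unfolding std_gauss_def g_def
    by (subst (asm) integrable_density) auto
  have lim: "(F \<longlongrightarrow> 0) A" if "((\<lambda>x::real. exp (a * \<bar>x\<bar>) * exp (- x\<^sup>2 / 2)) \<longlongrightarrow> 0) A" for A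
  proof (rule Lim_null_comparison)
    show "((\<lambda>x. (C / sqrt (2 * pi)) * (exp (a * \<bar>x\<bar>) * exp (- x\<^sup>2 / 2))) \<longlongrightarrow> 0) A"
      by (rule tendsto_mult_right_zero[OF that])
    show "\<forall>\<^sub>F x in A. norm (F x) \<le> (C / sqrt (2 * pi)) * (exp (a * \<bar>x\<bar>) * exp (- x\<^sup>2 / 2))"
      using bf unfolding F_def std_normal_density_def
      by (intro always_eventually allI) (auto simp: abs_mult field_simps)
  qed
  have "(LBINT x=-\<infinity>..\<infinity>. g x) = 0 - 0"
  proof (rule interval_integral_FTC_integrable[where F = F])
    show "(F has_vector_derivative g x) (at x)" for x
      using dF[of x] by (simp add: has_real_derivative_iff_has_vector_derivative)
    show "isCont g x" for x
      using cf f' unfolding g_def std_normal_density_def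
      by (auto intro!: continuous_intros simp: continuous_on_eq_continuous_at)
    show "set_integrable lborel (einterval (- \<infinity>) \<infinity>) g"
      using ig by (simp add: set_integrable_def)
    show "((F \<circ> real_of_ereal) \<longlongrightarrow> 0) (at_right (- \<infinity>))"
      unfolding comp_def using lim[OF exp_decay(2)[OF a]] by (simp add: ereal_tendsto_simps1[unfolded comp_def])
    show "((F \<circ> real_of_ereal) \<longlongrightarrow> 0) (at_left \<infinity>)"
      unfolding comp_def using lim[OF exp_decay(1)[OF a]] by (simp add: ereal_tendsto_simps1[unfolded comp_def])
  qed simp
  then have "(\<integral>x. g x \<partial>lborel) = 0"
    by (simp add: interval_lebesgue_integral_def set_lebesgue_integral_def)
  moreover have "(\<integral>x. g x \<partial>lborel) = (\<integral>x. f' x - x * f x \<partial>std_gauss)"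
    unfolding std_gauss_def g_def by (subst integral_density) auto
  ultimately show ?thesis
    using i1 i2 by simp
qed

text \<open>Fubini isolates the coordinate k, and the exponential bound on F and F' becomes, with
  the other coordinates frozen, a one-dimensional bound of the kind required by
  \<open>std_gauss_by_parts\<close>.\<close>

lemma gaussP_by_parts:
  fixes F F' :: "('i \<Rightarrow> real) \<Rightarrow> real"
  assumes I: "finite I" "k \<in> I" and F: "exp_bounded I F" and F': "exp_bounded I F'"
    and d: "\<And>J x. ((\<lambda>x. F (J(k := x))) has_real_derivative F' (J(k := x))) (at x)"
    and c: "\<And>J. continuous_on UNIV (\<lambda>x. F' (J(k := x)))"
  shows "(\<integral>J. J k * F J \<partial>gaussP I) = (\<integral>J. F' J \<partial>gaussP I)"
proof -
  define I' where "I' = I - {k}"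
  have I': "I = insert k I'" "k \<notin> I'" "finite I'" using I unfolding I'_def by auto
  obtain a C where 1: "0 \<le> a" "0 \<le> C" "\<And>J. \<bar>F J\<bar> \<le> C * exp (a * (\<Sum>i\<in>I. \<bar>J i\<bar>))"
    using F unfolding exp_bounded_def by blast
  obtain b D where 2: "0 \<le> b" "0 \<le> D" "\<And>J. \<bar>F' J\<bar> \<le> D * exp (b * (\<Sum>i\<in>I. \<bar>J i\<bar>))"
    using F' unfolding exp_bounded_def by blast
  have s: "(\<Sum>i\<in>I. \<bar>(J(k := x)) i\<bar>) = \<bar>x\<bar> + (\<Sum>i\<in>I'. \<bar>J i\<bar>)" for J :: "'i \<Rightarrow> real" and x
  proof -
    have "(\<Sum>i\<in>I'. \<bar>(J(k := x)) i\<bar>) = (\<Sum>i\<in>I'. \<bar>J i\<bar>)"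
      using I' by (intro sum.cong) auto
    then show ?thesis using I' by simp
  qed
  have "(\<integral>J. J k * F J \<partial>gaussP I) = (\<integral>J. \<integral>x. x * F (J(k := x)) \<partial>std_gauss \<partial>gaussP I')"
    using gauss_product.product_integral_insert[OF I'(3,2), of "\<lambda>J. J k * F J"]
      exp_bounded_integrable[OF I(1) exp_bounded_mult[OF exp_bounded_component[OF I] F]] I'(1)
    by simp
  also have "\<dots> = (\<integral>J. \<integral>x. F' (J(k := x)) \<partial>std_gauss \<partial>gaussP I')"
  proof (rule Bochner_Integration.integral_cong[OF refl])
    fix J :: "'i \<Rightarrow> real"
    \<comment> \<open>The added 1 makes the growth rate strictly positive, as the one-dimensional
      statement demands, even when a and b are 0.\<close>
    let ?S = "\<Sum>i\<in>I'. \<bar>J i\<bar>" and ?m = "max a b + 1"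
    let ?K = "max C D * exp (?m * ?S)"
    have S: "0 \<le> ?S" by (simp add: sum_nonneg)
    have b1: "\<bar>F (J(k := x))\<bar> \<le> ?K * exp (?m * \<bar>x\<bar>)" for x
    proof -
      have "\<bar>F (J(k := x))\<bar> \<le> C * exp (a * (\<bar>x\<bar> + ?S))" using 1(3)[of "J(k := x)"] by (simp only: s)
      also have "\<dots> \<le> max C D * exp (?m * (\<bar>x\<bar> + ?S))"
        using 1 S by (intro mult_mono) (auto intro!: mult_right_mono)
      finally show ?thesis by (simp add: distrib_left exp_add mult_ac)
    qed
    have b2: "\<bar>F' (J(k := x))\<bar> \<le> ?K * exp (?m * \<bar>x\<bar>)" for x
    proof -
      have "\<bar>F' (J(k := x))\<bar> \<le> D * exp (b * (\<bar>x\<bar> + ?S))" using 2(3)[of "J(k := x)"] by (simp only: s)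
      also have "\<dots> \<le> max C D * exp (?m * (\<bar>x\<bar> + ?S))"
        using 2 S by (intro mult_mono) (auto intro!: mult_right_mono)
      finally show ?thesis by (simp add: distrib_left exp_add mult_ac)
    qed
    show "(\<integral>x. x * F (J(k := x)) \<partial>std_gauss) = (\<integral>x. F' (J(k := x)) \<partial>std_gauss)"
      by (rule std_gauss_by_parts[OF d c b1 b2]) (use 1 in simp)
  qed
  also have "\<dots> = (\<integral>J. F' J \<partial>gaussP I)"
    using gauss_product.product_integral_insert[OF I'(3,2), of F'] exp_bounded_integrable[OF I(1) F'] I'(1)
    by simp
  finally show ?thesis .
qed

section \<open>Gibbs measures and Gaussian interpolation\<close>

lemma exp_taylor2:
  assumes "\<bar>t\<bar> \<le> (1::real)"
  shows "\<bar>exp t - (1 + t + t\<^sup>2 / 2)\<bar> \<le> \<bar>t\<bar> ^ 3"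
proof -
  obtain s where s: "\<bar>s\<bar> \<le> \<bar>t\<bar>" "exp t = (\<Sum>m<3. t ^ m / fact m) + exp s / fact 3 * t ^ 3"
    using Maclaurin_exp_le[of t 3] by blast
  have "exp t - (1 + t + t\<^sup>2 / 2) = exp s / 6 * t ^ 3"
    using s(2) by (simp add: eval_nat_numeral fact_numeral)
  moreover have "exp s / 6 \<le> 1"
  proof -
    have "exp s \<le> exp 1" using s(1) assms by simp
    also have "\<dots> \<le> 3" by (rule exp_le)
    finally show ?thesis by simp
  qed
  ultimately show ?thesis
    using mult_right_mono[of "exp s / 6" 1 "\<bar>t\<bar> ^ 3"] by (simp only: abs_mult power_abs) simp
qed

text \<open>The remainder vanishes at 0 and has derivative z^2/(1 + z), which is at most 2 y^2 on
  the ball of radius |y| since 1 + z is at least 1/2 there.\<close>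

lemma ln_taylor2:
  assumes "\<bar>y\<bar> \<le> (1/2::real)"
  shows "\<bar>ln (1 + y) - y + y\<^sup>2 / 2\<bar> \<le> 2 * \<bar>y\<bar> ^ 3"
proof -
  have "norm ((ln (1 + y) - y + y\<^sup>2 / 2) - (ln (1 + 0) - 0 + 0\<^sup>2 / 2)) \<le> (2 * y\<^sup>2) * norm (y - 0)"
  proof (rule field_differentiable_bound[where S = "cball 0 \<bar>y\<bar>" and f' = "\<lambda>z. z\<^sup>2 / (1 + z)"])
    fix z :: real assume z: "z \<in> cball 0 \<bar>y\<bar>"
    then have z': "1 + z \<ge> 1/2" "\<bar>z\<bar> \<le> \<bar>y\<bar>" using assms by auto
    then show "((\<lambda>a. ln (1 + a) - a + a\<^sup>2 / 2) has_field_derivative z\<^sup>2 / (1 + z)) (at z within cball 0 \<bar>y\<bar>)"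
      by (auto intro!: derivative_eq_intros simp: field_simps power2_eq_square)
    have "z\<^sup>2 \<le> y\<^sup>2" using z' by (simp add: abs_le_square_iff)
    moreover have "z\<^sup>2 / (1 + z) \<le> z\<^sup>2 / (1/2)" using z' by (intro divide_left_mono) auto
    ultimately show "norm (z\<^sup>2 / (1 + z)) \<le> 2 * y\<^sup>2" using z' by simp
  qed auto
  then show ?thesis by (simp add: power3_eq_cube power2_eq_square abs_mult mult_ac)
qed

lemma (in prob_space) integral_abs_bound:
  fixes f :: "'a \<Rightarrow> real"
  assumes [measurable]: "f \<in> borel_measurable M" and b: "\<And>x. x \<in> space M \<Longrightarrow> \<bar>f x\<bar> \<le> c"
  shows "integrable M f" "\<bar>\<integral>x. f x \<partial>M\<bar> \<le> c"
proof -
  show i: "integrable M f"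
    by (rule integrable_const_bound[where B = c]) (use b in auto)
  have "\<bar>\<integral>x. f x \<partial>M\<bar> \<le> (\<integral>x. \<bar>f x\<bar> \<partial>M)" by simp
  also have "\<dots> \<le> (\<integral>x. c \<partial>M)" using i b by (intro integral_mono) auto
  finally show "\<bar>\<integral>x. f x \<partial>M\<bar> \<le> c" by (simp add: prob_space)
qed

text \<open>The first two cumulants with a cubic error that holds for every size of e. No smallness
  may be assumed, because e will contain the unbounded disorder and the estimate is integrated over
  it. For small e this is Taylor's formula; for large e every term is at most a multiple of e^3
  anyway.\<close>

lemma (in prob_space) log_mgf_cumulant_bound:
  fixes D :: "'a \<Rightarrow> real"
  assumes [measurable]: "D \<in> borel_measurable M" and D: "\<And>x. x \<in> space M \<Longrightarrow> \<bar>D x\<bar> \<le> e"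
  defines "X \<equiv> \<integral>x. exp (D x) \<partial>M" and "m1 \<equiv> \<integral>x. D x \<partial>M" and "m2 \<equiv> \<integral>x. (D x)\<^sup>2 \<partial>M"
  shows "\<bar>ln X\<bar> \<le> e" and "\<bar>ln X - (m1 + (m2 - m1\<^sup>2) / 2)\<bar> \<le> 40 * e ^ 3"
proof -
  obtain x0 where "x0 \<in> space M" using not_empty by blast
  then have e: "0 \<le> e" using D[of x0] by linarith
  have iX: "integrable M (\<lambda>x. exp (D x))"
    by (rule integral_abs_bound(1)[where c = "exp e"]) (use D in \<open>force simp: abs_le_iff\<close>)+
  have iD: "integrable M D" by (rule integral_abs_bound(1)[OF _ D]) simp
  have m1: "\<bar>m1\<bar> \<le> e" unfolding m1_def by (rule integral_abs_bound(2)[OF _ D]) simp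
  have D2: "\<bar>(D x)\<^sup>2\<bar> \<le> e\<^sup>2" if "x \<in> space M" for x
    using power_mono[OF D[OF that], of 2] by simp
  have iD2: "integrable M (\<lambda>x. (D x)\<^sup>2)" by (rule integral_abs_bound(1)[OF _ D2]) simp
  have m2: "\<bar>m2\<bar> \<le> e\<^sup>2" unfolding m2_def by (rule integral_abs_bound(2)[OF _ D2]) simp
  have D': "- e \<le> D x" "D x \<le> e" if "x \<in> space M" for x
    using D[OF that] by (simp_all add: abs_le_iff)
  have X1: "exp (- e) \<le> X"
  proof -
    have "(\<integral>x. exp (- e) \<partial>M) \<le> X" unfolding X_def
      using iX D' by (intro integral_mono) auto
    then show ?thesis by (simp add: prob_space)
  qed
  have X2: "X \<le> exp e"
  proof -
    have "X \<le> (\<integral>x. exp e \<partial>M)" unfolding X_def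
      using iX D' by (intro integral_mono) auto
    then show ?thesis by (simp add: prob_space)
  qed
  have Xpos: "X > 0" using X1 by (meson exp_gt_zero less_le_trans)
  have "ln X \<le> e" using X2 Xpos by (metis ln_exp ln_mono)
  moreover have "- e \<le> ln X" using X1 Xpos by (metis exp_gt_zero ln_exp ln_mono)
  ultimately show lnX: "\<bar>ln X\<bar> \<le> e" by simp
  have m1s: "m1\<^sup>2 \<le> e\<^sup>2" using power_mono[OF m1, of 2] by simp
  show "\<bar>ln X - (m1 + (m2 - m1\<^sup>2) / 2)\<bar> \<le> 40 * e ^ 3"
  \<comment> \<open>The threshold keeps |m1 + r| below 2 e, hence below 1/2, where
    \<open>ln_taylor2\<close> applies.\<close>
  proof (cases "e \<le> 1/4")
    case True
    define E where "E = X - (1 + m1 + m2 / 2)"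
    have "\<bar>\<integral>x. exp (D x) - (1 + D x + (D x)\<^sup>2 / 2) \<partial>M\<bar> \<le> e ^ 3"
    proof (rule integral_abs_bound(2))
      fix x assume x: "x \<in> space M"
      have "\<bar>exp (D x) - (1 + D x + (D x)\<^sup>2 / 2)\<bar> \<le> \<bar>D x\<bar> ^ 3"
        using D[OF x] True by (intro exp_taylor2) linarith
      also have "\<dots> \<le> e ^ 3" using D[OF x] by (intro power_mono) auto
      finally show "\<bar>exp (D x) - (1 + D x + (D x)\<^sup>2 / 2)\<bar> \<le> e ^ 3" .
    qed measurable
    then have E: "\<bar>E\<bar> \<le> e ^ 3"
      unfolding E_def X_def m1_def m2_def using iX iD iD2 by (simp add: prob_space)
    define r where "r = m2 / 2 + E"
    have e3: "e ^ 3 \<le> e\<^sup>2 / 4"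
      using mult_right_mono[OF True, of "e\<^sup>2"] by (simp add: power3_eq_cube power2_eq_square)
    have e2: "e\<^sup>2 \<le> e / 4"
      using mult_right_mono[OF True, of "e"] e by (simp add: power2_eq_square)
    have r: "\<bar>r\<bar> \<le> 3/4 * e\<^sup>2" unfolding r_def using m2 E e3 by linarith
    have y: "X = 1 + (m1 + r)" unfolding r_def E_def by simp
    have yb: "\<bar>m1 + r\<bar> \<le> 2 * e" using m1 r e2 e by linarith
    have yb': "\<bar>m1 + r\<bar> ^ 3 \<le> 8 * e ^ 3"
      using power_mono[OF yb, of 3] by (simp add: power_mult_distrib)
    have L: "\<bar>ln X - (m1 + r) + (m1 + r)\<^sup>2 / 2\<bar> \<le> 16 * e ^ 3"
      using ln_taylor2[of "m1 + r"] yb yb' True unfolding y by linarith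
    have "\<bar>r * (2 * m1 + r)\<bar> \<le> (3/4 * e\<^sup>2) * (3 * e)"
      unfolding abs_mult using r m1 e2 e by (intro mult_mono) auto
    then have Q: "\<bar>r * (2 * m1 + r)\<bar> \<le> 9/4 * e ^ 3" by (simp add: power3_eq_cube power2_eq_square)
    have "ln X - (m1 + (m2 - m1\<^sup>2) / 2) = (ln X - (m1 + r) + (m1 + r)\<^sup>2 / 2) + E - r * (2 * m1 + r) / 2"
      unfolding r_def by (simp add: power2_eq_square field_simps)
    then show ?thesis using L E Q e by linarith
  next
    case False
    \<comment> \<open>Since 4 e > 1, both e and e^2 are dominated by e^3. The resulting bound 2 e +
      e^2 \<le> 36 e^3 is what sets the constant 40.\<close>
    have "e * 1 \<le> e * (4 * e)\<^sup>2" using False e by (intro mult_left_mono one_le_power) auto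
    then have 1: "e \<le> 16 * e ^ 3" by (simp add: power3_eq_cube power2_eq_square)
    have "e\<^sup>2 * 1 \<le> e\<^sup>2 * (4 * e)" using False e by (intro mult_left_mono) auto
    then have 2: "e\<^sup>2 \<le> 4 * e ^ 3" by (simp add: power3_eq_cube power2_eq_square)
    have half_diff: "\<bar>(a - p) / 2\<bar> \<le> q" if "\<bar>a\<bar> \<le> q" "0 \<le> p" "p \<le> q" for a p q :: real
      using that unfolding diff_divide_distrib by linarith
    have 3: "\<bar>(m2 - m1\<^sup>2) / 2\<bar> \<le> e\<^sup>2" by (rule half_diff[OF m2 zero_le_power2 m1s])
    have "\<bar>ln X - (m1 + (m2 - m1\<^sup>2) / 2)\<bar> \<le> \<bar>ln X\<bar> + (\<bar>m1\<bar> + \<bar>(m2 - m1\<^sup>2) / 2\<bar>)"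
      by (meson abs_triangle_ineq abs_triangle_ineq4 add_left_mono order_trans)
    also have "\<dots> \<le> e + (e + e\<^sup>2)" using lnX m1 3 by (intro add_mono)
    finally have "\<bar>ln X - (m1 + (m2 - m1\<^sup>2) / 2)\<bar> \<le> e + (e + e\<^sup>2)" .
    then show ?thesis using 1 2 by linarith
  qed
qed

lemma gaussP_mean: "finite I \<Longrightarrow> k \<in> I \<Longrightarrow> (\<integral>J. J k \<partial>gaussP I) = 0"
  using gaussP_by_parts[of I k "\<lambda>_. 1" "\<lambda>_. 0"] by auto

lemma gaussP_cov:
  assumes "finite I" "k \<in> I" "l \<in> I"
  shows "(\<integral>J. J k * J l \<partial>gaussP I) = (if k = l then 1 else 0)"
proof -
  have "(\<integral>J. J k * J l \<partial>gaussP I) = (\<integral>J. (if k = l then 1 else 0) \<partial>gaussP I)"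
    using assms by (intro gaussP_by_parts) (auto intro!: derivative_eq_intros)
  then show ?thesis
    using prob_space.prob_space[OF prob_space_gaussP[of I]] by simp
qed

section \<open>Increments of a Gaussian field in time\<close>

text \<open>Summing over n equal steps leaves a total error K / sqrt n, which tends to 0. It takes
  the place of a sign condition on a derivative.\<close>

lemma nonincreasing_from_increments:
  fixes f :: "real \<Rightarrow> real"
  assumes "\<And>t d. 0 \<le> t \<Longrightarrow> 0 \<le> d \<Longrightarrow> t + d \<le> 1 \<Longrightarrow> f (t + d) \<le> f t + K * (d * sqrt d)"
  shows "f 1 \<le> f 0"
proof -
  have *: "f (real m / real n) \<le> f 0 + real m * (K * (1 / real n * sqrt (1 / real n)))"
    if "n > 0" "m \<le> n" for n m :: nat
    using that(2)
  proof (induction m)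
    case (Suc m)
    have "f (real m / real n + 1 / real n) \<le> f (real m / real n) + K * (1 / real n * sqrt (1 / real n))"
      using Suc.prems that(1) by (intro assms) (auto simp: field_simps)
    then show ?case using Suc by (simp add: add_divide_distrib algebra_simps)
  qed simp
  have "f 1 \<le> f 0 + K * sqrt (1 / real (Suc n))" for n
    using *[of "Suc n" "Suc n"] by simp
  moreover have "(\<lambda>n. f 0 + K * sqrt (1 / real (Suc n))) \<longlonglongrightarrow> f 0 + K * sqrt 0"
    by (intro tendsto_intros lim_inverse_n'[THEN LIMSEQ_Suc] tendsto_real_sqrt)
  ultimately show ?thesis
    using LIMSEQ_le_const[of "\<lambda>n. f 0 + K * sqrt (1 / real (Suc n))" "f 0 + K * sqrt 0" "f 1"] by auto
qed

text \<open>The exponent is normalised so that its exponential has expectation 1 over the Gaussian field \<open>J\<close>.\<close>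

definition field_exponent :: "'k set \<Rightarrow> ('k \<Rightarrow> 'a \<Rightarrow> real) \<Rightarrow> real \<Rightarrow> ('k \<Rightarrow> real) \<Rightarrow> 'a \<Rightarrow> real" where
  "field_exponent I \<phi> t J x = sqrt t * (\<Sum>k\<in>I. J k * \<phi> k x) - t / 2 * (\<Sum>k\<in>I. (\<phi> k x)\<^sup>2)"

text \<open>For t \<le> 1 the variance correction of order t is absorbed into order
  \<open>sqrt t\<close>. The common factor matters: cubed, with t = d, it gives the error of order
  \<open>d * sqrt d\<close>.\<close>

lemma field_exponent_bound:
  assumes I: "finite I" and \<phi>: "\<And>k. k \<in> I \<Longrightarrow> \<bar>\<phi> k x\<bar> \<le> B" and t: "0 \<le> t" "t \<le> 1" and B: "0 \<le> B"
  shows "\<bar>field_exponent I \<phi> t J x\<bar> \<le> sqrt t * (B * (\<Sum>k\<in>I. \<bar>J k\<bar>) + real (card I) * B\<^sup>2)"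
proof -
  have "\<bar>\<Sum>k\<in>I. J k * \<phi> k x\<bar> \<le> (\<Sum>k\<in>I. \<bar>J k\<bar> * B)"
    using \<phi> by (intro order_trans[OF sum_abs] sum_mono) (auto simp: abs_mult intro!: mult_left_mono)
  then have 1: "\<bar>\<Sum>k\<in>I. J k * \<phi> k x\<bar> \<le> B * (\<Sum>k\<in>I. \<bar>J k\<bar>)" by (simp add: sum_distrib_left mult.commute)
  have "(\<Sum>k\<in>I. (\<phi> k x)\<^sup>2) \<le> (\<Sum>k\<in>I. B\<^sup>2)"
    using \<phi> B by (intro sum_mono) (metis abs_le_square_iff abs_of_nonneg)
  then have 2: "(\<Sum>k\<in>I. (\<phi> k x)\<^sup>2) \<le> real (card I) * B\<^sup>2" by simp
  have 3: "0 \<le> (\<Sum>k\<in>I. (\<phi> k x)\<^sup>2)" by (simp add: sum_nonneg)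
  have "t = sqrt t * sqrt t" using t by simp
  also have "\<dots> \<le> sqrt t * 1" using t by (intro mult_left_mono) auto
  finally have "t / 2 \<le> sqrt t" using t by simp
  then have "t / 2 * (\<Sum>k\<in>I. (\<phi> k x)\<^sup>2) \<le> sqrt t * (real (card I) * B\<^sup>2)"
    using 2 3 t by (intro mult_mono) auto
  moreover have "\<bar>sqrt t * (\<Sum>k\<in>I. J k * \<phi> k x)\<bar> \<le> sqrt t * (B * (\<Sum>k\<in>I. \<bar>J k\<bar>))"
    unfolding abs_mult using 1 t by (intro mult_mono) auto
  moreover have "0 \<le> t / 2 * (\<Sum>k\<in>I. (\<phi> k x)\<^sup>2)" using 3 t by simp
  ultimately show ?thesis unfolding field_exponent_def by (simp add: distrib_left)
qed

lemma measurable_field_exponent: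
  assumes "\<And>k. k \<in> I \<Longrightarrow> \<phi> k \<in> borel_measurable M"
  shows "(\<lambda>p. field_exponent I \<phi> t (fst p) (snd p)) \<in> borel_measurable (gaussP I \<Otimes>\<^sub>M M)"
proof -
  have [measurable]: "(\<lambda>p. \<phi> k (snd p)) \<in> borel_measurable (gaussP I \<Otimes>\<^sub>M M)" if "k \<in> I" for k
    using assms[OF that] by measurable
  show ?thesis unfolding field_exponent_def by measurable
qed

lemma measurable_field_exponent':
  assumes "\<And>k. k \<in> I \<Longrightarrow> \<phi> k \<in> borel_measurable M"
  shows "field_exponent I \<phi> t J \<in> borel_measurable M"
  unfolding field_exponent_def[abs_def] using assms by measurable

text \<open>The first summand is the cubic cumulant error averaged over the disorder, the second
  bounds the fluctuation of the variance, a term of order d^2. It depends on neither the base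
  measure nor the time, so the errors of many steps can be added.\<close>

definition step_const :: "'k set \<Rightarrow> real \<Rightarrow> real" where
  "step_const I B = (\<integral>J. 40 * (B * (\<Sum>k\<in>I. \<bar>J k\<bar>) + real (card I) * B\<^sup>2) ^ 3 \<partial>gaussP I) + (real (card I) * B\<^sup>2)\<^sup>2"

text \<open>The second cumulant expansion is a quadratic polynomial in J, so its Gaussian mean is
  explicit. The variance created by the field cancels against the normalisation of the exponent, and
  to first order in d only the squares of the means of \<phi> k survive.\<close>

lemma (in prob_space) gaussian_log_mgf_step:
  fixes \<phi> :: "'k \<Rightarrow> 'a \<Rightarrow> real"
  assumes I: "finite I" and \<phi>m: "\<And>k. k \<in> I \<Longrightarrow> \<phi> k \<in> borel_measurable M"
    and \<phi>: "\<And>k x. k \<in> I \<Longrightarrow> x \<in> space M \<Longrightarrow> \<bar>\<phi> k x\<bar> \<le> B" and B: "0 \<le> B"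
    and d: "0 \<le> d" "d \<le> 1"
  shows "exp_bounded I (\<lambda>J. ln (\<integral>x. exp (field_exponent I \<phi> d J x) \<partial>M))"
    and "\<bar>(\<integral>J. ln (\<integral>x. exp (field_exponent I \<phi> d J x) \<partial>M) \<partial>gaussP I) + d / 2 * (\<Sum>k\<in>I. (\<integral>x. \<phi> k x \<partial>M)\<^sup>2)\<bar>
           \<le> step_const I B * (d * sqrt d)"
proof -
  note [measurable] = \<phi>m
  define V where "V x = (\<Sum>k\<in>I. (\<phi> k x)\<^sup>2)" for x
  define e where "e J = B * (\<Sum>k\<in>I. \<bar>J k\<bar>) + real (card I) * B\<^sup>2" for J :: "'k \<Rightarrow> real"
  let ?D = "field_exponent I \<phi> d"
  have D: "\<bar>?D J x\<bar> \<le> sqrt d * e J" if "x \<in> space M" for J x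
    unfolding e_def using \<phi> that by (intro field_exponent_bound I d B) auto
  have Dm: "?D J \<in> borel_measurable M" for J by (rule measurable_field_exponent'[OF \<phi>m])
  have [measurable]: "V \<in> borel_measurable M" unfolding V_def by measurable
  have V: "\<bar>V x\<bar> \<le> real (card I) * B\<^sup>2" "0 \<le> V x" if "x \<in> space M" for x
  proof -
    show "0 \<le> V x" unfolding V_def by (simp add: sum_nonneg)
    moreover have "V x \<le> (\<Sum>k\<in>I. B\<^sup>2)" unfolding V_def
      using \<phi>[OF _ that] B by (intro sum_mono) (metis abs_le_square_iff abs_of_nonneg)
    ultimately show "\<bar>V x\<bar> \<le> real (card I) * B\<^sup>2" by simp
  qed
  have eb: "exp_bounded I e" unfolding e_def using I by (intro exp_bounded_add exp_bounded_mult exp_bounded_sum exp_bounded_abs) auto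
  let ?L = "\<lambda>J. ln (\<integral>x. exp (?D J x) \<partial>M)"
  have Lm: "?L \<in> borel_measurable (gaussP I)"
  proof -
    have "(\<lambda>p. exp (?D (fst p) (snd p))) \<in> borel_measurable (gaussP I \<Otimes>\<^sub>M M)"
      using measurable_field_exponent[OF \<phi>m] by measurable
    then have "(\<lambda>J. \<integral>x. exp (?D J x) \<partial>M) \<in> borel_measurable (gaussP I)"
      using borel_measurable_lebesgue_integral[of "\<lambda>J x. exp (?D J x)" "gaussP I"] by (simp add: case_prod_beta)
    then show ?thesis by measurable
  qed
  have Lb: "\<bar>?L J\<bar> \<le> sqrt d * e J" for J
    by (rule log_mgf_cumulant_bound(1)[OF Dm D])
  show Lx: "exp_bounded I ?L"
    by (rule exp_bounded_bound[OF exp_bounded_mult[OF exp_bounded_const eb] Lm Lb])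
  define a where "a k = (\<integral>x. \<phi> k x \<partial>M)" for k
  define b where "b k l = (\<integral>x. \<phi> k x * \<phi> l x \<partial>M)" for k l
  define c where "c k = (\<integral>x. \<phi> k x * V x \<partial>M)" for k
  define v where "v = (\<integral>x. V x \<partial>M)"
  define v2 where "v2 = (\<integral>x. (V x)\<^sup>2 \<partial>M)"
  \<comment> \<open>This is m1 + (m2 - m1^2)/2 for the exponent, sorted by degree in J.\<close>
  define T where "T J = (sqrt d * (\<Sum>k\<in>I. J k * a k) - d / 2 * v)
      + (d * (\<Sum>k\<in>I. \<Sum>l\<in>I. J k * J l * b k l) - d * sqrt d * (\<Sum>k\<in>I. J k * c k) + d\<^sup>2 / 4 * v2
         - (sqrt d * (\<Sum>k\<in>I. J k * a k) - d / 2 * v)\<^sup>2) / 2" for J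
  have i1: "integrable M (\<phi> k)" if "k \<in> I" for k
    using \<phi>[OF that] that by (intro integral_abs_bound(1)[where c = B]) auto
  have i2: "integrable M (\<lambda>x. \<phi> k x * \<phi> l x)" if "k \<in> I" "l \<in> I" for k l
    using \<phi>[OF that(1)] \<phi>[OF that(2)] that B
    by (intro integral_abs_bound(1)[where c = "B * B"]) (auto simp: abs_mult intro!: mult_mono)
  have i3: "integrable M (\<lambda>x. \<phi> k x * V x)" if "k \<in> I" for k
    using \<phi>[OF that] V that B
    by (intro integral_abs_bound(1)[where c = "B * (real (card I) * B\<^sup>2)"]) (auto simp: abs_mult intro!: mult_mono)
  have i4: "integrable M V" using V by (intro integral_abs_bound(1)[where c = "real (card I) * B\<^sup>2"]) auto
  have V2: "\<bar>(V x)\<^sup>2\<bar> \<le> (real (card I) * B\<^sup>2)\<^sup>2" if "x \<in> space M" for x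
    using power_mono[OF V(1)[OF that], of 2] by simp
  have i5: "integrable M (\<lambda>x. (V x)\<^sup>2)" by (rule integral_abs_bound(1)[OF _ V2]) measurable
  have m1: "(\<integral>x. ?D J x \<partial>M) = sqrt d * (\<Sum>k\<in>I. J k * a k) - d / 2 * v" for J
    unfolding field_exponent_def V_def[symmetric] a_def v_def using i1 i4
    by (simp add: Bochner_Integration.integral_sum)
  have m2: "(\<integral>x. (?D J x)\<^sup>2 \<partial>M)
     = d * (\<Sum>k\<in>I. \<Sum>l\<in>I. J k * J l * b k l) - d * sqrt d * (\<Sum>k\<in>I. J k * c k) + d\<^sup>2 / 4 * v2" for J
  proof -
    have "(?D J x)\<^sup>2 = d * (\<Sum>k\<in>I. \<Sum>l\<in>I. J k * J l * (\<phi> k x * \<phi> l x)) - d * sqrt d * (\<Sum>k\<in>I. J k * (\<phi> k x * V x))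
        + d\<^sup>2 / 4 * (V x)\<^sup>2" for x
    proof -
      have "(\<Sum>k\<in>I. J k * \<phi> k x)\<^sup>2 = (\<Sum>k\<in>I. \<Sum>l\<in>I. J k * J l * (\<phi> k x * \<phi> l x))"
        unfolding power2_eq_square sum_product by (intro sum.cong refl) (simp add: mult_ac)
      moreover have "(\<Sum>k\<in>I. J k * \<phi> k x) * V x = (\<Sum>k\<in>I. J k * (\<phi> k x * V x))"
        by (simp add: sum_distrib_right mult.assoc)
      moreover have "(?D J x)\<^sup>2 = (sqrt d)\<^sup>2 * (\<Sum>k\<in>I. J k * \<phi> k x)\<^sup>2 - d * sqrt d * ((\<Sum>k\<in>I. J k * \<phi> k x) * V x)
        + d\<^sup>2 / 4 * (V x)\<^sup>2"
        unfolding field_exponent_def V_def[symmetric] by (simp add: power2_eq_square field_simps)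
      ultimately show ?thesis using d by simp
    qed
    then show ?thesis
      unfolding b_def c_def v2_def using i2 i3 i5
      by (simp add: Bochner_Integration.integral_sum)
  qed
  have LT: "\<bar>?L J - T J\<bar> \<le> 40 * (sqrt d * e J) ^ 3" for J
    using log_mgf_cumulant_bound(2)[OF Dm D, of J] unfolding m1 m2 T_def .
  have Jk: "exp_bounded I (\<lambda>J. J k)" if "k \<in> I" for k using I that by auto
  have ETi: "exp_bounded I T" unfolding T_def[abs_def] power2_eq_square divide_inverse using I
    by (intro exp_bounded_add exp_bounded_diff exp_bounded_mult exp_bounded_sum exp_bounded_const Jk)
  define Y where "Y J = (\<Sum>k\<in>I. J k * a k)" for J :: "'k \<Rightarrow> real"
  have Yb: "exp_bounded I Y" unfolding Y_def by (intro exp_bounded_sum exp_bounded_mult exp_bounded_const Jk)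
  have EJ: "(\<integral>J. (\<Sum>k\<in>I. J k * f k) \<partial>gaussP I) = 0" for f :: "'k \<Rightarrow> real"
    using I by (subst Bochner_Integration.integral_sum)
      (auto simp: gaussP_mean intro!: exp_bounded_integrable exp_bounded_mult)
  have EJJ: "(\<integral>J. (\<Sum>k\<in>I. \<Sum>l\<in>I. J k * J l * f k l) \<partial>gaussP I) = (\<Sum>k\<in>I. f k k)" for f :: "'k \<Rightarrow> 'k \<Rightarrow> real"
  proof -
    have "(\<integral>J. (\<Sum>k\<in>I. \<Sum>l\<in>I. J k * J l * f k l) \<partial>gaussP I) = (\<Sum>k\<in>I. \<Sum>l\<in>I. \<integral>J. J k * J l * f k l \<partial>gaussP I)"
      using I by (subst Bochner_Integration.integral_sum, force intro!: exp_bounded_integrable exp_bounded_sum exp_bounded_mult)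
         (intro sum.cong refl Bochner_Integration.integral_sum exp_bounded_integrable exp_bounded_mult exp_bounded_const Jk; assumption)
    also have "\<dots> = (\<Sum>k\<in>I. \<Sum>l\<in>I. if k = l then f k l else 0)"
      using I by (intro sum.cong refl) (simp add: gaussP_cov)
    also have "\<dots> = (\<Sum>k\<in>I. f k k)" using I by (simp add: sum.delta)
    finally show ?thesis .
  qed
  have one: "(\<integral>J. c \<partial>gaussP I) = c" for c :: real
    using prob_space.prob_space[OF prob_space_gaussP[of I]] by simp
  have EY: "(\<integral>J. Y J \<partial>gaussP I) = 0" unfolding Y_def by (rule EJ)
  have EY2: "(\<integral>J. (Y J)\<^sup>2 \<partial>gaussP I) = (\<Sum>k\<in>I. (a k)\<^sup>2)"
  proof -
    have "(Y J)\<^sup>2 = (\<Sum>k\<in>I. \<Sum>l\<in>I. J k * J l * (a k * a l))" for J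
      unfolding Y_def power2_eq_square sum_product by (intro sum.cong refl) (simp add: mult_ac)
    then show ?thesis using EJJ[of "\<lambda>k l. a k * a l"] by (simp add: power2_eq_square)
  qed
  have bkk: "(\<Sum>k\<in>I. b k k) = v"
    unfolding b_def v_def V_def using i2 by (subst Bochner_Integration.integral_sum) (auto simp: power2_eq_square)
  \<comment> \<open>The double sum has mean v, so its d/2 v cancels the -d/2 v of the normalisation;
    the terms linear in J vanish, and the squared first cumulant contributes the negative
    sum.\<close>
  have ET: "(\<integral>J. T J \<partial>gaussP I) = - (d / 2 * (\<Sum>k\<in>I. (a k)\<^sup>2)) + d\<^sup>2 / 8 * (v2 - v\<^sup>2)"
  proof -
    have "T J = (sqrt d + sqrt d * d / 2 * v) * Y J + (- (d / 2 * v) + d\<^sup>2 / 8 * (v2 - v\<^sup>2))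
      + d / 2 * (\<Sum>k\<in>I. \<Sum>l\<in>I. J k * J l * b k l) - (d * sqrt d / 2) * (\<Sum>k\<in>I. J k * c k) - d / 2 * (Y J)\<^sup>2" for J
    proof -
      have "(sqrt d)\<^sup>2 = d" using d by simp
      then have sq: "(sqrt d * Y J - d / 2 * v)\<^sup>2 = d * (Y J)\<^sup>2 - sqrt d * d * v * Y J + d\<^sup>2 / 4 * v\<^sup>2"
        by (simp add: power2_diff power_mult_distrib field_simps)
      show ?thesis unfolding T_def Y_def[symmetric] sq by (simp add: field_simps)
    qed
    moreover have "integrable (gaussP I) Y" "integrable (gaussP I) (\<lambda>J. (Y J)\<^sup>2)"
      "integrable (gaussP I) (\<lambda>J. \<Sum>k\<in>I. J k * c k)" "integrable (gaussP I) (\<lambda>J. \<Sum>k\<in>I. \<Sum>l\<in>I. J k * J l * b k l)"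
      "integrable (gaussP I) (\<lambda>J. - (d / 2 * v) + d\<^sup>2 / 8 * (v2 - v\<^sup>2))"
      by (auto intro!: exp_bounded_integrable I exp_bounded_power Yb exp_bounded_sum exp_bounded_mult Jk)
    ultimately have "(\<integral>J. T J \<partial>gaussP I) = (sqrt d + sqrt d * d / 2 * v) * 0 + (- (d / 2 * v) + d\<^sup>2 / 8 * (v2 - v\<^sup>2))
      + d / 2 * v - (d * sqrt d / 2) * 0 - d / 2 * (\<Sum>k\<in>I. (a k)\<^sup>2)"
      by (simp add: EY EY2 EJ EJJ bkk one prob_space.prob_space[OF prob_space_gaussP])
    then show ?thesis by simp
  qed
  have "\<bar>v\<bar> \<le> real (card I) * B\<^sup>2" unfolding v_def by (rule integral_abs_bound(2)[OF _ V(1)]) measurable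
  then have v: "0 \<le> v\<^sup>2" "v\<^sup>2 \<le> (real (card I) * B\<^sup>2)\<^sup>2" using power_mono[of "\<bar>v\<bar>" _ 2] by auto
  have v2: "0 \<le> v2" "v2 \<le> (real (card I) * B\<^sup>2)\<^sup>2"
    using integral_abs_bound(2)[OF _ V2] unfolding v2_def by auto
  have dd: "d\<^sup>2 \<le> d * sqrt d"
  proof -
    have "d \<le> sqrt d" using d by (metis mult_left_le real_sqrt_ge_zero real_sqrt_le_1_iff real_sqrt_mult_self abs_of_nonneg)
    then show ?thesis using d by (simp add: power2_eq_square mult_left_mono)
  qed
  have dd8: "\<bar>d\<^sup>2 / 8\<bar> \<le> d * sqrt d"
    using dd mult_nonneg_nonneg[OF d(1) real_sqrt_ge_zero[OF d(1)]] zero_le_power2[of d] by linarith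
  have "\<bar>v2 - v\<^sup>2\<bar> \<le> (real (card I) * B\<^sup>2)\<^sup>2" using v v2 by linarith
  then have "\<bar>d\<^sup>2 / 8 * (v2 - v\<^sup>2)\<bar> \<le> (d * sqrt d) * (real (card I) * B\<^sup>2)\<^sup>2"
    unfolding abs_mult using dd8 d by (intro mult_mono) auto
  then have A: "\<bar>(\<integral>J. T J \<partial>gaussP I) + d / 2 * (\<Sum>k\<in>I. (a k)\<^sup>2)\<bar> \<le> (d * sqrt d) * (real (card I) * B\<^sup>2)\<^sup>2"
    unfolding ET by simp
  have e3: "integrable (gaussP I) (\<lambda>J. 40 * e J ^ 3)"
    using I eb by (intro exp_bounded_integrable exp_bounded_mult exp_bounded_power) auto
  have "\<bar>(\<integral>J. ?L J \<partial>gaussP I) - (\<integral>J. T J \<partial>gaussP I)\<bar> = \<bar>\<integral>J. ?L J - T J \<partial>gaussP I\<bar>"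
    using exp_bounded_integrable[OF I Lx] exp_bounded_integrable[OF I ETi] by simp
  also have "\<dots> \<le> (\<integral>J. \<bar>?L J - T J\<bar> \<partial>gaussP I)" by simp
  also have "\<dots> \<le> (\<integral>J. (d * sqrt d) * (40 * e J ^ 3) \<partial>gaussP I)"
  proof (rule integral_mono)
    show "integrable (gaussP I) (\<lambda>J. \<bar>?L J - T J\<bar>)"
      by (intro exp_bounded_integrable I exp_bounded_abs exp_bounded_diff Lx ETi)
    show "\<bar>?L J - T J\<bar> \<le> (d * sqrt d) * (40 * e J ^ 3)" for J
    proof -
      have "(sqrt d) ^ 3 = d * sqrt d" using d by (simp add: power3_eq_cube)
      then show ?thesis using LT[of J] by (simp add: power_mult_distrib mult_ac)
    qed
  qed (use e3 in simp)
  also have "\<dots> = (d * sqrt d) * (\<integral>J. 40 * e J ^ 3 \<partial>gaussP I)" by (rule integral_mult_right_zero)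
  finally have Bd: "\<bar>(\<integral>J. ?L J \<partial>gaussP I) - (\<integral>J. T J \<partial>gaussP I)\<bar> \<le> (d * sqrt d) * (\<integral>J. 40 * e J ^ 3 \<partial>gaussP I)" .
  show "\<bar>(\<integral>J. ?L J \<partial>gaussP I) + d / 2 * (\<Sum>k\<in>I. (\<integral>x. \<phi> k x \<partial>M)\<^sup>2)\<bar> \<le> step_const I B * (d * sqrt d)"
    unfolding step_const_def a_def[symmetric] e_def[symmetric] distrib_right using A Bd by (simp add: mult.commute abs_le_iff)
qed

section \<open>Gibbs measures under a small Gaussian field\<close>

definition gibbs :: "'a measure \<Rightarrow> ('a \<Rightarrow> real) \<Rightarrow> 'a measure" where
  "gibbs \<mu> G = density \<mu> (\<lambda>x. ennreal (exp (G x) / (\<integral>x. exp (G x) \<partial>\<mu>)))"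

lemma space_gibbs [simp]: "space (gibbs \<mu> G) = space \<mu>"
  and sets_gibbs [simp, measurable_cong]: "sets (gibbs \<mu> G) = sets \<mu>"
  by (simp_all add: gibbs_def)

context
  fixes \<mu> :: "'a measure" and G :: "'a \<Rightarrow> real" and C :: real
  assumes \<mu>: "finite_measure \<mu>" "emeasure \<mu> (space \<mu>) \<noteq> 0"
    and G: "G \<in> borel_measurable \<mu>" "\<And>x. x \<in> space \<mu> \<Longrightarrow> \<bar>G x\<bar> \<le> C"
begin

lemma integrable_exp_bounded_energy: "integrable \<mu> (\<lambda>x. exp (G x))"
  by (rule finite_measure.integrable_const_bound[OF \<mu>(1), where B = "exp C"])
     (use G in \<open>auto simp: abs_le_iff\<close>)

lemma partition_pos: "(\<integral>x. exp (G x) \<partial>\<mu>) > 0"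
proof -
  interpret finite_measure \<mu> by (rule \<mu>)
  have "(\<integral>x. exp (- C) \<partial>\<mu>) \<le> (\<integral>x. exp (G x) \<partial>\<mu>)"
    using integrable_exp_bounded_energy G(2) by (intro integral_mono) (auto simp: abs_le_iff minus_le_iff)
  then have "(\<integral>x. exp (G x) \<partial>\<mu>) \<ge> measure \<mu> (space \<mu>) * exp (- C)" by simp
  moreover have "measure \<mu> (space \<mu>) > 0"
    using \<mu>(2) by (simp add: emeasure_eq_measure zero_less_measure_iff)
  ultimately show ?thesis using mult_pos_pos[OF _ exp_gt_zero] less_le_trans by blast
qed

lemma integral_gibbs:
  assumes "f \<in> borel_measurable \<mu>"
  shows "(\<integral>x. f x \<partial>gibbs \<mu> G) = (\<integral>x. f x * exp (G x) \<partial>\<mu>) / (\<integral>x. exp (G x) \<partial>\<mu>)"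
  unfolding gibbs_def using assms G(1) partition_pos by (subst integral_density) (auto simp: mult.commute)

lemma prob_space_gibbs: "prob_space (gibbs \<mu> G)"
proof
  note [measurable] = G(1)
  have "emeasure (gibbs \<mu> G) (space (gibbs \<mu> G)) = (\<integral>\<^sup>+x. ennreal (exp (G x) / (\<integral>x. exp (G x) \<partial>\<mu>)) \<partial>\<mu>)"
    unfolding space_gibbs by (simp add: gibbs_def emeasure_density cong: nn_integral_cong_simp)
  also have "\<dots> = ennreal (\<integral>x. exp (G x) / (\<integral>x. exp (G x) \<partial>\<mu>) \<partial>\<mu>)"
    using integrable_exp_bounded_energy partition_pos by (intro nn_integral_eq_integral) auto
  also have "(\<integral>x. exp (G x) / (\<integral>x. exp (G x) \<partial>\<mu>) \<partial>\<mu>) = 1" using partition_pos by simp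
  finally show "emeasure (gibbs \<mu> G) (space (gibbs \<mu> G)) = 1" by simp
qed

text \<open>Taking the Gibbs measure of G as base measure, the ratio of the perturbed to the
  unperturbed partition function is a moment generating function, to which
  \<open>gaussian_log_mgf_step\<close> applies.\<close>

lemma gibbs_log_step:
  fixes \<phi> :: "'k \<Rightarrow> 'a \<Rightarrow> real"
  assumes I: "finite I" and \<phi>m: "\<And>k. k \<in> I \<Longrightarrow> \<phi> k \<in> borel_measurable \<mu>"
    and \<phi>: "\<And>k x. k \<in> I \<Longrightarrow> x \<in> space \<mu> \<Longrightarrow> \<bar>\<phi> k x\<bar> \<le> B" and B: "0 \<le> B"
    and d: "0 \<le> d" "d \<le> 1"
  shows "exp_bounded I (\<lambda>J. ln (\<integral>x. exp (G x + field_exponent I \<phi> d J x) \<partial>\<mu>))"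
    and "\<bar>(\<integral>J. ln (\<integral>x. exp (G x + field_exponent I \<phi> d J x) \<partial>\<mu>) \<partial>gaussP I) - ln (\<integral>x. exp (G x) \<partial>\<mu>)
           + d / 2 * (\<Sum>k\<in>I. (\<integral>x. \<phi> k x \<partial>gibbs \<mu> G)\<^sup>2)\<bar>
           \<le> step_const I B * (d * sqrt d)"
proof -
  note [measurable] = \<phi>m G(1)
  let ?Z = "\<integral>x. exp (G x) \<partial>\<mu>"
  interpret \<nu>: prob_space "gibbs \<mu> G" by (rule prob_space_gibbs)
  have \<phi>m': "\<And>k. k \<in> I \<Longrightarrow> \<phi> k \<in> borel_measurable (gibbs \<mu> G)" by measurable
  have \<phi>': "\<And>k x. k \<in> I \<Longrightarrow> x \<in> space (gibbs \<mu> G) \<Longrightarrow> \<bar>\<phi> k x\<bar> \<le> B" using \<phi> by auto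
  note step = \<nu>.gaussian_log_mgf_step[OF I \<phi>m' \<phi>' B d]
  have eqn: "ln (\<integral>x. exp (G x + field_exponent I \<phi> d J x) \<partial>\<mu>) = ln (\<integral>x. exp (field_exponent I \<phi> d J x) \<partial>gibbs \<mu> G) + ln ?Z" for J
  proof -
    have fm [measurable]: "field_exponent I \<phi> d J \<in> borel_measurable \<mu>" by (rule measurable_field_exponent'[OF \<phi>m])
    let ?X = "\<integral>x. exp (field_exponent I \<phi> d J x) \<partial>gibbs \<mu> G"
    have "?X > 0"
    proof -
      define e where "e = sqrt d * (B * (\<Sum>k\<in>I. \<bar>J k\<bar>) + real (card I) * B\<^sup>2)"
      have b: "\<bar>field_exponent I \<phi> d J x\<bar> \<le> e" if "x \<in> space (gibbs \<mu> G)" for x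
        unfolding e_def using \<phi>' that by (intro field_exponent_bound I d B) auto
      have fm': "field_exponent I \<phi> d J \<in> borel_measurable (gibbs \<mu> G)" by measurable
      have "(\<integral>x. exp (- e) \<partial>gibbs \<mu> G) \<le> ?X"
      proof (rule integral_mono)
        show "integrable (gibbs \<mu> G) (\<lambda>x. exp (field_exponent I \<phi> d J x))"
          by (rule \<nu>.integral_abs_bound(1)[where c = "exp e"]) (use b fm' in \<open>auto simp: abs_le_iff\<close>)
        show "exp (- e) \<le> exp (field_exponent I \<phi> d J x)" if "x \<in> space (gibbs \<mu> G)" for x
          using b[OF that] by (auto simp: abs_le_iff)
      qed simp
      then have "exp (- e) \<le> ?X" using \<nu>.prob_space by simp
      then show ?thesis by (meson exp_gt_zero less_le_trans)
    qed
    moreover have "?X = (\<integral>x. exp (G x + field_exponent I \<phi> d J x) \<partial>\<mu>) / ?Z"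
      by (subst integral_gibbs) (auto simp: exp_add mult.commute)
    ultimately show ?thesis using partition_pos by (simp add: ln_div zero_less_divide_iff)
  qed
  show "exp_bounded I (\<lambda>J. ln (\<integral>x. exp (G x + field_exponent I \<phi> d J x) \<partial>\<mu>))"
    unfolding eqn by (intro exp_bounded_add step(1) exp_bounded_const)
  have "(\<integral>J. ln (\<integral>x. exp (G x + field_exponent I \<phi> d J x) \<partial>\<mu>) \<partial>gaussP I)
      = (\<integral>J. ln (\<integral>x. exp (field_exponent I \<phi> d J x) \<partial>gibbs \<mu> G) \<partial>gaussP I) + ln ?Z"
    unfolding eqn using exp_bounded_integrable[OF I step(1)]
      exp_bounded_integrable[OF I exp_bounded_const[of I "ln ?Z"]]
    by (simp add: prob_space.prob_space[OF prob_space_gaussP])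
  then show "\<bar>(\<integral>J. ln (\<integral>x. exp (G x + field_exponent I \<phi> d J x) \<partial>\<mu>) \<partial>gaussP I) - ln ?Z
           + d / 2 * (\<Sum>k\<in>I. (\<integral>x. \<phi> k x \<partial>gibbs \<mu> G)\<^sup>2)\<bar>
           \<le> step_const I B * (d * sqrt d)"
    using step(2) by simp
qed

text \<open>Jensen's inequality for the Gibbs measure, obtained from the tangent of the exponential
  at the Gibbs mean of D. It is the only source of lower bounds on partition functions in what
  follows.\<close>

lemma ln_partition_ge:
  assumes "D \<in> borel_measurable \<mu>" "\<And>x. x \<in> space \<mu> \<Longrightarrow> \<bar>D x\<bar> \<le> E"
  shows "ln (\<integral>x. exp (G x + D x) \<partial>\<mu>) \<ge> ln (\<integral>x. exp (G x) \<partial>\<mu>) + (\<integral>x. D x \<partial>gibbs \<mu> G)"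
proof -
  note [measurable] = G(1) assms(1)
  interpret finite_measure \<mu> by (rule \<mu>)
  let ?Z = "\<integral>x. exp (G x) \<partial>\<mu>" and ?d = "\<integral>x. D x \<partial>gibbs \<mu> G"
  have iD: "integrable \<mu> (\<lambda>x. D x * exp (G x))"
    using G(2) assms(2) order_trans[OF abs_ge_zero assms(2)]
    by (intro integrable_const_bound[where B = "E * exp C"])
       (auto simp: abs_mult abs_le_iff intro!: mult_mono)
  have iGD: "integrable \<mu> (\<lambda>x. exp (G x + D x))"
    by (rule integrable_const_bound[where B = "exp (C + E)"])
       (use G(2) assms(2) in \<open>auto simp: abs_le_iff intro!: add_mono\<close>)
  have "?Z * exp ?d = (\<integral>x. exp ?d * (exp (G x) + (D x * exp (G x) - ?d * exp (G x))) \<partial>\<mu>)"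
  proof -
    have "(\<integral>x. D x * exp (G x) \<partial>\<mu>) = ?d * ?Z"
      using partition_pos by (simp add: integral_gibbs[OF assms(1)])
    then show ?thesis using iD integrable_exp_bounded_energy by simp
  qed
  also have "\<dots> \<le> (\<integral>x. exp (G x + D x) \<partial>\<mu>)"
  proof (rule integral_mono[OF _ iGD])
    show "integrable \<mu> (\<lambda>x. exp ?d * (exp (G x) + (D x * exp (G x) - ?d * exp (G x))))"
      using iD integrable_exp_bounded_energy by simp
    fix x
    have "exp ?d * (1 + (D x - ?d)) \<le> exp ?d * exp (D x - ?d)"
      using exp_ge_add_one_self[of "D x - ?d"] by simp
    also have "\<dots> = exp (D x)" by (simp add: exp_add[symmetric])
    finally have "exp (G x) * (exp ?d * (1 + (D x - ?d))) \<le> exp (G x) * exp (D x)"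
      by (intro mult_left_mono) auto
    then show "exp ?d * (exp (G x) + (D x * exp (G x) - ?d * exp (G x))) \<le> exp (G x + D x)"
      by (simp add: exp_add algebra_simps)
  qed
  finally have "ln (?Z * exp ?d) \<le> ln (\<integral>x. exp (G x + D x) \<partial>\<mu>)"
    using partition_pos by (intro ln_mono) auto
  then show ?thesis using partition_pos by (simp add: ln_mult)
qed

end

section \<open>The quenched free energy as a function of time\<close>

lemma gaussP_conv_distr:
  fixes a b :: real
  assumes ab: "a\<^sup>2 + b\<^sup>2 = 1" "a \<ge> 0" "b \<ge> 0" and I: "finite I"
  shows "distr (gaussP I \<Otimes>\<^sub>M gaussP I) (gaussP I) (\<lambda>p. \<lambda>k\<in>I. a * fst p k + b * snd p k) = gaussP I"
proof (rule measure_eqI)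
  have m [measurable]: "(\<lambda>p. \<lambda>k\<in>I. a * fst p k + b * snd p k) \<in> measurable (gaussP I \<Otimes>\<^sub>M gaussP I) (gaussP I)"
    by (rule measurable_gaussP_restrict) measurable
  fix A assume "A \<in> sets (distr (gaussP I \<Otimes>\<^sub>M gaussP I) (gaussP I) (\<lambda>p. \<lambda>k\<in>I. a * fst p k + b * snd p k))"
  then have A [measurable]: "A \<in> sets (gaussP I)" by simp
  interpret sigma_finite_measure "gaussP I" by (simp add: prob_space_imp_sigma_finite prob_space_gaussP)
  have "emeasure (distr (gaussP I \<Otimes>\<^sub>M gaussP I) (gaussP I) (\<lambda>p. \<lambda>k\<in>I. a * fst p k + b * snd p k)) A
     = (\<integral>\<^sup>+p. indicator A (\<lambda>k\<in>I. a * fst p k + b * snd p k) \<partial>(gaussP I \<Otimes>\<^sub>M gaussP I))"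
    by (subst nn_integral_indicator[symmetric], simp, subst nn_integral_distr) auto
  also have "\<dots> = (\<integral>\<^sup>+x. \<integral>\<^sup>+y. indicator A (\<lambda>k\<in>I. a * x k + b * y k) \<partial>gaussP I \<partial>gaussP I)"
    by (subst nn_integral_fst[symmetric]) auto
  also have "\<dots> = (\<integral>\<^sup>+x. indicator A x \<partial>gaussP I)"
    using A by (intro gaussP_conv[OF ab I]) auto
  finally show "emeasure (distr (gaussP I \<Otimes>\<^sub>M gaussP I) (gaussP I) (\<lambda>p. \<lambda>k\<in>I. a * fst p k + b * snd p k)) A = emeasure (gaussP I) A"
    by simp
qed simp

lemma gaussP_conv_integral:
  fixes a b :: real and F :: "('i \<Rightarrow> real) \<Rightarrow> real"
  assumes ab: "a\<^sup>2 + b\<^sup>2 = 1" "a \<ge> 0" "b \<ge> 0" and I: "finite I" and F: "integrable (gaussP I) F"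
  shows "integrable (gaussP I) (\<lambda>x. \<integral>y. F (\<lambda>k\<in>I. a * x k + b * y k) \<partial>gaussP I)"
    and "(\<integral>x. F x \<partial>gaussP I) = (\<integral>x. \<integral>y. F (\<lambda>k\<in>I. a * x k + b * y k) \<partial>gaussP I \<partial>gaussP I)"
proof -
  have m: "(\<lambda>p. \<lambda>k\<in>I. a * fst p k + b * snd p k) \<in> measurable (gaussP I \<Otimes>\<^sub>M gaussP I) (gaussP I)"
    by (rule measurable_gaussP_restrict) measurable
  interpret pair_sigma_finite "gaussP I" "gaussP I"
    by (simp add: pair_sigma_finite_def prob_space_imp_sigma_finite prob_space_gaussP)
  note d = gaussP_conv_distr[OF ab I]
  have i: "integrable (gaussP I \<Otimes>\<^sub>M gaussP I) (\<lambda>p. F (\<lambda>k\<in>I. a * fst p k + b * snd p k))"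
    using integrable_distr[OF m, of F] F unfolding d by simp
  show "integrable (gaussP I) (\<lambda>x. \<integral>y. F (\<lambda>k\<in>I. a * x k + b * y k) \<partial>gaussP I)"
    using integrable_fst'[OF i] by simp
  have "(\<integral>x. F x \<partial>gaussP I) = (\<integral>p. F (\<lambda>k\<in>I. a * fst p k + b * snd p k) \<partial>(gaussP I \<Otimes>\<^sub>M gaussP I))"
    using integral_distr[OF m, of F] F unfolding d by auto
  also have "\<dots> = (\<integral>x. \<integral>y. F (\<lambda>k\<in>I. a * x k + b * y k) \<partial>gaussP I \<partial>gaussP I)"
    using integral_fst'[OF i] by simp
  finally show "(\<integral>x. F x \<partial>gaussP I) = (\<integral>x. \<integral>y. F (\<lambda>k\<in>I. a * x k + b * y k) \<partial>gaussP I \<partial>gaussP I)" .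
qed

text \<open>The analogue of independent Brownian increments: the weights have squares summing to 1,
  as rotation invariance requires, and the normalising variances are additive in time.\<close>

lemma field_exponent_conv:
  assumes t: "0 \<le> t" "0 \<le> d" "t + d > 0" and I: "finite I"
  shows "field_exponent I \<phi> (t + d) (\<lambda>k\<in>I. sqrt (t / (t + d)) * J k + sqrt (d / (t + d)) * J' k) x
    = field_exponent I \<phi> t J x + field_exponent I \<phi> d J' x"
proof -
  have a: "sqrt (t + d) * sqrt (t / (t + d)) = sqrt t" "sqrt (t + d) * sqrt (d / (t + d)) = sqrt d"
    using t by (simp_all add: real_sqrt_mult[symmetric])
  have "sqrt (t + d) * (\<Sum>k\<in>I. (sqrt (t / (t + d)) * J k + sqrt (d / (t + d)) * J' k) * \<phi> k x)
     = (sqrt (t + d) * sqrt (t / (t + d))) * (\<Sum>k\<in>I. J k * \<phi> k x) + (sqrt (t + d) * sqrt (d / (t + d))) * (\<Sum>k\<in>I. J' k * \<phi> k x)"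
    by (simp add: sum.distrib sum_distrib_left distrib_left distrib_right mult.assoc)
  then show ?thesis unfolding field_exponent_def a by (simp add: algebra_simps add_divide_distrib)
qed

context
  fixes \<mu> :: "'a measure" and G :: "'a \<Rightarrow> real" and C :: real
    and I :: "'k set" and \<phi> :: "'k \<Rightarrow> 'a \<Rightarrow> real" and B :: real
  assumes \<mu>: "finite_measure \<mu>" "emeasure \<mu> (space \<mu>) \<noteq> 0"
    and G: "G \<in> borel_measurable \<mu>" "\<And>x. x \<in> space \<mu> \<Longrightarrow> \<bar>G x\<bar> \<le> C"
    and I: "finite I" and \<phi>m: "\<And>k. k \<in> I \<Longrightarrow> \<phi> k \<in> borel_measurable \<mu>"
    and \<phi>: "\<And>k x. k \<in> I \<Longrightarrow> x \<in> space \<mu> \<Longrightarrow> \<bar>\<phi> k x\<bar> \<le> B" and B: "0 \<le> B"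
begin

lemma energy_bound:
  assumes "0 \<le> t" "t \<le> 1"
  shows "(\<lambda>x. G x + field_exponent I \<phi> t J x) \<in> borel_measurable \<mu>"
    and "x \<in> space \<mu> \<Longrightarrow> \<bar>G x + field_exponent I \<phi> t J x\<bar> \<le> C + sqrt t * (B * (\<Sum>k\<in>I. \<bar>J k\<bar>) + real (card I) * B\<^sup>2)"
  using G(1) measurable_field_exponent'[of I \<phi> \<mu> t J, OF \<phi>m]
    order_trans[OF abs_triangle_ineq add_mono[OF G(2) field_exponent_bound[of I \<phi> x B t J]]]
    assms I \<phi> B by auto

lemma gibbs_mean_bound:
  assumes "0 \<le> t" "t \<le> 1" "k \<in> I"
  shows "\<bar>\<integral>x. \<phi> k x \<partial>gibbs \<mu> (\<lambda>x. G x + field_exponent I \<phi> t J x)\<bar> \<le> B"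
  using \<phi>m[OF assms(3)] \<phi>[OF assms(3)]
  by (intro prob_space.integral_abs_bound(2)[OF prob_space_gibbs[OF \<mu> energy_bound[OF assms(1,2)]]])
     (auto cong: measurable_cong_sets)

lemma measurable_gibbs_mean:
  fixes f :: "'a \<Rightarrow> real"
  assumes t: "0 \<le> t" "t \<le> 1" and f: "f \<in> borel_measurable \<mu>"
  shows "(\<lambda>J. \<integral>x. f x \<partial>gibbs \<mu> (\<lambda>x. G x + field_exponent I \<phi> t J x)) \<in> borel_measurable (gaussP I)"
proof -
  interpret finite_measure \<mu> by (rule \<mu>)
  have [measurable]: "(\<lambda>p. G (snd p)) \<in> borel_measurable (gaussP I \<Otimes>\<^sub>M \<mu>)" "(\<lambda>p. f (snd p)) \<in> borel_measurable (gaussP I \<Otimes>\<^sub>M \<mu>)"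
    using G(1) f by measurable
  note [measurable] = measurable_field_exponent[of I \<phi> \<mu> t, OF \<phi>m]
  have 1: "(\<lambda>J. \<integral>x. f x * exp (G x + field_exponent I \<phi> t J x) \<partial>\<mu>) \<in> borel_measurable (gaussP I)"
    using borel_measurable_lebesgue_integral[of "\<lambda>J x. f x * exp (G x + field_exponent I \<phi> t J x)" "gaussP I"]
    by (simp add: case_prod_beta)
  have 2: "(\<lambda>J. \<integral>x. exp (G x + field_exponent I \<phi> t J x) \<partial>\<mu>) \<in> borel_measurable (gaussP I)"
    using borel_measurable_lebesgue_integral[of "\<lambda>J x. exp (G x + field_exponent I \<phi> t J x)" "gaussP I"]
    by (simp add: case_prod_beta)
  have eq: "(\<integral>x. f x \<partial>gibbs \<mu> (\<lambda>x. G x + field_exponent I \<phi> t J x))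
    = (\<integral>x. f x * exp (G x + field_exponent I \<phi> t J x) \<partial>\<mu>) / (\<integral>x. exp (G x + field_exponent I \<phi> t J x) \<partial>\<mu>)" for J
    by (rule integral_gibbs[OF \<mu> energy_bound[OF t] f])
  show ?thesis
    unfolding eq by (rule borel_measurable_divide[OF 1 2])
qed

lemma exp_bounded_gibbs_means:
  assumes t: "0 \<le> t" "t \<le> 1"
  shows "exp_bounded I (\<lambda>J. \<Sum>k\<in>I. (\<integral>x. \<phi> k x \<partial>gibbs \<mu> (\<lambda>x. G x + field_exponent I \<phi> t J x))\<^sup>2)"
proof (intro exp_bounded_sum exp_bounded_power)
  fix k assume k: "k \<in> I"
  show "exp_bounded I (\<lambda>J. \<integral>x. \<phi> k x \<partial>gibbs \<mu> (\<lambda>x. G x + field_exponent I \<phi> t J x))"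
    by (rule exp_bounded_bound[OF exp_bounded_const measurable_gibbs_mean[OF t \<phi>m[OF k]] gibbs_mean_bound[OF t k]])
qed

text \<open>Conditionally on the field at time t, the field of the additional time d is a small
  independent perturbation of the current Gibbs measure, so the one-step estimate holds for each J
  with the same constant. In the limit d \<rightarrow> 0 the time derivative is minus half the mean
  sum of squared Gibbs averages.\<close>

lemma free_energy_increment:
  assumes t: "0 \<le> t" "0 \<le> d" "t + d \<le> 1"
  shows "\<bar>(\<integral>J. ln (\<integral>x. exp (G x + field_exponent I \<phi> (t + d) J x) \<partial>\<mu>) \<partial>gaussP I)
     - (\<integral>J. ln (\<integral>x. exp (G x + field_exponent I \<phi> t J x) \<partial>\<mu>) \<partial>gaussP I)
     + d / 2 * (\<integral>J. (\<Sum>k\<in>I. (\<integral>x. \<phi> k x \<partial>gibbs \<mu> (\<lambda>x. G x + field_exponent I \<phi> t J x))\<^sup>2) \<partial>gaussP I)\<bar>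
    \<le> step_const I B * (d * sqrt d)"
proof (cases "t + d = 0")
  case True
  then have "t = 0" "d = 0" using t by auto
  then show ?thesis by simp
next
  case False
  then have td: "t + d > 0" using t by simp
  have t1: "t \<le> 1" "d \<le> 1" using t by auto
  let ?L = "\<lambda>s J. ln (\<integral>x. exp (G x + field_exponent I \<phi> s J x) \<partial>\<mu>)"
  let ?S = "\<lambda>J. \<Sum>k\<in>I. (\<integral>x. \<phi> k x \<partial>gibbs \<mu> (\<lambda>x. G x + field_exponent I \<phi> t J x))\<^sup>2"
  let ?a = "sqrt (t / (t + d))" and ?b = "sqrt (d / (t + d))"
  let ?E = "\<lambda>J. \<integral>J'. ln (\<integral>x. exp ((G x + field_exponent I \<phi> t J x) + field_exponent I \<phi> d J' x) \<partial>\<mu>) \<partial>gaussP I"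
  have ab: "?a\<^sup>2 + ?b\<^sup>2 = 1" "?a \<ge> 0" "?b \<ge> 0"
    using t td by (simp_all add: add_divide_distrib[symmetric])
  have iL: "integrable (gaussP I) (?L s)" if "0 \<le> s" "s \<le> 1" for s
    using exp_bounded_integrable[OF I gibbs_log_step(1)[OF \<mu> G I \<phi>m \<phi> B that]] .
  note conv = gaussP_conv_integral[OF ab I iL[of "t + d"], unfolded field_exponent_conv[OF t(1,2) td I] add.assoc[symmetric]]
  have iE: "integrable (gaussP I) ?E" using conv(1) t by simp
  have cE: "(\<integral>J. ?L (t + d) J \<partial>gaussP I) = (\<integral>J. ?E J \<partial>gaussP I)"
    using conv(2) t by simp
  have iS: "integrable (gaussP I) ?S" by (rule exp_bounded_integrable[OF I exp_bounded_gibbs_means[OF t(1) t1(1)]])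
  have "(\<integral>J. ?L (t + d) J \<partial>gaussP I) - (\<integral>J. ?L t J \<partial>gaussP I) + d / 2 * (\<integral>J. ?S J \<partial>gaussP I)
     = (\<integral>J. ?E J - ?L t J + d / 2 * ?S J \<partial>gaussP I)"
    unfolding cE using iE iL[OF t(1) t1(1)] iS by simp
  also have "\<bar>\<dots>\<bar> \<le> step_const I B * (d * sqrt d)"
  proof (rule prob_space.integral_abs_bound(2)[OF prob_space_gaussP])
    show "(\<lambda>J. ?E J - ?L t J + d / 2 * ?S J) \<in> borel_measurable (gaussP I)"
      using iE iL[OF t(1) t1(1)] iS by (intro borel_measurable_add borel_measurable_diff borel_measurable_times) auto
    fix J :: "'k \<Rightarrow> real"
    show "\<bar>?E J - ?L t J + d / 2 * ?S J\<bar> \<le> step_const I B * (d * sqrt d)"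
      by (rule gibbs_log_step(2)[OF \<mu> energy_bound[OF t(1) t1(1)] I \<phi>m \<phi> B t(2) t1(2)])
  qed
  finally show ?thesis .
qed

end

lemma abs_ln_partition_le:
  fixes G :: "'a \<Rightarrow> real"
  assumes \<mu>: "finite_measure \<mu>" "emeasure \<mu> (space \<mu>) \<noteq> 0"
    and G: "G \<in> borel_measurable \<mu>" "\<And>x. x \<in> space \<mu> \<Longrightarrow> \<bar>G x\<bar> \<le> C"
  shows "\<bar>ln (\<integral>x. exp (G x) \<partial>\<mu>)\<bar> \<le> \<bar>ln (measure \<mu> (space \<mu>))\<bar> + C"
proof -
  interpret finite_measure \<mu> by (rule \<mu>)
  let ?m = "measure \<mu> (space \<mu>)"
  have m: "?m > 0" using \<mu>(2) by (simp add: emeasure_eq_measure zero_less_measure_iff)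
  note i = integrable_exp_bounded_energy[OF \<mu> G] and p = partition_pos[OF \<mu> G]
  have "(\<integral>x. exp (- C) \<partial>\<mu>) \<le> (\<integral>x. exp (G x) \<partial>\<mu>)"
    using i G(2) by (intro integral_mono) (auto simp: abs_le_iff minus_le_iff)
  then have "ln (?m * exp (- C)) \<le> ln (\<integral>x. exp (G x) \<partial>\<mu>)" using m by (intro ln_mono) auto
  then have 1: "ln ?m - C \<le> ln (\<integral>x. exp (G x) \<partial>\<mu>)" using m by (simp add: ln_mult)
  have "(\<integral>x. exp (G x) \<partial>\<mu>) \<le> (\<integral>x. exp C \<partial>\<mu>)"
    using i G(2) by (intro integral_mono) (auto simp: abs_le_iff)
  then have "ln (\<integral>x. exp (G x) \<partial>\<mu>) \<le> ln (?m * exp C)" using p by (intro ln_mono) auto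
  then have 2: "ln (\<integral>x. exp (G x) \<partial>\<mu>) \<le> ln ?m + C" using m by (simp add: ln_mult)
  show ?thesis using 1 2 by linarith
qed

lemma integrable_prob_fst:
  fixes f :: "'a \<Rightarrow> real"
  assumes M: "prob_space M" "prob_space N" and f: "integrable M f"
  shows "integrable (M \<Otimes>\<^sub>M N) (\<lambda>p. f (fst p))" "(\<integral>p. f (fst p) \<partial>(M \<Otimes>\<^sub>M N)) = (\<integral>x. f x \<partial>M)"
proof -
  have d: "distr (M \<Otimes>\<^sub>M N) M fst = M"
    using prob_space.distr_pair_fst[OF M(2)] by blast
  have m: "fst \<in> measurable (M \<Otimes>\<^sub>M N) M" by simp
  show "integrable (M \<Otimes>\<^sub>M N) (\<lambda>p. f (fst p))"
    using integrable_distr[OF m, of f] f unfolding d by simp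
  show "(\<integral>p. f (fst p) \<partial>(M \<Otimes>\<^sub>M N)) = (\<integral>x. f x \<partial>M)"
    using integral_distr[OF m, of f] f unfolding d by auto
qed

lemma integrable_prob_snd:
  fixes f :: "'a \<Rightarrow> real"
  assumes M: "prob_space M" "prob_space N" and f: "integrable N f"
  shows "integrable (M \<Otimes>\<^sub>M N) (\<lambda>p. f (snd p))" "(\<integral>p. f (snd p) \<partial>(M \<Otimes>\<^sub>M N)) = (\<integral>x. f x \<partial>N)"
proof -
  interpret M: prob_space M by (rule M)
  interpret N: prob_space N by (rule M)
  interpret pair_sigma_finite M N ..
  have m: "(\<lambda>p. f (snd p)) \<in> borel_measurable (M \<Otimes>\<^sub>M N)" using f by measurable
  show i: "integrable (M \<Otimes>\<^sub>M N) (\<lambda>p. f (snd p))"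
    using Fubini_integrable[OF m] f by (simp add: M.prob_space)
  show "(\<integral>p. f (snd p) \<partial>(M \<Otimes>\<^sub>M N)) = (\<integral>x. f x \<partial>N)"
    using integral_fst'[OF i] by (simp add: M.prob_space)
qed

lemma pair_integral_abs_bound:
  fixes g :: "'a \<Rightarrow> 'b \<Rightarrow> real"
  assumes M: "prob_space M" "prob_space N" and g: "integrable (M \<Otimes>\<^sub>M N) (\<lambda>p. g (fst p) (snd p))"
  shows "(\<And>x. x \<in> space M \<Longrightarrow> \<bar>\<integral>y. g x y \<partial>N\<bar> \<le> K) \<Longrightarrow> \<bar>\<integral>p. g (fst p) (snd p) \<partial>(M \<Otimes>\<^sub>M N)\<bar> \<le> K"
    and "(\<And>y. y \<in> space N \<Longrightarrow> \<bar>\<integral>x. g x y \<partial>M\<bar> \<le> K) \<Longrightarrow> \<bar>\<integral>p. g (fst p) (snd p) \<partial>(M \<Otimes>\<^sub>M N)\<bar> \<le> K"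
proof -
  interpret M: prob_space M by (rule M)
  interpret N: prob_space N by (rule M)
  interpret pair_sigma_finite M N ..
  have g': "integrable (M \<Otimes>\<^sub>M N) (case_prod g)" using g by (simp add: case_prod_beta')
  {
    assume *: "\<And>x. x \<in> space M \<Longrightarrow> \<bar>\<integral>y. g x y \<partial>N\<bar> \<le> K"
    have "\<bar>\<integral>x. (\<integral>y. g x y \<partial>N) \<partial>M\<bar> \<le> K"
      using integrable_fst[OF g'] * by (intro M.integral_abs_bound(2)) auto
    then show "\<bar>\<integral>p. g (fst p) (snd p) \<partial>(M \<Otimes>\<^sub>M N)\<bar> \<le> K"
      using integral_fst[OF g'] by (simp add: case_prod_beta')
  next
    assume *: "\<And>y. y \<in> space N \<Longrightarrow> \<bar>\<integral>x. g x y \<partial>M\<bar> \<le> K"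
    have "\<bar>\<integral>y. (\<integral>x. g x y \<partial>M) \<partial>N\<bar> \<le> K"
      using integrable_snd[OF g'] * by (intro N.integral_abs_bound(2)) auto
    then show "\<bar>\<integral>p. g (fst p) (snd p) \<partial>(M \<Otimes>\<^sub>M N)\<bar> \<le> K"
      using integral_snd[OF g'] by (simp add: case_prod_beta')
  }
qed

lemma field_exponent_0 [simp]: "field_exponent I \<phi> 0 J x = 0"
  by (simp add: field_exponent_def)

section \<open>Kahane's comparison inequality\<close>

text \<open>Both fields act on the same space independently, \<phi> at time t and \<psi> at time 1 -
  t. A sum of squared Gibbs means is the covariance averaged over two replicas, so moving along this
  path changes the free energy at a rate of at most c/2. Condition \<open>cov\<close> is wanted off
  the diagonal only in effect: the variances themselves have been removed by the
  normalisation.\<close>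

theorem gaussian_comparison:
  fixes \<mu> :: "'a measure" and \<phi> :: "'k \<Rightarrow> 'a \<Rightarrow> real" and \<psi> :: "'l \<Rightarrow> 'a \<Rightarrow> real"
  assumes \<mu>: "finite_measure \<mu>" "emeasure \<mu> (space \<mu>) \<noteq> 0"
    and G: "G \<in> borel_measurable \<mu>" "\<And>x. x \<in> space \<mu> \<Longrightarrow> \<bar>G x\<bar> \<le> C"
    and I: "finite I" and \<phi>m: "\<And>k. k \<in> I \<Longrightarrow> \<phi> k \<in> borel_measurable \<mu>"
    and \<phi>: "\<And>k x. k \<in> I \<Longrightarrow> x \<in> space \<mu> \<Longrightarrow> \<bar>\<phi> k x\<bar> \<le> B"
    and I': "finite I'" and \<psi>m: "\<And>k. k \<in> I' \<Longrightarrow> \<psi> k \<in> borel_measurable \<mu>"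
    and \<psi>: "\<And>k x. k \<in> I' \<Longrightarrow> x \<in> space \<mu> \<Longrightarrow> \<bar>\<psi> k x\<bar> \<le> B" and B: "0 \<le> B"
    and cov: "\<And>x y. x \<in> space \<mu> \<Longrightarrow> y \<in> space \<mu> \<Longrightarrow>
        (\<Sum>k\<in>I'. \<psi> k x * \<psi> k y) \<le> (\<Sum>k\<in>I. \<phi> k x * \<phi> k y) + c"
  shows "(\<integral>J. ln (\<integral>x. exp (G x + field_exponent I \<phi> 1 J x) \<partial>\<mu>) \<partial>gaussP I)
     \<le> (\<integral>h. ln (\<integral>x. exp (G x + field_exponent I' \<psi> 1 h x) \<partial>\<mu>) \<partial>gaussP I') + c / 2"
proof -
  interpret finite_measure \<mu> by (rule \<mu>)
  let ?P = "gaussP I \<Otimes>\<^sub>M gaussP I'"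
  note pI = prob_space_gaussP[of I] and pI' = prob_space_gaussP[of I']
  interpret P: prob_space ?P by (intro prob_space_pair pI pI')
  define E where "E s t J h x = G x + field_exponent I \<phi> s J x + field_exponent I' \<psi> t h x" for s t J h x
  define L where "L s t J h = ln (\<integral>x. exp (E s t J h x) \<partial>\<mu>)" for s t J h
  define S where "S s t J h = (\<Sum>k\<in>I. (\<integral>x. \<phi> k x \<partial>gibbs \<mu> (E s t J h))\<^sup>2)" for s t J h
  define S' where "S' s t J h = (\<Sum>k\<in>I'. (\<integral>x. \<psi> k x \<partial>gibbs \<mu> (E s t J h))\<^sup>2)" for s t J h
  define F where "F s t = (\<integral>p. L s t (fst p) (snd p) \<partial>?P)" for s t
  have E': "E s t J h = (\<lambda>x. (G x + field_exponent I' \<psi> t h x) + field_exponent I \<phi> s J x)" for s t J h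
    by (auto simp: E_def fun_eq_iff)
  have E'': "E s t J h = (\<lambda>x. (G x + field_exponent I \<phi> s J x) + field_exponent I' \<psi> t h x)" for s t J h
    by (auto simp: E_def fun_eq_iff)
  have Gh: "(\<lambda>x. G x + field_exponent I' \<psi> t h x) \<in> borel_measurable \<mu>"
    "\<And>x. x \<in> space \<mu> \<Longrightarrow> \<bar>G x + field_exponent I' \<psi> t h x\<bar> \<le> C + sqrt t * (B * (\<Sum>k\<in>I'. \<bar>h k\<bar>) + real (card I') * B\<^sup>2)"
    if "0 \<le> t" "t \<le> 1" for t h
    using energy_bound[where \<mu> = \<mu> and G = G and C = C and I = I' and \<phi> = \<psi> and B = B and t = t and J = h] \<mu> G I' \<psi>m \<psi> B that by blast+
  have GJ: "(\<lambda>x. G x + field_exponent I \<phi> s J x) \<in> borel_measurable \<mu>"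
    "\<And>x. x \<in> space \<mu> \<Longrightarrow> \<bar>G x + field_exponent I \<phi> s J x\<bar> \<le> C + sqrt s * (B * (\<Sum>k\<in>I. \<bar>J k\<bar>) + real (card I) * B\<^sup>2)"
    if "0 \<le> s" "s \<le> 1" for s J
    using energy_bound[where \<mu> = \<mu> and G = G and C = C and I = I and \<phi> = \<phi> and B = B and t = s and J = J] \<mu> G I \<phi>m \<phi> B that by blast+
  have Em: "E s t J h \<in> borel_measurable \<mu>" if "0 \<le> s" "s \<le> 1" "0 \<le> t" "t \<le> 1" for s t J h
    unfolding E' using energy_bound(1)[OF \<mu> Gh[OF that(3,4)] I \<phi>m \<phi> B that(1,2)] .
  \<comment> \<open>A dominating function that is independent of both times, so that all free
    energies on the square are integrable together.\<close>
  define b where "b J h = C + (B * (\<Sum>k\<in>I'. \<bar>h k\<bar>) + real (card I') * B\<^sup>2) + (B * (\<Sum>k\<in>I. \<bar>J k\<bar>) + real (card I) * B\<^sup>2)" for J :: "'k \<Rightarrow> real" and h :: "'l \<Rightarrow> real"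
  have Eb: "\<bar>E s t J h x\<bar> \<le> b J h" if "0 \<le> s" "s \<le> 1" "0 \<le> t" "t \<le> 1" "x \<in> space \<mu>" for s t J h x
  proof -
    let ?u = "B * (\<Sum>k\<in>I'. \<bar>h k\<bar>) + real (card I') * B\<^sup>2" and ?v = "B * (\<Sum>k\<in>I. \<bar>J k\<bar>) + real (card I) * B\<^sup>2"
    have uv: "0 \<le> ?u" "0 \<le> ?v" using B by (auto intro!: add_nonneg_nonneg mult_nonneg_nonneg sum_nonneg)
    have "\<bar>E s t J h x\<bar> \<le> C + sqrt t * ?u + sqrt s * ?v"
      unfolding E' using energy_bound(2)[OF \<mu> Gh[OF that(3,4)] I \<phi>m \<phi> B that(1,2,5)] .
    also have "\<dots> \<le> C + 1 * ?u + 1 * ?v"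
      using uv that by (intro add_mono mult_right_mono) auto
    finally show ?thesis unfolding b_def by simp
  qed
  have bi: "integrable ?P (\<lambda>p. \<bar>ln (measure \<mu> (space \<mu>))\<bar> + b (fst p) (snd p))"
  proof -
    have u: "integrable (gaussP I') (\<lambda>h. B * (\<Sum>k\<in>I'. \<bar>h k\<bar>) + real (card I') * B\<^sup>2)"
      using I' by (intro exp_bounded_integrable) (auto intro!: exp_bounded_add exp_bounded_mult exp_bounded_sum exp_bounded_abs)
    have v: "integrable (gaussP I) (\<lambda>J. B * (\<Sum>k\<in>I. \<bar>J k\<bar>) + real (card I) * B\<^sup>2)"
      using I by (intro exp_bounded_integrable) (auto intro!: exp_bounded_add exp_bounded_mult exp_bounded_sum exp_bounded_abs)
    have "integrable ?P (\<lambda>p. \<bar>ln (measure \<mu> (space \<mu>))\<bar> + C)" by simp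
    from Bochner_Integration.integrable_add[OF Bochner_Integration.integrable_add[OF this integrable_prob_snd(1)[OF pI pI' u]]
        integrable_prob_fst(1)[OF pI pI' v]]
    show ?thesis unfolding b_def by (simp add: add.assoc)
  qed
  have Ejm: "(\<lambda>q. E s t (fst (fst q)) (snd (fst q)) (snd q)) \<in> borel_measurable (?P \<Otimes>\<^sub>M \<mu>)" for s t
  proof -
    have [measurable]: "(\<lambda>q. G (snd q)) \<in> borel_measurable (?P \<Otimes>\<^sub>M \<mu>)" using G(1) by measurable
    have "(\<lambda>q. (fst (fst q), snd q)) \<in> measurable (?P \<Otimes>\<^sub>M \<mu>) (gaussP I \<Otimes>\<^sub>M \<mu>)" by measurable
    from measurable_compose[OF this measurable_field_exponent[of I \<phi> \<mu> s, OF \<phi>m]]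
    have [measurable]: "(\<lambda>q. field_exponent I \<phi> s (fst (fst q)) (snd q)) \<in> borel_measurable (?P \<Otimes>\<^sub>M \<mu>)" by simp
    have "(\<lambda>q. (snd (fst q), snd q)) \<in> measurable (?P \<Otimes>\<^sub>M \<mu>) (gaussP I' \<Otimes>\<^sub>M \<mu>)" by measurable
    from measurable_compose[OF this measurable_field_exponent[of I' \<psi> \<mu> t, OF \<psi>m]]
    have [measurable]: "(\<lambda>q. field_exponent I' \<psi> t (snd (fst q)) (snd q)) \<in> borel_measurable (?P \<Otimes>\<^sub>M \<mu>)" by simp
    show ?thesis unfolding E_def by measurable
  qed
  have Zm: "(\<lambda>p. \<integral>x. f x * exp (E s t (fst p) (snd p) x) \<partial>\<mu>) \<in> borel_measurable ?P" if "f \<in> borel_measurable \<mu>" for s t and f :: "'a \<Rightarrow> real"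
  proof -
    have [measurable]: "(\<lambda>q. f (snd q)) \<in> borel_measurable (?P \<Otimes>\<^sub>M \<mu>)" using that by measurable
    note [measurable] = Ejm[of s t]
    show ?thesis
      using borel_measurable_lebesgue_integral[of "\<lambda>p x. f x * exp (E s t (fst p) (snd p) x)" ?P] by (simp add: case_prod_beta)
  qed
  have Zm1: "(\<lambda>p. \<integral>x. exp (E s t (fst p) (snd p) x) \<partial>\<mu>) \<in> borel_measurable ?P" for s t
    using Zm[of "\<lambda>_. 1" s t] by simp
  have Li: "integrable ?P (\<lambda>p. L s t (fst p) (snd p))" if st: "0 \<le> s" "s \<le> 1" "0 \<le> t" "t \<le> 1" for s t
  proof (rule Bochner_Integration.integrable_bound[OF bi])
    show "(\<lambda>p. L s t (fst p) (snd p)) \<in> borel_measurable ?P"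
      unfolding L_def using Zm1 by measurable
    show "AE p in ?P. norm (L s t (fst p) (snd p)) \<le> norm (\<bar>ln (measure \<mu> (space \<mu>))\<bar> + b (fst p) (snd p))"
    proof (rule AE_I2)
      fix p
      have "\<bar>L s t (fst p) (snd p)\<bar> \<le> \<bar>ln (measure \<mu> (space \<mu>))\<bar> + b (fst p) (snd p)"
        unfolding L_def by (rule abs_ln_partition_le[OF \<mu> Em[OF st] Eb[OF st]])
      then show "norm (L s t (fst p) (snd p)) \<le> norm (\<bar>ln (measure \<mu> (space \<mu>))\<bar> + b (fst p) (snd p))" by simp
    qed
  qed
  have gm: "(\<lambda>p. \<integral>x. f x \<partial>gibbs \<mu> (E s t (fst p) (snd p))) \<in> borel_measurable ?P"
    if st: "0 \<le> s" "s \<le> 1" "0 \<le> t" "t \<le> 1" and f: "f \<in> borel_measurable \<mu>" for s t and f :: "'a \<Rightarrow> real"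
  proof -
    have eq: "(\<integral>x. f x \<partial>gibbs \<mu> (E s t J h)) = (\<integral>x. f x * exp (E s t J h x) \<partial>\<mu>) / (\<integral>x. exp (E s t J h x) \<partial>\<mu>)" for J h
      by (rule integral_gibbs[OF \<mu> Em[OF st] Eb[OF st] f])
    show ?thesis unfolding eq by (rule borel_measurable_divide[OF Zm[OF f] Zm1])
  qed
  have gp: "prob_space (gibbs \<mu> (E s t J h))" if st: "0 \<le> s" "s \<le> 1" "0 \<le> t" "t \<le> 1" for s t J h
    by (rule prob_space_gibbs[OF \<mu> Em[OF st] Eb[OF st]])
  have gi: "integrable (gibbs \<mu> (E s t J h)) f" "\<bar>\<integral>x. f x \<partial>gibbs \<mu> (E s t J h)\<bar> \<le> K"
    if st: "0 \<le> s" "s \<le> 1" "0 \<le> t" "t \<le> 1" and f: "f \<in> borel_measurable \<mu>" "\<And>x. x \<in> space \<mu> \<Longrightarrow> \<bar>f x\<bar> \<le> K"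
    for s t J h K and f :: "'a \<Rightarrow> real"
    using prob_space.integral_abs_bound[OF gp[OF st], of f J h K] f by (auto cong: measurable_cong_sets)
  have Si: "integrable ?P (\<lambda>p. S s t (fst p) (snd p))" if st: "0 \<le> s" "s \<le> 1" "0 \<le> t" "t \<le> 1" for s t
    unfolding S_def
  proof (intro Bochner_Integration.integrable_sum P.integrable_const_bound[where B = "B\<^sup>2"] AE_I2)
    fix k p assume k: "k \<in> I"
    show "norm ((\<integral>x. \<phi> k x \<partial>gibbs \<mu> (E s t (fst p) (snd p)))\<^sup>2) \<le> B\<^sup>2"
      using power_mono[OF gi(2)[OF st \<phi>m[OF k] \<phi>[OF k]], where n = 2] by simp
  qed (use gm[OF st \<phi>m] in measurable)
  have S'i: "integrable ?P (\<lambda>p. S' s t (fst p) (snd p))" if st: "0 \<le> s" "s \<le> 1" "0 \<le> t" "t \<le> 1" for s t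
    unfolding S'_def
  proof (intro Bochner_Integration.integrable_sum P.integrable_const_bound[where B = "B\<^sup>2"] AE_I2)
    fix k p assume k: "k \<in> I'"
    show "norm ((\<integral>x. \<psi> k x \<partial>gibbs \<mu> (E s t (fst p) (snd p)))\<^sup>2) \<le> B\<^sup>2"
      using power_mono[OF gi(2)[OF st \<psi>m[OF k] \<psi>[OF k]], where n = 2] by simp
  qed (use gm[OF st \<psi>m] in measurable)
  \<comment> \<open>The covariance inequality is averaged first over y with x fixed and then over x,
    which produces the squares without a product of Gibbs measures.\<close>
  have SS': "S' s t J h - S s t J h \<le> c" if st: "0 \<le> s" "s \<le> 1" "0 \<le> t" "t \<le> 1" for s t J h
  proof -
    let ?g = "gibbs \<mu> (E s t J h)"
    interpret g: prob_space ?g by (rule gp[OF st])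
    have i: "integrable ?g (\<phi> k)" if "k \<in> I" for k by (rule gi(1)[OF st \<phi>m[OF that] \<phi>[OF that]])
    have i': "integrable ?g (\<psi> k)" if "k \<in> I'" for k by (rule gi(1)[OF st \<psi>m[OF that] \<psi>[OF that]])
    have 1: "(\<Sum>k\<in>I'. \<psi> k x * (\<integral>y. \<psi> k y \<partial>?g)) - (\<Sum>k\<in>I. \<phi> k x * (\<integral>y. \<phi> k y \<partial>?g)) \<le> c"
      if x: "x \<in> space \<mu>" for x
    proof -
      have "(\<integral>y. (\<Sum>k\<in>I'. \<psi> k x * \<psi> k y) - (\<Sum>k\<in>I. \<phi> k x * \<phi> k y) \<partial>?g) \<le> (\<integral>y. c \<partial>?g)"
      proof (rule integral_mono)
        show "(\<Sum>k\<in>I'. \<psi> k x * \<psi> k y) - (\<Sum>k\<in>I. \<phi> k x * \<phi> k y) \<le> c" if "y \<in> space ?g" for y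
          using cov[OF x, of y] that by simp
      qed (use i i' in simp_all)
      then show ?thesis using i i' g.prob_space by (simp add: Bochner_Integration.integral_sum)
    qed
    have "(\<integral>x. (\<Sum>k\<in>I'. \<psi> k x * (\<integral>y. \<psi> k y \<partial>?g)) - (\<Sum>k\<in>I. \<phi> k x * (\<integral>y. \<phi> k y \<partial>?g)) \<partial>?g) \<le> (\<integral>x. c \<partial>?g)"
      by (rule integral_mono) (use i i' 1 in simp_all)
    then show ?thesis unfolding S_def S'_def using i i' g.prob_space
      by (simp add: Bochner_Integration.integral_sum power2_eq_square)
  qed
  have inc: "\<bar>F (s + d) t - F s t + d / 2 * (\<integral>p. S s t (fst p) (snd p) \<partial>?P)\<bar> \<le> step_const I B * (d * sqrt d)"
    if sd: "0 \<le> s" "0 \<le> d" "s + d \<le> 1" and t: "0 \<le> t" "t \<le> 1" for s d t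
  proof -
    have s: "0 \<le> s" "s \<le> 1" "0 \<le> s + d" using sd by auto
    let ?g = "\<lambda>J h. L (s + d) t J h - L s t J h + d / 2 * S s t J h"
    have i1: "integrable (gaussP I) (\<lambda>J. L u t J h)" if "0 \<le> u" "u \<le> 1" for u h
      unfolding L_def E' using exp_bounded_integrable[OF I gibbs_log_step(1)[OF \<mu> Gh[OF t] I \<phi>m \<phi> B that]] .
    have i2: "integrable (gaussP I) (\<lambda>J. S s t J h)" for h
      unfolding S_def E' using exp_bounded_integrable[OF I exp_bounded_gibbs_means[OF \<mu> Gh[OF t] I \<phi>m \<phi> B s(1,2)]] .
    have "\<bar>\<integral>p. ?g (fst p) (snd p) \<partial>?P\<bar> \<le> step_const I B * (d * sqrt d)"
    proof (rule pair_integral_abs_bound(2)[OF pI pI'])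
      show "integrable ?P (\<lambda>p. ?g (fst p) (snd p))"
        using Li[OF s(3) sd(3) t] Li[OF s(1,2) t] Si[OF s(1,2) t] by simp
      fix h
      have "(\<integral>J. ?g J h \<partial>gaussP I) = (\<integral>J. L (s + d) t J h \<partial>gaussP I) - (\<integral>J. L s t J h \<partial>gaussP I) + d / 2 * (\<integral>J. S s t J h \<partial>gaussP I)"
        using i1[OF s(3) sd(3)] i1[OF s(1,2)] i2 by simp
      also have "\<bar>\<dots>\<bar> \<le> step_const I B * (d * sqrt d)"
        unfolding L_def S_def E' by (rule free_energy_increment[OF \<mu> Gh[OF t] I \<phi>m \<phi> B sd])
      finally show "\<bar>\<integral>J. ?g J h \<partial>gaussP I\<bar> \<le> step_const I B * (d * sqrt d)" .
    qed
    then show ?thesis unfolding F_def using Li[OF s(3) sd(3) t] Li[OF s(1,2) t] Si[OF s(1,2) t] by simp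
  qed
  have inc': "\<bar>F s (t + d) - F s t + d / 2 * (\<integral>p. S' s t (fst p) (snd p) \<partial>?P)\<bar> \<le> step_const I' B * (d * sqrt d)"
    if td: "0 \<le> t" "0 \<le> d" "t + d \<le> 1" and s: "0 \<le> s" "s \<le> 1" for s d t
  proof -
    have t: "0 \<le> t" "t \<le> 1" "0 \<le> t + d" using td by auto
    let ?g = "\<lambda>J h. L s (t + d) J h - L s t J h + d / 2 * S' s t J h"
    have i1: "integrable (gaussP I') (\<lambda>h. L s u J h)" if "0 \<le> u" "u \<le> 1" for u J
      unfolding L_def E'' using exp_bounded_integrable[OF I' gibbs_log_step(1)[OF \<mu> GJ[OF s] I' \<psi>m \<psi> B that]] .
    have i2: "integrable (gaussP I') (\<lambda>h. S' s t J h)" for J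
      unfolding S'_def E'' using exp_bounded_integrable[OF I' exp_bounded_gibbs_means[OF \<mu> GJ[OF s] I' \<psi>m \<psi> B t(1,2)]] .
    have "\<bar>\<integral>p. ?g (fst p) (snd p) \<partial>?P\<bar> \<le> step_const I' B * (d * sqrt d)"
    proof (rule pair_integral_abs_bound(1)[OF pI pI'])
      show "integrable ?P (\<lambda>p. ?g (fst p) (snd p))"
        using Li[OF s t(3) td(3)] Li[OF s t(1,2)] S'i[OF s t(1,2)] by simp
      fix J
      have "(\<integral>h. ?g J h \<partial>gaussP I') = (\<integral>h. L s (t + d) J h \<partial>gaussP I') - (\<integral>h. L s t J h \<partial>gaussP I') + d / 2 * (\<integral>h. S' s t J h \<partial>gaussP I')"
        using i1[OF t(3) td(3)] i1[OF t(1,2)] i2 by simp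
      also have "\<bar>\<dots>\<bar> \<le> step_const I' B * (d * sqrt d)"
        unfolding L_def S'_def E'' by (rule free_energy_increment[OF \<mu> GJ[OF s] I' \<psi>m \<psi> B td])
      finally show "\<bar>\<integral>h. ?g J h \<partial>gaussP I'\<bar> \<le> step_const I' B * (d * sqrt d)" .
    qed
    then show ?thesis unfolding F_def using Li[OF s t(3) td(3)] Li[OF s t(1,2)] S'i[OF s t(1,2)] by simp
  qed
  define K where "K = step_const I B + step_const I' B"
  \<comment> \<open>The linear correction in t compensates the constant c of the covariance
    inequality.\<close>
  have "F 1 (1 - 1) - 1 * (c / 2) \<le> F 0 (1 - 0) - 0 * (c / 2)"
  proof (rule nonincreasing_from_increments[where f = "\<lambda>t. F t (1 - t) - t * (c / 2)" and K = K])
    fix t d :: real assume td: "0 \<le> t" "0 \<le> d" "t + d \<le> 1"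
    let ?r = "1 - (t + d)"
    have r: "0 \<le> ?r" "?r \<le> 1" "?r + d = 1 - t" "?r + d \<le> 1" and t: "0 \<le> t" "t \<le> 1" using td by auto
    have "(\<integral>p. S' t ?r (fst p) (snd p) \<partial>?P) - (\<integral>p. S t ?r (fst p) (snd p) \<partial>?P)
      = (\<integral>p. S' t ?r (fst p) (snd p) - S t ?r (fst p) (snd p) \<partial>?P)"
      using Si[OF t r(1,2)] S'i[OF t r(1,2)] by simp
    also have "\<dots> \<le> (\<integral>p. c \<partial>?P)"
      using Si[OF t r(1,2)] S'i[OF t r(1,2)] SS'[OF t r(1,2)] by (intro integral_mono) auto
    finally have "d / 2 * ((\<integral>p. S' t ?r (fst p) (snd p) \<partial>?P) - (\<integral>p. S t ?r (fst p) (snd p) \<partial>?P)) \<le> d / 2 * c"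
      using td P.prob_space by (intro mult_left_mono) auto
    then have e: "d / 2 * (\<integral>p. S' t ?r (fst p) (snd p) \<partial>?P) - d / 2 * (\<integral>p. S t ?r (fst p) (snd p) \<partial>?P) \<le> d / 2 * c"
      by (simp only: right_diff_distrib)
    have lin: "p \<le> r' + (k1 + k2) + e" if "\<bar>p - q + a\<bar> \<le> k1" "\<bar>r' - q + b\<bar> \<le> k2" "b - a \<le> e" for p q r' a b k1 k2 e :: real
      using that by linarith
    \<comment> \<open>The step passes through the corner (t, ?r): \<phi> advances by d from there,
      while \<psi> is read backwards as an advance from ?r to 1 - t. Both Gibbs sums are then taken
      at the same point, where \<open>SS'\<close> compares them.\<close>
    have "F (t + d) ?r \<le> F t (1 - t) + K * (d * sqrt d) + d / 2 * c"
      unfolding K_def distrib_right by (rule lin[OF inc[OF td r(1,2)] inc'[OF r(1) td(2) r(4) t, unfolded r(3)] e])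
    then show "F (t + d) (1 - (t + d)) - (t + d) * (c / 2) \<le> F t (1 - t) - t * (c / 2) + K * (d * sqrt d)"
      by (simp add: algebra_simps add_divide_distrib)
  qed
  then have "F 1 0 \<le> F 0 1 + c / 2" by simp
  moreover have "F 1 0 = (\<integral>J. ln (\<integral>x. exp (G x + field_exponent I \<phi> 1 J x) \<partial>\<mu>) \<partial>gaussP I)"
    unfolding F_def L_def E_def
    using integrable_prob_fst(2)[OF pI pI' exp_bounded_integrable[OF I gibbs_log_step(1)[OF \<mu> G I \<phi>m \<phi> B, where d = 1]]] by simp
  moreover have "F 0 1 = (\<integral>h. ln (\<integral>x. exp (G x + field_exponent I' \<psi> 1 h x) \<partial>\<mu>) \<partial>gaussP I')"
    unfolding F_def L_def E_def
    using integrable_prob_snd(2)[OF pI pI' exp_bounded_integrable[OF I' gibbs_log_step(1)[OF \<mu> G I' \<psi>m \<psi> B, where d = 1]]] by simp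
  ultimately show ?thesis by simp
qed

section \<open>The replica symmetric upper bound\<close>

definition sqnorm :: "nat \<Rightarrow> (nat \<Rightarrow> real) \<Rightarrow> real" where
  "sqnorm N z = (\<Sum>i<N. (z i)\<^sup>2)"

text \<open>Half the total variance of this field is the quartic term of the model, so
  \<open>field_exponent\<close> at time 1 is the interaction of \<open>Z_N\<close> together with its
  quartic term.\<close>

definition coupling :: "real \<Rightarrow> nat \<Rightarrow> nat \<times> nat \<Rightarrow> (nat \<Rightarrow> real) \<Rightarrow> real" where
  "coupling \<beta> N p z = \<beta> / sqrt (2 * real N) * (z (fst p) * z (snd p))"

abbreviation bonds :: "nat \<Rightarrow> (nat \<times> nat) set" where
  "bonds N \<equiv> {..<N} \<times> {..<N}"

lemma sqnorm_nonneg: "0 \<le> sqnorm N z"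
  by (simp add: sqnorm_def sum_nonneg)

lemma measurable_sqnorm [measurable]: "sqnorm N \<in> borel_measurable (gaussP {..<N})"
  unfolding sqnorm_def[abs_def] by measurable

lemma measurable_coupling:
  assumes "p \<in> bonds N" shows "coupling \<beta> N p \<in> borel_measurable (gaussP {..<N})"
proof -
  have "fst p \<in> {..<N}" "snd p \<in> {..<N}" using assms by auto
  then show ?thesis unfolding coupling_def[abs_def] by measurable
qed

lemma coupling_cov:
  "(\<Sum>p\<in>bonds N. coupling \<beta> N p x * coupling \<beta> N p y) = \<beta>\<^sup>2 / (2 * real N) * (\<Sum>i<N. x i * y i)\<^sup>2"
proof -
  have "(\<Sum>p\<in>bonds N. coupling \<beta> N p x * coupling \<beta> N p y)
     = (\<Sum>p\<in>bonds N. \<beta>\<^sup>2 / (2 * real N) * ((x (fst p) * y (fst p)) * (x (snd p) * y (snd p))))"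
    unfolding coupling_def by (intro sum.cong refl) (simp add: power2_eq_square mult_ac)
  also have "\<dots> = \<beta>\<^sup>2 / (2 * real N) * (\<Sum>i<N. \<Sum>j<N. (x i * y i) * (x j * y j))"
    by (simp add: sum.cartesian_product sum_distrib_left case_prod_beta)
  also have "\<dots> = \<beta>\<^sup>2 / (2 * real N) * (\<Sum>i<N. x i * y i)\<^sup>2"
    by (simp add: power2_eq_square sum_product)
  finally show ?thesis .
qed

lemma coupling_sq: "(\<Sum>p\<in>bonds N. (coupling \<beta> N p x)\<^sup>2) = \<beta>\<^sup>2 / (2 * real N) * (sqnorm N x)\<^sup>2"
  using coupling_cov[of \<beta> N x x] by (simp add: power2_eq_square sqnorm_def)

lemma field_exponent_coupling:
  "field_exponent (bonds N) (coupling \<beta> N) t J z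
    = sqrt t * (\<beta> / sqrt (2 * real N) * (\<Sum>i<N. \<Sum>j<N. J (i, j) * z i * z j)) - t * (\<beta>\<^sup>2 / (4 * real N) * (sqnorm N z)\<^sup>2)"
proof -
  have "(\<Sum>p\<in>bonds N. J p * coupling \<beta> N p z) = \<beta> / sqrt (2 * real N) * (\<Sum>i<N. \<Sum>j<N. J (i, j) * z i * z j)"
    by (simp add: sum.cartesian_product sum_distrib_left case_prod_beta coupling_def mult_ac)
  then show ?thesis unfolding field_exponent_def coupling_sq by simp
qed

lemma Z_N_eq:
  "Z_N N \<beta> lam J = (\<integral>z. exp (lam / 2 * sqnorm N z + field_exponent (bonds N) (coupling \<beta> N) 1 J z) \<partial>gaussP {..<N})"
  unfolding Z_N_def gauss_vec_eq field_exponent_coupling sqnorm_def by (simp add: algebra_simps)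

lemma coupling_bound:
  assumes "p \<in> bonds N" shows "\<bar>coupling \<beta> N p z\<bar> \<le> \<bar>\<beta>\<bar> / sqrt (2 * real N) * sqnorm N z"
proof -
  have 1: "(z i)\<^sup>2 \<le> sqnorm N z" if "i < N" for i
    unfolding sqnorm_def using that by (intro member_le_sum) auto
  have p: "fst p < N" "snd p < N" using assms by auto
  have "2 * (\<bar>z (fst p)\<bar> * \<bar>z (snd p)\<bar>) \<le> (z (fst p))\<^sup>2 + (z (snd p))\<^sup>2"
    using sum_squares_bound[of "\<bar>z (fst p)\<bar>" "\<bar>z (snd p)\<bar>"] by (simp add: mult.assoc)
  then have "\<bar>z (fst p) * z (snd p)\<bar> \<le> sqnorm N z"
    using 1[OF p(1)] 1[OF p(2)] unfolding abs_mult by linarith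
  from mult_left_mono[OF this, of "\<bar>\<beta>\<bar> / sqrt (2 * real N)"] show ?thesis
    unfolding coupling_def abs_mult[of "\<beta> / sqrt (2 * real N)"] by simp
qed

text \<open>With c the bracket that is squared, this is the maximum over r of c r - \<beta>^2 r^2/(4
  N), attained at r = 2 N c/\<beta>^2. The quartic term thus bounds the exponent uniformly in z by a
  polynomial in the |J p|.\<close>

definition energy_cap :: "real \<Rightarrow> real \<Rightarrow> nat \<Rightarrow> (nat \<times> nat \<Rightarrow> real) \<Rightarrow> real" where
  "energy_cap \<beta> lam N J = real N / \<beta>\<^sup>2 * (\<bar>\<beta>\<bar> / sqrt (2 * real N) * (\<Sum>p\<in>bonds N. \<bar>J p\<bar>) + \<bar>lam\<bar> / 2)\<^sup>2"

lemma exp_bounded_energy_cap: "exp_bounded (bonds N) (energy_cap \<beta> lam N)"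
  unfolding energy_cap_def[abs_def]
  by (intro exp_bounded_mult exp_bounded_power exp_bounded_add exp_bounded_const exp_bounded_sum
      exp_bounded_abs exp_bounded_component) auto

lemma energy_le_cap:
  assumes "N > 0" "\<beta> \<noteq> 0"
  shows "lam / 2 * sqnorm N z + field_exponent (bonds N) (coupling \<beta> N) 1 J z \<le> energy_cap \<beta> lam N J"
proof -
  define r where "r = sqnorm N z"
  define c where "c = \<bar>\<beta>\<bar> / sqrt (2 * real N) * (\<Sum>p\<in>bonds N. \<bar>J p\<bar>) + \<bar>lam\<bar> / 2"
  have r: "r \<ge> 0" by (simp add: r_def sqnorm_nonneg)
  have "(\<Sum>p\<in>bonds N. J p * coupling \<beta> N p z) \<le> (\<Sum>p\<in>bonds N. \<bar>J p\<bar> * (\<bar>\<beta>\<bar> / sqrt (2 * real N) * r))"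
  proof (rule sum_mono)
    fix p assume p: "p \<in> bonds N"
    have "J p * coupling \<beta> N p z \<le> \<bar>J p\<bar> * \<bar>coupling \<beta> N p z\<bar>" by (metis abs_ge_self abs_mult)
    also have "\<dots> \<le> \<bar>J p\<bar> * (\<bar>\<beta>\<bar> / sqrt (2 * real N) * r)"
      unfolding r_def by (intro mult_left_mono coupling_bound[OF p]) auto
    finally show "J p * coupling \<beta> N p z \<le> \<bar>J p\<bar> * (\<bar>\<beta>\<bar> / sqrt (2 * real N) * r)" .
  qed
  also have "\<dots> = \<bar>\<beta>\<bar> / sqrt (2 * real N) * (\<Sum>p\<in>bonds N. \<bar>J p\<bar>) * r"
    by (simp add: sum_distrib_left sum_distrib_right mult_ac)
  moreover have "lam / 2 * r \<le> \<bar>lam\<bar> / 2 * r" using r by (intro mult_right_mono) auto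
  ultimately have "lam / 2 * r + field_exponent (bonds N) (coupling \<beta> N) 1 J z \<le> c * r - \<beta>\<^sup>2 / (4 * real N) * r\<^sup>2"
    unfolding field_exponent_def coupling_sq r_def[symmetric] c_def distrib_right by simp
  also have "\<dots> \<le> real N / \<beta>\<^sup>2 * c\<^sup>2"
  proof -
    have "real N / \<beta>\<^sup>2 * c\<^sup>2 - (c * r - \<beta>\<^sup>2 / (4 * real N) * r\<^sup>2) = real N / \<beta>\<^sup>2 * (c - \<beta>\<^sup>2 / (2 * real N) * r)\<^sup>2"
      using assms by (simp add: field_simps power2_eq_square)
    moreover have "\<dots> \<ge> 0" by simp
    ultimately show ?thesis by linarith
  qed
  finally show ?thesis unfolding energy_cap_def r_def c_def .
qed

lemma measurable_energy:
  "(\<lambda>z. lam / 2 * sqnorm N z + field_exponent (bonds N) (coupling \<beta> N) t J z) \<in> borel_measurable (gaussP {..<N})"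
  using measurable_field_exponent'[of "bonds N" "coupling \<beta> N" "gaussP {..<N}" t J] measurable_coupling by measurable

lemma integrable_boltzmann:
  assumes "N > 0" "\<beta> \<noteq> 0"
  shows "integrable (gaussP {..<N}) (\<lambda>z. exp (lam / 2 * sqnorm N z + field_exponent (bonds N) (coupling \<beta> N) 1 J z))"
proof (rule finite_measure.integrable_const_bound[OF prob_space.finite_measure[OF prob_space_gaussP]])
  show "AE z in gaussP {..<N}. norm (exp (lam / 2 * sqnorm N z + field_exponent (bonds N) (coupling \<beta> N) 1 J z))
      \<le> exp (energy_cap \<beta> lam N J)"
    using energy_le_cap[OF assms] by (intro AE_I2) simp
  show "(\<lambda>z. exp (lam / 2 * sqnorm N z + field_exponent (bonds N) (coupling \<beta> N) 1 J z)) \<in> borel_measurable (gaussP {..<N})"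
    using measurable_energy by measurable
qed

lemma restrict_gaussP:
  assumes "S \<in> sets (gaussP {..<N})"
  shows "finite_measure (restrict_space (gaussP {..<N}) S)"
    and "space (restrict_space (gaussP {..<N}) S) = S"
    and "emeasure (restrict_space (gaussP {..<N}) S) (space (restrict_space (gaussP {..<N}) S)) = emeasure (gaussP {..<N}) S"
    and "\<And>f :: _ \<Rightarrow> real. (\<integral>z. f z \<partial>restrict_space (gaussP {..<N}) S) = (\<integral>z. indicator S z * f z \<partial>gaussP {..<N})"
proof -
  have S2: "S \<subseteq> space (gaussP {..<N})" by (rule sets.sets_into_space[OF assms])
  have S1: "S \<inter> space (gaussP {..<N}) \<in> sets (gaussP {..<N})" by (subst sets.Int_space_eq2[OF assms]) (rule assms)
  note S = S1 S2
  show "finite_measure (restrict_space (gaussP {..<N}) S)"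
    by (intro finite_measure_restrict_space prob_space.finite_measure prob_space_gaussP assms)
  show sp: "space (restrict_space (gaussP {..<N}) S) = S" using S(2) by (auto simp: space_restrict_space)
  show "emeasure (restrict_space (gaussP {..<N}) S) (space (restrict_space (gaussP {..<N}) S)) = emeasure (gaussP {..<N}) S"
    unfolding sp by (rule emeasure_restrict_space[OF S(1)]) simp
  show "(\<integral>z. f z \<partial>restrict_space (gaussP {..<N}) S) = (\<integral>z. indicator S z * f z \<partial>gaussP {..<N})" for f :: "_ \<Rightarrow> real"
    using integral_restrict_space[OF S(1), of f] by (simp add: set_lebesgue_integral_def)
qed

lemma gaussP_sq_mean: "finite I \<Longrightarrow> (\<integral>h. (\<Sum>i\<in>I. (h i)\<^sup>2) \<partial>gaussP I) = real (card I)"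
  by (subst Bochner_Integration.integral_sum)
     (auto simp: power2_eq_square gaussP_cov intro!: exp_bounded_integrable exp_bounded_mult)

text \<open>Comparison is available for bounded fields, so it is applied on cubes that exhaust the
  space. On the linear side the cube may be dropped at once because the integrand is positive; on
  the other side the logarithms converge by domination. The result holds for every N without error
  term.\<close>

proposition replica_symmetric_upper_bound:
  fixes \<beta> lam Q :: real
  assumes N: "N > 0" and \<beta>: "\<beta> > 0" and Q: "Q \<ge> 0"
  defines "u \<equiv> 1 - lam + \<beta>\<^sup>2 * Q"
  assumes u: "u > 0"
  shows "integrable (gaussP (bonds N)) (\<lambda>J. ln (Z_N N \<beta> lam J))"
    and "(\<integral>J. ln (Z_N N \<beta> lam J) \<partial>gaussP (bonds N)) \<le> real N * (- ln u / 2 + \<beta>\<^sup>2 * Q / (2 * u) + \<beta>\<^sup>2 * Q\<^sup>2 / 4)"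
proof -
  let ?g = "gaussP {..<N}"
  interpret g: prob_space ?g by (rule prob_space_gaussP)
  define S where "S n = {z \<in> space ?g. \<forall>i<N. \<bar>z i\<bar> \<le> real n}" for n :: nat
  have Ss [measurable]: "S n \<in> sets ?g" for n unfolding S_def by measurable
  define f where "f J z = exp (lam / 2 * sqnorm N z + field_exponent (bonds N) (coupling \<beta> N) 1 J z)" for J z
  define W where "W n J = (\<integral>z. indicator (S n) z * f J z \<partial>?g)" for n J
  have fi: "integrable ?g (f J)" for J unfolding f_def using integrable_boltzmann[OF N] \<beta> by auto
  have fm [measurable]: "f J \<in> borel_measurable ?g" for J using fi by auto
  have f0: "0 \<le> f J z" for J z by (simp add: f_def)
  have Smono: "S m \<subseteq> S n" if "m \<le> n" for m n using that unfolding S_def by (force intro: order_trans)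
  have Sun: "(\<Union>n. S n) = space ?g"
  proof (intro equalityI subsetI)
    fix z assume z: "z \<in> space ?g"
    obtain n :: nat where n: "(\<Sum>i<N. \<bar>z i\<bar>) \<le> real n" using real_arch_simple by blast
    have "\<bar>z i\<bar> \<le> real n" if "i < N" for i
      using that by (intro order_trans[OF member_le_sum n]) auto
    then show "z \<in> (\<Union>n. S n)" using z unfolding S_def by auto
  qed (auto simp: S_def)
  \<comment> \<open>Countably many null cubes cannot cover a probability space.\<close>
  obtain n0 where n0: "emeasure ?g (S n0) \<noteq> 0"
  proof (rule ccontr)
    assume *: "\<not> thesis"
    have "emeasure ?g (\<Union>n. S n) = 0"
      by (rule emeasure_UN_eq_0) (use * that Ss in auto)
    then show False unfolding Sun using g.emeasure_space_1 by simp
  qed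
  have Spos: "emeasure ?g (S n) \<noteq> 0" if "n \<ge> n0" for n
    using emeasure_mono[OF Smono[OF that] Ss] n0 by (metis le_zero_eq)
  define \<psi> where "\<psi> i z = \<beta> * sqrt Q * z i" for i and z :: "nat \<Rightarrow> real"
  define U where "U = real N * (- ln u / 2 + \<beta>\<^sup>2 * Q / (2 * u) + \<beta>\<^sup>2 * Q\<^sup>2 / 4)"
  have main: "exp_bounded (bonds N) (\<lambda>J. ln (W n J))" "(\<integral>J. ln (W n J) \<partial>gaussP (bonds N)) \<le> U" "\<And>J. W n J > 0"
    if n: "n \<ge> n0" for n
  proof -
    let ?m = "restrict_space ?g (S n)"
    note rs = restrict_gaussP[OF Ss[of n]]
    \<comment> \<open>The comparison theorem takes one bound for both fields, hence the sum of the
      two.\<close>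
    define B where "B = \<bar>\<beta>\<bar> / sqrt (2 * real N) * (real N * (real n)\<^sup>2) + \<beta> * sqrt Q * real n"
    have B0: "0 \<le> B" unfolding B_def using \<beta> Q by simp
    have zb: "\<bar>z i\<bar> \<le> real n" if "z \<in> space ?m" "i < N" for z i using that rs(2) unfolding S_def by auto
    have sb: "sqnorm N z \<le> real N * (real n)\<^sup>2" if "z \<in> space ?m" for z
    proof -
      have "sqnorm N z \<le> (\<Sum>i<N. (real n)\<^sup>2)" unfolding sqnorm_def
        using zb[OF that] by (intro sum_mono) (metis abs_le_square_iff abs_of_nat lessThan_iff)
      then show ?thesis by simp
    qed
    have cb: "\<bar>coupling \<beta> N p z\<bar> \<le> B" if "p \<in> bonds N" "z \<in> space ?m" for p z
    proof -
      have "\<bar>\<beta>\<bar> / sqrt (2 * real N) * sqnorm N z \<le> \<bar>\<beta>\<bar> / sqrt (2 * real N) * (real N * (real n)\<^sup>2)"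
        using sb[OF that(2)] by (intro mult_left_mono) auto
      moreover have "0 \<le> \<beta> * sqrt Q * real n" using \<beta> Q by simp
      ultimately show ?thesis using coupling_bound[OF that(1), of \<beta> z] unfolding B_def by linarith
    qed
    have pb: "\<bar>\<psi> i z\<bar> \<le> B" if "i \<in> {..<N}" "z \<in> space ?m" for i z
    proof -
      have "\<bar>\<psi> i z\<bar> \<le> \<beta> * sqrt Q * real n"
        unfolding \<psi>_def abs_mult using zb[OF that(2), of i] that(1) \<beta> Q by (intro mult_mono) auto
      moreover have "0 \<le> \<bar>\<beta>\<bar> / sqrt (2 * real N) * (real N * (real n)\<^sup>2)" by simp
      ultimately show ?thesis unfolding B_def by linarith
    qed
    have cm: "coupling \<beta> N p \<in> borel_measurable ?m" if "p \<in> bonds N" for p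
      by (rule measurable_restrict_space1[OF measurable_coupling[OF that]])
    have pm: "\<psi> i \<in> borel_measurable ?m" if "i \<in> {..<N}" for i
      unfolding \<psi>_def[abs_def] using that by (intro measurable_restrict_space1) measurable
    have Gm: "(\<lambda>z. lam / 2 * sqnorm N z) \<in> borel_measurable ?m"
      by (intro measurable_restrict_space1) measurable
    have Gb: "\<bar>lam / 2 * sqnorm N z\<bar> \<le> \<bar>lam\<bar> / 2 * (real N * (real n)\<^sup>2)" if "z \<in> space ?m" for z
      unfolding abs_mult using sb[OF that] sqnorm_nonneg[of N z] by (intro mult_mono) auto
    have mu: "finite_measure ?m" "emeasure ?m (space ?m) \<noteq> 0" using rs(1,3) Spos[OF n] by auto
    have W: "W n J = (\<integral>z. exp (lam / 2 * sqnorm N z + field_exponent (bonds N) (coupling \<beta> N) 1 J z) \<partial>?m)" for J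
      unfolding W_def f_def by (rule rs(4)[symmetric])
    show "exp_bounded (bonds N) (\<lambda>J. ln (W n J))"
      unfolding W by (rule gibbs_log_step(1)[OF mu Gm Gb _ cm cb B0]) auto
    show "W n J > 0" for J unfolding W
      by (rule partition_pos[OF mu energy_bound[OF mu Gm Gb _ cm cb B0]]) auto
    define V where "V h = ln (\<integral>z. exp (lam / 2 * sqnorm N z + field_exponent {..<N} \<psi> 1 h z) \<partial>?m)" for h
    have cov: "(\<Sum>i<N. \<psi> i x * \<psi> i y) \<le> (\<Sum>p\<in>bonds N. coupling \<beta> N p x * coupling \<beta> N p y) + \<beta>\<^sup>2 * Q\<^sup>2 * real N / 2" for x y
    proof -
      define s where "s = (\<Sum>i<N. x i * y i)"
      have "(\<Sum>i<N. \<psi> i x * \<psi> i y) = \<beta>\<^sup>2 * (sqrt Q)\<^sup>2 * s"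
      proof -
        have "\<psi> i x * \<psi> i y = \<beta>\<^sup>2 * (sqrt Q)\<^sup>2 * (x i * y i)" for i
          by (simp only: \<psi>_def power2_eq_square mult_ac)
        then show ?thesis by (simp only: s_def sum_distrib_left)
      qed
      moreover have "\<beta>\<^sup>2 / (2 * real N) * s\<^sup>2 + \<beta>\<^sup>2 * Q\<^sup>2 * real N / 2 - \<beta>\<^sup>2 * Q * s = \<beta>\<^sup>2 / (2 * real N) * (s - real N * Q)\<^sup>2"
        using N by (simp add: field_simps power2_eq_square)
      moreover have "\<beta>\<^sup>2 / (2 * real N) * (s - real N * Q)\<^sup>2 \<ge> 0" by simp
      moreover have "\<beta>\<^sup>2 * (sqrt Q)\<^sup>2 * s = \<beta>\<^sup>2 * Q * s" using Q by simp
      ultimately show ?thesis unfolding coupling_cov s_def[symmetric] by linarith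
    qed
    have "(\<integral>J. ln (W n J) \<partial>gaussP (bonds N)) \<le> (\<integral>h. V h \<partial>gaussP {..<N}) + (\<beta>\<^sup>2 * Q\<^sup>2 * real N / 2) / 2"
      unfolding W V_def by (rule gaussian_comparison[OF mu Gm Gb _ cm cb _ pm pb B0 cov]) auto
    also have "(\<integral>h. V h \<partial>gaussP {..<N}) \<le> (\<integral>h. - real N / 2 * ln u + \<beta>\<^sup>2 * Q / (2 * u) * (\<Sum>i<N. (h i)\<^sup>2) \<partial>gaussP {..<N})"
    proof (rule integral_mono)
      show "integrable ?g V"
        unfolding V_def by (rule exp_bounded_integrable[OF _ gibbs_log_step(1)[OF mu Gm Gb _ pm pb B0]]) auto
      show "integrable ?g (\<lambda>h. - real N / 2 * ln u + \<beta>\<^sup>2 * Q / (2 * u) * (\<Sum>i<N. (h i)\<^sup>2))"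
        by (intro exp_bounded_integrable exp_bounded_add exp_bounded_mult exp_bounded_sum exp_bounded_power exp_bounded_const exp_bounded_component) auto
      fix h
      \<comment> \<open>The normalisation of the linear field subtracts \<beta>^2 Q/2 times the
        squared length, which changes the coefficient \<open>lam\<close> into 1 - u.\<close>
      have e: "lam / 2 * sqnorm N z + field_exponent {..<N} \<psi> 1 h z = (\<Sum>i<N. (\<beta> * sqrt Q * h i) * z i) + (1 - u) / 2 * (\<Sum>i<N. (z i)\<^sup>2)" for z
      proof -
        have "(\<Sum>i<N. (\<psi> i z)\<^sup>2) = \<beta>\<^sup>2 * Q * (\<Sum>i<N. (z i)\<^sup>2)"
          unfolding \<psi>_def using Q by (simp add: power_mult_distrib sum_distrib_left)
        moreover have "(\<Sum>i<N. h i * \<psi> i z) = (\<Sum>i<N. (\<beta> * sqrt Q * h i) * z i)"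
          unfolding \<psi>_def by (simp add: mult_ac)
        ultimately show ?thesis unfolding field_exponent_def sqnorm_def u_def
          by (simp add: algebra_simps diff_divide_distrib)
      qed
      note mgf = gaussP_mgf[OF u, of "{..<N}" "\<lambda>i. \<beta> * sqrt Q * h i"]
      have "(\<integral>z. exp (lam / 2 * sqnorm N z + field_exponent {..<N} \<psi> 1 h z) \<partial>?m)
          \<le> exp ((\<Sum>i<N. (\<beta> * sqrt Q * h i)\<^sup>2) / (2 * u)) / sqrt u ^ N"
      proof -
        have "(\<integral>z. exp (lam / 2 * sqnorm N z + field_exponent {..<N} \<psi> 1 h z) \<partial>?m)
          \<le> (\<integral>z. exp ((\<Sum>i<N. (\<beta> * sqrt Q * h i) * z i) + (1 - u) / 2 * (\<Sum>i<N. (z i)\<^sup>2)) \<partial>?g)"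
          unfolding rs(4) e
        proof (rule integral_mono)
          show i: "integrable ?g (\<lambda>z. exp ((\<Sum>i<N. (\<beta> * sqrt Q * h i) * z i) + (1 - u) / 2 * (\<Sum>i<N. (z i)\<^sup>2)))"
            using mgf(1) by simp
          show "integrable ?g (\<lambda>z. indicator (S n) z * exp ((\<Sum>i<N. (\<beta> * sqrt Q * h i) * z i) + (1 - u) / 2 * (\<Sum>i<N. (z i)\<^sup>2)))"
            by (rule Bochner_Integration.integrable_bound[OF i]) (auto simp: indicator_def)
        qed (auto simp: indicator_def)
        also have "\<dots> = exp ((\<Sum>i<N. (\<beta> * sqrt Q * h i)\<^sup>2) / (2 * u)) / sqrt u ^ N"
          using mgf(2) by simp
        finally show ?thesis .
      qed
      then have "V h \<le> ln (exp ((\<Sum>i<N. (\<beta> * sqrt Q * h i)\<^sup>2) / (2 * u)) / sqrt u ^ N)"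
        unfolding V_def
        by (intro ln_mono partition_pos[OF mu energy_bound[OF mu Gm Gb _ pm pb B0]]) auto
      also have "\<dots> = (\<Sum>i<N. (\<beta> * sqrt Q * h i)\<^sup>2) / (2 * u) - real N * (ln u / 2)"
        using u by (simp add: ln_div ln_realpow ln_sqrt)
      also have "(\<Sum>i<N. (\<beta> * sqrt Q * h i)\<^sup>2) = \<beta>\<^sup>2 * Q * (\<Sum>i<N. (h i)\<^sup>2)"
        using Q by (simp add: power_mult_distrib sum_distrib_left)
      finally show "V h \<le> - real N / 2 * ln u + \<beta>\<^sup>2 * Q / (2 * u) * (\<Sum>i<N. (h i)\<^sup>2)" by simp
    qed
    also have "\<dots> = - real N / 2 * ln u + \<beta>\<^sup>2 * Q / (2 * u) * real N"
    proof -
      have "integrable ?g (\<lambda>h. \<Sum>i<N. (h i)\<^sup>2)"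
        by (intro exp_bounded_integrable exp_bounded_sum exp_bounded_power exp_bounded_component) auto
      then show ?thesis using gaussP_sq_mean[of "{..<N}"] g.prob_space by simp
    qed
    finally show "(\<integral>J. ln (W n J) \<partial>gaussP (bonds N)) \<le> U" unfolding U_def by (simp add: algebra_simps)
  qed
  have Zf: "Z_N N \<beta> lam J = (\<integral>z. f J z \<partial>?g)" for J unfolding Z_N_eq f_def ..
  have iW: "integrable ?g (\<lambda>z. indicator (S n) z * f J z)" for n J
    by (rule Bochner_Integration.integrable_bound[OF fi[of J]]) (auto simp: indicator_def)
  have Wmono: "W m J \<le> W n J" if "m \<le> n" for m n J
    unfolding W_def using Smono[OF that] f0 by (intro integral_mono iW) (auto simp: indicator_def)
  have WZ: "W n J \<le> Z_N N \<beta> lam J" for n J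
    unfolding Zf W_def using f0 by (intro integral_mono iW fi) (auto simp: indicator_def)
  have Zcap: "Z_N N \<beta> lam J \<le> exp (energy_cap \<beta> lam N J)" for J
  proof -
    have "(\<integral>z. f J z \<partial>?g) \<le> (\<integral>z. exp (energy_cap \<beta> lam N J) \<partial>?g)"
    proof (rule integral_mono[OF fi])
      show "f J z \<le> exp (energy_cap \<beta> lam N J)" for z
        unfolding f_def using energy_le_cap[OF N, of \<beta> lam z J] \<beta> by simp
    qed simp
    then show ?thesis unfolding Zf by (simp add: g.prob_space)
  qed
  have lim: "(\<lambda>n. W (n0 + n) J) \<longlonglongrightarrow> Z_N N \<beta> lam J" for J
    unfolding W_def Zf
  proof (rule integral_dominated_convergence[where w = "f J"])
    show "AE z in ?g. (\<lambda>n. indicator (S (n0 + n)) z * f J z) \<longlonglongrightarrow> f J z"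
    proof (rule AE_I2)
      fix z assume "z \<in> space ?g"
      then obtain m where m: "z \<in> S m" using Sun by auto
      have "\<forall>\<^sub>F n in sequentially. indicator (S (n0 + n)) z * f J z = f J z"
        using eventually_ge_at_top[of m] 
      proof eventually_elim
        fix n assume "m \<le> n"
        then have "z \<in> S (n0 + n)" using m Smono[of m "n0 + n"] by auto
        then show "indicator (S (n0 + n)) z * f J z = f J z" by simp
      qed
      then show "(\<lambda>n. indicator (S (n0 + n)) z * f J z) \<longlonglongrightarrow> f J z" by (rule tendsto_eventually)
    qed
    show "AE z in ?g. norm (indicator (S (n0 + n)) z * f J z) \<le> f J z" for n
      using f0 by (intro AE_I2) (auto simp: indicator_def)
  qed (use fi in auto)
  have Wpos: "W (n0 + n) J > 0" for n J using main(3)[of "n0 + n"] by simp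
  have Zpos: "Z_N N \<beta> lam J > 0" for J using Wpos[of 0 J] WZ[of n0 J] by simp
  have lnlim: "(\<lambda>n. ln (W (n0 + n) J)) \<longlonglongrightarrow> ln (Z_N N \<beta> lam J)" for J
    using Zpos[of J] by (intro tendsto_ln lim) auto
  have wi: "integrable (gaussP (bonds N)) (\<lambda>J. \<bar>ln (W n0 J)\<bar> + \<bar>energy_cap \<beta> lam N J\<bar>)"
    by (intro exp_bounded_integrable exp_bounded_add exp_bounded_abs main(1) exp_bounded_energy_cap) auto
  have Zm: "(\<lambda>J. ln (Z_N N \<beta> lam J)) \<in> borel_measurable (gaussP (bonds N))"
    by (rule borel_measurable_LIMSEQ_real[OF lnlim]) (use main(1)[of "n0 + _"] exp_bounded_measurable in auto)
  \<comment> \<open>The cube integrals increase with n, so the smallest one bounds the logarithms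
    from below and the energy cap bounds them from above.\<close>
  have dom: "\<bar>ln (W (n0 + n) J)\<bar> \<le> \<bar>ln (W n0 J)\<bar> + \<bar>energy_cap \<beta> lam N J\<bar>" for n J
  proof -
    have "ln (W n0 J) \<le> ln (W (n0 + n) J)" using Wmono[of n0 "n0 + n" J] Wpos[of 0 J] by simp
    moreover have "ln (W (n0 + n) J) \<le> ln (exp (energy_cap \<beta> lam N J))"
      using WZ[of "n0 + n" J] Zcap[of J] Wpos[of n J] by (intro ln_mono) auto
    ultimately show ?thesis by (simp add: abs_le_iff) linarith
  qed
  have mW: "(\<lambda>J. ln (W (n0 + n) J)) \<in> borel_measurable (gaussP (bonds N))" for n
    using main(1)[of "n0 + n"] exp_bounded_measurable by auto
  have ae1: "AE J in gaussP (bonds N). (\<lambda>n. ln (W (n0 + n) J)) \<longlonglongrightarrow> ln (Z_N N \<beta> lam J)"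
    using lnlim by (intro AE_I2)
  have ae2: "AE J in gaussP (bonds N). norm (ln (W (n0 + n) J)) \<le> \<bar>ln (W n0 J)\<bar> + \<bar>energy_cap \<beta> lam N J\<bar>" for n
    using dom by (intro AE_I2) simp
  show "integrable (gaussP (bonds N)) (\<lambda>J. ln (Z_N N \<beta> lam J))"
    by (rule integrable_dominated_convergence[OF Zm mW wi ae1 ae2])
  have "(\<lambda>n. \<integral>J. ln (W (n0 + n) J) \<partial>gaussP (bonds N)) \<longlonglongrightarrow> (\<integral>J. ln (Z_N N \<beta> lam J) \<partial>gaussP (bonds N))"
    by (rule integral_dominated_convergence[OF Zm mW wi ae1 ae2])
  then show "(\<integral>J. ln (Z_N N \<beta> lam J) \<partial>gaussP (bonds N)) \<le> real N * (- ln u / 2 + \<beta>\<^sup>2 * Q / (2 * u) + \<beta>\<^sup>2 * Q\<^sup>2 / 4)"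
    unfolding U_def[symmetric] by (rule LIMSEQ_le_const2) (use main(2)[of "n0 + _"] in auto)
qed

section \<open>The high temperature phase\<close>

lemma gaussP_exp_sqnorm:
  assumes "w > 0"
  shows "integrable (gaussP {..<N}) (\<lambda>z. exp ((1 - w) / 2 * sqnorm N z))"
    and "(\<integral>z. exp ((1 - w) / 2 * sqnorm N z) \<partial>gaussP {..<N}) = 1 / sqrt w ^ N"
  using gaussP_mgf[OF assms, of "{..<N}" "\<lambda>_. 0"] by (simp_all add: sqnorm_def)

definition shell :: "nat \<Rightarrow> real \<Rightarrow> real \<Rightarrow> (nat \<Rightarrow> real) set" where
  "shell N a b = {z \<in> space (gaussP {..<N}). real N * a \<le> sqnorm N z \<and> sqnorm N z \<le> real N * b}"

lemma sets_shell [measurable]: "shell N a b \<in> sets (gaussP {..<N})"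
  unfolding shell_def by measurable

text \<open>A Chernoff bound: changing the precision w by \<theta> in either direction shows that
  each tail has at most the fraction q^N of the total mass, with q = exp(-\<theta> \<eta>/4). Once
  q^N < 1/4 at least half of the mass is left on the shell.\<close>

lemma shell_mass:
  assumes w: "w > 0" and \<eta>: "\<eta> > 0"
  shows "\<forall>\<^sub>F N in sequentially.
    (\<integral>z. indicator (shell N (1 / w - \<eta>) (1 / w + \<eta>)) z * exp ((1 - w) / 2 * sqnorm N z) \<partial>gaussP {..<N}) \<ge> 1 / 2 / sqrt w ^ N"
proof -
  define \<rho> where "\<rho> = 1 / w"
  have \<rho>: "\<rho> > 0" "w * \<rho> = 1" using w by (auto simp: \<rho>_def)
  \<comment> \<open>The first entry keeps \<theta> \<rho> within the range of the second-order
    bounds for the logarithm; the second makes their error (\<theta> \<rho>)^2 at most half of the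
    linear gain \<theta> \<eta>/2.\<close>
  define \<theta> where "\<theta> = min (1 / (2 * \<rho>)) (\<eta> / (4 * \<rho>\<^sup>2))"
  have \<theta>: "\<theta> > 0" using \<rho> \<eta> by (simp add: \<theta>_def)
  have x: "0 < \<theta> * \<rho>" "\<theta> * \<rho> \<le> 1 / 2" using \<theta> \<rho> by (auto simp: \<theta>_def min_def field_simps)
  have x2: "(\<theta> * \<rho>)\<^sup>2 \<le> \<theta> * \<eta> / 4"
  proof -
    have "\<theta> * \<rho>\<^sup>2 \<le> \<eta> / 4" using \<rho> unfolding \<theta>_def by (auto simp: min_def field_simps)
    then have "\<theta> * (\<theta> * \<rho>\<^sup>2) \<le> \<theta> * (\<eta> / 4)" using \<theta> by (intro mult_left_mono) auto
    then show ?thesis by (simp add: power2_eq_square mult_ac)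
  qed
  have w1: "w - \<theta> = w * (1 - \<theta> * \<rho>)" "w + \<theta> = w * (1 + \<theta> * \<rho>)" using \<rho> by (simp_all add: algebra_simps)
  have wp: "w - \<theta> > 0" "w + \<theta> > 0" unfolding w1 using w x by auto
  define q where "q = exp (- \<theta> * \<eta> / 4)"
  have q: "0 < q" "q < 1" using \<theta> \<eta> by (auto simp: q_def)
  have up: "exp (- \<theta> / 2 * (\<rho> + \<eta>)) / sqrt (w - \<theta>) \<le> q / sqrt w"
  proof -
    have "- (\<theta> * \<rho>) - 2 * (\<theta> * \<rho>)\<^sup>2 \<le> ln (1 - \<theta> * \<rho>)"
      using x ln_one_minus_pos_lower_bound[of "\<theta> * \<rho>"] by simp
    then have "- \<theta> / 2 * (\<rho> + \<eta>) - ln (1 - \<theta> * \<rho>) / 2 \<le> - \<theta> * \<eta> / 4"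
    proof -
      have "- \<theta> / 2 * (\<rho> + \<eta>) = - (\<theta> * \<rho>) / 2 - \<theta> * \<eta> / 2" by (simp add: field_simps)
      with \<open>- (\<theta> * \<rho>) - 2 * (\<theta> * \<rho>)\<^sup>2 \<le> ln (1 - \<theta> * \<rho>)\<close> show ?thesis using x2 by linarith
    qed
    then have "exp (- \<theta> / 2 * (\<rho> + \<eta>) - ln (1 - \<theta> * \<rho>) / 2) \<le> q" by (simp add: q_def)
    moreover have "exp (ln (1 - \<theta> * \<rho>) / 2) = sqrt (1 - \<theta> * \<rho>)"
      using x by (simp add: ln_sqrt[symmetric])
    ultimately have "exp (- \<theta> / 2 * (\<rho> + \<eta>)) / sqrt (1 - \<theta> * \<rho>) \<le> q" by (simp add: exp_diff)
    from divide_right_mono[OF this, of "sqrt w"] show ?thesis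
      unfolding w1 real_sqrt_mult divide_divide_eq_left using w by (simp add: mult.commute)
  qed
  have lo: "exp (\<theta> / 2 * (\<rho> - \<eta>)) / sqrt (w + \<theta>) \<le> q / sqrt w"
  proof -
    have "\<theta> * \<rho> - (\<theta> * \<rho>)\<^sup>2 \<le> ln (1 + \<theta> * \<rho>)"
      using x ln_one_plus_pos_lower_bound[of "\<theta> * \<rho>"] by simp
    then have "\<theta> / 2 * (\<rho> - \<eta>) - ln (1 + \<theta> * \<rho>) / 2 \<le> - \<theta> * \<eta> / 4"
    proof -
      have "\<theta> / 2 * (\<rho> - \<eta>) = (\<theta> * \<rho>) / 2 - \<theta> * \<eta> / 2" by (simp add: field_simps)
      with \<open>\<theta> * \<rho> - (\<theta> * \<rho>)\<^sup>2 \<le> ln (1 + \<theta> * \<rho>)\<close> show ?thesis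
        using x2 zero_le_power2[of "\<theta> * \<rho>"] by linarith
    qed
    then have "exp (\<theta> / 2 * (\<rho> - \<eta>) - ln (1 + \<theta> * \<rho>) / 2) \<le> q" by (simp add: q_def)
    moreover have "exp (ln (1 + \<theta> * \<rho>) / 2) = sqrt (1 + \<theta> * \<rho>)"
      using x by (simp add: ln_sqrt[symmetric])
    ultimately have "exp (\<theta> / 2 * (\<rho> - \<eta>)) / sqrt (1 + \<theta> * \<rho>) \<le> q" by (simp add: exp_diff)
    from divide_right_mono[OF this, of "sqrt w"] show ?thesis
      unfolding w1 real_sqrt_mult divide_divide_eq_left using w by (simp add: mult.commute)
  qed
  have "(\<lambda>N. q ^ N) \<longlonglongrightarrow> 0" using q by (intro LIMSEQ_power_zero) auto
  then have "\<forall>\<^sub>F N in sequentially. q ^ N < 1 / 4" by (rule order_tendstoD) simp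
  then show ?thesis
  proof eventually_elim
    fix N assume qN: "q ^ N < 1 / 4"
    let ?g = "gaussP {..<N}" and ?S = "shell N (1 / w - \<eta>) (1 / w + \<eta>)"
    let ?I = "\<integral>z. indicator ?S z * exp ((1 - w) / 2 * sqnorm N z) \<partial>?g"
    let ?a = "exp (- \<theta> / 2 * (\<rho> + \<eta>)) ^ N" and ?b = "exp (\<theta> / 2 * (\<rho> - \<eta>)) ^ N"
    note i1 = gaussP_exp_sqnorm[OF w, of N] and i2 = gaussP_exp_sqnorm[OF wp(1), of N] and i3 = gaussP_exp_sqnorm[OF wp(2), of N]
    have i0: "integrable ?g (\<lambda>z. indicator ?S z * exp ((1 - w) / 2 * sqnorm N z))"
      by (rule Bochner_Integration.integrable_bound[OF i1(1)]) (auto simp: indicator_def)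
    have "(\<integral>z. exp ((1 - w) / 2 * sqnorm N z) \<partial>?g)
      \<le> (\<integral>z. indicator ?S z * exp ((1 - w) / 2 * sqnorm N z) + ?a * exp ((1 - (w - \<theta>)) / 2 * sqnorm N z)
            + ?b * exp ((1 - (w + \<theta>)) / 2 * sqnorm N z) \<partial>?g)"
    proof (rule integral_mono[OF i1(1)])
      show "integrable ?g (\<lambda>z. indicator ?S z * exp ((1 - w) / 2 * sqnorm N z) + ?a * exp ((1 - (w - \<theta>)) / 2 * sqnorm N z)
            + ?b * exp ((1 - (w + \<theta>)) / 2 * sqnorm N z))"
        using i0 i2(1) i3(1) by (intro Bochner_Integration.integrable_add integrable_mult_right) auto
      fix z assume z: "z \<in> space ?g"
      let ?r = "sqnorm N z"
      have ea: "?a * exp ((1 - (w - \<theta>)) / 2 * ?r) = exp ((1 - w) / 2 * ?r) * exp (\<theta> / 2 * (?r - real N * (\<rho> + \<eta>)))"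
        by (simp add: exp_of_nat_mult[symmetric] exp_add[symmetric] field_simps)
      have eb: "?b * exp ((1 - (w + \<theta>)) / 2 * ?r) = exp ((1 - w) / 2 * ?r) * exp (\<theta> / 2 * (real N * (\<rho> - \<eta>) - ?r))"
        by (simp add: exp_of_nat_mult[symmetric] exp_add[symmetric] field_simps)
      consider "z \<in> ?S" | "?r > real N * (\<rho> + \<eta>)" | "?r < real N * (\<rho> - \<eta>)"
        using z unfolding shell_def \<rho>_def by force
      \<comment> \<open>The constant 1 is covered by the indicator and two exponential Markov
        weights, each at least 1 on its own tail.\<close>
      then have one: "1 \<le> indicat_real ?S z + exp (\<theta> / 2 * (?r - real N * (\<rho> + \<eta>))) + exp (\<theta> / 2 * (real N * (\<rho> - \<eta>) - ?r))"
      proof cases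
        case 1 then show ?thesis by (simp add: add_nonneg_nonneg)
      next
        case 2
        then have "0 \<le> \<theta> / 2 * (?r - real N * (\<rho> + \<eta>))" using \<theta> by simp
        then have "1 \<le> exp (\<theta> / 2 * (?r - real N * (\<rho> + \<eta>)))" by (simp only: one_le_exp_iff)
        moreover have "0 \<le> indicat_real ?S z" "0 \<le> exp (\<theta> / 2 * (real N * (\<rho> - \<eta>) - ?r))" by auto
        ultimately show ?thesis by linarith
      next
        case 3
        then have "0 \<le> \<theta> / 2 * (real N * (\<rho> - \<eta>) - ?r)" using \<theta> by simp
        then have "1 \<le> exp (\<theta> / 2 * (real N * (\<rho> - \<eta>) - ?r))" by (simp only: one_le_exp_iff)
        moreover have "0 \<le> indicat_real ?S z" "0 \<le> exp (\<theta> / 2 * (?r - real N * (\<rho> + \<eta>)))" by auto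
        ultimately show ?thesis by linarith
      qed
      from mult_left_mono[OF one, of "exp ((1 - w) / 2 * ?r)"]
      show "exp ((1 - w) / 2 * ?r) \<le> indicator ?S z * exp ((1 - w) / 2 * ?r) + ?a * exp ((1 - (w - \<theta>)) / 2 * ?r)
            + ?b * exp ((1 - (w + \<theta>)) / 2 * ?r)"
        unfolding ea eb by (simp add: algebra_simps)
    qed
    also have "\<dots> = ?I + ?a * (1 / sqrt (w - \<theta>) ^ N) + ?b * (1 / sqrt (w + \<theta>) ^ N)"
      using i0 i2 i3 by simp
    also have "?a * (1 / sqrt (w - \<theta>) ^ N) = (exp (- \<theta> / 2 * (\<rho> + \<eta>)) / sqrt (w - \<theta>)) ^ N" by (simp add: power_divide)
    also have "?b * (1 / sqrt (w + \<theta>) ^ N) = (exp (\<theta> / 2 * (\<rho> - \<eta>)) / sqrt (w + \<theta>)) ^ N" by (simp add: power_divide)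
    finally have "1 / sqrt w ^ N \<le> ?I + (q / sqrt w) ^ N + (q / sqrt w) ^ N"
      using power_mono[OF up, of N] power_mono[OF lo, of N] wp i1(2) by simp
    moreover have "(q / sqrt w) ^ N \<le> 1 / 4 / sqrt w ^ N"
      unfolding power_divide using qN w by (intro divide_right_mono) auto
    ultimately show "1 / 2 / sqrt w ^ N \<le> ?I" by simp
  qed
qed

text \<open>Gaussian linearisation of the square in the two-replica interaction.\<close>

lemma pair_interaction_integral:
  fixes x :: "nat \<Rightarrow> real"
  assumes w: "w > 0" and c: "c\<^sup>2 * sqnorm N x < w"
  shows "(\<integral>\<^sup>+y. ennreal (exp ((1 - w) / 2 * sqnorm N y + c\<^sup>2 / 2 * (\<Sum>i<N. x i * y i)\<^sup>2)) \<partial>gaussP {..<N})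
      = ennreal (1 / (sqrt w ^ N * sqrt (1 - c\<^sup>2 * sqnorm N x / w)))"
proof -
  let ?g = "gaussP {..<N}"
  define s where "s = c\<^sup>2 * sqnorm N x"
  have v: "1 - s / w > 0" using c w by (simp add: s_def)
  note h = has_bochner_integral_std_gauss_mgf
  have "(\<integral>\<^sup>+y. ennreal (exp ((1 - w) / 2 * sqnorm N y + c\<^sup>2 / 2 * (\<Sum>i<N. x i * y i)\<^sup>2)) \<partial>?g)
     = (\<integral>\<^sup>+y. \<integral>\<^sup>+g. ennreal (exp ((\<Sum>i<N. (g * c * x i) * y i) + (1 - w) / 2 * (\<Sum>i<N. (y i)\<^sup>2))) \<partial>std_gauss \<partial>?g)"
  proof (rule nn_integral_cong)
    fix y :: "nat \<Rightarrow> real"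
    let ?d = "c * (\<Sum>i<N. x i * y i)"
    have "(\<integral>\<^sup>+g. ennreal (exp ((\<Sum>i<N. (g * c * x i) * y i) + (1 - w) / 2 * (\<Sum>i<N. (y i)\<^sup>2))) \<partial>std_gauss)
      = (\<integral>\<^sup>+g. ennreal (exp ((1 - w) / 2 * sqnorm N y)) * ennreal (exp (?d * g + (1 - 1) / 2 * g\<^sup>2)) \<partial>std_gauss)"
      by (intro nn_integral_cong) (simp add: ennreal_mult[symmetric] exp_add[symmetric] sqnorm_def sum_distrib_left sum_distrib_right mult_ac)
    also have "\<dots> = ennreal (exp ((1 - w) / 2 * sqnorm N y)) * ennreal (exp (?d\<^sup>2 / (2 * 1)) / sqrt 1)"
      using h[OF zero_less_one, of ?d]
      by (subst nn_integral_cmult, simp, subst nn_integral_eq_integral) (auto simp: has_bochner_integral_iff)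
    also have "\<dots> = ennreal (exp ((1 - w) / 2 * sqnorm N y + c\<^sup>2 / 2 * (\<Sum>i<N. x i * y i)\<^sup>2))"
      by (simp add: ennreal_mult[symmetric] exp_add[symmetric] power_mult_distrib)
    finally show "ennreal (exp ((1 - w) / 2 * sqnorm N y + c\<^sup>2 / 2 * (\<Sum>i<N. x i * y i)\<^sup>2))
      = (\<integral>\<^sup>+g. ennreal (exp ((\<Sum>i<N. (g * c * x i) * y i) + (1 - w) / 2 * (\<Sum>i<N. (y i)\<^sup>2))) \<partial>std_gauss)" ..
  qed
  also have "\<dots> = (\<integral>\<^sup>+g. \<integral>\<^sup>+y. ennreal (exp ((\<Sum>i<N. (g * c * x i) * y i) + (1 - w) / 2 * (\<Sum>i<N. (y i)\<^sup>2))) \<partial>?g \<partial>std_gauss)"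
  proof (rule pair_sigma_finite.Fubini')
    show "pair_sigma_finite std_gauss ?g"
      by (simp add: pair_sigma_finite_def prob_space_imp_sigma_finite prob_space_std_gauss prob_space_gaussP)
    have [measurable]: "(\<lambda>p. fst p) \<in> borel_measurable (std_gauss \<Otimes>\<^sub>M ?g)"
      using measurable_fst[of std_gauss ?g] by (simp cong: measurable_cong_sets)
    show "(\<lambda>(g, y). ennreal (exp ((\<Sum>i<N. (g * c * x i) * y i) + (1 - w) / 2 * (\<Sum>i<N. (y i)\<^sup>2)))) \<in> borel_measurable (std_gauss \<Otimes>\<^sub>M ?g)"
      unfolding case_prod_beta' by measurable
  qed
  \<comment> \<open>With g fixed the spins decouple and integrate to a Gaussian in g of precision 1
    - s/w; the hypothesis \<open>c\<close> makes this precision positive.\<close>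
  also have "\<dots> = (\<integral>\<^sup>+g. ennreal (1 / sqrt w ^ N) * ennreal (exp (0 * g + (1 - (1 - s / w)) / 2 * g\<^sup>2)) \<partial>std_gauss)"
  proof (rule nn_integral_cong)
    fix g :: real
    note m = gaussP_mgf[OF w, of "{..<N}" "\<lambda>i. g * c * x i"]
    have "(\<Sum>i<N. (g * c * x i)\<^sup>2) = g\<^sup>2 * s"
      unfolding s_def sqnorm_def by (simp add: power_mult_distrib sum_distrib_left mult_ac)
    then show "(\<integral>\<^sup>+y. ennreal (exp ((\<Sum>i<N. (g * c * x i) * y i) + (1 - w) / 2 * (\<Sum>i<N. (y i)\<^sup>2))) \<partial>?g)
       = ennreal (1 / sqrt w ^ N) * ennreal (exp (0 * g + (1 - (1 - s / w)) / 2 * g\<^sup>2))"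
      using m w by (subst nn_integral_eq_integral) (auto simp: ennreal_mult[symmetric] field_simps)
  qed
  also have "\<dots> = ennreal (1 / sqrt w ^ N) * ennreal (exp (0\<^sup>2 / (2 * (1 - s / w))) / sqrt (1 - s / w))"
    using h[OF v, of 0]
    by (subst nn_integral_cmult, simp, subst nn_integral_eq_integral) (auto simp: has_bochner_integral_iff)
  also have "\<dots> = ennreal (1 / (sqrt w ^ N * sqrt (1 - s / w)))"
    using v w by (simp add: ennreal_mult[symmetric])
  finally show ?thesis unfolding s_def .
qed

section \<open>Quenched free energy and Gibbs means from the two-replica integral\<close>

context
  fixes \<mu> :: "'a measure" and G :: "'a \<Rightarrow> real" and C :: real
    and I :: "'k set" and \<phi> :: "'k \<Rightarrow> 'a \<Rightarrow> real" and B \<tau> K :: real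
  assumes \<mu>: "finite_measure \<mu>" "emeasure \<mu> (space \<mu>) \<noteq> 0"
    and G: "G \<in> borel_measurable \<mu>" "\<And>x. x \<in> space \<mu> \<Longrightarrow> \<bar>G x\<bar> \<le> C"
    and I: "finite I" and \<phi>m: "\<And>k. k \<in> I \<Longrightarrow> \<phi> k \<in> borel_measurable \<mu>"
    and \<phi>: "\<And>k x. k \<in> I \<Longrightarrow> x \<in> space \<mu> \<Longrightarrow> \<bar>\<phi> k x\<bar> \<le> B" and B: "0 \<le> B"
    and K: "K > 0" "(\<integral>\<^sup>+x. \<integral>\<^sup>+y. ennreal (exp (G x + G y + \<tau> * (\<Sum>k\<in>I. \<phi> k x * \<phi> k y))) \<partial>\<mu> \<partial>\<mu>) \<le> ennreal K"
begin

text \<open>By Jensen, exp(2 ln Z + (\<tau> - t) S) is at most the partition function of two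
  replicas in the same disorder with an extra attraction \<tau> - t, where S is the sum of squared
  Gibbs means. Averaging over the disorder adds an attraction t, so the total is \<tau> at every
  time and K bounds it. Jensen for the logarithm in J finishes the argument.\<close>

lemma replica_annealed_bound:
  assumes t: "0 \<le> t" "t \<le> 1" "t \<le> \<tau>"
  shows "(\<tau> - t) * (\<integral>J. (\<Sum>k\<in>I. (\<integral>x. \<phi> k x \<partial>gibbs \<mu> (\<lambda>x. G x + field_exponent I \<phi> t J x))\<^sup>2) \<partial>gaussP I)
      + 2 * (\<integral>J. ln (\<integral>x. exp (G x + field_exponent I \<phi> t J x) \<partial>\<mu>) \<partial>gaussP I) \<le> ln K"
proof -
  interpret finite_measure \<mu> by (rule \<mu>)
  interpret g: prob_space "gaussP I" by (rule prob_space_gaussP)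
  interpret pair: pair_sigma_finite "gaussP I" \<mu> ..
  define E where "E J x = G x + field_exponent I \<phi> t J x" for J x
  define c where "c x y = (\<Sum>k\<in>I. \<phi> k x * \<phi> k y)" for x y
  define a where "a J k = (\<integral>x. \<phi> k x \<partial>gibbs \<mu> (E J))" for J k
  define Z where "Z J = (\<integral>x. exp (E J x) \<partial>\<mu>)" for J
  define S where "S J = (\<Sum>k\<in>I. (a J k)\<^sup>2)" for J
  define \<kappa> where "\<kappa> = \<tau> - t"
  have \<kappa>: "0 \<le> \<kappa>" using t by (simp add: \<kappa>_def)
  note [measurable] = \<phi>m G(1)
  have Em [measurable]: "E J \<in> borel_measurable \<mu>" for J
    unfolding E_def by (rule energy_bound(1)[OF \<mu> G I \<phi>m \<phi> B t(1,2)])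
  define D where "D J = C + sqrt t * (B * (\<Sum>k\<in>I. \<bar>J k\<bar>) + real (card I) * B\<^sup>2)" for J :: "'k \<Rightarrow> real"
  have Db: "\<bar>E J x\<bar> \<le> D J" if "x \<in> space \<mu>" for J x
    unfolding E_def D_def by (rule energy_bound(2)[OF \<mu> G I \<phi>m \<phi> B t(1,2) that])
  have Zpos: "Z J > 0" for J unfolding Z_def by (rule partition_pos[OF \<mu> Em Db])
  have ab: "\<bar>a J k\<bar> \<le> B" if "k \<in> I" for J k
    unfolding a_def E_def by (rule gibbs_mean_bound[OF \<mu> G I \<phi>m \<phi> B t(1,2) that])
  have gi: "integrable (gibbs \<mu> (E J)) (\<phi> k)" if "k \<in> I" for J k
    using prob_space.integral_abs_bound(1)[OF prob_space_gibbs[OF \<mu> Em Db], of "\<phi> k" J B] \<phi> \<phi>m[OF that] that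
    by (simp cong: measurable_cong_sets)
  \<comment> \<open>The Gibbs inequality is used once per replica: with the coefficients a J k for
    one of them, and then, at fixed x, with the coefficients \<phi> k x for the other.\<close>
  have low: "ennreal (exp (2 * ln (Z J) + \<kappa> * S J)) \<le> (\<integral>\<^sup>+x. \<integral>\<^sup>+y. ennreal (exp (E J x + E J y + \<kappa> * c x y)) \<partial>\<mu> \<partial>\<mu>)" for J
  proof -
    have inner: "ennreal (Z J * exp (\<kappa> * (\<Sum>k\<in>I. b k * a J k))) \<le> (\<integral>\<^sup>+y. ennreal (exp (E J y + \<kappa> * (\<Sum>k\<in>I. b k * \<phi> k y))) \<partial>\<mu>)"
      if b: "\<And>k. k \<in> I \<Longrightarrow> \<bar>b k\<bar> \<le> B" for b
    proof -
      let ?D = "\<lambda>y. \<kappa> * (\<Sum>k\<in>I. b k * \<phi> k y)"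
      have Dm: "?D \<in> borel_measurable \<mu>" by measurable
      have Dbd: "\<bar>?D y\<bar> \<le> \<kappa> * (\<Sum>k\<in>I. B * B)" if "y \<in> space \<mu>" for y
        unfolding abs_mult using \<kappa> b \<phi>[OF _ that] B
        by (intro mult_mono order_trans[OF sum_abs] sum_mono) (auto simp: abs_mult intro!: mult_mono sum_nonneg)
      have 1: "ln (Z J) + (\<integral>y. ?D y \<partial>gibbs \<mu> (E J)) \<le> ln (\<integral>y. exp (E J y + ?D y) \<partial>\<mu>)"
        unfolding Z_def by (rule ln_partition_ge[OF \<mu> Em Db Dm Dbd])
      have 2: "(\<integral>y. ?D y \<partial>gibbs \<mu> (E J)) = \<kappa> * (\<Sum>k\<in>I. b k * a J k)"
        unfolding a_def using gi by (simp add: Bochner_Integration.integral_sum)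
      have sb: "\<bar>E J y + ?D y\<bar> \<le> D J + \<kappa> * (\<Sum>k\<in>I. B * B)" if "y \<in> space \<mu>" for y
        by (rule order_trans[OF abs_triangle_ineq add_mono[OF Db[OF that] Dbd[OF that]]])
      have sm: "(\<lambda>y. E J y + ?D y) \<in> borel_measurable \<mu>" by measurable
      have "exp (ln (Z J) + \<kappa> * (\<Sum>k\<in>I. b k * a J k)) \<le> (\<integral>y. exp (E J y + ?D y) \<partial>\<mu>)"
        using 1[unfolded 2] ln_ge_iff[OF partition_pos[OF \<mu> sm sb]] by blast
      then have "Z J * exp (\<kappa> * (\<Sum>k\<in>I. b k * a J k)) \<le> (\<integral>y. exp (E J y + ?D y) \<partial>\<mu>)"
        using Zpos[of J] by (simp add: exp_add)
      moreover have "(\<integral>\<^sup>+y. ennreal (exp (E J y + ?D y)) \<partial>\<mu>) = ennreal (\<integral>y. exp (E J y + ?D y) \<partial>\<mu>)"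
        by (rule nn_integral_eq_integral[OF integrable_exp_bounded_energy[OF \<mu> sm sb]]) auto
      ultimately show ?thesis by (simp add: ennreal_leI)
    qed
    have "ennreal (exp (2 * ln (Z J) + \<kappa> * S J)) = ennreal (Z J) * ennreal (Z J * exp (\<kappa> * (\<Sum>k\<in>I. a J k * a J k)))"
      using Zpos[of J] by (simp add: S_def power2_eq_square exp_add exp_double ennreal_mult[symmetric] mult.assoc)
    also have "\<dots> \<le> ennreal (Z J) * (\<integral>\<^sup>+x. ennreal (exp (E J x + \<kappa> * (\<Sum>k\<in>I. a J k * \<phi> k x))) \<partial>\<mu>)"
      by (intro mult_left_mono inner ab) auto
    also have "\<dots> = (\<integral>\<^sup>+x. ennreal (exp (E J x)) * ennreal (Z J * exp (\<kappa> * (\<Sum>k\<in>I. \<phi> k x * a J k))) \<partial>\<mu>)"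
      using Zpos[of J] by (subst nn_integral_cmult[symmetric], measurable)
        (auto intro!: nn_integral_cong simp: ennreal_mult[symmetric] exp_add mult_ac)
    also have "\<dots> \<le> (\<integral>\<^sup>+x. ennreal (exp (E J x)) * (\<integral>\<^sup>+y. ennreal (exp (E J y + \<kappa> * c x y)) \<partial>\<mu>) \<partial>\<mu>)"
      unfolding c_def by (intro nn_integral_mono mult_left_mono inner \<phi>) auto
    also have "\<dots> = (\<integral>\<^sup>+x. \<integral>\<^sup>+y. ennreal (exp (E J x + E J y + \<kappa> * c x y)) \<partial>\<mu> \<partial>\<mu>)"
      unfolding c_def by (subst nn_integral_cmult[symmetric], measurable)
         (auto simp: ennreal_mult[symmetric] exp_add[symmetric] add.assoc)
    finally show ?thesis .
  qed
  have fe: "(\<lambda>p. field_exponent I \<phi> t (f p) (h p)) \<in> borel_measurable M"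
    if "f \<in> measurable M (gaussP I)" "h \<in> measurable M \<mu>" for f h and M :: "'z measure"
    using measurable_compose[OF measurable_Pair[OF that] measurable_field_exponent[of I \<phi> \<mu> t, OF \<phi>m]] by simp
  have Gh: "(\<lambda>p. G (h p)) \<in> borel_measurable M" if "h \<in> measurable M \<mu>" for h and M :: "'z measure"
    by (rule measurable_compose[OF that G(1)])
  have \<phi>h: "(\<lambda>p. \<phi> k (h p)) \<in> borel_measurable M" if "h \<in> measurable M \<mu>" "k \<in> I" for h k and M :: "'z measure"
    by (rule measurable_compose[OF that(1) \<phi>m[OF that(2)]])
  have ex: "(\<lambda>p. ennreal (exp (E (f p) (h p) + E (f p) (h' p) + \<kappa> * c (h p) (h' p)))) \<in> borel_measurable M"
    if m: "f \<in> measurable M (gaussP I)" "h \<in> measurable M \<mu>" "h' \<in> measurable M \<mu>" for f h h' and M :: "'z measure"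
    unfolding E_def c_def using fe[OF m(1,2)] fe[OF m(1,3)] Gh[OF m(2)] Gh[OF m(3)] \<phi>h[OF m(2)] \<phi>h[OF m(3)]
    by measurable
  have "(\<integral>\<^sup>+J. \<integral>\<^sup>+x. \<integral>\<^sup>+y. ennreal (exp (E J x + E J y + \<kappa> * c x y)) \<partial>\<mu> \<partial>\<mu> \<partial>gaussP I)
     = (\<integral>\<^sup>+x. \<integral>\<^sup>+J. \<integral>\<^sup>+y. ennreal (exp (E J x + E J y + \<kappa> * c x y)) \<partial>\<mu> \<partial>gaussP I \<partial>\<mu>)"
  proof (rule pair.Fubini'[symmetric])
    have "(\<lambda>q. ennreal (exp (E (fst (fst q)) (snd (fst q)) + E (fst (fst q)) (snd q) + \<kappa> * c (snd (fst q)) (snd q))))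
       \<in> borel_measurable ((gaussP I \<Otimes>\<^sub>M \<mu>) \<Otimes>\<^sub>M \<mu>)"
      by (rule ex) measurable
    then show "(\<lambda>(J, x). \<integral>\<^sup>+y. ennreal (exp (E J x + E J y + \<kappa> * c x y)) \<partial>\<mu>) \<in> borel_measurable (gaussP I \<Otimes>\<^sub>M \<mu>)"
      using borel_measurable_nn_integral[of "\<lambda>p y. ennreal (exp (E (fst p) (snd p) + E (fst p) y + \<kappa> * c (snd p) y))" "gaussP I \<Otimes>\<^sub>M \<mu>"]
      by (simp add: case_prod_beta')
  qed
  also have "\<dots> = (\<integral>\<^sup>+x. \<integral>\<^sup>+y. \<integral>\<^sup>+J. ennreal (exp (E J x + E J y + \<kappa> * c x y)) \<partial>gaussP I \<partial>\<mu> \<partial>\<mu>)"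
  proof (rule nn_integral_cong, rule pair.Fubini'[symmetric])
    fix x assume x: "x \<in> space \<mu>"
    have "(\<lambda>q. ennreal (exp (E (fst q) x + E (fst q) (snd q) + \<kappa> * c x (snd q)))) \<in> borel_measurable (gaussP I \<Otimes>\<^sub>M \<mu>)"
      by (rule ex) (use x in measurable)
    then show "(\<lambda>(J, y). ennreal (exp (E J x + E J y + \<kappa> * c x y))) \<in> borel_measurable (gaussP I \<Otimes>\<^sub>M \<mu>)"
      by (simp add: case_prod_beta')
  qed
  also have "\<dots> = (\<integral>\<^sup>+x. \<integral>\<^sup>+y. ennreal (exp (G x + G y + \<tau> * c x y)) \<partial>\<mu> \<partial>\<mu>)"
  proof (intro nn_integral_cong)
    fix x y
    let ?b = "\<lambda>k. sqrt t * (\<phi> k x + \<phi> k y)"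
    let ?r = "G x + G y + \<kappa> * c x y - t / 2 * ((\<Sum>k\<in>I. (\<phi> k x)\<^sup>2) + (\<Sum>k\<in>I. (\<phi> k y)\<^sup>2))"
    have e: "E J x + E J y + \<kappa> * c x y = ?r + (\<Sum>k\<in>I. ?b k * J k)" for J
      unfolding E_def field_exponent_def
      by (simp add: sum_distrib_left sum.distrib algebra_simps)
    have s: "(\<Sum>k\<in>I. (?b k)\<^sup>2) = t * ((\<Sum>k\<in>I. (\<phi> k x)\<^sup>2) + (\<Sum>k\<in>I. (\<phi> k y)\<^sup>2)) + 2 * t * c x y"
    proof -
      have "(?b k)\<^sup>2 = t * ((\<phi> k x)\<^sup>2 + (\<phi> k y)\<^sup>2) + 2 * t * (\<phi> k x * \<phi> k y)" for k
      proof -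
        have "(?b k)\<^sup>2 = (sqrt t)\<^sup>2 * ((\<phi> k x)\<^sup>2 + (\<phi> k y)\<^sup>2 + 2 * (\<phi> k x * \<phi> k y))"
          by (simp only: power_mult_distrib power2_sum mult.assoc)
        then show ?thesis using t by (simp add: distrib_left)
      qed
      then show ?thesis unfolding c_def by (simp only: sum.distrib sum_distrib_left[symmetric])
    qed
    \<comment> \<open>The diagonal terms of the disorder average cancel the normalisation, and the
      cross term 2 t c x y, halved, completes \<kappa> to \<tau>.\<close>
    have r: "?r + (\<Sum>k\<in>I. (?b k)\<^sup>2) / 2 = G x + G y + \<tau> * c x y"
      unfolding s \<kappa>_def by (simp add: field_simps)
    have "(\<integral>\<^sup>+J. ennreal (exp (E J x + E J y + \<kappa> * c x y)) \<partial>gaussP I)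
       = (\<integral>\<^sup>+J. ennreal (exp ?r) * ennreal (exp (\<Sum>k\<in>I. ?b k * J k)) \<partial>gaussP I)"
      unfolding e by (simp only: exp_add ennreal_mult[symmetric] exp_ge_zero)
    also have "\<dots> = ennreal (exp ?r) * ennreal (exp ((\<Sum>k\<in>I. (?b k)\<^sup>2) / 2))"
      using gaussP_exp_linear[OF I, of ?b]
      by (subst nn_integral_cmult, measurable) (subst nn_integral_eq_integral, auto)
    also have "\<dots> = ennreal (exp (G x + G y + \<tau> * c x y))"
      unfolding r[symmetric] by (simp only: exp_add ennreal_mult[symmetric] exp_ge_zero)
    finally show "(\<integral>\<^sup>+J. ennreal (exp (E J x + E J y + \<kappa> * c x y)) \<partial>gaussP I) = ennreal (exp (G x + G y + \<tau> * c x y))" .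
  qed
  also have "\<dots> \<le> ennreal K" unfolding c_def by (rule K(2))
  finally have WK: "(\<integral>\<^sup>+J. \<integral>\<^sup>+x. \<integral>\<^sup>+y. ennreal (exp (E J x + E J y + \<kappa> * c x y)) \<partial>\<mu> \<partial>\<mu> \<partial>gaussP I) \<le> ennreal K" .
  define v where "v J = 2 * ln (Z J) + \<kappa> * S J" for J
  have iL: "integrable (gaussP I) (\<lambda>J. ln (Z J))"
    unfolding Z_def E_def by (rule exp_bounded_integrable[OF I gibbs_log_step(1)[OF \<mu> G I \<phi>m \<phi> B t(1,2)]])
  have iS: "integrable (gaussP I) S"
    unfolding S_def a_def E_def by (rule exp_bounded_integrable[OF I exp_bounded_gibbs_means[OF \<mu> G I \<phi>m \<phi> B t(1,2)]])
  have iv: "integrable (gaussP I) v" unfolding v_def using iL iS by simp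
  then have [measurable]: "v \<in> borel_measurable (gaussP I)" by simp
  have evK: "(\<integral>\<^sup>+J. ennreal (exp (v J)) \<partial>gaussP I) \<le> ennreal K"
    by (rule order_trans[OF nn_integral_mono WK]) (use low in \<open>simp add: v_def\<close>)
  have iev: "integrable (gaussP I) (\<lambda>J. exp (v J))"
  proof (rule integrableI_bounded)
    show "(\<integral>\<^sup>+J. ennreal (norm (exp (v J))) \<partial>gaussP I) < \<infinity>"
      using evK by (simp add: le_less_trans)
  qed measurable
  have Eev: "(\<integral>J. exp (v J) \<partial>gaussP I) \<le> K"
    using evK K(1) nn_integral_eq_integral[OF iev] by (simp add: ennreal_le_iff)
  \<comment> \<open>The tangent of the logarithm at K replaces Jensen's inequality in J.\<close>
  have "(\<integral>J. v J \<partial>gaussP I) \<le> (\<integral>J. ln K - 1 + exp (v J) / K \<partial>gaussP I)"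
  proof (rule integral_mono[OF iv])
    show "integrable (gaussP I) (\<lambda>J. ln K - 1 + exp (v J) / K)" using iev by simp
    show "v J \<le> ln K - 1 + exp (v J) / K" for J
      using exp_ge_add_one_self[of "v J - ln K"] K(1) by (simp add: exp_diff)
  qed
  also have "\<dots> = ln K - 1 + (\<integral>J. exp (v J) \<partial>gaussP I) / K"
    using iev g.prob_space by simp
  also have "\<dots> \<le> ln K" using Eev K(1) by (simp add: field_simps)
  finally have "2 * (\<integral>J. ln (Z J) \<partial>gaussP I) + \<kappa> * (\<integral>J. S J \<partial>gaussP I) \<le> ln K"
    unfolding v_def using iL iS by simp
  then show ?thesis unfolding S_def a_def Z_def E_def \<kappa>_def by linarith
qed

text \<open>Gronwall's argument. The gap y between ln K/2 and the quenched free energy grows at rate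
  S/2, and the previous lemma bounds S by 2 y/(\<tau> - t); hence (\<tau> - t) y(t) does not
  increase. Its value at t = 0 contains no disorder. Coupling \<tau> > 1 leaves room at t = 1 to
  bound S as well.\<close>

lemma high_temperature_bound:
  assumes \<tau>: "\<tau> > 1"
  defines "y0 \<equiv> ln K / 2 - ln (\<integral>x. exp (G x) \<partial>\<mu>)"
  shows "ln K / 2 - (\<integral>J. ln (\<integral>x. exp (G x + field_exponent I \<phi> 1 J x) \<partial>\<mu>) \<partial>gaussP I) \<le> \<tau> / (\<tau> - 1) * y0"
    and "(\<integral>J. (\<Sum>k\<in>I. (\<integral>x. \<phi> k x \<partial>gibbs \<mu> (\<lambda>x. G x + field_exponent I \<phi> 1 J x))\<^sup>2) \<partial>gaussP I)
       \<le> 2 * \<tau> / (\<tau> - 1)\<^sup>2 * y0"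
proof -
  interpret g: prob_space "gaussP I" by (rule prob_space_gaussP)
  define a where "a t = (\<integral>J. ln (\<integral>x. exp (G x + field_exponent I \<phi> t J x) \<partial>\<mu>) \<partial>gaussP I)" for t
  define S where "S t = (\<integral>J. (\<Sum>k\<in>I. (\<integral>x. \<phi> k x \<partial>gibbs \<mu> (\<lambda>x. G x + field_exponent I \<phi> t J x))\<^sup>2) \<partial>gaussP I)" for t
  define y where "y t = ln K / 2 - a t" for t
  define T where "T = \<bar>step_const I B\<bar>"
  have S0: "S t \<ge> 0" for t unfolding S_def by (intro Bochner_Integration.integral_nonneg sum_nonneg) auto
  have Sy: "(\<tau> - t) * S t \<le> 2 * y t" if "0 \<le> t" "t \<le> 1" for t
    using replica_annealed_bound[of t] that \<tau> unfolding S_def y_def a_def by simp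
  have y_nonneg: "y t \<ge> 0" if "0 \<le> t" "t \<le> 1" for t
  proof -
    have "0 \<le> (\<tau> - t) * S t" using that \<tau> S0 by simp
    then show ?thesis using Sy[OF that] by linarith
  qed
  have "y 1 * (\<tau> - 1) \<le> y 0 * (\<tau> - 0)"
  proof (rule nonincreasing_from_increments[where K = "T * \<tau>"])
    fix t d :: real assume td: "0 \<le> t" "0 \<le> d" "t + d \<le> 1"
    have t: "0 \<le> t" "t \<le> 1" using td by auto
    define s where "s = \<tau> - t"
    have s: "s > 0" "s - d > 0" "s - d \<le> \<tau>" using td \<tau> by (auto simp: s_def)
    have ds: "0 \<le> d * sqrt d" using td by simp
    have "\<bar>a (t + d) - a t + d / 2 * S t\<bar> \<le> step_const I B * (d * sqrt d)"
      unfolding a_def S_def by (rule free_energy_increment[OF \<mu> G I \<phi>m \<phi> B td])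
    moreover have "step_const I B * (d * sqrt d) \<le> T * (d * sqrt d)"
      unfolding T_def using ds by (intro mult_right_mono) auto
    ultimately have 1: "y (t + d) \<le> y t + d / 2 * S t + T * (d * sqrt d)" unfolding y_def by linarith
    have "d * (s * S t) \<le> d * (2 * y t)" using Sy[OF t] td unfolding s_def by (intro mult_left_mono) auto
    then have "d / 2 * S t \<le> d * y t / s" using s by (simp add: field_simps)
    with 1 have "y (t + d) \<le> y t + d * y t / s + T * (d * sqrt d)" by linarith
    then have "y (t + d) * (s - d) \<le> (y t + d * y t / s + T * (d * sqrt d)) * (s - d)"
      using s by (intro mult_right_mono) auto
    also have "\<dots> = y t * s - y t * d\<^sup>2 / s + T * (d * sqrt d) * (s - d)"
      using s by (simp add: field_simps power2_eq_square)
    \<comment> \<open>The quadratic term in d is dropped by its sign; y \<ge> 0 itself follows from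
      \<open>Sy\<close> and S \<ge> 0.\<close>
    also have "\<dots> \<le> y t * s + T * (d * sqrt d) * \<tau>"
    proof -
      have "0 \<le> y t * d\<^sup>2 / s" using y_nonneg[OF t] s by simp
      moreover have "T * (d * sqrt d) * (s - d) \<le> T * (d * sqrt d) * \<tau>"
        using s ds unfolding T_def by (intro mult_left_mono) auto
      ultimately show ?thesis by linarith
    qed
    finally show "y (t + d) * (\<tau> - (t + d)) \<le> y t * (\<tau> - t) + T * \<tau> * (d * sqrt d)"
      unfolding s_def by (simp add: algebra_simps)
  qed
  moreover have "y 0 = y0" unfolding y_def y0_def a_def by (simp add: g.prob_space)
  ultimately have y1: "y 1 \<le> \<tau> / (\<tau> - 1) * y0" using \<tau> by (simp add: field_simps)
  then show "ln K / 2 - (\<integral>J. ln (\<integral>x. exp (G x + field_exponent I \<phi> 1 J x) \<partial>\<mu>) \<partial>gaussP I) \<le> \<tau> / (\<tau> - 1) * y0"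
    unfolding y_def a_def .
  have "S 1 \<le> 2 * y 1 / (\<tau> - 1)" using Sy[of 1] \<tau> by (simp add: field_simps)
  also have "\<dots> \<le> 2 * (\<tau> / (\<tau> - 1) * y0) / (\<tau> - 1)" using y1 \<tau> by (intro divide_right_mono) auto
  also have "\<dots> = 2 * \<tau> / (\<tau> - 1)\<^sup>2 * y0" by (simp add: power2_eq_square)
  finally show "(\<integral>J. (\<Sum>k\<in>I. (\<integral>x. \<phi> k x \<partial>gibbs \<mu> (\<lambda>x. G x + field_exponent I \<phi> 1 J x))\<^sup>2) \<partial>gaussP I)
       \<le> 2 * \<tau> / (\<tau> - 1)\<^sup>2 * y0" unfolding S_def .
qed

end

lemma shell_facts:
  fixes N :: nat and a b \<beta> :: real
  defines "\<mu> \<equiv> restrict_space (gaussP {..<N}) (shell N a b)"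
  shows "finite_measure \<mu>" "space \<mu> = shell N a b" "emeasure \<mu> (space \<mu>) = emeasure (gaussP {..<N}) (shell N a b)"
    and "\<And>w. (\<lambda>z. (1 - w) / 2 * sqnorm N z) \<in> borel_measurable \<mu>"
    and "\<And>w z. z \<in> space \<mu> \<Longrightarrow> \<bar>(1 - w) / 2 * sqnorm N z\<bar> \<le> \<bar>(1 - w) / 2\<bar> * (real N * b)"
    and "\<And>p. p \<in> bonds N \<Longrightarrow> coupling \<beta> N p \<in> borel_measurable \<mu>"
    and "\<And>p z. p \<in> bonds N \<Longrightarrow> z \<in> space \<mu> \<Longrightarrow> \<bar>coupling \<beta> N p z\<bar> \<le> \<bar>\<beta>\<bar> / sqrt (2 * real N) * (real N * \<bar>b\<bar>)"
proof -
  note rs = restrict_gaussP[OF sets_shell[of N a b]]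
  show "finite_measure \<mu>" unfolding \<mu>_def by (rule rs(1))
  show sp: "space \<mu> = shell N a b" unfolding \<mu>_def by (rule rs(2))
  show "emeasure \<mu> (space \<mu>) = emeasure (gaussP {..<N}) (shell N a b)" unfolding \<mu>_def by (rule rs(3))
  show "(\<lambda>z. (1 - w) / 2 * sqnorm N z) \<in> borel_measurable \<mu>" for w
    unfolding \<mu>_def by (intro measurable_restrict_space1) measurable
  show "\<bar>(1 - w) / 2 * sqnorm N z\<bar> \<le> \<bar>(1 - w) / 2\<bar> * (real N * b)" if "z \<in> space \<mu>" for w z
    unfolding abs_mult using that sqnorm_nonneg[of N z] unfolding sp shell_def by (intro mult_left_mono) auto
  show "coupling \<beta> N p \<in> borel_measurable \<mu>" if "p \<in> bonds N" for p
    unfolding \<mu>_def by (rule measurable_restrict_space1[OF measurable_coupling[OF that]])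
  show "\<bar>coupling \<beta> N p z\<bar> \<le> \<bar>\<beta>\<bar> / sqrt (2 * real N) * (real N * \<bar>b\<bar>)" if "p \<in> bonds N" "z \<in> space \<mu>" for p z
  proof -
    have "sqnorm N z \<le> real N * b" using that(2) unfolding sp shell_def by auto
    also have "\<dots> \<le> real N * \<bar>b\<bar>" by (intro mult_left_mono) auto
    finally show ?thesis
      using coupling_bound[OF that(1), of \<beta> z] mult_left_mono[of "sqnorm N z" "real N * \<bar>b\<bar>" "\<bar>\<beta>\<bar> / sqrt (2 * real N)"] by simp
  qed
qed

text \<open>On the shell |x|^2 \<le> N b, so the interaction of two replicas costs only the factor
  1/sqrt(1 - s) with s < 1, whatever N is. The two-replica constant therefore exceeds the square of
  the one-replica integral by a bounded factor, and the initial gap in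
  \<open>high_temperature_bound\<close> is bounded in N.\<close>

proposition high_temperature:
  fixes \<beta> w \<eta> \<tau> :: real
  assumes \<beta>: "\<beta> > 0" and w: "w > 0" and \<eta>: "\<eta> > 0" and \<tau>: "\<tau> > 1" and ht: "\<tau> * \<beta>\<^sup>2 * (1 / w + \<eta>) < w"
  defines "S \<equiv> \<lambda>N. shell N (1 / w - \<eta>) (1 / w + \<eta>)"
  defines "E \<equiv> \<lambda>N J z. (1 - w) / 2 * sqnorm N z + field_exponent (bonds N) (coupling \<beta> N) 1 J z"
  shows "\<exists>K. \<forall>\<^sub>F N in sequentially. emeasure (gaussP {..<N}) (S N) \<noteq> 0 \<and>
     - real N / 2 * ln w - K \<le> (\<integral>J. ln (\<integral>z. exp (E N J z) \<partial>restrict_space (gaussP {..<N}) (S N)) \<partial>gaussP (bonds N)) \<and>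
     (\<integral>J. (\<Sum>p\<in>bonds N. (\<integral>z. coupling \<beta> N p z \<partial>gibbs (restrict_space (gaussP {..<N}) (S N)) (E N J))\<^sup>2) \<partial>gaussP (bonds N)) \<le> K"
proof -
  define b where "b = 1 / w + \<eta>"
  have b: "b > 0" using w \<eta> by (simp add: b_def add_pos_pos)
  define s where "s = \<tau> * \<beta>\<^sup>2 * b / w"
  have s: "1 - s > 0" "0 \<le> s" using ht w \<tau> b unfolding s_def b_def by auto
  \<comment> \<open>Bound for the initial gap: ln 2 is the price of keeping only half of the
    Gaussian mass on the shell, and the term in 1 - s is the price of the replica
    interaction.\<close>
  define Y where "Y = (ln 2 - ln (1 - s) / 2) / 2"
  define K where "K = max (ln 2 + Y / (\<tau> - 1)) (2 * \<tau> / (\<tau> - 1)\<^sup>2 * Y)"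
  show ?thesis
  proof (rule exI[of _ K], use shell_mass[OF w \<eta>] eventually_gt_at_top[of 0] in eventually_elim)
    fix N :: nat
    assume mass: "1 / 2 / sqrt w ^ N \<le> (\<integral>z. indicator (shell N (1 / w - \<eta>) (1 / w + \<eta>)) z * exp ((1 - w) / 2 * sqnorm N z) \<partial>gaussP {..<N})"
      and N: "0 < N"
    let ?g = "gaussP {..<N}"
    let ?\<mu> = "restrict_space ?g (S N)"
    let ?G = "\<lambda>z. (1 - w) / 2 * sqnorm N z"
    define M where "M = (\<integral>z. exp (?G z) \<partial>?\<mu>)"
    have S_N: "S N = shell N (1 / w - \<eta>) (1 / w + \<eta>)" by (simp add: S_def)
    note rs = restrict_gaussP[OF sets_shell[where N = N and a = "1 / w - \<eta>" and b = "1 / w + \<eta>"], folded S_N]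
    note sf = shell_facts[where N = N and a = "1 / w - \<eta>" and b = "1 / w + \<eta>", folded S_N b_def]
    have M: "M \<ge> 1 / 2 / sqrt w ^ N" using mass[folded S_N] unfolding M_def rs(4) .
    moreover have "1 / 2 / sqrt w ^ N > 0" using w by simp
    ultimately have Mpos: "M > 0" by linarith
    have nz: "emeasure ?g (S N) \<noteq> 0"
    proof
      assume "emeasure ?g (S N) = 0"
      then have "AE z in ?g. z \<notin> S N"
        using sets_shell by (intro AE_I'[of "S N"]) (auto simp: S_def null_sets_def)
      then have "(\<integral>z. indicator (S N) z * exp (?G z) \<partial>?g) = 0"
        by (intro integral_eq_zero_AE) (auto elim!: eventually_mono)
      then show False using Mpos unfolding M_def rs(4) by linarith
    qed
    then have mu: "finite_measure ?\<mu>" "emeasure ?\<mu> (space ?\<mu>) \<noteq> 0" using sf(1,3) by auto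
    interpret finite_measure ?\<mu> by (rule mu)
    \<comment> \<open>One replica stays on the shell and contributes M; the other is integrated over
      the whole space, which only increases the value.\<close>
    define K0 where "K0 = M / (sqrt w ^ N * sqrt (1 - s))"
    have K0: "K0 > 0" using Mpos w s by (simp add: K0_def)
    let ?D = "1 / (sqrt w ^ N * sqrt (1 - s))"
    have D0: "0 \<le> ?D" using w s by simp
    have pair: "(\<integral>\<^sup>+x. \<integral>\<^sup>+y. ennreal (exp (?G x + ?G y + \<tau> * (\<Sum>p\<in>bonds N. coupling \<beta> N p x * coupling \<beta> N p y))) \<partial>?\<mu> \<partial>?\<mu>) \<le> ennreal K0"
    proof -
      have "(\<integral>\<^sup>+y. ennreal (exp (?G x + ?G y + \<tau> * (\<Sum>p\<in>bonds N. coupling \<beta> N p x * coupling \<beta> N p y))) \<partial>?\<mu>)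
          \<le> ennreal (exp (?G x)) * ennreal ?D" if x: "x \<in> space ?\<mu>" for x
      proof -
        \<comment> \<open>Chosen so that c^2/2 equals \<tau> times the covariance prefactor
          \<beta>^2/(2 N), the form needed for the Gaussian linearisation.\<close>
        define c where "c = \<beta> * sqrt (\<tau> / real N)"
        have c2: "c\<^sup>2 = \<beta>\<^sup>2 * \<tau> / real N" using \<tau> by (simp add: c_def power_mult_distrib)
        have xb: "sqnorm N x \<le> real N * b" using x sf(2) by (auto simp: shell_def S_def b_def)
        have cx: "c\<^sup>2 * sqnorm N x \<le> s * w"
        proof -
          have "c\<^sup>2 * sqnorm N x \<le> c\<^sup>2 * (real N * b)" using xb by (intro mult_left_mono) auto
          also have "\<dots> = s * w" using N w by (simp add: c2 s_def)
          finally show ?thesis .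
        qed
        have sw: "s * w < w" using s w by simp
        have e: "?G x + ?G y + \<tau> * (\<Sum>p\<in>bonds N. coupling \<beta> N p x * coupling \<beta> N p y) = ?G x + (?G y + c\<^sup>2 / 2 * (\<Sum>i<N. x i * y i)\<^sup>2)" for y
          unfolding coupling_cov c2 by (simp add: field_simps)
        have m: "(\<lambda>y. ennreal (exp (?G y + c\<^sup>2 / 2 * (\<Sum>i<N. x i * y i)\<^sup>2))) \<in> borel_measurable ?g" by measurable
        have eq: "(\<integral>\<^sup>+y. ennreal (exp (?G x + ?G y + \<tau> * (\<Sum>p\<in>bonds N. coupling \<beta> N p x * coupling \<beta> N p y))) \<partial>?\<mu>)
           = ennreal (exp (?G x)) * (\<integral>\<^sup>+y. ennreal (exp (?G y + c\<^sup>2 / 2 * (\<Sum>i<N. x i * y i)\<^sup>2)) \<partial>?\<mu>)"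
          unfolding e exp_add[of "?G x"]
          by (subst nn_integral_cmult[symmetric, OF measurable_restrict_space1[OF m]]) (simp add: ennreal_mult)
        have "(\<integral>\<^sup>+y. ennreal (exp (?G y + c\<^sup>2 / 2 * (\<Sum>i<N. x i * y i)\<^sup>2)) \<partial>?\<mu>)
           \<le> (\<integral>\<^sup>+y. ennreal (exp (?G y + c\<^sup>2 / 2 * (\<Sum>i<N. x i * y i)\<^sup>2)) \<partial>?g)"
        proof -
          have "S N \<inter> space ?g \<in> sets ?g" unfolding S_def by (rule sets.Int[OF sets_shell sets.top])
          from nn_integral_restrict_space[OF this] show ?thesis
            by (auto intro!: nn_integral_mono simp: indicator_def)
        qed
        also have "\<dots> = ennreal (1 / (sqrt w ^ N * sqrt (1 - c\<^sup>2 * sqnorm N x / w)))"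
          by (rule pair_interaction_integral[OF w]) (use cx sw in linarith)
        also have "\<dots> \<le> ennreal ?D"
        proof (rule ennreal_leI, rule divide_left_mono)
          have "c\<^sup>2 * sqnorm N x / w \<le> s" using cx w by (simp add: field_simps)
          then show le: "sqrt w ^ N * sqrt (1 - s) \<le> sqrt w ^ N * sqrt (1 - c\<^sup>2 * sqnorm N x / w)"
            using w by (intro mult_left_mono) auto
          have l: "0 < sqrt w ^ N * sqrt (1 - s)" using w s by simp
          show "0 < sqrt w ^ N * sqrt (1 - c\<^sup>2 * sqnorm N x / w) * (sqrt w ^ N * sqrt (1 - s))"
            by (rule mult_pos_pos[OF less_le_trans[OF l le] l])
        qed simp
        finally show ?thesis unfolding eq by (rule mult_left_mono) simp
      qed
      then have "(\<integral>\<^sup>+x. \<integral>\<^sup>+y. ennreal (exp (?G x + ?G y + \<tau> * (\<Sum>p\<in>bonds N. coupling \<beta> N p x * coupling \<beta> N p y))) \<partial>?\<mu> \<partial>?\<mu>)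
         \<le> (\<integral>\<^sup>+x. ennreal (exp (?G x)) * ennreal ?D \<partial>?\<mu>)"
        by (intro nn_integral_mono)
      also have "\<dots> = ennreal M * ennreal ?D"
      proof -
        have i: "integrable ?\<mu> (\<lambda>z. exp (?G z))" by (rule integrable_exp_bounded_energy[OF mu sf(4) sf(5)])
        have "(\<integral>\<^sup>+x. ennreal (exp (?G x)) \<partial>?\<mu>) = ennreal M"
          unfolding M_def by (rule nn_integral_eq_integral[OF i]) simp
        moreover have "(\<lambda>x. ennreal (exp (?G x))) \<in> borel_measurable ?\<mu>" using i by simp
        ultimately show ?thesis by (simp only: nn_integral_multc)
      qed
      also have "\<dots> = ennreal K0" using D0 Mpos by (simp add: ennreal_mult[symmetric] K0_def)
      finally show ?thesis .
    qed
    have B0: "0 \<le> \<bar>\<beta>\<bar> / sqrt (2 * real N) * (real N * \<bar>b\<bar>)" by simp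
    have fb: "finite (bonds N)" by simp
    note htb = high_temperature_bound[OF mu sf(4) sf(5) fb sf(6) sf(7) B0 K0 pair \<tau>, folded E_def M_def]
    define y0 where "y0 = ln K0 / 2 - ln M"
    have lM: "ln M \<ge> - ln 2 - real N / 2 * ln w"
    proof -
      have "ln (1 / 2 / sqrt w ^ N) \<le> ln M" using M w by (intro ln_mono) auto
      then show ?thesis using w by (simp add: ln_div ln_realpow ln_sqrt ln_mult)
    qed
    have "ln K0 = ln M - real N / 2 * ln w - ln (1 - s) / 2"
      unfolding K0_def using Mpos w s by (simp add: ln_div ln_mult ln_realpow ln_sqrt)
    then have y0: "y0 \<le> Y" unfolding y0_def Y_def using lM by (simp add: field_simps)
    have "(\<integral>J. ln (\<integral>z. exp (E N J z) \<partial>?\<mu>) \<partial>gaussP (bonds N)) \<ge> ln K0 / 2 - \<tau> / (\<tau> - 1) * y0"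
      using htb(1) unfolding E_def y0_def by linarith
    moreover have "ln K0 / 2 - \<tau> / (\<tau> - 1) * y0 = ln M - y0 / (\<tau> - 1)"
      using \<tau> unfolding y0_def by (simp add: field_simps)
    moreover have "y0 / (\<tau> - 1) \<le> Y / (\<tau> - 1)" using y0 \<tau> by (intro divide_right_mono) auto
    moreover have "ln 2 + Y / (\<tau> - 1) \<le> K" unfolding K_def by simp
    ultimately have A: "- real N / 2 * ln w - K \<le> (\<integral>J. ln (\<integral>z. exp (E N J z) \<partial>?\<mu>) \<partial>gaussP (bonds N))"
      using lM by simp
    have "(\<integral>J. (\<Sum>p\<in>bonds N. (\<integral>z. coupling \<beta> N p z \<partial>gibbs ?\<mu> (E N J))\<^sup>2) \<partial>gaussP (bonds N)) \<le> 2 * \<tau> / (\<tau> - 1)\<^sup>2 * y0"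
      using htb(2) unfolding E_def y0_def .
    also have "\<dots> \<le> 2 * \<tau> / (\<tau> - 1)\<^sup>2 * Y" using y0 \<tau> by (intro mult_left_mono) auto
    also have "\<dots> \<le> K" unfolding K_def by simp
    finally show "emeasure ?g (S N) \<noteq> 0 \<and> - real N / 2 * ln w - K \<le> (\<integral>J. ln (\<integral>z. exp (E N J z) \<partial>?\<mu>) \<partial>gaussP (bonds N)) \<and>
       (\<integral>J. (\<Sum>p\<in>bonds N. (\<integral>z. coupling \<beta> N p z \<partial>gibbs ?\<mu> (E N J))\<^sup>2) \<partial>gaussP (bonds N)) \<le> K"
      using nz A by blast
  qed
qed

section \<open>Moments of the Wigner matrix\<close>

text \<open>The GOE normalisation: off-diagonal entries have variance 1/N, so the limiting spectrum
  is [-2, 2], and the random part of the energy is \<beta>/2 times the quadratic form of this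
  matrix.\<close>

definition wigner :: "nat \<Rightarrow> (nat \<times> nat \<Rightarrow> real) \<Rightarrow> nat \<Rightarrow> nat \<Rightarrow> real" where
  "wigner N J i j = (J (i, j) + J (j, i)) / sqrt (2 * real N)"

primrec wpow :: "nat \<Rightarrow> (nat \<times> nat \<Rightarrow> real) \<Rightarrow> nat \<Rightarrow> nat \<Rightarrow> nat \<Rightarrow> real" where
  "wpow N J 0 i j = (if i = j then 1 else 0)"
| "wpow N J (Suc k) i j = (\<Sum>l<N. wpow N J k i l * wigner N J l j)"

definition wtr :: "nat \<Rightarrow> (nat \<times> nat \<Rightarrow> real) \<Rightarrow> nat \<Rightarrow> real" where
  "wtr N J k = (\<Sum>i<N. wpow N J k i i) / real N"

lemma wigner_sym: "wigner N J i j = wigner N J j i"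
  by (simp add: wigner_def add.commute)

lemma wpow_add: "i < N \<Longrightarrow> j < N \<Longrightarrow> wpow N J (a + b) i j = (\<Sum>l<N. wpow N J a i l * wpow N J b l j)"
proof (induction b arbitrary: j)
  case 0
  then show ?case by (simp add: if_distrib[of "\<lambda>x. _ * x"] sum.delta' cong: if_cong)
next
  case (Suc b)
  have "wpow N J (a + Suc b) i j = (\<Sum>m<N. (\<Sum>l<N. wpow N J a i l * wpow N J b l m) * wigner N J m j)"
    using Suc by simp
  also have "\<dots> = (\<Sum>m<N. \<Sum>l<N. wpow N J a i l * (wpow N J b l m * wigner N J m j))"
    by (simp add: sum_distrib_right mult.assoc)
  also have "\<dots> = (\<Sum>l<N. \<Sum>m<N. wpow N J a i l * (wpow N J b l m * wigner N J m j))"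
    by (rule sum.swap)
  also have "\<dots> = (\<Sum>l<N. wpow N J a i l * wpow N J (Suc b) l j)"
    by (simp add: sum_distrib_left)
  finally show ?case .
qed

lemma wpow_1: "i < N \<Longrightarrow> wpow N J (Suc 0) i j = wigner N J i j"
  by (simp add: if_distrib[of "\<lambda>x. x * _"] sum.delta cong: if_cong)

lemma wpow_sym: "i < N \<Longrightarrow> j < N \<Longrightarrow> wpow N J k i j = wpow N J k j i"
proof (induction k arbitrary: i j)
  case (Suc k)
  have "wpow N J (Suc k) i j = (\<Sum>l<N. wigner N J j l * wpow N J k l i)"
    using Suc by (auto intro!: sum.cong simp: wigner_sym[of N J j] mult.commute)
  also have "\<dots> = (\<Sum>l<N. wpow N J (Suc 0) j l * wpow N J k l i)"
    using Suc.prems by (intro sum.cong refl) (simp only: wpow_1)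
  also have "\<dots> = wpow N J (Suc 0 + k) j i" using Suc.prems by (intro wpow_add[symmetric])
  finally show ?case by simp
qed auto

lemma wpow_contract:
  "i < N \<Longrightarrow> j < N \<Longrightarrow> (\<Sum>l<N. wpow N J a i l * wpow N J b j l) = wpow N J (a + b) i j"
  unfolding wpow_add by (intro sum.cong refl) (simp add: wpow_sym)

lemma wpow_frobenius:
  assumes "N > 0"
  shows "(\<Sum>p\<in>bonds N. wpow N J a (fst p) (snd p) * wpow N J b (fst p) (snd p)) = real N * wtr N J (a + b)"
proof -
  have "(\<Sum>p\<in>bonds N. wpow N J a (fst p) (snd p) * wpow N J b (fst p) (snd p))
     = (\<Sum>i<N. \<Sum>l<N. wpow N J a i l * wpow N J b i l)"
    by (simp add: sum.cartesian_product case_prod_beta)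
  also have "\<dots> = (\<Sum>i<N. wpow N J (a + b) i i)" by (intro sum.cong refl wpow_contract) auto
  finally show ?thesis using assms by (simp add: wtr_def)
qed

section \<open>Derivatives with respect to one disorder variable\<close>

text \<open>The product rule for a matrix power: the differentiated factor sits at position q and
  equals a matrix unit plus its transpose, over \<open>sqrt (2 * real N)\<close>. For a diagonal p
  both summands coincide, matching the doubled diagonal entry of \<open>wigner\<close>.\<close>

definition dwpow :: "nat \<Rightarrow> nat \<times> nat \<Rightarrow> (nat \<times> nat \<Rightarrow> real) \<Rightarrow> nat \<Rightarrow> nat \<Rightarrow> nat \<Rightarrow> real" where
  "dwpow N p J k i j = (\<Sum>q<k. wpow N J q i (fst p) * wpow N J (k - 1 - q) (snd p) j
      + wpow N J q i (snd p) * wpow N J (k - 1 - q) (fst p) j) / sqrt (2 * real N)"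

lemma dwpow_Suc:
  assumes p: "p \<in> bonds N"
  shows "dwpow N p J (Suc k) i j = (\<Sum>l<N. dwpow N p J k i l * wigner N J l j
    + wpow N J k i l * (((if (l, j) = p then 1 else 0) + (if (j, l) = p then 1 else 0)) / sqrt (2 * real N)))"
proof -
  let ?s = "sqrt (2 * real N)"
  have ab: "fst p < N" "snd p < N" using p by auto
  have 1: "(\<Sum>l<N. dwpow N p J k i l * wigner N J l j)
    = (\<Sum>q<k. wpow N J q i (fst p) * wpow N J (k - q) (snd p) j + wpow N J q i (snd p) * wpow N J (k - q) (fst p) j) / ?s"
  proof -
    have "(\<Sum>l<N. dwpow N p J k i l * wigner N J l j)
      = (\<Sum>l<N. \<Sum>q<k. (wpow N J q i (fst p) * (wpow N J (k - 1 - q) (snd p) l * wigner N J l j)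
          + wpow N J q i (snd p) * (wpow N J (k - 1 - q) (fst p) l * wigner N J l j)) / ?s)"
      unfolding dwpow_def sum_divide_distrib sum_distrib_right
      by (intro sum.cong refl) (simp add: distrib_right mult.assoc)
    also have "\<dots> = (\<Sum>q<k. \<Sum>l<N. (wpow N J q i (fst p) * (wpow N J (k - 1 - q) (snd p) l * wigner N J l j)
          + wpow N J q i (snd p) * (wpow N J (k - 1 - q) (fst p) l * wigner N J l j)) / ?s)"
      by (rule sum.swap)
    also have "\<dots> = (\<Sum>q<k. (wpow N J q i (fst p) * wpow N J (Suc (k - 1 - q)) (snd p) j
          + wpow N J q i (snd p) * wpow N J (Suc (k - 1 - q)) (fst p) j) / ?s)"
      by (simp add: sum_divide_distrib[symmetric] sum.distrib sum_distrib_left)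
    also have "\<dots> = (\<Sum>q<k. (wpow N J q i (fst p) * wpow N J (k - q) (snd p) j
          + wpow N J q i (snd p) * wpow N J (k - q) (fst p) j) / ?s)"
      by (intro sum.cong refl) (auto simp del: wpow.simps simp: Suc_diff_Suc)
    finally show ?thesis by (simp add: sum_divide_distrib)
  qed
  have d1: "(\<Sum>l<N. wpow N J k i l * (if (l, j) = p then 1 else 0)) = wpow N J k i (fst p) * (if snd p = j then 1 else 0)"
  proof -
    have "(\<Sum>l<N. wpow N J k i l * (if (l, j) = p then 1 else 0)) = (\<Sum>l<N. if l = fst p then wpow N J k i (fst p) * (if snd p = j then 1 else 0) else 0)"
      by (intro sum.cong refl) (cases p, auto)
    then show ?thesis using ab by simp
  qed
  have d2: "(\<Sum>l<N. wpow N J k i l * (if (j, l) = p then 1 else 0)) = wpow N J k i (snd p) * (if fst p = j then 1 else 0)"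
  proof -
    have "(\<Sum>l<N. wpow N J k i l * (if (j, l) = p then 1 else 0)) = (\<Sum>l<N. if l = snd p then wpow N J k i (snd p) * (if fst p = j then 1 else 0) else 0)"
      by (intro sum.cong refl) (cases p, auto)
    then show ?thesis using ab by simp
  qed
  have 2: "(\<Sum>l<N. wpow N J k i l * (((if (l, j) = p then 1 else 0) + (if (j, l) = p then 1 else 0)) / ?s))
    = (wpow N J k i (fst p) * wpow N J 0 (snd p) j + wpow N J k i (snd p) * wpow N J 0 (fst p) j) / ?s"
    using d1 d2 by (simp add: distrib_left sum.distrib sum_divide_distrib[symmetric])
  show ?thesis
    unfolding sum.distrib 1 2 unfolding dwpow_def by (simp add: add_divide_distrib sum.distrib del: wpow.simps(2))
qed

lemma wigner_derivative:
  "((\<lambda>x. wigner N (J(p := x)) i j) has_real_derivative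
     (((if (i, j) = p then 1 else 0) + (if (j, i) = p then 1 else 0)) / sqrt (2 * real N))) (at x)"
proof -
  have "((\<lambda>x. (J(p := x)) q) has_real_derivative (if q = p then 1 else 0)) (at x)" for q
    by (cases "q = p") (auto intro!: derivative_eq_intros)
  from DERIV_cdivide[OF DERIV_add[OF this[of "(i, j)"] this[of "(j, i)"]]]
  show ?thesis unfolding wigner_def .
qed

lemma wpow_derivative:
  assumes p: "p \<in> bonds N"
  shows "((\<lambda>x. wpow N (J(p := x)) k i j) has_real_derivative dwpow N p (J(p := x)) k i j) (at x)"
proof (induction k arbitrary: i j)
  case 0
  then show ?case by (simp add: dwpow_def)
next
  case (Suc k)
  show ?case unfolding dwpow_Suc[OF p] wpow.simps
    by (rule DERIV_sum) (rule DERIV_mult'[OF Suc wigner_derivative, THEN DERIV_cong], simp add: add.commute fun_upd_def)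
qed

lemma continuous_wpow:
  assumes "p \<in> bonds N"
  shows "continuous_on UNIV (\<lambda>x. wpow N (J(p := x)) k i j)"
  using DERIV_isCont[OF wpow_derivative[OF assms]] continuous_at_imp_continuous_on by blast

lemma exp_bounded_wpow: "j < N \<Longrightarrow> exp_bounded (bonds N) (\<lambda>J. wpow N J k i j)"
proof (induction k arbitrary: j)
  case 0
  show ?case by (cases "i = j") (auto intro: exp_bounded_const)
next
  case (Suc k)
  have "exp_bounded (bonds N) (\<lambda>J. wigner N J l j)" if "l < N" for l
    unfolding wigner_def divide_inverse using that Suc.prems
    by (intro exp_bounded_mult exp_bounded_add exp_bounded_const exp_bounded_component) auto
  then show ?case using Suc by (simp, intro exp_bounded_sum exp_bounded_mult) auto
qed

lemma exp_bounded_wtr: "exp_bounded (bonds N) (\<lambda>J. wtr N J k)"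
  unfolding wtr_def divide_inverse
  by (intro exp_bounded_mult exp_bounded_sum exp_bounded_const exp_bounded_wpow) auto

text \<open>By cyclicity of the trace all c positions of the differentiated factor contribute
  equally, and the 2 comes from the symmetric pair of entries. At c = 0 the factor c makes the
  truncated exponent c - 1 harmless.\<close>

definition dwtr :: "nat \<Rightarrow> nat \<times> nat \<Rightarrow> (nat \<times> nat \<Rightarrow> real) \<Rightarrow> nat \<Rightarrow> real" where
  "dwtr N p J c = 2 * real c / (real N * sqrt (2 * real N)) * wpow N J (c - 1) (fst p) (snd p)"

lemma wtr_derivative:
  assumes p: "p \<in> bonds N"
  shows "((\<lambda>x. wtr N (J(p := x)) c) has_real_derivative dwtr N p (J(p := x)) c) (at x)"
proof -
  let ?J = "J(p := x)"
  have ab: "fst p < N" "snd p < N" using p by auto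
  have "(\<Sum>i<N. dwpow N p ?J c i i) = (\<Sum>i<N. \<Sum>q<c. (wpow N ?J q i (fst p) * wpow N ?J (c - 1 - q) (snd p) i
      + wpow N ?J q i (snd p) * wpow N ?J (c - 1 - q) (fst p) i) / sqrt (2 * real N))"
    unfolding dwpow_def by (simp add: sum_divide_distrib)
  also have "\<dots> = (\<Sum>q<c. \<Sum>i<N. (wpow N ?J q i (fst p) * wpow N ?J (c - 1 - q) (snd p) i
      + wpow N ?J q i (snd p) * wpow N ?J (c - 1 - q) (fst p) i) / sqrt (2 * real N))"
    by (rule sum.swap)
  also have "\<dots> = (\<Sum>q<c. 2 * wpow N ?J (c - 1) (fst p) (snd p) / sqrt (2 * real N))"
  proof (rule sum.cong[OF refl])
    fix q assume "q \<in> {..<c}"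
    then have qc: "q + (c - 1 - q) = c - 1" by auto
    have "(\<Sum>i<N. wpow N ?J q i (fst p) * wpow N ?J (c - 1 - q) (snd p) i) = wpow N ?J (c - 1) (fst p) (snd p)"
      using wpow_contract[OF ab, of ?J q "c - 1 - q"] ab unfolding qc
      by (simp add: wpow_sym[of _ N "fst p" ?J q] cong: sum.cong_simp)
    moreover have "(\<Sum>i<N. wpow N ?J q i (snd p) * wpow N ?J (c - 1 - q) (fst p) i) = wpow N ?J (c - 1) (fst p) (snd p)"
      using wpow_contract[OF ab(2,1), of ?J q "c - 1 - q"] ab unfolding qc
      by (simp add: wpow_sym[of _ N "snd p" ?J q] wpow_sym[OF ab] cong: sum.cong_simp)
    ultimately show "(\<Sum>i<N. (wpow N ?J q i (fst p) * wpow N ?J (c - 1 - q) (snd p) i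
      + wpow N ?J q i (snd p) * wpow N ?J (c - 1 - q) (fst p) i) / sqrt (2 * real N))
      = 2 * wpow N ?J (c - 1) (fst p) (snd p) / sqrt (2 * real N)"
      by (simp add: sum_divide_distrib[symmetric] sum.distrib)
  qed
  also have "\<dots> / real N = dwtr N p ?J c" by (simp add: dwtr_def mult_ac)
  finally have e: "(\<Sum>i<N. dwpow N p ?J c i i) / real N = dwtr N p ?J c" .
  show ?thesis unfolding wtr_def e[symmetric]
    by (intro DERIV_cdivide DERIV_sum wpow_derivative[OF p])
qed

text \<open>Products are carried along because integration by parts in a single trace already
  produces products of two; only the family of all products is closed under the recursion.\<close>

definition wprod :: "nat \<Rightarrow> (nat \<times> nat \<Rightarrow> real) \<Rightarrow> nat list \<Rightarrow> real" where
  "wprod N J cs = prod_list (map (wtr N J) cs)"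

lemma wprod_simps [simp]: "wprod N J [] = 1" "wprod N J (c # cs) = wtr N J c * wprod N J cs"
  by (simp_all add: wprod_def)

lemma exp_bounded_wprod: "exp_bounded (bonds N) (\<lambda>J. wprod N J cs)"
  by (induction cs) (auto intro: exp_bounded_mult exp_bounded_wtr)

primrec dwprod :: "nat \<Rightarrow> nat \<times> nat \<Rightarrow> (nat \<times> nat \<Rightarrow> real) \<Rightarrow> nat list \<Rightarrow> real" where
  "dwprod N p J [] = 0"
| "dwprod N p J (c # cs) = dwtr N p J c * wprod N J cs + wtr N J c * dwprod N p J cs"

lemma wprod_derivative:
  assumes p: "p \<in> bonds N"
  shows "((\<lambda>x. wprod N (J(p := x)) cs) has_real_derivative dwprod N p (J(p := x)) cs) (at x)"
proof (induction cs)
  case (Cons c cs)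
  show ?case
    unfolding wprod_simps dwprod.simps
    by (rule DERIV_mult'[OF wtr_derivative[OF p] Cons, THEN DERIV_cong]) (simp add: add.commute fun_upd_def)
qed simp

lemma continuous_wprod:
  assumes "p \<in> bonds N"
  shows "continuous_on UNIV (\<lambda>x. wprod N (J(p := x)) cs)" "continuous_on UNIV (\<lambda>x. wtr N (J(p := x)) c)"
  using DERIV_isCont[OF wprod_derivative[OF assms]] DERIV_isCont[OF wtr_derivative[OF assms]]
    continuous_at_imp_continuous_on by blast+

lemma continuous_dwprod:
  assumes p: "p \<in> bonds N"
  shows "continuous_on UNIV (\<lambda>x. dwprod N p (J(p := x)) cs)"
proof (induction cs)
  case (Cons c cs)
  have "continuous_on UNIV (\<lambda>x. dwtr N p (J(p := x)) c)"
    unfolding dwtr_def by (rule continuous_on_mult_left[OF continuous_wpow[OF p]])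
  then show ?case unfolding dwprod.simps
    by (intro continuous_on_add continuous_on_mult Cons continuous_wprod[OF p])
qed simp

lemma exp_bounded_dwprod:
  assumes p: "p \<in> bonds N"
  shows "exp_bounded (bonds N) (\<lambda>J. dwprod N p J cs)"
proof (induction cs)
  case (Cons c cs)
  have "exp_bounded (bonds N) (\<lambda>J. dwtr N p J c)"
    unfolding dwtr_def using p by (intro exp_bounded_mult exp_bounded_const exp_bounded_wpow) auto
  then show ?case unfolding dwprod.simps
    by (intro exp_bounded_add exp_bounded_mult Cons exp_bounded_wprod exp_bounded_wtr)
qed (simp add: exp_bounded_const)

section \<open>Loop equations for products of traces\<close>

text \<open>The terms in which the derivative falls on another trace. A trace of power c is then
  merged with the open chain of length k into one trace of power k + c - 1, with weight 2 c.\<close>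

primrec contractions :: "nat \<Rightarrow> nat list \<Rightarrow> (nat \<times> nat list) list" where
  "contractions k [] = []"
| "contractions k (c # cs) = (2 * c, (k + (c - 1)) # cs) # map (\<lambda>(w, l). (w, c # l)) (contractions k cs)"

definition wcontr :: "nat \<Rightarrow> (nat \<times> nat \<Rightarrow> real) \<Rightarrow> nat \<Rightarrow> nat list \<Rightarrow> real" where
  "wcontr N J k cs = (\<Sum>(w, l)\<leftarrow>contractions k cs. real w * wprod N J l)"

lemma wcontr_simps: "wcontr N J k [] = 0"
  "wcontr N J k (c # cs) = 2 * real c * wtr N J (k + (c - 1)) * wprod N J cs + wtr N J c * wcontr N J k cs"
proof -
  have "(\<Sum>(w, l)\<leftarrow>map (\<lambda>(w, l). (w, c # l)) xs. real w * wprod N J l) = wtr N J c * (\<Sum>(w, l)\<leftarrow>xs. real w * wprod N J l)" for xs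
    by (induction xs) (auto simp: algebra_simps)
  then show "wcontr N J k (c # cs) = 2 * real c * wtr N J (k + (c - 1)) * wprod N J cs + wtr N J c * wcontr N J k cs"
    by (simp add: wcontr_def)
qed (simp add: wcontr_def)

lemma sum_dwprod:
  assumes N: "N > 0"
  shows "(\<Sum>p\<in>bonds N. wpow N J k (fst p) (snd p) * dwprod N p J cs) = wcontr N J k cs / sqrt (2 * real N)"
proof (induction cs)
  case (Cons c cs)
  let ?P = "\<lambda>k p. wpow N J k (fst p) (snd p)"
  have "(\<Sum>p\<in>bonds N. ?P k p * dwprod N p J (c # cs))
    = (\<Sum>p\<in>bonds N. (2 * real c / (real N * sqrt (2 * real N)) * wprod N J cs) * (?P k p * ?P (c - 1) p)
       + wtr N J c * (?P k p * dwprod N p J cs))"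
    by (simp add: dwtr_def algebra_simps)
  also have "\<dots> = (2 * real c / (real N * sqrt (2 * real N)) * wprod N J cs) * (real N * wtr N J (k + (c - 1)))
      + wtr N J c * (wcontr N J k cs / sqrt (2 * real N))"
    unfolding sum.distrib sum_distrib_left[symmetric] wpow_frobenius[OF N] Cons ..
  also have "\<dots> = wcontr N J k (c # cs) / sqrt (2 * real N)"
    using N by (simp add: wcontr_simps add_divide_distrib)
  finally show ?case .
qed (simp add: wcontr_simps)

text \<open>The two index orders of the symmetric derivative behave differently: one separates the
  chain into two independent closed loops, of order N^2, the other reconnects it into a single loop,
  of order N.\<close>

lemma sum_dwpow:
  assumes N: "N > 0"
  shows "(\<Sum>p\<in>bonds N. dwpow N p J k (fst p) (snd p))
    = ((real N)\<^sup>2 * (\<Sum>q<k. wtr N J q * wtr N J (k - 1 - q)) + real k * real N * wtr N J (k - 1)) / sqrt (2 * real N)"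
proof -
  have "(\<Sum>p\<in>bonds N. dwpow N p J k (fst p) (snd p))
    = (\<Sum>p\<in>bonds N. \<Sum>q<k. wpow N J q (fst p) (fst p) * wpow N J (k - 1 - q) (snd p) (snd p)
       + wpow N J q (fst p) (snd p) * wpow N J (k - 1 - q) (fst p) (snd p)) / sqrt (2 * real N)"
    unfolding dwpow_def by (simp add: sum_divide_distrib)
  also have "(\<Sum>p\<in>bonds N. \<Sum>q<k. wpow N J q (fst p) (fst p) * wpow N J (k - 1 - q) (snd p) (snd p)
       + wpow N J q (fst p) (snd p) * wpow N J (k - 1 - q) (fst p) (snd p))
    = (\<Sum>q<k. \<Sum>p\<in>bonds N. wpow N J q (fst p) (fst p) * wpow N J (k - 1 - q) (snd p) (snd p)
       + wpow N J q (fst p) (snd p) * wpow N J (k - 1 - q) (fst p) (snd p))"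
    by (rule sum.swap)
  also have "\<dots> = (\<Sum>q<k. (real N)\<^sup>2 * (wtr N J q * wtr N J (k - 1 - q)) + real N * wtr N J (k - 1))"
  proof (rule sum.cong[OF refl])
    fix q assume "q \<in> {..<k}"
    then have qk: "q + (k - 1 - q) = k - 1" by auto
    have "(\<Sum>p\<in>bonds N. wpow N J q (fst p) (fst p) * wpow N J (k - 1 - q) (snd p) (snd p))
      = (\<Sum>i<N. wpow N J q i i) * (\<Sum>l<N. wpow N J (k - 1 - q) l l)"
      by (simp add: sum_product sum.cartesian_product case_prod_beta)
    also have "\<dots> = (real N)\<^sup>2 * (wtr N J q * wtr N J (k - 1 - q))"
      using N by (simp add: wtr_def power2_eq_square)
    finally show "(\<Sum>p\<in>bonds N. wpow N J q (fst p) (fst p) * wpow N J (k - 1 - q) (snd p) (snd p)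
       + wpow N J q (fst p) (snd p) * wpow N J (k - 1 - q) (fst p) (snd p))
      = (real N)\<^sup>2 * (wtr N J q * wtr N J (k - 1 - q)) + real N * wtr N J (k - 1)"
      unfolding sum.distrib wpow_frobenius[OF N] qk by simp
  qed
  also have "\<dots> = (real N)\<^sup>2 * (\<Sum>q<k. wtr N J q * wtr N J (k - 1 - q)) + real k * real N * wtr N J (k - 1)"
    by (simp add: sum.distrib sum_distrib_left)
  finally show ?thesis .
qed

text \<open>The Schwinger-Dyson equation: one matrix factor of the first trace is integrated by
  parts. All terms share the prefactor 1/N^2, so splitting the trace is of order 1, the transposed
  term of order 1/N, and merging with another trace of order 1/N^2.\<close>

lemma trace_recursion:
  assumes N: "N > 0"
  shows "(\<integral>J. wprod N J (Suc k # cs) \<partial>gaussP (bonds N))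
    = (\<Sum>q<k. \<integral>J. wprod N J (q # (k - 1 - q) # cs) \<partial>gaussP (bonds N))
      + real k / real N * (\<integral>J. wprod N J ((k - 1) # cs) \<partial>gaussP (bonds N))
      + 1 / (real N)\<^sup>2 * (\<Sum>(w, l)\<leftarrow>contractions k cs. real w * (\<integral>J. wprod N J l \<partial>gaussP (bonds N)))"
proof -
  let ?g = "gaussP (bonds N)" and ?s = "sqrt (2 * real N)"
  let ?P = "\<lambda>J p. wpow N J k (fst p) (snd p)"
  have ss: "?s * ?s = 2 * real N" by simp
  have s0: "?s \<noteq> 0" using N by simp
  have ip: "integrable ?g (\<lambda>J. wprod N J l)" for l by (intro exp_bounded_integrable exp_bounded_wprod) auto
  have fb: "finite (bonds N)" by simp
  \<comment> \<open>The split-off matrix factor is J plus its transpose, and symmetry of the k-th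
    power makes both contribute the same; hence the factor 2.\<close>
  have tr: "wtr N J (Suc k) = 2 / (real N * ?s) * (\<Sum>p\<in>bonds N. J p * ?P J p)" for J
  proof -
    have "(\<Sum>i<N. wpow N J (Suc k) i i) = (\<Sum>i<N. \<Sum>l<N. wpow N J k i l * J (i, l) / ?s) + (\<Sum>i<N. \<Sum>l<N. wpow N J k i l * J (l, i) / ?s)"
      by (simp add: wigner_def sum.distrib[symmetric] add_divide_distrib distrib_left add.commute)
    also have "(\<Sum>i<N. \<Sum>l<N. wpow N J k i l * J (l, i) / ?s) = (\<Sum>l<N. \<Sum>i<N. wpow N J k l i * J (l, i) / ?s)"
      by (subst sum.swap) (auto intro!: sum.cong simp: wpow_sym)
    also have "(\<Sum>i<N. \<Sum>l<N. wpow N J k i l * J (i, l) / ?s) + \<dots> = 2 / ?s * (\<Sum>i<N. \<Sum>l<N. J (i, l) * wpow N J k i l)"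
      by (simp add: sum_distrib_left sum.distrib[symmetric] field_simps)
    also have "(\<Sum>i<N. \<Sum>l<N. J (i, l) * wpow N J k i l) = (\<Sum>p\<in>bonds N. J p * ?P J p)"
      by (simp add: sum.cartesian_product case_prod_beta)
    finally show ?thesis using N by (simp add: wtr_def)
  qed
  have bp: "(\<integral>J. J p * (?P J p * wprod N J cs) \<partial>?g)
     = (\<integral>J. dwpow N p J k (fst p) (snd p) * wprod N J cs + ?P J p * dwprod N p J cs \<partial>?g)" if p: "p \<in> bonds N" for p
  proof (rule gaussP_by_parts[OF fb p])
    have lt: "fst p < N" "snd p < N" using p by auto
    show "exp_bounded (bonds N) (\<lambda>J. ?P J p * wprod N J cs)"
      using lt by (intro exp_bounded_mult exp_bounded_wpow exp_bounded_wprod)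
    show "exp_bounded (bonds N) (\<lambda>J. dwpow N p J k (fst p) (snd p) * wprod N J cs + ?P J p * dwprod N p J cs)"
      unfolding dwpow_def divide_inverse using lt
      by (intro exp_bounded_add exp_bounded_mult exp_bounded_sum exp_bounded_const exp_bounded_wpow exp_bounded_wprod exp_bounded_dwprod p) auto
    show "((\<lambda>x. ?P (J(p := x)) p * wprod N (J(p := x)) cs) has_real_derivative
       dwpow N p (J(p := x)) k (fst p) (snd p) * wprod N (J(p := x)) cs + ?P (J(p := x)) p * dwprod N p (J(p := x)) cs) (at x)" for J x
      by (rule DERIV_mult'[OF wpow_derivative[OF p] wprod_derivative[OF p], THEN DERIV_cong]) (simp add: add.commute fun_upd_def)
    show "continuous_on UNIV (\<lambda>x. dwpow N p (J(p := x)) k (fst p) (snd p) * wprod N (J(p := x)) cs + ?P (J(p := x)) p * dwprod N p (J(p := x)) cs)" for J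
      unfolding dwpow_def using s0
      by (intro continuous_intros continuous_wpow[OF p] continuous_wprod[OF p] continuous_dwprod[OF p]) auto
  qed
  have i1: "integrable ?g (\<lambda>J. J p * (?P J p * wprod N J cs))" if "p \<in> bonds N" for p
    using that by (intro exp_bounded_integrable exp_bounded_mult exp_bounded_component exp_bounded_wpow exp_bounded_wprod) auto
  have i2: "integrable ?g (\<lambda>J. dwpow N p J k (fst p) (snd p) * wprod N J cs + ?P J p * dwprod N p J cs)" if "p \<in> bonds N" for p
    unfolding dwpow_def divide_inverse using that
    by (intro exp_bounded_integrable exp_bounded_add exp_bounded_mult exp_bounded_sum exp_bounded_const exp_bounded_wpow exp_bounded_wprod exp_bounded_dwprod that) auto
  have "(\<integral>J. wprod N J (Suc k # cs) \<partial>?g) = (\<integral>J. 2 / (real N * ?s) * (\<Sum>p\<in>bonds N. J p * (?P J p * wprod N J cs)) \<partial>?g)"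
    unfolding wprod_simps tr by (simp add: sum_distrib_right mult.assoc)
  also have "\<dots> = 2 / (real N * ?s) * (\<Sum>p\<in>bonds N. \<integral>J. J p * (?P J p * wprod N J cs) \<partial>?g)"
    using i1 by (simp add: Bochner_Integration.integral_sum)
  also have "(\<Sum>p\<in>bonds N. \<integral>J. J p * (?P J p * wprod N J cs) \<partial>?g)
    = (\<integral>J. (\<Sum>p\<in>bonds N. dwpow N p J k (fst p) (snd p) * wprod N J cs + ?P J p * dwprod N p J cs) \<partial>?g)"
    using i2 by (simp add: bp Bochner_Integration.integral_sum cong: sum.cong_simp)
  also have "\<dots> = (\<integral>J. ((real N)\<^sup>2 * (\<Sum>q<k. wprod N J (q # (k - 1 - q) # cs)) + real k * real N * wprod N J ((k - 1) # cs)
      + (\<Sum>(w, l)\<leftarrow>contractions k cs. real w * wprod N J l)) / ?s \<partial>?g)"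
  proof (rule Bochner_Integration.integral_cong[OF refl])
    fix J
    let ?X = "wprod N J cs"
    have X: "(\<Sum>q<k. wprod N J (q # (k - 1 - q) # cs)) = (\<Sum>q<k. wtr N J q * wtr N J (k - 1 - q)) * ?X"
      by (simp add: sum_distrib_right mult.assoc)
    have "(\<Sum>p\<in>bonds N. dwpow N p J k (fst p) (snd p) * ?X + ?P J p * dwprod N p J cs)
      = (((real N)\<^sup>2 * (\<Sum>q<k. wtr N J q * wtr N J (k - 1 - q)) + real k * real N * wtr N J (k - 1)) / ?s) * ?X
        + wcontr N J k cs / ?s"
      by (simp only: sum.distrib sum_distrib_right[symmetric] sum_dwpow[OF N] sum_dwprod[OF N])
    also have "\<dots> = ((real N)\<^sup>2 * (\<Sum>q<k. wprod N J (q # (k - 1 - q) # cs)) + real k * real N * wprod N J ((k - 1) # cs)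
      + wcontr N J k cs) / ?s"
      unfolding X unfolding wprod_simps by (simp add: add_divide_distrib distrib_right mult.assoc)
    finally show "(\<Sum>p\<in>bonds N. dwpow N p J k (fst p) (snd p) * ?X + ?P J p * dwprod N p J cs)
      = ((real N)\<^sup>2 * (\<Sum>q<k. wprod N J (q # (k - 1 - q) # cs)) + real k * real N * wprod N J ((k - 1) # cs)
      + (\<Sum>(w, l)\<leftarrow>contractions k cs. real w * wprod N J l)) / ?s" unfolding wcontr_def .
  qed
  also have "\<dots> = ((real N)\<^sup>2 * (\<Sum>q<k. \<integral>J. wprod N J (q # (k - 1 - q) # cs) \<partial>?g) + real k * real N * (\<integral>J. wprod N J ((k - 1) # cs) \<partial>?g)
      + (\<Sum>(w, l)\<leftarrow>contractions k cs. real w * (\<integral>J. wprod N J l \<partial>?g))) / ?s"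
  proof -
    have li: "integrable ?g (\<lambda>J. \<Sum>(w, l)\<leftarrow>xs. real w * wprod N J l) \<and>
       (\<integral>J. (\<Sum>(w, l)\<leftarrow>xs. real w * wprod N J l) \<partial>?g) = (\<Sum>(w, l)\<leftarrow>xs. real w * (\<integral>J. wprod N J l \<partial>?g))" for xs :: "(nat \<times> nat list) list"
      by (induction xs) (auto simp: ip)
    have "integrable ?g (\<lambda>J. (real N)\<^sup>2 * (\<Sum>q<k. wprod N J (q # (k - 1 - q) # cs)))"
      "integrable ?g (\<lambda>J. real k * real N * wprod N J ((k - 1) # cs))"
      by (intro integrable_mult_right Bochner_Integration.integrable_sum ip)+
    then show ?thesis using li[of "contractions k cs"] ip
      by (simp only: integral_divide_zero Bochner_Integration.integral_add Bochner_Integration.integrable_add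
         integral_mult_right_zero Bochner_Integration.integral_sum)
  qed
  also have "2 / (real N * ?s) * (((real N)\<^sup>2 * X + real k * real N * Y + Z) / ?s) = X + real k / real N * Y + 1 / (real N)\<^sup>2 * Z" for X Y Z :: real
  proof -
    have "2 / (real N * ?s) * (((real N)\<^sup>2 * X + real k * real N * Y + Z) / ?s) = 2 * ((real N)\<^sup>2 * X + real k * real N * Y + Z) / (real N * (?s * ?s))"
      by (simp add: mult.assoc)
    then show ?thesis unfolding ss using N by (simp add: field_simps power2_eq_square)
  qed
  finally show ?thesis .
qed

section \<open>Convergence to the semicircle moments\<close>

text \<open>The moments of the semicircle law on [-2, 2]: Catalan numbers at even arguments, 0 at
  odd ones. The recursion is the large N limit of \<open>trace_recursion\<close>.\<close>

function semicircle :: "nat \<Rightarrow> real" where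
  "semicircle 0 = 1"
| "semicircle (Suc k) = (\<Sum>q<k. semicircle q * semicircle (k - 1 - q))"
  by pat_completeness auto
termination by (relation "Wellfounded.measure (\<lambda>k. k)") auto

text \<open>Merging consumes one matrix factor of each of the two traces, so the total degree drops.
  This feeds the induction in \<open>trace_moments\<close>.\<close>

lemma contractions_degree:
  "(w, l) \<in> set (contractions k cs) \<Longrightarrow> w = 0 \<or> sum_list l < Suc k + sum_list cs"
  by (induction cs arbitrary: w l) force+

text \<open>Induction on the total degree through the loop equation; the length of the list is the
  second component because removing a zeroth power leaves the degree unchanged. That limits of
  products factorise is the concentration of the traces, needed later for the square of
  \<open>tr2\<close>.\<close>

theorem trace_moments:
  "(\<lambda>N. \<integral>J. wprod N J cs \<partial>gaussP (bonds N)) \<longlonglongrightarrow> prod_list (map semicircle cs)"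
proof (induction cs rule: wf_induct_rule[OF wf_measures[of "[sum_list, length]"]])
  case (1 cs)
  note IH = 1
  let ?E = "\<lambda>cs N. \<integral>J. wprod N J cs \<partial>gaussP (bonds N)"
  show ?case
  proof (cases cs)
    case Nil
    then show ?thesis by (simp add: prob_space.prob_space[OF prob_space_gaussP])
  next
    case (Cons c ds)
    show ?thesis
    proof (cases c)
      case 0
      have "?E ds \<longlonglongrightarrow> prod_list (map semicircle ds)" using Cons 0 by (intro IH) auto
      \<comment> \<open>The normalised trace of the zeroth power is 1 only for N > 0; at N = 0 it is
        0/0 = 0.\<close>
      moreover have "\<forall>\<^sub>F N in sequentially. ?E ds N = ?E cs N"
        using eventually_gt_at_top[of 0] by eventually_elim (simp add: Cons 0 wtr_def)
      ultimately show ?thesis using Cons 0 by (simp add: tendsto_cong)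
    next
      case (Suc k)
      have l1: "?E (q # (k - 1 - q) # ds) \<longlonglongrightarrow> prod_list (map semicircle (q # (k - 1 - q) # ds))" if "q < k" for q
        using Cons Suc that by (intro IH) auto
      have l2: "?E ((k - 1) # ds) \<longlonglongrightarrow> prod_list (map semicircle ((k - 1) # ds))"
        using Cons Suc by (intro IH) auto
      \<comment> \<open>The value of this limit is irrelevant, since the sum is multiplied by 1/N^2;
        convergence provides the boundedness.\<close>
      have l3: "\<exists>L. (\<lambda>N. \<Sum>(w, l)\<leftarrow>xs. real w * ?E l N) \<longlonglongrightarrow> L" if "set xs \<subseteq> set (contractions k ds)" for xs
        using that
      proof (induction xs)
        case (Cons x xs)
        obtain w l where x: "x = (w, l)" by (cases x)
        obtain L where L: "(\<lambda>N. \<Sum>(w, l)\<leftarrow>xs. real w * ?E l N) \<longlonglongrightarrow> L" using Cons by auto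
        have "w = 0 \<or> sum_list l < Suc k + sum_list ds" using Cons.prems x by (intro contractions_degree) auto
        then have "\<exists>L'. (\<lambda>N. real w * ?E l N) \<longlonglongrightarrow> L'"
        proof
          assume "sum_list l < Suc k + sum_list ds"
          then have "?E l \<longlonglongrightarrow> prod_list (map semicircle l)" using \<open>cs = c # ds\<close> Suc by (intro IH) auto
          from tendsto_mult_left[OF this, of "real w"] show ?thesis by blast
        qed (auto intro: tendsto_const)
        then show ?case using x L by (auto intro: tendsto_add)
      qed (auto intro: tendsto_const)
      then obtain L where L: "(\<lambda>N. \<Sum>(w, l)\<leftarrow>contractions k ds. real w * ?E l N) \<longlonglongrightarrow> L" by blast
      have z1: "(\<lambda>N. real k / real N) \<longlonglongrightarrow> 0" by (rule lim_const_over_n)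
      have z2: "(\<lambda>N. 1 / (real N)\<^sup>2) \<longlonglongrightarrow> 0" by real_asymp
      have "(\<lambda>N. (\<Sum>q<k. ?E (q # (k - 1 - q) # ds) N) + real k / real N * ?E ((k - 1) # ds) N
          + 1 / (real N)\<^sup>2 * (\<Sum>(w, l)\<leftarrow>contractions k ds. real w * ?E l N))
        \<longlonglongrightarrow> (\<Sum>q<k. prod_list (map semicircle (q # (k - 1 - q) # ds))) + 0 * prod_list (map semicircle ((k - 1) # ds)) + 0 * L"
        by (intro tendsto_add tendsto_mult tendsto_sum l1 l2 L z1 z2) auto
      moreover have "(\<Sum>q<k. prod_list (map semicircle (q # (k - 1 - q) # ds))) = prod_list (map semicircle cs)"
        unfolding Cons Suc by (simp add: sum_distrib_right mult.assoc)
      moreover have "\<forall>\<^sub>F N in sequentially. (\<Sum>q<k. ?E (q # (k - 1 - q) # ds) N) + real k / real N * ?E ((k - 1) # ds) N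
          + 1 / (real N)\<^sup>2 * (\<Sum>(w, l)\<leftarrow>contractions k ds. real w * ?E l N) = ?E cs N"
        using eventually_gt_at_top[of 0] unfolding Cons Suc
        by eventually_elim (rule trace_recursion[symmetric])
      ultimately show ?thesis by (simp add: tendsto_cong)
    qed
  qed
qed

section \<open>The shifted lower bound\<close>

declare semicircle.simps(2) [simp del]

section \<open>Growth of the even semicircle moments\<close>

text \<open>The two indices in each product add up to an odd number, so one of them is odd and
  smaller.\<close>

lemma semicircle_odd: "semicircle (2 * k + 1) = 0"
proof (induction k rule: less_induct)
  case (less k)
  have "semicircle q * semicircle (2 * k - 1 - q) = 0" if "q < 2 * k" for q
  proof (cases "even q")
    case True
    then obtain i where "q = 2 * i" by blast
    then have "2 * k - 1 - q = 2 * (k - 1 - i) + 1" "k - 1 - i < k" using that by auto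
    then show ?thesis using less by (metis mult_zero_right)
  next
    case False
    then obtain i where "q = 2 * i + 1" by (metis oddE)
    moreover have "i < k" using that calculation by auto
    ultimately show ?thesis using less by (metis mult_zero_left)
  qed
  then have "(\<Sum>q<2 * k. semicircle q * semicircle (2 * k - 1 - q)) = 0" by (intro sum.neutral) auto
  then show ?case by (simp add: semicircle.simps(2))
qed

lemma sum_even_support:
  fixes f :: "nat \<Rightarrow> real"
  assumes "\<And>i. f (2 * i + 1) = 0"
  shows "(\<Sum>q<2 * k + 1. f q) = (\<Sum>i\<le>k. f (2 * i))"
proof (induction k)
  case (Suc k)
  have "(\<Sum>q<2 * Suc k + 1. f q) = (\<Sum>q<2 * k + 1. f q) + f (2 * k + 1) + f (2 * k + 2)" by simp
  then show ?case using Suc assms[of k] by simp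
qed simp

lemma semicircle_even: "semicircle (2 * Suc k) = (\<Sum>i\<le>k. semicircle (2 * i) * semicircle (2 * (k - i)))"
proof -
  have "semicircle (2 * Suc k) = (\<Sum>q<2 * k + 1. semicircle q * semicircle (2 * k - q))"
    by (simp add: semicircle.simps(2))
  also have "\<dots> = (\<Sum>i\<le>k. semicircle (2 * i) * semicircle (2 * k - 2 * i))"
    by (rule sum_even_support) (use semicircle_odd in auto)
  finally show ?thesis by (simp add: diff_mult_distrib2)
qed

lemma semicircle_even_pos: "semicircle (2 * k) > 0"
proof (induction k rule: less_induct)
  case (less k)
  show ?case
  proof (cases k)
    case (Suc m)
    have "0 < (\<Sum>i\<le>m. semicircle (2 * i) * semicircle (2 * (m - i)))"
      using less Suc by (intro sum_pos mult_pos_pos) auto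
    then show ?thesis unfolding Suc semicircle_even .
  qed simp
qed

text \<open>The generating function of the even moments satisfies \<open>S = 1 + z S\<^sup>2\<close>, which has no real solution
  for \<open>z > 1/4\<close>; hence its radius of convergence is at most \<open>1/4\<close>.\<close>

lemma semicircle_growth:
  assumes e: "0 < e" "e < 4"
  shows "\<exists>k. semicircle (2 * Suc k) \<ge> (4 - e) * semicircle (2 * k)"
proof (rule ccontr)
  assume "\<not> ?thesis"
  then have lt: "semicircle (2 * Suc k) < (4 - e) * semicircle (2 * k)" for k by (auto simp: not_le)
  define c where "c k = semicircle (2 * k)" for k
  have c0: "c k > 0" for k unfolding c_def by (rule semicircle_even_pos)
  have cb: "c k \<le> (4 - e) ^ k" for k
  proof (induction k)
    case (Suc k)
    have "c (Suc k) \<le> (4 - e) * c k" using lt[of k] unfolding c_def by simp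
    also have "\<dots> \<le> (4 - e) * (4 - e) ^ k" using Suc e by (intro mult_left_mono) auto
    finally show ?case by simp
  qed (simp add: c_def)
  \<comment> \<open>This z lies strictly between 1/4 and 1/(4 - e): the series converges by the
    assumed slow growth, while the quadratic equation for its sum has no real root.\<close>
  define z where "z = 1 / (4 - e / 2)"
  have z: "z > 0" "4 * z > 1" "(4 - e) * z < 1" using e by (auto simp: z_def field_simps)
  have sg: "summable (\<lambda>k. ((4 - e) * z) ^ k)" using z e by (intro summable_geometric) auto
  have nb: "norm (c k * z ^ k) \<le> ((4 - e) * z) ^ k" for k
    using cb[of k] c0[of k] z by (simp add: power_mult_distrib mult_right_mono abs_mult)
  have sn: "summable (\<lambda>k. norm (c k * z ^ k))"
    by (rule summable_comparison_test'[OF sg, of 0]) (use nb in simp)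
  define S where "S = (\<Sum>k. c k * z ^ k)"
  have s: "summable (\<lambda>k. c k * z ^ k)" by (rule summable_norm_cancel[OF sn])
  have "(\<lambda>k. \<Sum>i\<le>k. (c i * z ^ i) * (c (k - i) * z ^ (k - i))) sums (S * S)"
    unfolding S_def by (rule Cauchy_product_sums[OF sn sn])
  moreover have "(\<Sum>i\<le>k. (c i * z ^ i) * (c (k - i) * z ^ (k - i))) = c (Suc k) * z ^ k" for k
  proof -
    have "(\<Sum>i\<le>k. (c i * z ^ i) * (c (k - i) * z ^ (k - i))) = (\<Sum>i\<le>k. c i * c (k - i) * z ^ k)"
      by (intro sum.cong refl) (simp add: power_add[symmetric] mult_ac)
    also have "\<dots> = c (Suc k) * z ^ k" unfolding c_def semicircle_even by (simp add: sum_distrib_right)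
    finally show ?thesis .
  qed
  ultimately have "(\<lambda>k. c (Suc k) * z ^ k) sums (S * S)" by simp
  then have "(\<lambda>k. z * (c (Suc k) * z ^ k)) sums (z * (S * S))" by (rule sums_mult)
  then have "(\<Sum>k. c (Suc k) * z ^ Suc k) = z * S\<^sup>2" by (simp add: sums_iff power2_eq_square mult_ac)
  moreover have "(\<Sum>k. c (Suc k) * z ^ Suc k) = S - c 0 * z ^ 0"
    unfolding S_def by (rule suminf_split_head[OF s])
  moreover have "c 0 = 1" by (simp add: c_def)
  ultimately have eq: "S = 1 + z * S\<^sup>2" by simp
  \<comment> \<open>Completing the square in the equation expresses that its discriminant 1 - 4 z is
    negative.\<close>
  have "0 \<le> z * (S - 1 / (2 * z))\<^sup>2" using z by simp
  also have "\<dots> = z * S\<^sup>2 - S + 1 / (4 * z)" using z by (simp add: power2_eq_square field_simps)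
  also have "\<dots> = 1 / (4 * z) - 1" using eq by simp
  also have "\<dots> < 0" using z by (simp add: field_simps)
  finally show False by simp
qed

section \<open>Second moments of Gaussian quadratic forms\<close>

lemma gaussP_linear_sq:
  assumes I: "finite I"
  shows "(\<integral>g. (\<Sum>j\<in>I. a j * g j)\<^sup>2 \<partial>gaussP I) = (\<Sum>j\<in>I. (a j)\<^sup>2)"
proof -
  have "(\<integral>g. (\<Sum>j\<in>I. a j * g j)\<^sup>2 \<partial>gaussP I) = (\<integral>g. (\<Sum>j\<in>I. \<Sum>l\<in>I. a j * a l * (g j * g l)) \<partial>gaussP I)"
    unfolding power2_eq_square sum_product by (simp add: mult_ac)
  also have "\<dots> = (\<Sum>j\<in>I. \<Sum>l\<in>I. a j * a l * (\<integral>g. g j * g l \<partial>gaussP I))"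
  proof -
    have i: "integrable (gaussP I) (\<lambda>g. a j * a l * (g j * g l))" if "j \<in> I" "l \<in> I" for j l
      using that I by (intro exp_bounded_integrable exp_bounded_mult exp_bounded_const exp_bounded_component)
    then show ?thesis by (simp add: Bochner_Integration.integral_sum)
  qed
  also have "\<dots> = (\<Sum>j\<in>I. \<Sum>l\<in>I. if j = l then (a j)\<^sup>2 else 0)"
    using I by (intro sum.cong refl) (simp add: gaussP_cov power2_eq_square)
  finally show ?thesis using I by (simp add: sum.delta)
qed

text \<open>Write the form as the sum of g k times a linear form l k. One integration by parts in g
  k turns l k times q into A k k times q plus 2 (l k)^2, because the gradient of q is 2 l; summing
  over k gives Wick's formula.\<close>

lemma gaussP_quadratic_form:
  fixes A :: "'i \<Rightarrow> 'i \<Rightarrow> real"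
  assumes I: "finite I" and sym: "\<And>i j. i \<in> I \<Longrightarrow> j \<in> I \<Longrightarrow> A i j = A j i"
  shows "(\<integral>g. (\<Sum>i\<in>I. \<Sum>j\<in>I. A i j * (g i * g j)) \<partial>gaussP I) = (\<Sum>i\<in>I. A i i)"
    and "(\<integral>g. (\<Sum>i\<in>I. \<Sum>j\<in>I. A i j * (g i * g j))\<^sup>2 \<partial>gaussP I) = (\<Sum>i\<in>I. A i i)\<^sup>2 + 2 * (\<Sum>i\<in>I. \<Sum>j\<in>I. (A i j)\<^sup>2)"
proof -
  define q where "q g = (\<Sum>i\<in>I. \<Sum>j\<in>I. A i j * (g i * g j))" for g
  define l where "l i g = (\<Sum>j\<in>I. A i j * g j)" for i g
  have lb: "exp_bounded I (l i)" for i
    unfolding l_def using I by (intro exp_bounded_sum exp_bounded_mult exp_bounded_const exp_bounded_component)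
  have qb: "exp_bounded I q"
    unfolding q_def using I by (intro exp_bounded_sum exp_bounded_mult exp_bounded_const exp_bounded_component)
  have ij: "integrable (gaussP I) (\<lambda>g. A i j * (g i * g j))" if "i \<in> I" "j \<in> I" for i j
    using that I by (intro exp_bounded_integrable exp_bounded_mult exp_bounded_const exp_bounded_component)
  have Eq: "(\<integral>g. q g \<partial>gaussP I) = (\<Sum>i\<in>I. A i i)"
  proof -
    have "(\<integral>g. q g \<partial>gaussP I) = (\<Sum>i\<in>I. \<Sum>j\<in>I. A i j * (\<integral>g. g i * g j \<partial>gaussP I))"
      unfolding q_def using ij by (simp add: Bochner_Integration.integral_sum)
    also have "\<dots> = (\<Sum>i\<in>I. \<Sum>j\<in>I. if i = j then A i j else 0)"
      using I by (intro sum.cong refl) (simp add: gaussP_cov)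
    finally show ?thesis using I by (simp add: sum.delta)
  qed
  then show "(\<integral>g. (\<Sum>i\<in>I. \<Sum>j\<in>I. A i j * (g i * g j)) \<partial>gaussP I) = (\<Sum>i\<in>I. A i i)" unfolding q_def .
  have upd: "(\<Sum>j\<in>I. f j * (g(k := x)) j) = f k * x + (\<Sum>j\<in>I - {k}. f j * g j)" if "k \<in> I" for f k x and g :: "'i \<Rightarrow> real"
    using I that by (subst sum.remove[of I k]) (auto intro!: sum.cong)
  have dl: "((\<lambda>x. l i (g(k := x))) has_real_derivative A i k) (at x)" if "k \<in> I" for i k g x
    unfolding l_def upd[OF that] by (auto intro!: derivative_eq_intros)
  have ql: "q g = (\<Sum>i\<in>I. g i * l i g)" for g
    unfolding q_def l_def by (simp add: sum_distrib_left mult_ac)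
  have dq: "((\<lambda>x. q (g(k := x))) has_real_derivative 2 * l k (g(k := x))) (at x)" if k: "k \<in> I" for k g x
  proof -
    have dg: "((\<lambda>x. (g(k := x)) i) has_real_derivative (if i = k then 1 else 0)) (at x)" for i
      by (cases "i = k") (auto intro!: derivative_eq_intros)
    have "((\<lambda>x. \<Sum>i\<in>I. (g(k := x)) i * l i (g(k := x))) has_real_derivative
        (\<Sum>i\<in>I. (g(k := x)) i * A i k + (if i = k then 1 else 0) * l i (g(k := x)))) (at x)"
      by (intro DERIV_sum DERIV_mult' dg dl k)
    moreover have "(\<Sum>i\<in>I. (g(k := x)) i * A i k + (if i = k then 1 else 0) * l i (g(k := x))) = 2 * l k (g(k := x))"
    proof -
      have "(\<Sum>i\<in>I. (g(k := x)) i * A i k) = l k (g(k := x))"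
        unfolding l_def using sym[OF _ k] by (intro sum.cong refl) (simp add: mult.commute)
      moreover have "(\<Sum>i\<in>I. (if i = k then 1 else 0) * l i (g(k := x))) = l k (g(k := x))"
        using I k by (simp add: if_distrib[of "\<lambda>y. y * _"] sum.delta cong: if_cong)
      ultimately show ?thesis by (simp only: sum.distrib mult_2)
    qed
    ultimately show ?thesis unfolding ql by simp
  qed
  have cl: "continuous_on UNIV (\<lambda>x. l i (g(k := x)))" "continuous_on UNIV (\<lambda>x. q (g(k := x)))" if "k \<in> I" for i k g
    using DERIV_isCont[OF dl[OF that]] DERIV_isCont[OF dq[OF that]] continuous_at_imp_continuous_on by blast+
  have bp: "(\<integral>g. g k * (l k g * q g) \<partial>gaussP I) = (\<integral>g. A k k * q g + 2 * (l k g)\<^sup>2 \<partial>gaussP I)" if k: "k \<in> I" for k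
  proof (rule gaussP_by_parts[OF I k])
    show "exp_bounded I (\<lambda>g. l k g * q g)" by (intro exp_bounded_mult lb qb)
    show "exp_bounded I (\<lambda>g. A k k * q g + 2 * (l k g)\<^sup>2)"
      by (intro exp_bounded_add exp_bounded_mult exp_bounded_const exp_bounded_power lb qb)
    show "((\<lambda>x. l k (g(k := x)) * q (g(k := x))) has_real_derivative A k k * q (g(k := x)) + 2 * (l k (g(k := x)))\<^sup>2) (at x)" for g x
      by (auto intro!: DERIV_mult'[OF dl[OF k] dq[OF k], THEN DERIV_cong] simp: power2_eq_square)
    show "continuous_on UNIV (\<lambda>x. A k k * q (g(k := x)) + 2 * (l k (g(k := x)))\<^sup>2)" for g
      by (intro continuous_intros cl k)
  qed
  have i1: "integrable (gaussP I) (\<lambda>g. g k * (l k g * q g))" if "k \<in> I" for k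
    using that by (intro exp_bounded_integrable exp_bounded_mult exp_bounded_component lb qb I)
  have iq: "integrable (gaussP I) q" and il: "integrable (gaussP I) (\<lambda>g. (l k g)\<^sup>2)" for k
    by (intro exp_bounded_integrable exp_bounded_power lb qb I)+
  have "(\<integral>g. (q g)\<^sup>2 \<partial>gaussP I) = (\<integral>g. (\<Sum>k\<in>I. g k * (l k g * q g)) \<partial>gaussP I)"
    by (simp add: power2_eq_square ql[of _] sum_distrib_right mult.assoc)
  also have "\<dots> = (\<Sum>k\<in>I. A k k * (\<integral>g. q g \<partial>gaussP I) + 2 * (\<integral>g. (l k g)\<^sup>2 \<partial>gaussP I))"
    using i1 iq il by (simp add: Bochner_Integration.integral_sum bp cong: sum.cong_simp)
  also have "\<dots> = (\<Sum>i\<in>I. A i i)\<^sup>2 + 2 * (\<Sum>i\<in>I. \<Sum>j\<in>I. (A i j)\<^sup>2)"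
    unfolding l_def gaussP_linear_sq[OF I] Eq
    by (simp only: sum.distrib sum_distrib_right[symmetric] sum_distrib_left[symmetric] power2_eq_square)
  finally show "(\<integral>g. (\<Sum>i\<in>I. \<Sum>j\<in>I. A i j * (g i * g j))\<^sup>2 \<partial>gaussP I) = (\<Sum>i\<in>I. A i i)\<^sup>2 + 2 * (\<Sum>i\<in>I. \<Sum>j\<in>I. (A i j)\<^sup>2)"
    unfolding q_def .
qed

text \<open>Shifting the integration variable by \<open>s\<close> and \<open>-s\<close> and applying Jensen's inequality to the average of the two bounds
  removes all terms that are odd in \<open>s\<close>.\<close>

lemma shifted_lower_bound:
  fixes s :: "nat \<Rightarrow> real" and J :: "nat \<times> nat \<Rightarrow> real" and \<beta> lam v a b :: real
  assumes N: "N > 0" and \<beta>: "\<beta> > 0" and b: "b \<ge> 0" and nz: "emeasure (gaussP {..<N}) (shell N a b) \<noteq> 0"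
    and v: "v \<ge> 1 - lam"
  defines "\<mu> \<equiv> restrict_space (gaussP {..<N}) (shell N a b)"
  defines "E \<equiv> \<lambda>z. (1 - v) / 2 * sqnorm N z + field_exponent (bonds N) (coupling \<beta> N) 1 J z"
  shows "ln (Z_N N \<beta> lam J) \<ge> ln (\<integral>z. exp (E z) \<partial>\<mu>) + real N * a * (v - (1 - lam)) / 2
     + \<beta> / sqrt (2 * real N) * (\<Sum>i<N. \<Sum>j<N. J (i, j) * (s i * s j))
     - \<beta>\<^sup>2 / (4 * real N) * (sqnorm N s)\<^sup>2 - ((1 - lam) + \<beta>\<^sup>2 * b) / 2 * sqnorm N s
     - \<beta> * sqrt (2 / real N) * (\<Sum>i<N. \<Sum>j<N. s i * s j * (\<integral>z. coupling \<beta> N (i, j) z \<partial>gibbs \<mu> E))"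
proof -
  let ?g = "gaussP {..<N}"
  note sf = shell_facts[where N = N and a = a and b = b, folded \<mu>_def]
  have mu: "finite_measure \<mu>" "emeasure \<mu> (space \<mu>) \<noteq> 0" using sf(1,3) nz by auto
  have fb: "finite (bonds N)" by simp
  have B0: "0 \<le> \<bar>\<beta>\<bar> / sqrt (2 * real N) * (real N * \<bar>b\<bar>)" by simp
  define CE where "CE = \<bar>(1 - v) / 2\<bar> * (real N * b) + sqrt 1 * (\<bar>\<beta>\<bar> / sqrt (2 * real N) * (real N * \<bar>b\<bar>) * (\<Sum>k\<in>bonds N. \<bar>J k\<bar>) + real (card (bonds N)) * (\<bar>\<beta>\<bar> / sqrt (2 * real N) * (real N * \<bar>b\<bar>))\<^sup>2)"
  have Em: "E \<in> borel_measurable \<mu>"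
    unfolding E_def using energy_bound(1)[OF mu sf(4) sf(5) fb sf(6) sf(7) B0, where t = 1] by simp
  have Eb: "\<bar>E z\<bar> \<le> CE" if "z \<in> space \<mu>" for z
    unfolding E_def CE_def using energy_bound(2)[OF mu sf(4) sf(5) fb sf(6) sf(7) B0, where t = 1] that by simp
  define H where "H z = lam / 2 * sqnorm N z + field_exponent (bonds N) (coupling \<beta> N) 1 J z" for z
  define add where "add s x = (\<lambda>i\<in>{..<N}. x i + s i)" for s x :: "nat \<Rightarrow> real"
  \<comment> \<open>The exponent of the original model after the shift, together with the
    Cameron-Martin weight: its exponential integrates to \<open>Z_N\<close> over the whole
    space.\<close>
  define F where "F s x = H (add s x) - (\<Sum>i<N. s i * x i) - sqnorm N s / 2" for s x
  have addm: "add s \<in> measurable ?g ?g" for s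
    unfolding add_def[abs_def] by (rule measurable_gaussP_restrict) measurable
  have Hm: "H \<in> borel_measurable ?g" unfolding H_def[abs_def] by (rule measurable_energy)
  have Fm: "F s \<in> borel_measurable ?g" for s
  proof -
    note [measurable] = measurable_compose[OF addm Hm]
    show ?thesis unfolding F_def[abs_def] by measurable
  qed
  have Fm': "F s \<in> borel_measurable \<mu>" for s unfolding \<mu>_def by (rule measurable_restrict_space1[OF Fm])
  \<comment> \<open>A crude coordinate bound on the shell from 2 |x i| \<le> (x i)^2 + 1. It serves
    boundedness only and enters no estimate.\<close>
  define X where "X = 1 + real N * b"
  have xb: "\<bar>x i\<bar> \<le> X" if "x \<in> space \<mu>" "i < N" for x i
  proof -
    have "(x i)\<^sup>2 \<le> sqnorm N x" unfolding sqnorm_def using that by (intro member_le_sum) auto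
    also have "\<dots> \<le> real N * b" using that sf(2) by (auto simp: shell_def)
    finally have 1: "(x i)\<^sup>2 \<le> real N * b" .
    have "0 \<le> (\<bar>x i\<bar> - 1)\<^sup>2" by simp
    then have "2 * \<bar>x i\<bar> \<le> (x i)\<^sup>2 + 1" by (simp add: power2_eq_square algebra_simps abs_mult_self_eq)
    then show ?thesis using 1 mult_nonneg_nonneg[OF _ b, of "real N"] unfolding X_def by simp
  qed
  have Fb: "\<exists>C. \<forall>x\<in>space \<mu>. \<bar>F s x\<bar> \<le> C" for s
  proof -
    define R where "R = (\<Sum>i<N. (X + \<bar>s i\<bar>)\<^sup>2)"
    define B where "B = \<bar>\<beta>\<bar> / sqrt (2 * real N) * R"
    have R0: "R \<ge> 0" unfolding R_def by (simp add: sum_nonneg)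
    then have B0: "B \<ge> 0" unfolding B_def by simp
    have "\<bar>F s x\<bar> \<le> (\<bar>lam\<bar> / 2 * R + sqrt 1 * (B * (\<Sum>p\<in>bonds N. \<bar>J p\<bar>) + real (card (bonds N)) * B\<^sup>2)) + (\<Sum>i<N. \<bar>s i\<bar> * X) + sqnorm N s / 2"
      if x: "x \<in> space \<mu>" for x
    proof -
      have "sqnorm N (add s x) \<le> R" unfolding sqnorm_def R_def
      proof (rule sum_mono)
        fix i assume i: "i \<in> {..<N}"
        have "\<bar>add s x i\<bar> \<le> X + \<bar>s i\<bar>" using xb[OF x, of i] i unfolding add_def by auto
        from power_mono[OF this, of 2] show "(add s x i)\<^sup>2 \<le> (X + \<bar>s i\<bar>)\<^sup>2" by simp
      qed
      note r = this sqnorm_nonneg[of N "add s x"]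
      have 1: "\<bar>lam / 2 * sqnorm N (add s x)\<bar> \<le> \<bar>lam\<bar> / 2 * R"
        unfolding abs_mult using r by (intro mult_mono) auto
      have cb: "\<bar>coupling \<beta> N p (add s x)\<bar> \<le> B" if "p \<in> bonds N" for p
        using coupling_bound[OF that, of \<beta> "add s x"] mult_left_mono[OF r(1), of "\<bar>\<beta>\<bar> / sqrt (2 * real N)"] unfolding B_def by simp
      have 2: "\<bar>field_exponent (bonds N) (coupling \<beta> N) 1 J (add s x)\<bar> \<le> sqrt 1 * (B * (\<Sum>p\<in>bonds N. \<bar>J p\<bar>) + real (card (bonds N)) * B\<^sup>2)"
        using field_exponent_bound[of "bonds N" "coupling \<beta> N" "add s x" B 1 J] fb cb B0 by simp
      have 3: "\<bar>\<Sum>i<N. s i * x i\<bar> \<le> (\<Sum>i<N. \<bar>s i\<bar> * X)"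
        using xb[OF x] by (intro order_trans[OF sum_abs] sum_mono) (auto simp: abs_mult intro!: mult_left_mono)
      show ?thesis unfolding F_def H_def using 1 2 3 sqnorm_nonneg[of N s] by linarith
    qed
    then show ?thesis by blast
  qed
  have ZF: "ln (Z_N N \<beta> lam J) \<ge> ln (\<integral>z. exp (E z) \<partial>\<mu>) + (\<integral>x. F s x - E x \<partial>gibbs \<mu> E)"
    and iFE: "integrable (gibbs \<mu> E) (\<lambda>x. F s x - E x)" for s
  proof -
    obtain C where C: "\<And>x. x \<in> space \<mu> \<Longrightarrow> \<bar>F s x\<bar> \<le> C" using Fb[of s] by blast
    have Dm: "(\<lambda>x. F s x - E x) \<in> borel_measurable \<mu>" using Fm'[of s] Em by measurable
    have Db: "\<bar>F s x - E x\<bar> \<le> C + CE" if "x \<in> space \<mu>" for x using C[OF that] Eb[OF that] by linarith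
    show "integrable (gibbs \<mu> E) (\<lambda>x. F s x - E x)"
      using prob_space.integral_abs_bound(1)[OF prob_space_gibbs[OF mu Em Eb], of "\<lambda>x. F s x - E x" "C + CE"] Dm Db
      by (simp cong: measurable_cong_sets)
    have iF: "integrable \<mu> (\<lambda>x. exp (F s x))" by (rule integrable_exp_bounded_energy[OF mu Fm' C])
    have pF: "(\<integral>x. exp (F s x) \<partial>\<mu>) > 0" by (rule partition_pos[OF mu Fm' C])
    have iH: "integrable ?g (\<lambda>z. exp (H z))" unfolding H_def using integrable_boltzmann[OF N] \<beta> by simp
    have "ennreal (\<integral>x. exp (F s x) \<partial>\<mu>) = (\<integral>\<^sup>+x. ennreal (exp (F s x)) \<partial>\<mu>)"
      by (rule nn_integral_eq_integral[OF iF, symmetric]) simp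
    \<comment> \<open>Giving up the shell enlarges the integral of a positive function; the formula
      for the shift then applies on the full space.\<close>
    also have "\<dots> \<le> (\<integral>\<^sup>+x. ennreal (exp (F s x)) \<partial>?g)"
    proof -
      have "shell N a b \<inter> space ?g \<in> sets ?g" by (rule sets.Int[OF sets_shell sets.top])
      from nn_integral_restrict_space[OF this] show ?thesis unfolding \<mu>_def
        by (auto intro!: nn_integral_mono simp: indicator_def)
    qed
    also have "\<dots> = (\<integral>\<^sup>+x. ennreal (exp (- (\<Sum>i<N. s i * x i) - (\<Sum>i<N. (s i)\<^sup>2) / 2)) * ennreal (exp (H (\<lambda>i\<in>{..<N}. x i + s i))) \<partial>?g)"
      by (intro nn_integral_cong) (simp add: F_def add_def sqnorm_def ennreal_mult[symmetric] exp_add[symmetric] algebra_simps)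
    also have "\<dots> = (\<integral>\<^sup>+z. ennreal (exp (H z)) \<partial>?g)"
      using Hm by (intro gaussP_shift[symmetric]) auto
    also have "\<dots> = ennreal (Z_N N \<beta> lam J)"
      unfolding Z_N_eq H_def[symmetric] by (rule nn_integral_eq_integral[OF iH]) simp
    finally have "(\<integral>x. exp (F s x) \<partial>\<mu>) \<le> Z_N N \<beta> lam J" using pF
      by (auto simp: ennreal_le_iff2)
    then have "ln (\<integral>x. exp (F s x) \<partial>\<mu>) \<le> ln (Z_N N \<beta> lam J)" using pF by (intro ln_mono) auto
    moreover have "ln (\<integral>z. exp (E z) \<partial>\<mu>) + (\<integral>x. F s x - E x \<partial>gibbs \<mu> E) \<le> ln (\<integral>x. exp (E x + (F s x - E x)) \<partial>\<mu>)"
      by (rule ln_partition_ge[OF mu Em Eb Dm Db])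
    ultimately show "ln (Z_N N \<beta> lam J) \<ge> ln (\<integral>z. exp (E z) \<partial>\<mu>) + (\<integral>x. F s x - E x \<partial>gibbs \<mu> E)" by simp
  qed
  let ?s' = "\<lambda>i. - s i"
  define A where "A z = (\<Sum>i<N. \<Sum>j<N. J (i, j) * (z i * z j))" for z
  define \<sigma> where "\<sigma> = sqnorm N s"
  define \<kappa> where "\<kappa> = real N * a * (v - (1 - lam)) / 2 + \<beta> / sqrt (2 * real N) * A s - \<beta>\<^sup>2 / (4 * real N) * \<sigma>\<^sup>2 - ((1 - lam) + \<beta>\<^sup>2 * b) / 2 * \<sigma>"
  define T where "T x = (\<Sum>i<N. \<Sum>j<N. s i * s j * coupling \<beta> N (i, j) x)" for x
  \<comment> \<open>In the sum over both signs the terms of odd order in s cancel, and the quartic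
    term leaves the products r \<sigma> and d^2. The shell bounds r from below where its coefficient
    is v - (1 - \<open>lam\<close>) \<ge> 0, and from above where it multiplies \<sigma>.\<close>
  have pointwise: "2 * \<kappa> - 2 * (\<beta> * sqrt (2 / real N)) * T x \<le> (F s x - E x) + (F ?s' x - E x)" if x: "x \<in> space \<mu>" for x
  proof -
    define r where "r = sqnorm N x"
    define d where "d = (\<Sum>i<N. s i * x i)"
    have rb: "real N * a \<le> r" "r \<le> real N * b" using x sf(2) unfolding r_def by (auto simp: shell_def)
    have A1: "A (add s x) = A x + A s + (\<Sum>i<N. \<Sum>j<N. J (i, j) * (x i * s j + s i * x j))"
      unfolding A_def add_def by (simp add: sum.distrib[symmetric] algebra_simps cong: sum.cong_simp)
    have A2: "A (add ?s' x) = A x + A s - (\<Sum>i<N. \<Sum>j<N. J (i, j) * (x i * s j + s i * x j))"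
      unfolding A_def add_def by (simp add: sum.distrib[symmetric] sum_subtractf[symmetric] algebra_simps cong: sum.cong_simp)
    have r1: "sqnorm N (add s x) = r + \<sigma> + 2 * d"
      unfolding r_def \<sigma>_def d_def sqnorm_def add_def
      by (simp add: sum.distrib[symmetric] sum_distrib_left power2_eq_square algebra_simps cong: sum.cong_simp)
    have r2: "sqnorm N (add ?s' x) = r + \<sigma> - 2 * d"
      unfolding r_def \<sigma>_def d_def sqnorm_def add_def
      by (simp add: sum.distrib[symmetric] sum_subtractf[symmetric] sum_distrib_left power2_eq_square algebra_simps cong: sum.cong_simp)
    have \<sigma>': "sqnorm N ?s' = \<sigma>" unfolding \<sigma>_def sqnorm_def by simp
    have fe: "field_exponent (bonds N) (coupling \<beta> N) 1 J z = \<beta> / sqrt (2 * real N) * A z - \<beta>\<^sup>2 / (4 * real N) * (sqnorm N z)\<^sup>2" for z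
      unfolding field_exponent_coupling A_def by (simp add: mult.assoc)
    \<comment> \<open>The squared overlap of shift and spin is a combination of the products x i x
      j, so its Gibbs mean is controlled by the means of \<open>coupling\<close>, which are small at
      high temperature.\<close>
    have dT: "\<beta>\<^sup>2 / real N * d\<^sup>2 = \<beta> * sqrt (2 / real N) * T x"
    proof -
      have "T x = \<beta> / sqrt (2 * real N) * d\<^sup>2"
        unfolding T_def d_def coupling_def power2_eq_square sum_product by (simp add: sum_distrib_left mult_ac)
      moreover have "sqrt (2 / real N) / sqrt (2 * real N) = 1 / real N"
        using N by (simp add: real_sqrt_divide real_sqrt_mult)
      moreover have "\<beta> * sqrt (2 / real N) * (\<beta> / sqrt (2 * real N) * d\<^sup>2)
          = \<beta>\<^sup>2 * d\<^sup>2 * (sqrt (2 / real N) / sqrt (2 * real N))"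
        by (simp add: power2_eq_square)
      ultimately show ?thesis by simp
    qed
    have "(F s x - E x) + (F ?s' x - E x) = (lam - 1 + v) * r + (lam - 1) * \<sigma> + 2 * (\<beta> / sqrt (2 * real N) * A s)
      - \<beta>\<^sup>2 / (2 * real N) * \<sigma>\<^sup>2 - \<beta>\<^sup>2 / real N * (r * \<sigma>) - 2 * (\<beta>\<^sup>2 / real N * d\<^sup>2)"
    proof -
      define p where "p = \<beta> / sqrt (2 * real N)"
      define c where "c = (\<Sum>i<N. \<Sum>j<N. J (i, j) * (x i * s j + s i * x j))"
      define n where "n = \<beta>\<^sup>2 / (4 * real N)"
      have n: "\<beta>\<^sup>2 / (2 * real N) = 2 * n" "\<beta>\<^sup>2 / real N = 4 * n" unfolding n_def by simp_all
      have F1: "F s x = lam / 2 * (r + \<sigma> + 2 * d) + (p * (A x + A s + c) - n * (r + \<sigma> + 2 * d)\<^sup>2) - d - \<sigma> / 2"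
        unfolding F_def H_def fe A1 r1 p_def n_def c_def d_def \<sigma>_def by simp
      have F2: "F ?s' x = lam / 2 * (r + \<sigma> - 2 * d) + (p * (A x + A s - c) - n * (r + \<sigma> - 2 * d)\<^sup>2) + d - \<sigma> / 2"
        unfolding F_def H_def fe A2 r2 p_def n_def c_def \<sigma>' by (simp add: d_def sum_negf)
      have E1: "E x = (1 - v) / 2 * r + (p * A x - n * r\<^sup>2)" unfolding E_def fe r_def p_def n_def ..
      show ?thesis unfolding F1 F2 E1 n p_def[symmetric] by (simp add: power2_eq_square field_simps)
    qed
    moreover have "(v - (1 - lam)) * (real N * a) \<le> (v - (1 - lam)) * r" using rb v by (intro mult_left_mono) auto
    moreover have "\<beta>\<^sup>2 / real N * (r * \<sigma>) \<le> \<beta>\<^sup>2 * b * \<sigma>"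
    proof -
      have "\<beta>\<^sup>2 / real N * (r * \<sigma>) \<le> \<beta>\<^sup>2 / real N * ((real N * b) * \<sigma>)"
        using rb sqnorm_nonneg[of N s] unfolding \<sigma>_def by (intro mult_left_mono mult_right_mono) auto
      then show ?thesis using N by simp
    qed
    moreover have "2 * \<kappa> = (v - (1 - lam)) * (real N * a) + 2 * (\<beta> / sqrt (2 * real N) * A s) - \<beta>\<^sup>2 / (2 * real N) * \<sigma>\<^sup>2 - (1 - lam) * \<sigma> - \<beta>\<^sup>2 * b * \<sigma>"
      unfolding \<kappa>_def by (simp add: field_simps)
    moreover have "(lam - 1 + v) * r = (v - (1 - lam)) * r" "(lam - 1) * \<sigma> = - ((1 - lam) * \<sigma>)" by (simp_all add: algebra_simps)
    ultimately show ?thesis using dT by linarith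
  qed
  have gi: "integrable (gibbs \<mu> E) (coupling \<beta> N (i, j))" if "i < N" "j < N" for i j
  proof (rule prob_space.integral_abs_bound(1)[OF prob_space_gibbs[OF mu Em Eb]])
    show "coupling \<beta> N (i, j) \<in> borel_measurable (gibbs \<mu> E)"
      using sf(6)[of "(i, j)" \<beta>] that by (simp cong: measurable_cong_sets)
    show "\<bar>coupling \<beta> N (i, j) x\<bar> \<le> \<bar>\<beta>\<bar> / sqrt (2 * real N) * (real N * \<bar>b\<bar>)" if "x \<in> space (gibbs \<mu> E)" for x
      using sf(7)[of "(i, j)" x \<beta>] that \<open>i < N\<close> \<open>j < N\<close> by simp
  qed
  have iT: "integrable (gibbs \<mu> E) T" unfolding T_def[abs_def]
    by (intro Bochner_Integration.integrable_sum integrable_mult_right gi) auto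
  have ET: "(\<integral>x. T x \<partial>gibbs \<mu> E) = (\<Sum>i<N. \<Sum>j<N. s i * s j * (\<integral>z. coupling \<beta> N (i, j) z \<partial>gibbs \<mu> E))"
  proof -
    have 1: "integrable (gibbs \<mu> E) (\<lambda>x. s i * s j * coupling \<beta> N (i, j) x)" if "i \<in> {..<N}" "j \<in> {..<N}" for i j
      using that by (intro integrable_mult_right gi) auto
    show ?thesis unfolding T_def
    proof (subst Bochner_Integration.integral_sum)
      show "integrable (gibbs \<mu> E) (\<lambda>x. \<Sum>j<N. s i * s j * coupling \<beta> N (i, j) x)" if "i \<in> {..<N}" for i
        by (intro Bochner_Integration.integrable_sum 1 that)
      show "(\<Sum>i<N. \<integral>x. (\<Sum>j<N. s i * s j * coupling \<beta> N (i, j) x) \<partial>gibbs \<mu> E)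
        = (\<Sum>i<N. \<Sum>j<N. s i * s j * (\<integral>z. coupling \<beta> N (i, j) z \<partial>gibbs \<mu> E))"
      proof (rule sum.cong[OF refl])
        fix i assume i: "i \<in> {..<N}"
        show "(\<integral>x. (\<Sum>j<N. s i * s j * coupling \<beta> N (i, j) x) \<partial>gibbs \<mu> E)
          = (\<Sum>j<N. s i * s j * (\<integral>z. coupling \<beta> N (i, j) z \<partial>gibbs \<mu> E))"
          by (simp only: Bochner_Integration.integral_sum[OF 1[OF i]] integral_mult_right_zero)
      qed
    qed
  qed
  interpret G: prob_space "gibbs \<mu> E" by (rule prob_space_gibbs[OF mu Em Eb])
  have "(\<integral>x. 2 * \<kappa> - 2 * (\<beta> * sqrt (2 / real N)) * T x \<partial>gibbs \<mu> E) \<le> (\<integral>x. (F s x - E x) + (F ?s' x - E x) \<partial>gibbs \<mu> E)"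
  proof (rule integral_mono)
    show "integrable (gibbs \<mu> E) (\<lambda>x. 2 * \<kappa> - 2 * (\<beta> * sqrt (2 / real N)) * T x)"
      by (intro Bochner_Integration.integrable_diff integrable_mult_right iT) simp
    show "integrable (gibbs \<mu> E) (\<lambda>x. (F s x - E x) + (F ?s' x - E x))"
      by (intro Bochner_Integration.integrable_add iFE)
  qed (use pointwise in simp)
  also have "\<dots> = (\<integral>x. F s x - E x \<partial>gibbs \<mu> E) + (\<integral>x. F ?s' x - E x \<partial>gibbs \<mu> E)"
    by (rule Bochner_Integration.integral_add[OF iFE iFE])
  also have "(\<integral>x. 2 * \<kappa> - 2 * (\<beta> * sqrt (2 / real N)) * T x \<partial>gibbs \<mu> E) = 2 * \<kappa> - 2 * (\<beta> * sqrt (2 / real N)) * (\<integral>x. T x \<partial>gibbs \<mu> E)"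
    using iT G.prob_space by simp
  finally have "\<kappa> - \<beta> * sqrt (2 / real N) * (\<integral>x. T x \<partial>gibbs \<mu> E) \<le> ln (Z_N N \<beta> lam J) - ln (\<integral>z. exp (E z) \<partial>\<mu>)"
    using ZF[of s] ZF[of ?s'] by linarith
  then show ?thesis unfolding ET \<kappa>_def A_def \<sigma>_def by simp
qed

section \<open>The variational problem\<close>

lemma piecewise_order_param_facts:
  assumes "piecewise_order_param Q x"
  shows "Q \<ge> 0" and "\<And>f. continuous_on {0..Q} f \<Longrightarrow> (\<lambda>q. f q * x q) integrable_on {0..Q}"
    and "\<And>t. 0 \<le> t \<Longrightarrow> t < Q \<Longrightarrow> 0 \<le> x t \<and> x t \<le> 1"
    and "\<exists>S. finite S \<and> (\<forall>t\<in>{0<..<Q} - S. isCont x t)"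
proof -
  obtain K :: nat and q m :: "nat \<Rightarrow> real" where K: "K \<ge> 1" "q 0 = 0" "q K = Q" "\<And>a. a < K \<Longrightarrow> q a \<le> q (Suc a)"
    "0 \<le> m 1" "\<And>a. 1 \<le> a \<Longrightarrow> a < K \<Longrightarrow> m a \<le> m (Suc a)" "m K \<le> 1"
    "\<And>a t. 1 \<le> a \<Longrightarrow> a \<le> K \<Longrightarrow> q (a - 1) \<le> t \<Longrightarrow> t < q a \<Longrightarrow> x t = m a"
    using assms unfolding piecewise_order_param_def by blast
  have qm: "0 \<le> q a" if "a \<le> K" for a
    using that
  proof (induction a)
    case (Suc a)
    then show ?case using K(4)[of a] by simp
  qed (simp add: K)
  show Q: "Q \<ge> 0" using qm[of K] K by simp
  have mlow: "0 \<le> m (Suc a)" if "Suc a \<le> K" for a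
    using that by (induction a) (use K(5,6) in \<open>auto intro: order_trans\<close>)
  have mup: "m (K - a) \<le> 1" if "a < K" for a
    using that
  proof (induction a)
    case (Suc a)
    have "m (K - Suc a) \<le> m (Suc (K - Suc a))" using Suc by (intro K(6)) auto
    moreover have "Suc (K - Suc a) = K - a" using Suc by auto
    ultimately show ?case using Suc by simp
  qed (use K in auto)
  have piece: "\<exists>a. a < K \<and> q a \<le> t \<and> t < q (Suc a)" if t: "0 \<le> t" "t < Q" for t
  proof -
      \<comment> \<open>The first right endpoint beyond t. Minimality yields q a \<le> t even if
        some pieces are empty because neighbouring endpoints coincide.\<close>
      define a where "a = (LEAST a. t < q (Suc a))"
      have ex: "t < q (Suc (K - 1))" using t K by simp
      have 1: "t < q (Suc a)" unfolding a_def by (rule LeastI[of "\<lambda>a. t < q (Suc a)", OF ex])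
      have 2: "a \<le> K - 1" unfolding a_def by (rule Least_le[of "\<lambda>a. t < q (Suc a)", OF ex])
      have "q a \<le> t"
      proof (cases a)
        case (Suc b)
        then have "\<not> t < q (Suc b)" using not_less_Least[of b "\<lambda>a. t < q (Suc a)"] unfolding a_def[symmetric] by simp
        then show ?thesis using Suc by simp
      qed (use K t in simp)
      then show ?thesis using 1 2 K(1) by (intro exI[of _ a]) auto
  qed
  show "\<exists>S. finite S \<and> (\<forall>t\<in>{0<..<Q} - S. isCont x t)"
  proof (intro exI[of _ "q ` {..K}"] conjI ballI)
    fix t assume t: "t \<in> {0<..<Q} - q ` {..K}"
    then obtain a where a: "a < K" "q a \<le> t" "t < q (Suc a)" using piece[of t] by auto
    then have "q a < t" using t by (metis DiffD2 atMost_iff image_eqI le_less less_imp_le)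
    have "\<forall>\<^sub>F y in nhds t. y \<in> {q a<..<q (Suc a)}"
      using \<open>q a < t\<close> a by (intro eventually_nhds_in_open) auto
    then have "\<forall>\<^sub>F y in nhds t. x y = m (Suc a)"
      by eventually_elim (use K(8)[of "Suc a"] a in auto)
    then show "isCont x t" by (subst isCont_cong[where g = "\<lambda>_. m (Suc a)"]) auto
  qed simp
  show "0 \<le> x t \<and> x t \<le> 1" if t: "0 \<le> t" "t < Q" for t
  proof -
    obtain a where a: "a < K" "q a \<le> t" "t < q (Suc a)" using piece[OF t] by blast
    have "x t = m (Suc a)" using K(8)[of "Suc a" t] a by simp
    moreover have "m (Suc a) \<le> 1" using mup[of "K - Suc a"] a by simp
    ultimately show ?thesis using mlow[of a] a by simp
  qed
  show "(\<lambda>s. f s * x s) integrable_on {0..Q}" if f: "continuous_on {0..Q} f" for f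
  proof -
    have mono: "q a \<le> q b" if "a \<le> b" "b \<le> K" for a b
      using that by (induction b) (use K(4) in \<open>auto simp: le_Suc_eq intro: order_trans\<close>)
    have "(\<lambda>s. f s * x s) integrable_on {0..q a}" if "a \<le> K" for a
      using that
    proof (induction a)
      case 0
      show ?case using has_integral_integrable[OF has_integral_refl(2)] K(2) by simp
    next
      case (Suc a)
      have "(\<lambda>s. f s * m (Suc a)) integrable_on {q a..q (Suc a)}"
        using qm[of a] mono[of "Suc a" K] K(3) Suc.prems
        by (intro integrable_continuous_interval continuous_intros continuous_on_subset[OF f]) auto
      \<comment> \<open>The pieces are half-open, so the value of x at the right endpoint may differ
        from the constant and is changed at that single point.\<close>
      then have "(\<lambda>s. f s * x s) integrable_on {q a..q (Suc a)}"
        by (rule integrable_spike[of _ _ "{q (Suc a)}"])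
           (use K(8)[of "Suc a"] Suc.prems in auto)
      then show ?case
        using Suc by (intro Henstock_Kurzweil_Integration.integrable_combine[OF qm[of a] K(4)[of a]]) simp_all
    qed
    from this[of K] show ?thesis using K(3) by simp
  qed
qed

text \<open>Integrate the derivative of q times the tail integral of x, which vanishes at both ends.
  The fundamental theorem with finitely many exceptional points takes care of the jumps of
  x.\<close>

lemma integral_tail_parts:
  fixes x :: "real \<Rightarrow> real"
  assumes Q: "0 \<le> Q" and x: "x integrable_on {0..Q}" and S: "finite S" "\<And>t. t \<in> {0<..<Q} - S \<Longrightarrow> isCont x t"
    and qx: "(\<lambda>q. q * x q) integrable_on {0..Q}"
  shows "continuous_on {0..Q} (\<lambda>q. integral {q..Q} x)"
    and "integral {0..Q} (\<lambda>q. q * x q) = integral {0..Q} (\<lambda>q. integral {q..Q} x)"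
proof -
  have split: "integral {q..Q} x = integral {0..Q} x - integral {0..q} x" if "q \<in> {0..Q}" for q
    using Henstock_Kurzweil_Integration.integral_combine[of 0 q Q x] that x by auto
  have c: "continuous_on {0..Q} (\<lambda>q. integral {0..Q} x - integral {0..q} x)"
    by (intro continuous_intros indefinite_integral_continuous_1 x)
  then show c': "continuous_on {0..Q} (\<lambda>q. integral {q..Q} x)"
    by (rule continuous_on_eq) (rule split[symmetric])
  have i\<phi>: "(\<lambda>q. integral {q..Q} x) integrable_on {0..Q}" by (rule integrable_continuous_interval[OF c'])
  have "((\<lambda>q. integral {q..Q} x - q * x q) has_integral
      Q * (integral {0..Q} x - integral {0..Q} x) - 0 * (integral {0..Q} x - integral {0..0} x)) {0..Q}"
  proof (rule fundamental_theorem_of_calculus_interior_strong[OF S(1) Q])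
    show "continuous_on {0..Q} (\<lambda>q. q * (integral {0..Q} x - integral {0..q} x))"
      by (intro continuous_intros c)
    fix t assume t: "t \<in> {0<..<Q} - S"
    then have t': "t \<in> {0..Q}" by auto
    have "((\<lambda>u. integral {0..u} x) has_vector_derivative x t) (at t within {0..Q})"
      using integral_has_vector_derivative_continuous_at[OF x, of t "{}"] S(2)[OF t] t'
      by (simp add: continuous_at_imp_continuous_at_within)
    then have "((\<lambda>u. integral {0..u} x) has_vector_derivative x t) (at t)"
      using t by (subst (asm) at_within_interior) auto
    then have "((\<lambda>u. integral {0..u} x) has_real_derivative x t) (at t)"
      by (simp add: has_real_derivative_iff_has_vector_derivative)
    then have "((\<lambda>u. u * (integral {0..Q} x - integral {0..u} x)) has_real_derivative
       (integral {0..Q} x - integral {0..t} x) - t * x t) (at t)"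
      by (auto intro!: derivative_eq_intros)
    then show "((\<lambda>u. u * (integral {0..Q} x - integral {0..u} x)) has_vector_derivative integral {t..Q} x - t * x t) (at t)"
      using split[OF t'] by (simp add: has_real_derivative_iff_has_vector_derivative)
  qed
  then have "integral {0..Q} (\<lambda>q. integral {q..Q} x - q * x q) = 0" by (simp add: integral_unique)
  then show "integral {0..Q} (\<lambda>q. q * x q) = integral {0..Q} (\<lambda>q. integral {q..Q} x)"
    using Henstock_Kurzweil_Integration.integral_diff[OF i\<phi> qx] by simp
qed

text \<open>The difference of the two sides has derivative (1 - z)^2/z up to sign and vanishes at 1:
  the quadratic touches the logarithm to second order there. It settles the case of an order
  parameter ending before the replica symmetric value.\<close>

lemma ln_le_second_order:
  assumes "0 < y" "y \<le> (1::real)"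
  shows "ln y \<le> 2 * y - y\<^sup>2 / 2 - 3 / 2"
proof -
  have "ln y - 2 * y + y\<^sup>2 / 2 \<le> ln 1 - 2 * 1 + 1\<^sup>2 / 2"
  proof (rule DERIV_nonneg_imp_nondecreasing[OF assms(2)])
    fix z assume z: "y \<le> z" "z \<le> 1"
    have "((\<lambda>y. ln y - 2 * y + y\<^sup>2 / 2) has_real_derivative (1 - z)\<^sup>2 / z) (at z)"
      using z assms by (auto intro!: derivative_eq_intros simp: field_simps power2_eq_square)
    then show "\<exists>d. ((\<lambda>y. ln y - 2 * y + y\<^sup>2 / 2) has_real_derivative d) (at z) \<and> 0 \<le> d"
      using z assms by (intro exI conjI) auto
  qed
  then show ?thesis by simp
qed

section \<open>Minimality of the replica symmetric parameter\<close>

context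
  fixes \<beta> lam :: real
  assumes \<beta>: "\<beta> > 0"
begin

text \<open>A complementary slackness pair: U \<ge> \<beta> always, with equality as soon as q is
  nonzero.\<close>

lemma q_RS_facts:
  shows "q_RS \<beta> lam \<ge> 0" and "1 - lam + \<beta>\<^sup>2 * q_RS \<beta> lam > 0" and "1 - lam + \<beta>\<^sup>2 * q_RS \<beta> lam \<ge> \<beta>"
    and "q_RS \<beta> lam * (\<beta> - (1 - lam) - \<beta>\<^sup>2 * q_RS \<beta> lam) = 0"
    and "q_RS \<beta> lam \<noteq> 0 \<Longrightarrow> 1 - lam + \<beta>\<^sup>2 * q_RS \<beta> lam = \<beta>"
  using \<beta> unfolding q_RS_def by (auto simp: field_simps)

lemma q_RS_in_param_set: "(q_RS \<beta> lam, \<lambda>_. 0) \<in> param_set \<beta> lam"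
proof -
  have "piecewise_order_param (q_RS \<beta> lam) (\<lambda>_. 0)"
    unfolding piecewise_order_param_def
    by (rule exI[of _ 1], rule exI[of _ "\<lambda>a. if a = 0 then 0 else q_RS \<beta> lam"], rule exI[of _ "\<lambda>_. 0"])
       (use q_RS_facts in auto)
  then show ?thesis using q_RS_facts unfolding param_set_def by simp
qed

text \<open>The two expressions agree because q (\<beta> - U) = 0. The first is the value produced
  by the upper bound, the second the one met in the lower bound and in the variational
  problem.\<close>

lemma A_hat_q_RS:
  defines "q \<equiv> q_RS \<beta> lam" and "u \<equiv> 1 - lam + \<beta>\<^sup>2 * q_RS \<beta> lam"
  shows "A_hat \<beta> lam (q, \<lambda>_. 0) = - ln u / 2 + \<beta>\<^sup>2 * q / (2 * u) + \<beta>\<^sup>2 * q\<^sup>2 / 4"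
    and "A_hat \<beta> lam (q, \<lambda>_. 0) = - ln u / 2 + \<beta> * q - (1 - lam) * q / 2 - \<beta>\<^sup>2 * q\<^sup>2 / 4"
proof -
  have u: "u > 0" and q: "q \<ge> 0" using q_RS_facts unfolding u_def q_def by auto
  have s: "sigma \<beta> lam q = 1 / sqrt u" by (simp add: sigma_def u_def q_def)
  show 1: "A_hat \<beta> lam (q, \<lambda>_. 0) = - ln u / 2 + \<beta>\<^sup>2 * q / (2 * u) + \<beta>\<^sup>2 * q\<^sup>2 / 4"
    unfolding A_hat_def using u q by (simp add: s ln_div ln_sqrt power_divide)
  show "A_hat \<beta> lam (q, \<lambda>_. 0) = - ln u / 2 + \<beta> * q - (1 - lam) * q / 2 - \<beta>\<^sup>2 * q\<^sup>2 / 4"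
  proof (cases "q = 0")
    case True
    then show ?thesis unfolding 1 by simp
  next
    case False
    then have ub: "u = \<beta>" using q_RS_facts(5) unfolding u_def q_def by simp
    have "q * (\<beta> - (1 - lam) - \<beta>\<^sup>2 * q) = 0" using q_RS_facts(4) unfolding q_def .
    then show ?thesis unfolding 1 ub using \<beta> by (simp add: field_simps power2_eq_square)
  qed
qed

proposition A_hat_minimal:
  assumes p: "p \<in> param_set \<beta> lam"
  shows "A_hat \<beta> lam (q_RS \<beta> lam, \<lambda>_. 0) \<le> A_hat \<beta> lam p"
proof -
  obtain Q x where pQ: "p = (Q, x)" by (cases p)
  define w where "w = 1 - lam"
  define u where "u = w + \<beta>\<^sup>2 * Q"
  have Q: "Q \<ge> 0" and u: "u > 0" and px: "piecewise_order_param Q x"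
    and less: "\<And>q. q \<in> {0..Q} \<Longrightarrow> \<beta>\<^sup>2 * (sigma \<beta> lam Q)\<^sup>2 * integral {q..Q} x < 1"
    using p unfolding pQ param_set_def u_def w_def by auto
  have s: "sigma \<beta> lam Q = 1 / sqrt u" by (simp add: sigma_def u_def w_def)
  have s2: "(sigma \<beta> lam Q)\<^sup>2 = 1 / u" unfolding s using u by (simp add: power_divide)
  note pp = piecewise_order_param_facts[OF px]
  have ix: "x integrable_on {0..Q}" using pp(2)[of "\<lambda>_. 1"] by simp
  have iqx: "(\<lambda>q. q * x q) integrable_on {0..Q}" using pp(2)[of "\<lambda>q. q"] by simp
  obtain S where S: "finite S" "\<And>t. t \<in> {0<..<Q} - S \<Longrightarrow> isCont x t" using pp(4) by blast
  define \<phi> where "\<phi> q = integral {q..Q} x" for q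
  have c\<phi>: "continuous_on {0..Q} \<phi>" and parts: "integral {0..Q} (\<lambda>q. q * x q) = integral {0..Q} \<phi>"
    using integral_tail_parts[OF Q ix S iqx] unfolding \<phi>_def[abs_def] by auto
  have \<phi>b: "0 \<le> \<phi> q" "\<phi> q \<le> Q - q" if q: "q \<in> {0..Q}" for q
  proof -
    have i: "x integrable_on {q..Q}" using ix by (rule integrable_on_subinterval) (use q in auto)
    \<comment> \<open>The order parameter is prescribed on the half-open interval only, so its value
      at Q is replaced before bounding it by 0 and 1.\<close>
    define x' where "x' t = (if t = Q then 0 else x t)" for t
    have e: "integral {q..Q} x = integral {q..Q} x'"
      by (rule integral_spike[of "{Q}"]) (auto simp: x'_def)
    have i': "x' integrable_on {q..Q}" by (rule integrable_spike[OF i, of "{Q}"]) (auto simp: x'_def)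
    have b: "0 \<le> x' t" "x' t \<le> 1" if "t \<in> {q..Q}" for t using pp(3)[of t] that q unfolding x'_def by auto
    show "0 \<le> \<phi> q" unfolding \<phi>_def e by (rule integral_nonneg[OF i']) (use b in auto)
    have "integral {q..Q} x' \<le> integral {q..Q} (\<lambda>_. 1)" by (rule integral_le[OF i']) (use b in auto)
    then show "\<phi> q \<le> Q - q" unfolding \<phi>_def e using q by simp
  qed
  define v where "v q = u - \<beta>\<^sup>2 * \<phi> q" for q
  have vpos: "v q > 0" if "q \<in> {0..Q}" for q
    using less[OF that] u unfolding s2 v_def \<phi>_def by (simp add: field_simps)
  have vlow: "w + \<beta>\<^sup>2 * q \<le> v q" if "q \<in> {0..Q}" for q
  proof -
    have "\<beta>\<^sup>2 * \<phi> q \<le> \<beta>\<^sup>2 * (Q - q)" using \<phi>b(2)[OF that] by (intro mult_left_mono) auto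
    then show ?thesis unfolding v_def u_def by (simp add: algebra_simps)
  qed
  have cv: "continuous_on {0..Q} v" unfolding v_def by (intro continuous_intros c\<phi>)
  define h where "h v = \<beta>\<^sup>2 / v + v" for v :: real
  have hint: "(\<lambda>q. h (v q)) integrable_on {0..Q}"
    unfolding h_def using vpos by (intro integrable_continuous_interval continuous_intros cv) force
  have h2: "h v \<ge> 2 * \<beta>" if "v > 0" for v
  proof -
    have "h v - 2 * \<beta> = (\<beta> - v)\<^sup>2 / v" using that by (simp add: h_def field_simps power2_eq_square)
    moreover have "\<dots> \<ge> 0" using that by simp
    ultimately show ?thesis by linarith
  qed
  have hmono: "h v0 \<le> h v" if "\<beta> \<le> v0" "v0 \<le> v" for v0 v
  proof -
    have v0: "v0 > 0" "v > 0" using that \<beta> by auto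
    have "\<beta> * \<beta> \<le> v0 * v" using that \<beta> by (intro mult_mono) auto
    then have "0 \<le> (v - v0) * (v0 * v - \<beta>\<^sup>2) / (v0 * v)"
      using that v0 by (intro divide_nonneg_pos mult_nonneg_nonneg) (auto simp: power2_eq_square)
    also have "\<dots> = h v - h v0" using v0 by (simp add: h_def field_simps power2_eq_square)
    finally show ?thesis by simp
  qed
  \<comment> \<open>Integration by parts replaces the integral of q x(q) by that of \<phi>, and
    \<phi> = (u - v)/\<beta>^2. The two remaining integrals then combine into that of h(v).\<close>
  have A: "A_hat \<beta> lam p = - ln u / 2 + \<beta>\<^sup>2 / 4 * Q\<^sup>2 - u * Q / 2 + integral {0..Q} (\<lambda>q. h (v q)) / 2"
  proof -
    have iv: "(\<lambda>q. 1 / v q) integrable_on {0..Q}"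
      using vpos by (intro integrable_continuous_interval continuous_intros cv) force
    have i\<phi>: "\<phi> integrable_on {0..Q}" by (rule integrable_continuous_interval[OF c\<phi>])
    have "integral {0..Q} (\<lambda>q. 1 / (1 - \<beta>\<^sup>2 * (sigma \<beta> lam Q)\<^sup>2 * integral {q..Q} x)) = integral {0..Q} (\<lambda>q. u * (1 / v q))"
      unfolding s2 v_def \<phi>_def using u by (intro integral_cong) (simp add: field_simps)
    also have "\<dots> = u * integral {0..Q} (\<lambda>q. 1 / v q)"
      by (rule Henstock_Kurzweil_Integration.integral_mult_right)
    finally have 1: "integral {0..Q} (\<lambda>q. 1 / (1 - \<beta>\<^sup>2 * (sigma \<beta> lam Q)\<^sup>2 * integral {q..Q} x)) = u * integral {0..Q} (\<lambda>q. 1 / v q)" .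
    have "integral {0..Q} (\<lambda>q. h (v q)) = integral {0..Q} (\<lambda>q. \<beta>\<^sup>2 * (1 / v q) + (u - \<beta>\<^sup>2 * \<phi> q))"
      by (simp add: h_def v_def)
    also have "\<dots> = \<beta>\<^sup>2 * integral {0..Q} (\<lambda>q. 1 / v q) + (u * Q - \<beta>\<^sup>2 * integral {0..Q} \<phi>)"
    proof -
      have a: "(\<lambda>q. \<beta>\<^sup>2 * (1 / v q)) integrable_on {0..Q}" using integrable_cmul[OF iv, of "\<beta>\<^sup>2"] by simp
      have b: "(\<lambda>q. \<beta>\<^sup>2 * \<phi> q) integrable_on {0..Q}" using integrable_cmul[OF i\<phi>, of "\<beta>\<^sup>2"] by simp
      have c: "(\<lambda>q::real. u) integrable_on {0..Q}"
        by (rule integrable_continuous_interval) (rule continuous_on_const)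
      have "integral {0..Q} (\<lambda>q::real. u) = u * Q" using Q by simp
      then show ?thesis
        by (simp only: Henstock_Kurzweil_Integration.integral_add[OF a Henstock_Kurzweil_Integration.integrable_diff[OF c b]]
            Henstock_Kurzweil_Integration.integral_diff[OF c b] Henstock_Kurzweil_Integration.integral_mult_right)
    qed
    finally have 2: "integral {0..Q} (\<lambda>q. h (v q)) = \<beta>\<^sup>2 * integral {0..Q} (\<lambda>q. 1 / v q) + (u * Q - \<beta>\<^sup>2 * integral {0..Q} \<phi>)" .
    have ls: "ln (sigma \<beta> lam Q) = - ln u / 2" unfolding s using u by (simp add: ln_div ln_sqrt)
    show ?thesis
      unfolding pQ A_hat_def prod.case unfolding 1 unfolding 2 parts ls s2 using u by (simp add: field_simps)
  qed
  define q where "q = q_RS \<beta> lam"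
  define U where "U = w + \<beta>\<^sup>2 * q"
  have q0: "q \<ge> 0" and U: "U > 0" "U \<ge> \<beta>" and qz: "q \<noteq> 0 \<Longrightarrow> U = \<beta>"
    using q_RS_facts unfolding q_def U_def w_def by auto
  have ARS: "A_hat \<beta> lam (q, \<lambda>_. 0) = - ln U / 2 + \<beta> * q - w * q / 2 - \<beta>\<^sup>2 * q\<^sup>2 / 4"
    using A_hat_q_RS(2) unfolding q_def U_def w_def .
  have "A_hat \<beta> lam (q, \<lambda>_. 0) \<le> A_hat \<beta> lam p"
  proof (cases "Q < q")
    \<comment> \<open>The stretch from Q to q is missing here, so bounding h by its minimum leaves a
      comparison of boundary terms. As q > 0 forces U = \<beta>, this becomes an inequality for y =
      u/\<beta> \<le> 1, namely \<open>ln_le_second_order\<close>.\<close>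
    case True
    then have Ub: "U = \<beta>" using qz Q by auto
    have "u \<le> U" using True unfolding u_def U_def by (simp add: mult_left_mono)
    then have ub: "u \<le> \<beta>" using Ub by simp
    have "integral {0..Q} (\<lambda>q. 2 * \<beta>) \<le> integral {0..Q} (\<lambda>q. h (v q))"
      using h2 vpos by (intro integral_le hint) auto
    then have 1: "A_hat \<beta> lam p \<ge> - ln u / 2 + \<beta>\<^sup>2 / 4 * Q\<^sup>2 - u * Q / 2 + \<beta> * Q"
      unfolding A using Q by (simp add: mult_ac)
    define y where "y = u / \<beta>"
    have y: "0 < y" "y \<le> 1" "u = \<beta> * y" using u ub \<beta> by (auto simp: y_def)
    have Qy: "\<beta>\<^sup>2 * Q = \<beta> * y - w" using y(3) unfolding u_def by simp
    have qy: "\<beta>\<^sup>2 * q = \<beta> - w" using Ub unfolding U_def by simp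
    have e1: "\<beta>\<^sup>2 / 4 * Q\<^sup>2 - u * Q / 2 + \<beta> * Q = (w\<^sup>2 / \<beta>\<^sup>2 - y\<^sup>2) / 4 + y - w / \<beta>"
    proof -
      have Q': "Q = (\<beta> * y - w) / \<beta>\<^sup>2" using Qy \<beta> by (simp add: field_simps)
      show ?thesis unfolding y(3) Q' using \<beta> by (simp add: field_simps power2_eq_square)
    qed
    have e2: "\<beta> * q - w * q / 2 - \<beta>\<^sup>2 * q\<^sup>2 / 4 = (w\<^sup>2 / \<beta>\<^sup>2 - 1) / 4 + 1 - w / \<beta>"
    proof -
      have q': "q = (\<beta> - w) / \<beta>\<^sup>2" using qy \<beta> by (simp add: field_simps)
      show ?thesis unfolding q' using \<beta> by (simp add: field_simps power2_eq_square)
    qed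
    have lu: "ln u = ln \<beta> + ln y" using y \<beta> by (simp add: ln_mult)
    have "- (ln \<beta> + ln y) / 2 = - ln \<beta> / 2 - ln y / 2" by (simp add: field_simps)
    then show ?thesis
      using 1 e1 e2 ln_le_second_order[OF y(1,2)] unfolding ARS Ub lu diff_divide_distrib
      by linarith
  next
    case False
    then have qQ: "q \<le> Q" by simp
    have "integral {0..Q} (\<lambda>q. h (v q)) = integral {0..q} (\<lambda>q. h (v q)) + integral {q..Q} (\<lambda>q. h (v q))"
      by (rule Henstock_Kurzweil_Integration.integral_combine[OF q0 qQ hint, symmetric])
    moreover have "integral {0..q} (\<lambda>q. 2 * \<beta>) \<le> integral {0..q} (\<lambda>q. h (v q))"
    proof (rule integral_le)
      show "(\<lambda>q. h (v q)) integrable_on {0..q}" by (rule integrable_on_subinterval[OF hint]) (use qQ in auto)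
      show "2 * \<beta> \<le> h (v t)" if "t \<in> {0..q}" for t using that qQ by (intro h2 vpos) auto
    qed (rule integrable_continuous_interval, rule continuous_on_const)
    moreover have "integral {q..Q} (\<lambda>t. h (w + \<beta>\<^sup>2 * t)) \<le> integral {q..Q} (\<lambda>q. h (v q))"
      and F: "integral {q..Q} (\<lambda>t. h (w + \<beta>\<^sup>2 * t)) = (ln u + w * Q + \<beta>\<^sup>2 * Q\<^sup>2 / 2) - (ln U + w * q + \<beta>\<^sup>2 * q\<^sup>2 / 2)"
    proof -
      \<comment> \<open>From q onwards the lower envelope of v is at least \<beta>, where h is
        increasing; this is why the bound by \<open>hmono\<close> starts exactly at q.\<close>
      have ge: "w + \<beta>\<^sup>2 * t \<ge> \<beta>" if "t \<in> {q..Q}" for t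
      proof -
        have "\<beta>\<^sup>2 * q \<le> \<beta>\<^sup>2 * t" using that by (intro mult_left_mono) auto
        then show ?thesis using U(2) unfolding U_def by linarith
      qed
      have "((\<lambda>t. h (w + \<beta>\<^sup>2 * t)) has_integral (ln (w + \<beta>\<^sup>2 * Q) + w * Q + \<beta>\<^sup>2 * Q\<^sup>2 / 2) - (ln (w + \<beta>\<^sup>2 * q) + w * q + \<beta>\<^sup>2 * q\<^sup>2 / 2)) {q..Q}"
      proof (rule fundamental_theorem_of_calculus[OF qQ])
        fix t assume t: "t \<in> {q..Q}"
        have "w + \<beta>\<^sup>2 * t > 0" using ge[OF t] \<beta> by linarith
        then have "((\<lambda>t. ln (w + \<beta>\<^sup>2 * t) + w * t + \<beta>\<^sup>2 * t\<^sup>2 / 2) has_real_derivative h (w + \<beta>\<^sup>2 * t)) (at t within {q..Q})"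
          unfolding h_def by (auto intro!: derivative_eq_intros simp: field_simps)
        then show "((\<lambda>t. ln (w + \<beta>\<^sup>2 * t) + w * t + \<beta>\<^sup>2 * t\<^sup>2 / 2) has_vector_derivative h (w + \<beta>\<^sup>2 * t)) (at t within {q..Q})"
          by (simp add: has_real_derivative_iff_has_vector_derivative)
      qed
      then have hi: "(\<lambda>t. h (w + \<beta>\<^sup>2 * t)) integrable_on {q..Q}"
        and "integral {q..Q} (\<lambda>t. h (w + \<beta>\<^sup>2 * t)) = (ln (w + \<beta>\<^sup>2 * Q) + w * Q + \<beta>\<^sup>2 * Q\<^sup>2 / 2) - (ln (w + \<beta>\<^sup>2 * q) + w * q + \<beta>\<^sup>2 * q\<^sup>2 / 2)"
        by (auto simp: integral_unique has_integral_integrable)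
      then show "integral {q..Q} (\<lambda>t. h (w + \<beta>\<^sup>2 * t)) = (ln u + w * Q + \<beta>\<^sup>2 * Q\<^sup>2 / 2) - (ln U + w * q + \<beta>\<^sup>2 * q\<^sup>2 / 2)"
        unfolding u_def U_def by simp
      show "integral {q..Q} (\<lambda>t. h (w + \<beta>\<^sup>2 * t)) \<le> integral {q..Q} (\<lambda>q. h (v q))"
      proof (rule integral_le[OF hi])
        show "(\<lambda>q. h (v q)) integrable_on {q..Q}" by (rule integrable_on_subinterval[OF hint]) (use q0 in auto)
        show "h (w + \<beta>\<^sup>2 * t) \<le> h (v t)" if "t \<in> {q..Q}" for t
          using ge[OF that] vlow[of t] that q0 by (intro hmono) auto
      qed
    qed
    moreover have "integral {0..q} (\<lambda>q. 2 * \<beta>) = 2 * (\<beta> * q)" using q0 by simp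
    moreover have "u * Q = w * Q + \<beta>\<^sup>2 * Q\<^sup>2" unfolding u_def by (simp add: power2_eq_square algebra_simps)
    moreover have "\<beta>\<^sup>2 / 4 * Q\<^sup>2 = \<beta>\<^sup>2 * Q\<^sup>2 / 4" by simp
    ultimately show ?thesis unfolding ARS A by linarith
  qed
  then show ?thesis unfolding q_def .
qed

end

section \<open>Averaging the shift over a Gaussian vector\<close>

lemma gaussP_linear_prod:
  assumes I: "finite I"
  shows "(\<integral>g. (\<Sum>j\<in>I. a j * g j) * (\<Sum>j\<in>I. b j * g j) \<partial>gaussP I) = (\<Sum>j\<in>I. a j * b j)"
proof -
  have i: "integrable (gaussP I) (\<lambda>g. (\<Sum>j\<in>I. c j * g j)\<^sup>2)" for c :: "'a \<Rightarrow> real"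
    using I by (intro exp_bounded_integrable exp_bounded_power exp_bounded_sum exp_bounded_mult exp_bounded_const exp_bounded_component)
  have e: "(\<Sum>j\<in>I. a j * g j) * (\<Sum>j\<in>I. b j * g j)
     = ((\<Sum>j\<in>I. (a j + b j) * g j)\<^sup>2 - (\<Sum>j\<in>I. (a j - b j) * g j)\<^sup>2) / 4" for g
    by (simp add: distrib_right left_diff_distrib sum.distrib sum_subtractf power2_eq_square algebra_simps)
  have "(\<integral>g. (\<Sum>j\<in>I. a j * g j) * (\<Sum>j\<in>I. b j * g j) \<partial>gaussP I) = ((\<Sum>j\<in>I. (a j + b j)\<^sup>2) - (\<Sum>j\<in>I. (a j - b j)\<^sup>2)) / 4"
    unfolding e using i[of "\<lambda>j. a j + b j"] i[of "\<lambda>j. a j - b j"] by (simp add: gaussP_linear_sq[OF I])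
  also have "\<dots> = (\<Sum>j\<in>I. a j * b j)"
    by (simp add: sum_subtractf[symmetric] sum_divide_distrib power2_eq_square algebra_simps)
  finally show ?thesis .
qed

lemma wtr_Suc:
  assumes N: "N > 0"
  shows "(\<Sum>i<N. \<Sum>l<N. J (i, l) * wpow N J k i l) = sqrt (2 * real N) / 2 * (real N * wtr N J (Suc k))"
proof -
  let ?s = "sqrt (2 * real N)"
  have "(\<Sum>i<N. wpow N J (Suc k) i i) = (\<Sum>i<N. \<Sum>l<N. wpow N J k i l * J (i, l) / ?s) + (\<Sum>i<N. \<Sum>l<N. wpow N J k i l * J (l, i) / ?s)"
    by (simp add: wigner_def sum.distrib[symmetric] add_divide_distrib distrib_left add.commute)
  also have "(\<Sum>i<N. \<Sum>l<N. wpow N J k i l * J (l, i) / ?s) = (\<Sum>l<N. \<Sum>i<N. wpow N J k l i * J (l, i) / ?s)"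
    by (subst sum.swap) (auto intro!: sum.cong simp: wpow_sym)
  also have "(\<Sum>i<N. \<Sum>l<N. wpow N J k i l * J (i, l) / ?s) + \<dots> = 2 / ?s * (\<Sum>i<N. \<Sum>l<N. J (i, l) * wpow N J k i l)"
    by (simp add: sum_distrib_left sum.distrib[symmetric] field_simps)
  finally show ?thesis using N by (simp add: wtr_def field_simps)
qed

text \<open>The bound for a shift by \<open>s\<close> is averaged over \<open>s = \<alpha> P g\<close> with \<open>g\<close> standard Gaussian, so that only traces
  enter and no eigenvector has to be selected.\<close>

lemma gaussian_shift_lower_bound:
  fixes P :: "nat \<Rightarrow> nat \<Rightarrow> real" and J :: "nat \<times> nat \<Rightarrow> real" and \<beta> lam v a b \<alpha> :: real
  assumes N: "N > 0" and \<beta>: "\<beta> > 0" and b: "b \<ge> 0" and nz: "emeasure (gaussP {..<N}) (shell N a b) \<noteq> 0"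
    and v: "v \<ge> 1 - lam" and sym: "\<And>i j. i < N \<Longrightarrow> j < N \<Longrightarrow> P i j = P j i"
  defines "\<mu> \<equiv> restrict_space (gaussP {..<N}) (shell N a b)"
  defines "E \<equiv> \<lambda>z. (1 - v) / 2 * sqnorm N z + field_exponent (bonds N) (coupling \<beta> N) 1 J z"
  defines "R \<equiv> \<lambda>i j. \<Sum>l<N. P i l * P l j"
  shows "ln (Z_N N \<beta> lam J) \<ge> ln (\<integral>z. exp (E z) \<partial>\<mu>) + real N * a * (v - (1 - lam)) / 2
     + \<beta> / sqrt (2 * real N) * \<alpha>\<^sup>2 * (\<Sum>i<N. \<Sum>j<N. J (i, j) * R i j)
     - \<beta>\<^sup>2 / (4 * real N) * \<alpha> ^ 4 * ((\<Sum>i<N. R i i)\<^sup>2 + 2 * (\<Sum>i<N. \<Sum>j<N. (R i j)\<^sup>2))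
     - ((1 - lam) + \<beta>\<^sup>2 * b) / 2 * \<alpha>\<^sup>2 * (\<Sum>i<N. R i i)
     - \<beta> * sqrt (2 / real N) * \<alpha>\<^sup>2 * (\<Sum>i<N. \<Sum>j<N. R i j * (\<integral>z. coupling \<beta> N (i, j) z \<partial>gibbs \<mu> E))"
proof -
  let ?g = "gaussP {..<N}"
  interpret g: prob_space ?g by (rule prob_space_gaussP)
  define G where "G i j = (\<integral>z. coupling \<beta> N (i, j) z \<partial>gibbs \<mu> E)" for i j
  define y where "y g i = (\<Sum>l<N. P i l * g l)" for g :: "nat \<Rightarrow> real" and i
  define c where "c i j = \<beta> / sqrt (2 * real N) * \<alpha>\<^sup>2 * J (i, j) - \<beta> * sqrt (2 / real N) * \<alpha>\<^sup>2 * G i j" for i j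
  define \<kappa> where "\<kappa> = ln (\<integral>z. exp (E z) \<partial>\<mu>) + real N * a * (v - (1 - lam)) / 2"
  define d where "d = ((1 - lam) + \<beta>\<^sup>2 * b) / 2 * \<alpha>\<^sup>2"
  define n where "n = \<beta>\<^sup>2 / (4 * real N) * \<alpha> ^ 4"
  define q where "q g = (\<Sum>i<N. \<Sum>j<N. R i j * (g i * g j))" for g :: "nat \<Rightarrow> real"
  have Rs: "R i j = R j i" if "i \<in> {..<N}" "j \<in> {..<N}" for i j
    unfolding R_def using that sym by (intro sum.cong refl) (simp add: mult.commute)
  have yq: "sqnorm N (y g) = q g" for g
  proof -
    have "sqnorm N (y g) = (\<Sum>i<N. \<Sum>l<N. \<Sum>m<N. (P i l * P i m) * (g l * g m))"
      unfolding sqnorm_def y_def power2_eq_square sum_product by (simp add: mult_ac)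
    also have "\<dots> = (\<Sum>l<N. \<Sum>i<N. \<Sum>m<N. (P i l * P i m) * (g l * g m))" by (rule sum.swap)
    also have "\<dots> = (\<Sum>l<N. \<Sum>m<N. \<Sum>i<N. (P i l * P i m) * (g l * g m))" by (intro sum.cong refl sum.swap)
    also have "\<dots> = q g"
      unfolding q_def R_def using sym by (intro sum.cong refl) (simp add: sum_distrib_right)
    finally show ?thesis .
  qed
  \<comment> \<open>The shifted bound for each fixed g, rewritten so that only quadratic forms of g
    and the square of one of them occur; all their Gaussian means are known.\<close>
  have pt: "\<kappa> + (\<Sum>i<N. \<Sum>j<N. c i j * (y g i * y g j)) - n * (q g)\<^sup>2 - d * q g \<le> ln (Z_N N \<beta> lam J)" for g
  proof -
    have sq: "sqnorm N (\<lambda>i. \<alpha> * y g i) = \<alpha>\<^sup>2 * q g"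
      unfolding yq[symmetric] sqnorm_def by (simp add: power_mult_distrib sum_distrib_left)
    have "(\<Sum>i<N. \<Sum>j<N. c i j * (y g i * y g j)) = \<beta> / sqrt (2 * real N) * (\<Sum>i<N. \<Sum>j<N. J (i, j) * ((\<alpha> * y g i) * (\<alpha> * y g j)))
        - \<beta> * sqrt (2 / real N) * (\<Sum>i<N. \<Sum>j<N. (\<alpha> * y g i) * (\<alpha> * y g j) * G i j)"
      unfolding c_def by (simp add: left_diff_distrib right_diff_distrib sum_subtractf sum_distrib_left power2_eq_square mult_ac)
    moreover have "n * (q g)\<^sup>2 = \<beta>\<^sup>2 / (4 * real N) * (\<alpha>\<^sup>2 * q g)\<^sup>2"
      unfolding n_def by (simp add: power_mult_distrib power_mult[symmetric])
    moreover have "d * q g = ((1 - lam) + \<beta>\<^sup>2 * b) / 2 * (\<alpha>\<^sup>2 * q g)" unfolding d_def by simp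
    moreover note shifted_lower_bound[OF N \<beta> b nz v, of J "\<lambda>i. \<alpha> * y g i", folded \<mu>_def, folded E_def, folded G_def, unfolded sq]
    ultimately show ?thesis unfolding \<kappa>_def E_def by linarith
  qed
  have yb: "exp_bounded {..<N} (\<lambda>g. y g i)" for i
    unfolding y_def by (intro exp_bounded_sum exp_bounded_mult exp_bounded_const exp_bounded_component) auto
  have qb: "exp_bounded {..<N} q"
    unfolding q_def by (intro exp_bounded_sum exp_bounded_mult exp_bounded_const exp_bounded_component) auto
  have fN: "finite {..<N}" by simp
  have iy: "integrable ?g (\<lambda>g. c i j * (y g i * y g j))" for i j
    by (intro exp_bounded_integrable exp_bounded_mult exp_bounded_const yb fN)
  have iq: "integrable ?g q" "integrable ?g (\<lambda>g. (q g)\<^sup>2)"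
    by (intro exp_bounded_integrable exp_bounded_power qb fN)+
  have ic: "integrable ?g (\<lambda>g. \<Sum>i<N. \<Sum>j<N. c i j * (y g i * y g j))"
    by (intro Bochner_Integration.integrable_sum iy)
  have ik: "integrable ?g (\<lambda>g. \<kappa>)" by simp
  have Ey: "(\<integral>g. y g i * y g j \<partial>?g) = R i j" if "i < N" "j < N" for i j
    unfolding y_def gaussP_linear_prod[OF fN] R_def using sym that by (intro sum.cong refl) auto
  have Ec: "(\<integral>g. (\<Sum>i<N. \<Sum>j<N. c i j * (y g i * y g j)) \<partial>?g) = (\<Sum>i<N. \<Sum>j<N. c i j * R i j)"
  proof -
    have "(\<integral>g. (\<Sum>i<N. \<Sum>j<N. c i j * (y g i * y g j)) \<partial>?g) = (\<Sum>i<N. \<Sum>j<N. c i j * (\<integral>g. y g i * y g j \<partial>?g))"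
      using iy by (simp only: Bochner_Integration.integral_sum Bochner_Integration.integrable_sum integral_mult_right_zero)
    also have "\<dots> = (\<Sum>i<N. \<Sum>j<N. c i j * R i j)" by (intro sum.cong refl) (simp add: Ey)
    finally show ?thesis .
  qed
  have Eq: "(\<integral>g. q g \<partial>?g) = (\<Sum>i<N. R i i)" "(\<integral>g. (q g)\<^sup>2 \<partial>?g) = (\<Sum>i<N. R i i)\<^sup>2 + 2 * (\<Sum>i<N. \<Sum>j<N. (R i j)\<^sup>2)"
    unfolding q_def by (rule gaussP_quadratic_form[OF fN Rs]; assumption)+
  \<comment> \<open>The right-hand side does not depend on g, so averaging the lower bound over g
    costs nothing.\<close>
  have "(\<integral>g. \<kappa> + (\<Sum>i<N. \<Sum>j<N. c i j * (y g i * y g j)) - n * (q g)\<^sup>2 - d * q g \<partial>?g) \<le> (\<integral>g. ln (Z_N N \<beta> lam J) \<partial>?g)"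
    by (rule integral_mono) (intro Bochner_Integration.integrable_diff Bochner_Integration.integrable_add ic ik integrable_mult_right iq, simp, rule pt)
  also have "\<dots> = ln (Z_N N \<beta> lam J)" by (simp add: g.prob_space)
  also have "(\<integral>g. \<kappa> + (\<Sum>i<N. \<Sum>j<N. c i j * (y g i * y g j)) - n * (q g)\<^sup>2 - d * q g \<partial>?g)
    = \<kappa> + (\<Sum>i<N. \<Sum>j<N. c i j * R i j) - n * ((\<Sum>i<N. R i i)\<^sup>2 + 2 * (\<Sum>i<N. \<Sum>j<N. (R i j)\<^sup>2)) - d * (\<Sum>i<N. R i i)"
    using ic iq by (simp add: Ec Eq g.prob_space)
  also have "(\<Sum>i<N. \<Sum>j<N. c i j * R i j) = \<beta> / sqrt (2 * real N) * \<alpha>\<^sup>2 * (\<Sum>i<N. \<Sum>j<N. J (i, j) * R i j)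
     - \<beta> * sqrt (2 / real N) * \<alpha>\<^sup>2 * (\<Sum>i<N. \<Sum>j<N. R i j * G i j)"
    unfolding c_def by (simp add: left_diff_distrib right_diff_distrib sum_subtractf sum_distrib_left sum_divide_distrib mult_ac)
  finally show ?thesis unfolding \<kappa>_def n_def d_def G_def by linarith
qed

section \<open>Traces of the edge polynomial\<close>

text \<open>With P = M^k (M + 2), the three quantities \<open>tr2\<close>, \<open>tr3\<close> and
  \<open>tr4\<close> are the normalised traces of P^2, M P^2 and P^4, expanded in powers of M. They
  measure the squared length of the shift, its energy, and the fluctuation terms.\<close>

definition tr2 :: "nat \<Rightarrow> nat \<Rightarrow> (nat \<times> nat \<Rightarrow> real) \<Rightarrow> real" where
  "tr2 k N J = wtr N J (2 * k + 2) + 4 * wtr N J (2 * k + 1) + 4 * wtr N J (2 * k)"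

definition tr3 :: "nat \<Rightarrow> nat \<Rightarrow> (nat \<times> nat \<Rightarrow> real) \<Rightarrow> real" where
  "tr3 k N J = wtr N J (2 * k + 3) + 4 * wtr N J (2 * k + 2) + 4 * wtr N J (2 * k + 1)"

definition tr4 :: "nat \<Rightarrow> nat \<Rightarrow> (nat \<times> nat \<Rightarrow> real) \<Rightarrow> real" where
  "tr4 k N J = wtr N J (4 * k + 4) + 8 * wtr N J (4 * k + 3) + 24 * wtr N J (4 * k + 2) + 32 * wtr N J (4 * k + 1) + 16 * wtr N J (4 * k)"

text \<open>The choice \<open>P = M\<^sup>k (M + 2)\<close>, which concentrates on the upper edge of the spectrum of \<open>M\<close> as \<open>k\<close> grows.\<close>

lemma edge_polynomial_traces:
  fixes J :: "nat \<times> nat \<Rightarrow> real" and k N :: nat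
  assumes N: "N > 0"
  defines "P \<equiv> \<lambda>i j. wpow N J (Suc k) i j + 2 * wpow N J k i j"
  defines "R \<equiv> \<lambda>i j. \<Sum>l<N. P i l * P l j"
  shows "\<And>i j. i < N \<Longrightarrow> j < N \<Longrightarrow> P i j = P j i"
    and "(\<Sum>i<N. R i i) = real N * tr2 k N J"
    and "(\<Sum>i<N. \<Sum>j<N. J (i, j) * R i j) = sqrt (2 * real N) / 2 * (real N * tr3 k N J)"
    and "(\<Sum>i<N. \<Sum>j<N. (R i j)\<^sup>2) = real N * tr4 k N J"
proof -
  show "P i j = P j i" if "i < N" "j < N" for i j
    unfolding P_def using wpow_sym[OF that, of J "Suc k"] wpow_sym[OF that, of J k] by simp
  let ?W = "wpow N J"
  have R: "R i j = ?W (2 * k + 2) i j + 4 * ?W (2 * k + 1) i j + 4 * ?W (2 * k) i j" if "i < N" "j < N" for i j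
  proof -
    have "R i j = (\<Sum>l<N. ?W (Suc k) i l * ?W (Suc k) l j) + 2 * (\<Sum>l<N. ?W (Suc k) i l * ?W k l j)
        + 2 * (\<Sum>l<N. ?W k i l * ?W (Suc k) l j) + 4 * (\<Sum>l<N. ?W k i l * ?W k l j)"
      unfolding R_def P_def by (simp add: sum_distrib_left sum.distrib[symmetric] algebra_simps del: wpow.simps)
    also have "\<dots> = ?W (Suc k + Suc k) i j + 2 * ?W (Suc k + k) i j + 2 * ?W (k + Suc k) i j + 4 * ?W (k + k) i j"
      by (simp only: wpow_add[OF that])
    also have "Suc k + Suc k = 2 * k + 2" by simp
    also have "Suc k + k = 2 * k + 1" by simp
    also have "k + Suc k = 2 * k + 1" by simp
    also have "k + k = 2 * k" by simp
    finally show ?thesis by simp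
  qed
  have "(\<Sum>i<N. R i i) = (\<Sum>i<N. ?W (2 * k + 2) i i + 4 * ?W (2 * k + 1) i i + 4 * ?W (2 * k) i i)"
    by (intro sum.cong refl R) auto
  also have "\<dots> = real N * tr2 k N J"
    using N by (simp add: tr2_def wtr_def sum.distrib sum_distrib_left[symmetric] algebra_simps del: wpow.simps)
  finally show "(\<Sum>i<N. R i i) = real N * tr2 k N J" .
  have "(\<Sum>i<N. \<Sum>j<N. J (i, j) * R i j) = (\<Sum>i<N. \<Sum>j<N. J (i, j) * ?W (2 * k + 2) i j + 4 * (J (i, j) * ?W (2 * k + 1) i j) + 4 * (J (i, j) * ?W (2 * k) i j))"
    by (intro sum.cong refl) (simp add: R algebra_simps del: wpow.simps)
  also have "\<dots> = sqrt (2 * real N) / 2 * (real N * tr3 k N J)"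
    unfolding sum.distrib sum_distrib_left[symmetric] wtr_Suc[OF N] tr3_def
    by (simp add: algebra_simps eval_nat_numeral)
  finally show "(\<Sum>i<N. \<Sum>j<N. J (i, j) * R i j) = sqrt (2 * real N) / 2 * (real N * tr3 k N J)" .
  define f where "f a b = (\<Sum>i<N. \<Sum>j<N. ?W a i j * ?W b i j)" for a b
  have f: "f a b = real N * wtr N J (a + b)" for a b
    using wpow_frobenius[OF N, of J a b] unfolding f_def by (simp add: sum.cartesian_product case_prod_beta)
  have "(\<Sum>i<N. \<Sum>j<N. (R i j)\<^sup>2) = (\<Sum>i<N. \<Sum>j<N. ?W (2 * k + 2) i j * ?W (2 * k + 2) i j + 8 * (?W (2 * k + 2) i j * ?W (2 * k + 1) i j)
     + 16 * (?W (2 * k + 1) i j * ?W (2 * k + 1) i j) + 8 * (?W (2 * k + 2) i j * ?W (2 * k) i j) + 32 * (?W (2 * k + 1) i j * ?W (2 * k) i j)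
     + 16 * (?W (2 * k) i j * ?W (2 * k) i j))"
    by (intro sum.cong refl) (simp add: R power2_eq_square algebra_simps del: wpow.simps)
  also have "\<dots> = f (2 * k + 2) (2 * k + 2) + 8 * f (2 * k + 2) (2 * k + 1) + 16 * f (2 * k + 1) (2 * k + 1)
     + 8 * f (2 * k + 2) (2 * k) + 32 * f (2 * k + 1) (2 * k) + 16 * f (2 * k) (2 * k)"
    unfolding f_def sum.distrib sum_distrib_left[symmetric] ..
  also have "\<dots> = real N * tr4 k N J"
  proof -
    have "2 * k + 2 + (2 * k + 2) = 4 * k + 4" "2 * k + 2 + (2 * k + 1) = 4 * k + 3" "2 * k + 1 + (2 * k + 1) = 4 * k + 2"
      "2 * k + 2 + 2 * k = 4 * k + 2" "2 * k + 1 + 2 * k = 4 * k + 1" "2 * k + 2 * k = 4 * k" by simp_all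
    note eqs = this
    show ?thesis unfolding f eqs tr4_def by algebra
  qed
  finally show "(\<Sum>i<N. \<Sum>j<N. (R i j)\<^sup>2) = real N * tr4 k N J" .
qed

text \<open>Odd moments vanish in the limit, so only even powers contribute, and products of traces
  factorise. For \<open>tr4\<close> the existence of a limit is enough, since it enters the free
  energy per spin with a vanishing prefactor.\<close>

lemma trace_limits:
  defines "p \<equiv> semicircle"
  shows "(\<lambda>N. \<integral>J. tr2 k N J \<partial>gaussP (bonds N)) \<longlonglongrightarrow> p (2 * Suc k) + 4 * p (2 * k)"
    and "(\<lambda>N. \<integral>J. (tr2 k N J)\<^sup>2 \<partial>gaussP (bonds N)) \<longlonglongrightarrow> (p (2 * Suc k) + 4 * p (2 * k))\<^sup>2"
    and "(\<lambda>N. \<integral>J. tr3 k N J \<partial>gaussP (bonds N)) \<longlonglongrightarrow> 4 * p (2 * Suc k)"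
    and "\<exists>L. (\<lambda>N. \<integral>J. tr4 k N J \<partial>gaussP (bonds N)) \<longlonglongrightarrow> L"
proof -
  have i1: "integrable (gaussP (bonds N)) (\<lambda>J. wtr N J c)" for N c
    by (intro exp_bounded_integrable exp_bounded_wtr) auto
  have i2: "integrable (gaussP (bonds N)) (\<lambda>J. wtr N J c * wtr N J d)" for N c d
    by (intro exp_bounded_integrable exp_bounded_mult exp_bounded_wtr) auto
  have l1: "(\<lambda>N. \<integral>J. wtr N J c \<partial>gaussP (bonds N)) \<longlonglongrightarrow> p c" for c
    using trace_moments[of "[c]"] by (simp add: p_def)
  have l2: "(\<lambda>N. \<integral>J. wtr N J c * wtr N J d \<partial>gaussP (bonds N)) \<longlonglongrightarrow> p c * p d" for c d
    using trace_moments[of "[c, d]"] by (simp add: p_def)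
  have odd: "p (2 * k + 1) = 0" "p (2 * k + 3) = 0"
    using semicircle_odd[of k] semicircle_odd[of "Suc k"] unfolding p_def by (simp_all add: eval_nat_numeral)
  have "(\<lambda>N. (\<integral>J. wtr N J (2 * k + 2) \<partial>gaussP (bonds N)) + 4 * (\<integral>J. wtr N J (2 * k + 1) \<partial>gaussP (bonds N)) + 4 * (\<integral>J. wtr N J (2 * k) \<partial>gaussP (bonds N)))
    \<longlonglongrightarrow> p (2 * k + 2) + 4 * p (2 * k + 1) + 4 * p (2 * k)"
    by (intro tendsto_intros l1)
  then show "(\<lambda>N. \<integral>J. tr2 k N J \<partial>gaussP (bonds N)) \<longlonglongrightarrow> p (2 * Suc k) + 4 * p (2 * k)"
    unfolding tr2_def using i1 by (simp only: odd Bochner_Integration.integral_add Bochner_Integration.integrable_add integrable_mult_right integral_mult_right_zero) simp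
  have "(\<lambda>N. (\<integral>J. wtr N J (2 * k + 3) \<partial>gaussP (bonds N)) + 4 * (\<integral>J. wtr N J (2 * k + 2) \<partial>gaussP (bonds N)) + 4 * (\<integral>J. wtr N J (2 * k + 1) \<partial>gaussP (bonds N)))
    \<longlonglongrightarrow> p (2 * k + 3) + 4 * p (2 * k + 2) + 4 * p (2 * k + 1)"
    by (intro tendsto_intros l1)
  then show "(\<lambda>N. \<integral>J. tr3 k N J \<partial>gaussP (bonds N)) \<longlonglongrightarrow> 4 * p (2 * Suc k)"
    unfolding tr3_def using i1 by (simp only: odd Bochner_Integration.integral_add Bochner_Integration.integrable_add integrable_mult_right integral_mult_right_zero) simp
  have "(\<lambda>N. (\<integral>J. wtr N J (4 * k + 4) \<partial>gaussP (bonds N)) + 8 * (\<integral>J. wtr N J (4 * k + 3) \<partial>gaussP (bonds N)) + 24 * (\<integral>J. wtr N J (4 * k + 2) \<partial>gaussP (bonds N))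
      + 32 * (\<integral>J. wtr N J (4 * k + 1) \<partial>gaussP (bonds N)) + 16 * (\<integral>J. wtr N J (4 * k) \<partial>gaussP (bonds N)))
    \<longlonglongrightarrow> p (4 * k + 4) + 8 * p (4 * k + 3) + 24 * p (4 * k + 2) + 32 * p (4 * k + 1) + 16 * p (4 * k)"
    by (intro tendsto_intros l1)
  moreover have "(\<integral>J. tr4 k N J \<partial>gaussP (bonds N)) = (\<integral>J. wtr N J (4 * k + 4) \<partial>gaussP (bonds N)) + 8 * (\<integral>J. wtr N J (4 * k + 3) \<partial>gaussP (bonds N)) + 24 * (\<integral>J. wtr N J (4 * k + 2) \<partial>gaussP (bonds N))
      + 32 * (\<integral>J. wtr N J (4 * k + 1) \<partial>gaussP (bonds N)) + 16 * (\<integral>J. wtr N J (4 * k) \<partial>gaussP (bonds N))" for N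
    unfolding tr4_def using i1 by (simp only: Bochner_Integration.integral_add Bochner_Integration.integrable_add integrable_mult_right integral_mult_right_zero)
  ultimately show "\<exists>L. (\<lambda>N. \<integral>J. tr4 k N J \<partial>gaussP (bonds N)) \<longlonglongrightarrow> L" by auto
  let ?w = "\<lambda>N c d. \<integral>J. wtr N J c * wtr N J d \<partial>gaussP (bonds N)"
  let ?a = "2 * k + 2" and ?b = "2 * k + 1" and ?c = "2 * k"
  have "(\<lambda>N. ?w N ?a ?a + 8 * ?w N ?a ?b + 8 * ?w N ?a ?c + 16 * ?w N ?b ?b + 32 * ?w N ?b ?c + 16 * ?w N ?c ?c)
    \<longlonglongrightarrow> p ?a * p ?a + 8 * (p ?a * p ?b) + 8 * (p ?a * p ?c) + 16 * (p ?b * p ?b) + 32 * (p ?b * p ?c) + 16 * (p ?c * p ?c)"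
    by (intro tendsto_intros l2)
  moreover have "p ?a * p ?a + 8 * (p ?a * p ?b) + 8 * (p ?a * p ?c) + 16 * (p ?b * p ?b) + 32 * (p ?b * p ?c) + 16 * (p ?c * p ?c)
     = (p (2 * Suc k) + 4 * p (2 * k))\<^sup>2"
    unfolding odd by (simp add: power2_eq_square algebra_simps)
  moreover have "(\<integral>J. (tr2 k N J)\<^sup>2 \<partial>gaussP (bonds N)) = ?w N ?a ?a + 8 * ?w N ?a ?b + 8 * ?w N ?a ?c + 16 * ?w N ?b ?b + 32 * ?w N ?b ?c + 16 * ?w N ?c ?c" for N
  proof -
    have "(tr2 k N J)\<^sup>2 = wtr N J ?a * wtr N J ?a + 8 * (wtr N J ?a * wtr N J ?b) + 8 * (wtr N J ?a * wtr N J ?c)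
      + 16 * (wtr N J ?b * wtr N J ?b) + 32 * (wtr N J ?b * wtr N J ?c) + 16 * (wtr N J ?c * wtr N J ?c)" for J
      unfolding tr2_def by (simp add: power2_eq_square algebra_simps)
    then show ?thesis using i2
      by (simp only: Bochner_Integration.integral_add Bochner_Integration.integrable_add integrable_mult_right integral_mult_right_zero)
  qed
  ultimately show "(\<lambda>N. \<integral>J. (tr2 k N J)\<^sup>2 \<partial>gaussP (bonds N)) \<longlonglongrightarrow> (p (2 * Suc k) + 4 * p (2 * k))\<^sup>2"
    by simp
qed

section \<open>The limit of the free energy\<close>

lemma exp_bounded_traces:
  "exp_bounded (bonds N) (tr2 k N)" "exp_bounded (bonds N) (tr3 k N)" "exp_bounded (bonds N) (tr4 k N)"
  unfolding tr2_def[abs_def] tr3_def[abs_def] tr4_def[abs_def]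
  by (intro exp_bounded_add exp_bounded_mult exp_bounded_const exp_bounded_wtr)+

text \<open>Integrability comes with the upper bound for any admissible Q, and the replica symmetric
  value is always admissible.\<close>

lemma integrable_ln_partition:
  assumes N: "N > 0" and \<beta>: "\<beta> > 0"
  shows "integrable (gaussP (bonds N)) (\<lambda>J. ln (Z_N N \<beta> lam J))"
  by (rule replica_symmetric_upper_bound(1)[OF N \<beta> q_RS_facts(1)[OF \<beta>] q_RS_facts(2)[OF \<beta>]])

text \<open>The disorder average of the shifted bound. The last line is the interaction of the shift
  with the Gibbs means: a sum of order N times a prefactor of order 1/sqrt N, negligible against N
  once the squared means are bounded.\<close>

proposition edge_shift_lower_bound:
  fixes \<beta> lam v a b \<alpha> :: real and k N :: nat
  assumes N: "N > 0" and \<beta>: "\<beta> > 0" and b: "b \<ge> 0" and nz: "emeasure (gaussP {..<N}) (shell N a b) \<noteq> 0"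
    and v: "v \<ge> 1 - lam"
  defines "\<mu> \<equiv> restrict_space (gaussP {..<N}) (shell N a b)"
  defines "E \<equiv> \<lambda>J z. (1 - v) / 2 * sqnorm N z + field_exponent (bonds N) (coupling \<beta> N) 1 J z"
  defines "m \<equiv> \<lambda>J p. \<integral>z. coupling \<beta> N p z \<partial>gibbs \<mu> (E J)"
  shows "(\<integral>J. ln (\<integral>z. exp (E J z) \<partial>\<mu>) \<partial>gaussP (bonds N)) + real N * a * (v - (1 - lam)) / 2
     + \<beta> / 2 * \<alpha>\<^sup>2 * real N * (\<integral>J. tr3 k N J \<partial>gaussP (bonds N))
     - \<beta>\<^sup>2 / 4 * \<alpha> ^ 4 * (real N * (\<integral>J. (tr2 k N J)\<^sup>2 \<partial>gaussP (bonds N)) + 2 * (\<integral>J. tr4 k N J \<partial>gaussP (bonds N)))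
     - ((1 - lam) + \<beta>\<^sup>2 * b) / 2 * \<alpha>\<^sup>2 * real N * (\<integral>J. tr2 k N J \<partial>gaussP (bonds N))
     - \<beta> * sqrt (2 / real N) * \<alpha>\<^sup>2 / 2 * (real N * (\<integral>J. tr4 k N J \<partial>gaussP (bonds N)) + (\<integral>J. (\<Sum>p\<in>bonds N. (m J p)\<^sup>2) \<partial>gaussP (bonds N)))
     \<le> (\<integral>J. ln (Z_N N \<beta> lam J) \<partial>gaussP (bonds N))"
proof -
  let ?D = "gaussP (bonds N)"
  interpret D: prob_space ?D by (rule prob_space_gaussP)
  define F where "F J = ln (\<integral>z. exp (E J z) \<partial>\<mu>)" for J
  define M where "M J = (\<Sum>p\<in>bonds N. (m J p)\<^sup>2)" for J
  define \<kappa> where "\<kappa> = real N * a * (v - (1 - lam)) / 2"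
  define c2 where "c2 = ((1 - lam) + \<beta>\<^sup>2 * b) / 2 * \<alpha>\<^sup>2 * real N"
  define c3 where "c3 = \<beta> / 2 * \<alpha>\<^sup>2 * real N"
  define c4 where "c4 = \<beta>\<^sup>2 / 4 * \<alpha> ^ 4"
  define c5 where "c5 = \<beta> * sqrt (2 / real N) * \<alpha>\<^sup>2 / 2"
  have c5: "c5 \<ge> 0" using \<beta> by (simp add: c5_def)
  note sf = shell_facts[where N = N and a = a and b = b, folded \<mu>_def]
  have nz': "emeasure \<mu> (space \<mu>) \<noteq> 0" using nz sf(3) by simp
  have fb: "finite (bonds N)" by simp
  have iF: "integrable ?D F"
    unfolding F_def[abs_def] E_def
    by (rule exp_bounded_integrable[OF fb gibbs_log_step(1)[OF sf(1) nz' sf(4,5) fb sf(6,7)]]) auto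
  have iM: "integrable ?D M"
    unfolding M_def[abs_def] m_def E_def
    by (rule exp_bounded_integrable[OF fb exp_bounded_gibbs_means[OF sf(1) nz' sf(4,5) fb sf(6,7)]]) auto
  have it: "integrable ?D (tr2 k N)" "integrable ?D (tr3 k N)" "integrable ?D (tr4 k N)" "integrable ?D (\<lambda>J. (tr2 k N J)\<^sup>2)"
    by (intro exp_bounded_integrable exp_bounded_power exp_bounded_traces fb)+
  have pt: "F J + \<kappa> + c3 * tr3 k N J - c4 * (real N * (tr2 k N J)\<^sup>2 + 2 * tr4 k N J) - c2 * tr2 k N J
      - c5 * (real N * tr4 k N J + M J) \<le> ln (Z_N N \<beta> lam J)" for J
  proof -
    define P where "P i j = wpow N J (Suc k) i j + 2 * wpow N J k i j" for i j
    define R where "R i j = (\<Sum>l<N. P i l * P l j)" for i j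
    note et = edge_polynomial_traces[where J = J and k = k, OF N, folded P_def, folded R_def]
    \<comment> \<open>Shift and Gibbs means depend on the same disorder; the inequality between
      arithmetic and geometric mean separates them, so that no correlation has to be
      estimated.\<close>
    have "(\<Sum>i<N. \<Sum>j<N. R i j * m J (i, j)) \<le> (\<Sum>i<N. \<Sum>j<N. ((R i j)\<^sup>2 + (m J (i, j))\<^sup>2) / 2)"
    proof (intro sum_mono)
      fix i j
      show "R i j * m J (i, j) \<le> ((R i j)\<^sup>2 + (m J (i, j))\<^sup>2) / 2"
        using sum_squares_bound[of "R i j" "m J (i, j)"] by simp
    qed
    also have "\<dots> = (real N * tr4 k N J + M J) / 2"
      unfolding et(4)[symmetric] M_def
      by (simp add: sum.cartesian_product case_prod_beta sum.distrib sum_divide_distrib[symmetric])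
    finally have "2 * c5 * (\<Sum>i<N. \<Sum>j<N. R i j * m J (i, j)) \<le> 2 * c5 * ((real N * tr4 k N J + M J) / 2)"
      using c5 by (intro mult_left_mono) auto
    then have 1: "\<beta> * sqrt (2 / real N) * \<alpha>\<^sup>2 * (\<Sum>i<N. \<Sum>j<N. R i j * m J (i, j)) \<le> c5 * (real N * tr4 k N J + M J)"
      by (simp add: c5_def)
    have 2: "\<beta> / sqrt (2 * real N) * \<alpha>\<^sup>2 * (sqrt (2 * real N) / 2 * (real N * tr3 k N J)) = c3 * tr3 k N J"
      using N by (simp add: c3_def)
    have 3: "\<beta>\<^sup>2 / (4 * real N) * \<alpha> ^ 4 * ((real N * tr2 k N J)\<^sup>2 + 2 * (real N * tr4 k N J)) = c4 * (real N * (tr2 k N J)\<^sup>2 + 2 * tr4 k N J)"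
      using N by (simp add: c4_def power2_eq_square field_simps)
    have 4: "((1 - lam) + \<beta>\<^sup>2 * b) / 2 * \<alpha>\<^sup>2 * (real N * tr2 k N J) = c2 * tr2 k N J"
      by (simp add: c2_def)
    from gaussian_shift_lower_bound[where P = P and J = J and \<alpha> = \<alpha>, OF N \<beta> b nz v et(1), folded R_def, unfolded et(2,3,4), unfolded 2 3 4]
    show ?thesis using 1 unfolding F_def \<kappa>_def m_def E_def \<mu>_def by linarith
  qed
  have "(\<integral>J. F J + \<kappa> + c3 * tr3 k N J - c4 * (real N * (tr2 k N J)\<^sup>2 + 2 * tr4 k N J) - c2 * tr2 k N J
      - c5 * (real N * tr4 k N J + M J) \<partial>?D) \<le> (\<integral>J. ln (Z_N N \<beta> lam J) \<partial>?D)"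
    using iF iM it by (intro integral_mono integrable_ln_partition[OF N \<beta>] pt) simp_all
  also have "(\<integral>J. F J + \<kappa> + c3 * tr3 k N J - c4 * (real N * (tr2 k N J)\<^sup>2 + 2 * tr4 k N J) - c2 * tr2 k N J
      - c5 * (real N * tr4 k N J + M J) \<partial>?D)
    = (\<integral>J. F J \<partial>?D) + \<kappa> + c3 * (\<integral>J. tr3 k N J \<partial>?D) - c4 * (real N * (\<integral>J. (tr2 k N J)\<^sup>2 \<partial>?D) + 2 * (\<integral>J. tr4 k N J \<partial>?D))
      - c2 * (\<integral>J. tr2 k N J \<partial>?D) - c5 * (real N * (\<integral>J. tr4 k N J \<partial>?D) + (\<integral>J. M J \<partial>?D))"
    using iF iM it by (simp add: D.prob_space)
  finally show ?thesis unfolding F_def M_def \<kappa>_def c2_def c3_def c4_def c5_def .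
qed

text \<open>Division by N sends the bounded corrections of the high temperature phase and all terms
  with \<open>tr4\<close> to 0, and the remaining traces to their semicircle values. The parameter s
  is the squared amplitude of the shift, still free here.\<close>

lemma free_energy_eventually_ge:
  fixes \<beta> lam v \<eta> \<epsilon> s :: real and k :: nat
  assumes \<beta>: "\<beta> > 0" and v: "v > 0" "v \<ge> 1 - lam" and \<eta>: "\<eta> > 0" "\<beta>\<^sup>2 * (1 / v + \<eta>) < v" and s: "s \<ge> 0" and \<epsilon>: "\<epsilon> > 0"
  defines "p2 \<equiv> semicircle (2 * Suc k) + 4 * semicircle (2 * k)" and "p3 \<equiv> 4 * semicircle (2 * Suc k)"
  shows "\<forall>\<^sub>F N in sequentially. A_N N \<beta> lam > - ln v / 2 + (1 / v - \<eta>) * (v - (1 - lam)) / 2 + \<beta> / 2 * s * p3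
     - \<beta>\<^sup>2 / 4 * s\<^sup>2 * p2\<^sup>2 - ((1 - lam) + \<beta>\<^sup>2 * (1 / v + \<eta>)) / 2 * s * p2 - \<epsilon>"
proof -
  define X where "X = \<beta>\<^sup>2 * (1 / v + \<eta>)"
  have X: "X > 0" using \<beta> v \<eta> by (simp add: X_def add_pos_pos)
  \<comment> \<open>The midpoint between 1 and v/X, so that both \<tau> > 1 and \<tau> X < v
    hold.\<close>
  define \<tau> where "\<tau> = (1 + v / X) / 2"
  have \<tau>: "\<tau> > 1" using X \<eta>(2) unfolding \<tau>_def X_def[symmetric] by simp
  have "\<tau> * X = X / 2 + v / 2" using X by (simp add: \<tau>_def field_simps)
  moreover have "X < v" using \<eta>(2) by (simp only: X_def)
  ultimately have "\<tau> * X < v" by linarith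
  then have ht: "\<tau> * \<beta>\<^sup>2 * (1 / v + \<eta>) < v" unfolding X_def mult.assoc .
  from high_temperature[OF \<beta> v(1) \<eta>(1) \<tau> ht] obtain K where K:
    "\<forall>\<^sub>F N in sequentially. emeasure (gaussP {..<N}) (shell N (1 / v - \<eta>) (1 / v + \<eta>)) \<noteq> 0 \<and>
     - real N / 2 * ln v - K \<le> (\<integral>J. ln (\<integral>z. exp ((1 - v) / 2 * sqnorm N z + field_exponent (bonds N) (coupling \<beta> N) 1 J z)
        \<partial>restrict_space (gaussP {..<N}) (shell N (1 / v - \<eta>) (1 / v + \<eta>))) \<partial>gaussP (bonds N)) \<and>
     (\<integral>J. (\<Sum>p\<in>bonds N. (\<integral>z. coupling \<beta> N p z \<partial>gibbs (restrict_space (gaussP {..<N}) (shell N (1 / v - \<eta>) (1 / v + \<eta>)))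
        (\<lambda>z. (1 - v) / 2 * sqnorm N z + field_exponent (bonds N) (coupling \<beta> N) 1 J z))\<^sup>2) \<partial>gaussP (bonds N)) \<le> K"
    by blast
  obtain L4 where L4: "(\<lambda>N. \<integral>J. tr4 k N J \<partial>gaussP (bonds N)) \<longlonglongrightarrow> L4" using trace_limits(4) by blast
  define T2 where "T2 N = (\<integral>J. tr2 k N J \<partial>gaussP (bonds N))" for N
  define T22 where "T22 N = (\<integral>J. (tr2 k N J)\<^sup>2 \<partial>gaussP (bonds N))" for N
  define T3 where "T3 N = (\<integral>J. tr3 k N J \<partial>gaussP (bonds N))" for N
  define T4 where "T4 N = (\<integral>J. tr4 k N J \<partial>gaussP (bonds N))" for N
  define d where "d = ((1 - lam) + \<beta>\<^sup>2 * (1 / v + \<eta>)) / 2 * s"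
  define B where "B N = - ln v / 2 - K / real N + (1 / v - \<eta>) * (v - (1 - lam)) / 2 + \<beta> / 2 * s * T3 N
    - \<beta>\<^sup>2 / 4 * s\<^sup>2 * (T22 N + 2 * T4 N / real N) - d * T2 N - \<beta> * sqrt (2 / real N) * s / 2 * (T4 N + K / real N)" for N
  have z: "(\<lambda>N. c / real N) \<longlonglongrightarrow> 0" for c by (rule lim_const_over_n)
  have T: "T2 \<longlonglongrightarrow> p2" "T22 \<longlonglongrightarrow> p2\<^sup>2" "T3 \<longlonglongrightarrow> p3" "T4 \<longlonglongrightarrow> L4"
    using trace_limits(1-3) L4 unfolding T2_def[abs_def] T22_def[abs_def] T3_def[abs_def] T4_def[abs_def] p2_def p3_def by auto
  have "(\<lambda>N. sqrt (2 / real N)) \<longlonglongrightarrow> sqrt 0" by (intro tendsto_intros z)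
  then have zs: "(\<lambda>N. sqrt (2 / real N)) \<longlonglongrightarrow> 0" by simp
  have z4: "(\<lambda>N. 2 * T4 N / real N) \<longlonglongrightarrow> 0"
    using tendsto_mult[OF T(4) z[of 2]] by (simp add: mult.commute)
  have "B \<longlonglongrightarrow> - ln v / 2 - 0 + (1 / v - \<eta>) * (v - (1 - lam)) / 2 + \<beta> / 2 * s * p3 - \<beta>\<^sup>2 / 4 * s\<^sup>2 * (p2\<^sup>2 + 0) - d * p2
     - \<beta> * 0 * s / 2 * (L4 + 0)"
    unfolding B_def[abs_def] by (intro tendsto_intros T z zs z4) auto
  then have "B \<longlonglongrightarrow> - ln v / 2 + (1 / v - \<eta>) * (v - (1 - lam)) / 2 + \<beta> / 2 * s * p3 - \<beta>\<^sup>2 / 4 * s\<^sup>2 * p2\<^sup>2 - d * p2"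
    by simp
  then have evB: "\<forall>\<^sub>F N in sequentially. B N > - ln v / 2 + (1 / v - \<eta>) * (v - (1 - lam)) / 2 + \<beta> / 2 * s * p3 - \<beta>\<^sup>2 / 4 * s\<^sup>2 * p2\<^sup>2 - d * p2 - \<epsilon>"
    using \<epsilon> by (intro order_tendstoD(1)) auto
  show ?thesis
    using evB K eventually_gt_at_top[of 0]
  proof eventually_elim
    case (elim N)
    let ?b = "1 / v + \<eta>"
    have b: "?b \<ge> 0" using v \<eta> by simp
    have N: "N > 0" using elim by simp
    let ?I = "\<integral>J. (\<Sum>p\<in>bonds N. (\<integral>z. coupling \<beta> N p z \<partial>gibbs (restrict_space (gaussP {..<N}) (shell N (1 / v - \<eta>) (1 / v + \<eta>)))
        (\<lambda>z. (1 - v) / 2 * sqnorm N z + field_exponent (bonds N) (coupling \<beta> N) 1 J z))\<^sup>2) \<partial>gaussP (bonds N)"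
    have "sqrt s ^ 4 = ((sqrt s)\<^sup>2)\<^sup>2" by (simp flip: power_mult)
    then have "sqrt s ^ 4 = s\<^sup>2" "(sqrt s)\<^sup>2 = s" using s by simp_all
    note low = edge_shift_lower_bound[where \<alpha> = "sqrt s" and k = k, OF N \<beta> b conjunct1[OF elim(2)] v(2), unfolded this,
        folded T2_def T22_def T3_def T4_def]
    have "\<beta> * sqrt (2 / real N) * s / 2 * (real N * T4 N + ?I) \<le> \<beta> * sqrt (2 / real N) * s / 2 * (real N * T4 N + K)"
      using elim(2) \<beta> s by (intro mult_left_mono) auto
    then have "- real N / 2 * ln v - K + real N * (1 / v - \<eta>) * (v - (1 - lam)) / 2 + \<beta> / 2 * s * real N * T3 N
      - \<beta>\<^sup>2 / 4 * s\<^sup>2 * (real N * T22 N + 2 * T4 N) - ((1 - lam) + \<beta>\<^sup>2 * (1 / v + \<eta>)) / 2 * s * real N * T2 N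
      - \<beta> * sqrt (2 / real N) * s / 2 * (real N * T4 N + K) \<le> (\<integral>J. ln (Z_N N \<beta> lam J) \<partial>gaussP (bonds N))"
      using low elim(2) by linarith
    also have "- real N / 2 * ln v - K + real N * (1 / v - \<eta>) * (v - (1 - lam)) / 2 + \<beta> / 2 * s * real N * T3 N
      - \<beta>\<^sup>2 / 4 * s\<^sup>2 * (real N * T22 N + 2 * T4 N) - ((1 - lam) + \<beta>\<^sup>2 * (1 / v + \<eta>)) / 2 * s * real N * T2 N
      - \<beta> * sqrt (2 / real N) * s / 2 * (real N * T4 N + K) = real N * B N"
    proof -
      have e: "real N * (T22 N + 2 * T4 N / real N) = real N * T22 N + 2 * T4 N" "real N * (T4 N + K / real N) = real N * T4 N + K"
        "real N * (K / real N) = K"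
        using N by (simp_all add: distrib_left)
      have "real N * B N = real N * (- ln v / 2) - real N * (K / real N) + real N * ((1 / v - \<eta>) * (v - (1 - lam)) / 2) + real N * (\<beta> / 2 * s * T3 N)
        - \<beta>\<^sup>2 / 4 * s\<^sup>2 * (real N * (T22 N + 2 * T4 N / real N)) - real N * (d * T2 N) - \<beta> * sqrt (2 / real N) * s / 2 * (real N * (T4 N + K / real N))"
        unfolding B_def by (simp only: distrib_left right_diff_distrib mult.left_commute[of "real N"] mult.assoc)
      then show ?thesis unfolding e d_def by (simp add: mult_ac)
    qed
    finally have "B N \<le> A_N N \<beta> lam"
      using N unfolding A_N_def disorder_eq by (simp add: field_simps)
    then show ?case using elim(1) unfolding d_def by linarith
  qed
qed

text \<open>The upper bound is exact for every positive N. In the lower bound the parameters are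
  fixed one after the other: v close to U, then \<delta>, then k depending on \<delta>, and N goes
  to infinity last.\<close>

theorem A_N_limit:
  fixes \<beta> lam :: real
  assumes \<beta>: "\<beta> > 0"
  shows "(\<lambda>N. A_N N \<beta> lam) \<longlonglongrightarrow> A_hat \<beta> lam (q_RS \<beta> lam, \<lambda>_. 0)"
proof -
  define w where "w = 1 - lam"
  define q where "q = q_RS \<beta> lam"
  define U where "U = w + \<beta>\<^sup>2 * q"
  define A where "A = A_hat \<beta> lam (q, \<lambda>_. 0)"
  have q: "q \<ge> 0" and U: "U > 0" "U \<ge> \<beta>" using q_RS_facts[OF \<beta>, of lam] unfolding q_def U_def w_def by auto
  have A: "A = - ln U / 2 + \<beta>\<^sup>2 * q / (2 * U) + \<beta>\<^sup>2 * q\<^sup>2 / 4" "A = - ln U / 2 + \<beta> * q - w * q / 2 - \<beta>\<^sup>2 * q\<^sup>2 / 4"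
    using A_hat_q_RS[OF \<beta>, of lam] unfolding A_def q_def U_def w_def by auto
  have upper: "A_N N \<beta> lam \<le> A" if N: "N > 0" for N
    using replica_symmetric_upper_bound(2)[OF N \<beta> q, of lam] U(1) N
    unfolding A(1) A_N_def disorder_eq U_def w_def by (simp add: field_simps)
  have lower: "\<forall>\<^sub>F N in sequentially. A_N N \<beta> lam > A - \<epsilon>" if \<epsilon>: "\<epsilon> > 0" for \<epsilon>
  proof -
    \<comment> \<open>The limiting lower bound for s = q/p2, with p3/p2 replaced by 2 - \<delta>/2.
      One \<delta> serves both as half-width of the shell and as error in the ratio of
      moments.\<close>
    define h where "h v \<delta> = - ln v / 2 + (1 / v - \<delta>) * (v - w) / 2 + q * \<beta> * (2 - \<delta> / 2) / 2 - \<beta>\<^sup>2 / 4 * q\<^sup>2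
       - (w + \<beta>\<^sup>2 * (1 / v + \<delta>)) / 2 * q" for v \<delta> :: real
    have "U - w = \<beta>\<^sup>2 * q" by (simp add: U_def)
    then have "(1 / U - 0) * (U - w) / 2 = \<beta>\<^sup>2 * q / (2 * U)" by simp
    moreover have "(w + \<beta>\<^sup>2 * (1 / U + 0)) / 2 * q = w * q / 2 + \<beta>\<^sup>2 * q / (2 * U)"
      using U(1) by (simp add: field_simps)
    moreover have "q * \<beta> * (2 - 0 / 2) / 2 = \<beta> * q" "\<beta>\<^sup>2 / 4 * q\<^sup>2 = \<beta>\<^sup>2 * q\<^sup>2 / 4" by simp_all
    ultimately have hU: "h U 0 = A" unfolding h_def A(2) by linarith
    \<comment> \<open>Continuity is used in one variable at a time: in v at \<delta> = 0, and
      afterwards in \<delta> at the chosen v.\<close>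
    have "((\<lambda>v. h v 0) \<longlongrightarrow> h U 0) (at_right U)"
      unfolding h_def using U(1) by (auto intro!: tendsto_eq_intros)
    then have "\<forall>\<^sub>F v in at_right U. h v 0 > A - \<epsilon> / 2"
      using \<epsilon> unfolding hU by (intro order_tendstoD(1)) auto
    then have "\<forall>\<^sub>F v in at_right U. h v 0 > A - \<epsilon> / 2 \<and> v > U"
      using eventually_at_right_less[of U] by eventually_elim simp
    then obtain v where v: "h v 0 > A - \<epsilon> / 2" "v > U"
      using eventually_happens'[OF trivial_limit_at_right_real] by blast
    have v0: "v > 0" "v > \<beta>" using v(2) U by auto
    have "0 \<le> \<beta>\<^sup>2 * q" using q by simp
    then have vw: "v \<ge> 1 - lam" using v(2) unfolding U_def w_def by linarith
    have "((\<lambda>\<delta>. h v \<delta>) \<longlongrightarrow> h v 0) (at_right 0)"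
      unfolding h_def by (auto intro!: tendsto_eq_intros)
    then have e1: "\<forall>\<^sub>F \<delta> in at_right 0. h v \<delta> > A - \<epsilon> / 2"
      using v(1) by (rule order_tendstoD(1))
    have "((\<lambda>\<delta>. \<beta>\<^sup>2 * (1 / v + \<delta>)) \<longlongrightarrow> \<beta>\<^sup>2 * (1 / v + 0)) (at_right 0)" by (intro tendsto_intros)
    \<comment> \<open>Here v > \<beta> must be strict: it leaves room for a shell of positive width
      within the high temperature condition.\<close>
    moreover have "\<beta>\<^sup>2 * (1 / v + 0) < v"
      using v0 \<beta> mult_strict_mono[of \<beta> v \<beta> v] by (simp add: field_simps power2_eq_square)
    ultimately have e2: "\<forall>\<^sub>F \<delta> in at_right 0. \<beta>\<^sup>2 * (1 / v + \<delta>) < v" by (rule order_tendstoD(2))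
    have e3: "\<forall>\<^sub>F \<delta> in at_right (0::real). \<delta> < 4"
      by (rule order_tendstoD(2)[OF tendsto_ident_at]) simp
    have "\<forall>\<^sub>F \<delta> in at_right 0. h v \<delta> > A - \<epsilon> / 2 \<and> \<beta>\<^sup>2 * (1 / v + \<delta>) < v \<and> \<delta> < 4 \<and> 0 < \<delta>"
      using e1 e2 e3 eventually_at_right_less[of 0] by eventually_elim simp
    then obtain \<delta> where \<delta>: "h v \<delta> > A - \<epsilon> / 2" "\<beta>\<^sup>2 * (1 / v + \<delta>) < v" "\<delta> < 4" "0 < \<delta>"
      using eventually_happens'[OF trivial_limit_at_right_real] by blast
    obtain k where k: "semicircle (2 * Suc k) \<ge> (4 - \<delta>) * semicircle (2 * k)"
      using semicircle_growth[OF \<delta>(4,3)] by blast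
    define p2 where "p2 = semicircle (2 * Suc k) + 4 * semicircle (2 * k)"
    define p3 where "p3 = 4 * semicircle (2 * Suc k)"
    have pos: "semicircle (2 * Suc k) > 0" "semicircle (2 * k) > 0" by (rule semicircle_even_pos)+
    have p2: "p2 > 0" using pos by (simp add: p2_def)
    define c where "c = semicircle (2 * k)"
    define c' where "c' = semicircle (2 * Suc k)"
    have cc: "(4 - \<delta>) * c \<le> c'" "0 < c" "0 < c'" using k pos by (simp_all add: c_def c'_def)
    \<comment> \<open>The quotient p3/p2 = 4 c'/(c' + 4 c) is the mean of M under the weight P^2; it
      approaches the upper edge 2 as c'/c approaches 4.\<close>
    have "p3 - (2 - \<delta> / 2) * p2 = 2 * (c' - (4 - \<delta>) * c) + \<delta> / 2 * c'"
      unfolding p2_def p3_def c_def[symmetric] c'_def[symmetric] by (simp add: algebra_simps)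
    moreover have "\<dots> \<ge> 0" using cc \<delta>(4) by simp
    ultimately have "(2 - \<delta> / 2) * p2 \<le> p3" by linarith
    then have ratio: "2 - \<delta> / 2 \<le> p3 / p2" using p2 by (simp add: pos_le_divide_eq)
    \<comment> \<open>The amplitude s = q/p2 normalises the shift: its mean squared length is s N
      times the mean of \<open>tr2\<close>, hence asymptotically N q.\<close>
    have "\<beta> / 2 * (q / p2) * p3 = q * \<beta> * (p3 / p2) / 2" by (simp add: mult_ac)
    also have "\<dots> \<ge> q * \<beta> * (2 - \<delta> / 2) / 2"
      using ratio q \<beta> by (intro divide_right_mono mult_left_mono) auto
    finally have 1: "\<beta> / 2 * (q / p2) * p3 \<ge> q * \<beta> * (2 - \<delta> / 2) / 2" .
    have 2: "\<beta>\<^sup>2 / 4 * (q / p2)\<^sup>2 * p2\<^sup>2 = \<beta>\<^sup>2 / 4 * q\<^sup>2"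
      using p2 by (simp add: power_divide)
    have 3: "((1 - lam) + \<beta>\<^sup>2 * (1 / v + \<delta>)) / 2 * (q / p2) * p2 = (w + \<beta>\<^sup>2 * (1 / v + \<delta>)) / 2 * q"
      using p2 by (simp add: w_def)
    have "\<forall>\<^sub>F N in sequentially. A_N N \<beta> lam > - ln v / 2 + (1 / v - \<delta>) * (v - (1 - lam)) / 2 + \<beta> / 2 * (q / p2) * p3
       - \<beta>\<^sup>2 / 4 * (q / p2)\<^sup>2 * p2\<^sup>2 - ((1 - lam) + \<beta>\<^sup>2 * (1 / v + \<delta>)) / 2 * (q / p2) * p2 - \<epsilon> / 2"
      unfolding p2_def p3_def
      by (rule free_energy_eventually_ge[OF \<beta> v0(1) vw \<delta>(4,2)]) (use q p2 \<epsilon> in \<open>auto simp: p2_def\<close>)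
    then show ?thesis
    proof eventually_elim
      case (elim N)
      then show ?case using 1 \<delta>(1) unfolding 2 3 h_def w_def by linarith
    qed
  qed
  have "(\<lambda>N. A_N N \<beta> lam) \<longlonglongrightarrow> A"
  proof (rule order_tendstoI)
    fix a assume "a < A"
    then show "\<forall>\<^sub>F N in sequentially. a < A_N N \<beta> lam" using lower[of "A - a"] by simp
  next
    fix a assume "A < a"
    show "\<forall>\<^sub>F N in sequentially. A_N N \<beta> lam < a"
      using eventually_gt_at_top[of "0::nat"]
    proof eventually_elim
      case (elim N)
      then show ?case using upper[of N] \<open>A < a\<close> by linarith
    qed
  qed
  then show ?thesis unfolding A_def q_def .
qed

theorem mainTheorem16:
  fixes \<beta> lam :: real
  assumes "\<beta> > 0"
  shows "(\<lambda>N. A_N N \<beta> lam) \<longlonglongrightarrow> (INF p\<in>param_set \<beta> lam. A_hat \<beta> lam p)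
     \<and> (q_RS \<beta> lam, \<lambda>_. 0) \<in> param_set \<beta> lam
     \<and> (\<forall>p\<in>param_set \<beta> lam. A_hat \<beta> lam (q_RS \<beta> lam, \<lambda>_. 0) \<le> A_hat \<beta> lam p)
     \<and> A_hat \<beta> lam (q_RS \<beta> lam, \<lambda>_. 0) = (INF p\<in>param_set \<beta> lam. A_hat \<beta> lam p)"
proof -
  let ?p = "(q_RS \<beta> lam, \<lambda>_. 0)"
  note minimal = A_hat_minimal[OF assms]
  have p: "?p \<in> param_set \<beta> lam" by (rule q_RS_in_param_set[OF assms])
  have "(INF p\<in>param_set \<beta> lam. A_hat \<beta> lam p) = A_hat \<beta> lam ?p"
    by (rule cInf_eq_minimum) (use p minimal in auto)
  then show ?thesis using A_N_limit[OF assms, of lam] p minimal by auto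
qed

end
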